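(* Let $t_0>0$, $T\ge t_0^2/2$, and let $h_0>0$, $B_0$ be smooth functions on $\mathbb{T}^3$ with $\nabla\cdot B_0=0$. Suppose $(h',B',D',P')$, $h'>0$, is a smooth solution on $[0,t_0]\times\mathbb{T}^3$ of the augmented Born–Infeld system (ABI) with initial data $(h_0,B_0,0,0)$, and $(h,B,D,P)$ is a dissipative solution of (DMHD) on $[0,T]$ with the same initial data $(h_0,B_0)$. Then there exists a constant $C$ depending only on $(h',B',D',P')$ and $t_0$ such that for every $t\in[0,t_0]$ $$\|h'(t)-h(t^2/2)\|_{TV},\ \ \|B'(t)-B(t^2/2)\|_{TV}\le Ct^3,$$ $$\big|D'(s)-sD(s^2/2)\big|([0,t]\times\mathbb{T}^3),\ \ \big|P'(s)-sP(s^2/2)\big|([0,t]\times\mathbb{T}^3)\le Ct^4.$$ Here $\|\cdot\|_{TV}$ is the total variation on $\mathbb{T}^3$, $|\cdot|$ denotes the variation measure of a vector-valued measure, and $sD(s^2/2)$, $sP(s^2/2)$ are the $\mathbb{R}^3$-valued Borel measures on $[0,t_0]\times\mathbb{T}^3$ defined by $$\int_0^{t_0}\!\!\int_{\mathbb{T}^3}\varphi(s)\cdot sD(s^2/2)=\int_0^{t_0^2/2}\!\!\int_{\mathbb{T}^3}\varphi(\sqrt{2s})\cdot D(s),\qquad \int_0^{t_0}\!\!\int_{\mathbb{T}^3}\varphi(s)\cdot sP(s^2/2)=\int_0^{t_0^2/2}\!\!\int_{\mathbb{T}^3}\varphi(\sqrt{2s})\cdot P(s)$$ for all $\varphi\in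 C([0,t_0]\times\mathbb{T}^3,\mathbb{R}^3)$.
   Context: $\mathbb{T}=\mathbb{R}/\mathbb{Z}$. Conventions: $(a\otimes b)_{ij}=a_ib_j$, $(\nabla\cdot M)_i=\sum_j\partial_jM_{ij}$, $(\nabla v)_{ij}=\partial_jv_i$. For $E$ a compact space, $C(E,\mathbb{R}^m)'$ is the space of $\mathbb{R}^m$-valued finite Borel measures; a subscript $w^*$ means it carries the weak-$*$ topology. $\mathcal L$ is Lebesgue measure on $\mathbb{T}^3$. Functions are identified with the measures of which they are the Lebesgue densities. The augmented Born–Infeld system (ABI) for $(h,B,D,P)$ is $$\partial_th+\nabla\cdot P=0,\quad \partial_tB+\nabla\times\Big(\frac{B\times P+D}{h}\Big)=0,\quad \nabla\cdot B=\nabla\cdot D=0,$$ $$\partial_tD+\nabla\times\Big(\frac{D\times P-B}{h}\Big)=0,\quad \partial_tP+\nabla\cdot\Big(\frac{P\otimes P-B\otimes B-D\otimes D-I_3}{h}\Big)=0.$$ The Darcy MHD system (DMHD), with $d=D/h$, $v=P/h$, is $$\partial_t h+\nabla\cdot(hv)=0,\quad \partial_tB+\nabla\times(B\times v+d)=0,\quad \nabla\cdot B=0,$$ $$D=\nabla\times\Big(\frac Bh\Big),\quad P=\nabla\cdot\Big(\frac{B\otimes B}{h}\Big)+\nabla(h^{-1}).$$ For $\rho\in C(\mathbb{T}^3,\mathbb{R})'$, $U\in C(\mathbb{T}^3,\mathbb{R}^4)'$, $$\Lambda(\rho,U)=\sup\Big\{\int_{\mathbb{T}^3}a\rho+A\cdot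 U:\ (a,A)\in C(\mathbb{T}^3,\mathbb{R}\times\mathbb{R}^4),\ a+\tfrac12|A|^2\le0\Big\}\in[0,+\infty].$$ For $\rho\in C([0,T]\times\mathbb{T}^3,\mathbb{R})'$, $W\in C([0,T]\times\mathbb{T}^3,\mathbb{R}^{10})'$, $Q\in C([0,T]\times\mathbb{T}^3,\mathbb{R}^{10\times10})$ symmetric positive definite everywhere, $0\le s<t\le T$, $$\widetilde\Lambda(\rho,W,Q;s,t)=\sup\Big\{\int_s^t\!\!\int_{\mathbb{T}^3}a\rho+A\cdot W:\ (a,A)\in C([s,t]\times\mathbb{T}^3,\mathbb{R}\times\mathbb{R}^{10}),\ a+\tfrac12|\sqrt{Q^{-1}}A|^2\le0\Big\}.$$ For $w^*=({h^*}^{-1},b^*,d^*,v^* )$ with $b^*,d^*,v^*\in C^1([0,T]\times\mathbb{T}^3,\mathbb{R}^3)$, $0<h^*\in C^1([0,T]\times\mathbb{T}^3,\mathbb{R})$, set (blocks of sizes $1,3,3,3$) $$Q(w^* )=\begin{pmatrix} -2\nabla\cdot v^* & (\nabla\times d^* )^{\mathrm T} & -(\nabla\times b^* )^{\mathrm T} & 0\\ \nabla\times d^* & -\nabla v^*-(\nabla v^* )^{\mathrm T} & 0 & \nabla b^*-(\nabla b^* )^{\mathrm T}\\ -\nabla\times b^* & 0 & 2I_3 & 0\\ 0 & (\nabla b^* )^{\mathrm T}-\nabla b^* & 0 & 2I_3\end{pmatrix},$$ $Q_r(w^* )=Q(w^* )+r\,\mathrm{diag}(1,1,1,1,0,0,0,0,0,0)$,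 and $\mathrm L(w^* )=(\mathrm L_h,\mathrm L_B,\mathrm L_D,\mathrm L_P)$ with $\mathrm L_h=\partial_t({h^*}^{-1})-{h^*}^{-1}\nabla\cdot v^*+v^*\cdot\nabla({h^*}^{-1})$, $\mathrm L_B=\partial_tb^*+(v^*\cdot\nabla)b^*-(b^*\cdot\nabla)v^*+{h^*}^{-1}\nabla\times d^*$, $\mathrm L_D=d^*-{h^*}^{-1}\nabla\times b^*$, $\mathrm L_P=v^*-(b^*\cdot\nabla)b^*-{h^*}^{-1}\nabla({h^*}^{-1})$. Metric: for $\mu,\nu\in C(\mathbb{T}^3,\mathbb{R}^4)'$, $\mathrm d(\mu,\nu)=\sup\{\langle\mu-\nu,f\rangle: f\in C^1(\mathbb{T}^3,\mathbb{R}^4),\|f\|_\infty\le1,\|\nabla f\|_\infty\le1\}$. Definition. $(h,B,D,P)$ with $h\in C([0,T],C(\mathbb{T}^3,\mathbb{R})'_{w^*})$, $B\in C([0,T],C(\mathbb{T}^3,\mathbb{R}^3)'_{w^*})$, $D,P\in C([0,T]\times\mathbb{T}^3,\mathbb{R}^3)'$ is a dissipative solution of (DMHD) (with constant $K>0$) with initial data $h_0\in C(\mathbb{T}^3,\mathbb{R})'$, $B_0\in C(\mathbb{T}^3,\mathbb{R}^3)'$ if: (i) $h(0)=h_0$, $B(0)=B_0$, $\Lambda(h_0,U_0)<\infty$ where $U_0=(\mathcal L,B_0)$; (ii) $(h,B)$ is bounded by $K$ in $C^{0,1/2}$: $\mathrm d((h,B)(t),0)\le K$ and $\mathrm d((h,B)(t),(h,B)(s))\le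 K|t-s|^{1/2}$ for all $s,t\in[0,T]$; here $K$ is a constant depending only on $T$ and $(h_0,B_0)$ (the present result holds whatever the value of $K$, and the constant $C$ does not depend on it); (iii) for all $u\in C^1([0,T]\times\mathbb{T}^3,\mathbb{R})$ and $t\in[0,T]$: $\int_0^t\int_{\mathbb{T}^3}\partial_tu\,h+\nabla u\cdot P=\int_{\mathbb{T}^3}u(t)h(t)-\int_{\mathbb{T}^3}u(0)h(0)$ and $\int_{\mathbb{T}^3}\nabla u(t)\cdot B(t)=0$; (iv) for all $t\in[0,T]$, all $v^*,b^*,d^*\in C^1([0,T]\times\mathbb{T}^3,\mathbb{R}^3)$, $0<h^*\in C^1([0,T]\times\mathbb{T}^3,\mathbb{R})$, and all real $r$ such that $Q_r(w^* )\ge I_{10}$ on $[0,T]\times\mathbb{T}^3$, $$e^{-rt}\Lambda(h(t),\widetilde U(t))+\widetilde\Lambda(h,\widetilde W,e^{-rs}Q_r(w^* );0,t)+\int_0^t\!\!\int_{\mathbb{T}^3}e^{-rs}\,\widetilde W\cdot\mathrm L(w^* )\le\Lambda(h(0),\widetilde U(0)),$$ where $\widetilde U=(\mathcal L-{h^*}^{-1}h,\,B-hb^* )$, $\widetilde W=(\widetilde U,\,D-hd^*,\,P-hv^* )$. ($h$ and $\widetilde U$ are viewed as space-time measures $h(s)\,\mathrm ds$, $\widetilde U(s)\,\mathrm ds$ where needed; in $e^{-rs}Q_r$ the variable $s$ is time.) *)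

theory Defs
  imports "HOL-Analysis.Analysis"
begin

section \<open>The torus\<close>

quotient_type torus = real / "\<lambda>x y. x - y \<in> \<int>"
  morphisms rep_torus to_torus
proof (rule equivpI)
  show "reflp (\<lambda>x y::real. x - y \<in> \<int>)" by (auto intro: reflpI)
  show "symp (\<lambda>x y::real. x - y \<in> \<int>)"
    by (rule sympI) (metis Ints_minus minus_diff_eq)
  show "transp (\<lambda>x y::real. x - y \<in> \<int>)"
    by (rule transpI) (metis Ints_add diff_add_cancel add_diff_eq)
qed

instantiation torus :: ab_group_add
begin

lift_definition zero_torus :: torus is "0::real" .

lift_definition plus_torus :: "torus \<Rightarrow> torus \<Rightarrow> torus" is "(+)"
  by (metis Ints_add add_diff_add)

lift_definition uminus_torus :: "torus \<Rightarrow> torus" is uminus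
  by (metis Ints_minus minus_diff_minus)

lift_definition minus_torus :: "torus \<Rightarrow> torus \<Rightarrow> torus" is "(-)"
  by (metis Ints_diff diff_diff_eq2 diff_diff_add add.commute diff_add_eq)

instance by standard (transfer; simp)+

end

text \<open>The quotient topology.\<close>

instantiation torus :: topological_space
begin

definition open_torus :: "torus set \<Rightarrow> bool"
  where "open_torus U \<longleftrightarrow> open (to_torus -` U)"

instance
  by standard (auto simp: open_torus_def vimage_Union vimage_Int)

end

type_synonym T3 = "torus ^ 3"

definition to_T3 :: "real ^ 3 \<Rightarrow> T3"
  where "to_T3 y = (\<chi> i. to_torus (y $ i))"

definition Leb :: "T3 measure"
  where "Leb = distr (restrict_space lborel {y. \<forall>i. 0 \<le> y $ i \<and> y $ i < 1}) borel to_T3"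

lemma cont_to_torus: "continuous_on UNIV to_torus"
  by (auto simp: continuous_on_open_vimage open_torus_def)

lemma cont_to_T3: "continuous_on UNIV to_T3"
  unfolding to_T3_def
  by (intro continuous_on_vec_lambda continuous_on_compose2[OF cont_to_torus] continuous_intros) auto

lemma meas_to_T3: "to_T3 \<in> borel_measurable borel"
  by (rule borel_measurable_continuous_onI[OF cont_to_T3])

lemma emeasure_Leb_UNIV: "emeasure Leb UNIV = 1"
proof -
  let ?Q = "{y::real^3. \<forall>i. 0 \<le> y $ i \<and> y $ i < 1}"
  have Q: "?Q \<in> sets borel" by measurable
  have 1: "box 0 1 \<subseteq> ?Q" "?Q \<subseteq> cbox 0 (1::real^3)" by (auto simp: mem_box_cart less_imp_le)
  have o: "b \<bullet> (1::real^3) = 1" if "b \<in> Basis" for b using that by (auto simp: Basis_vec_def inner_axis')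
  have "emeasure lborel (cbox 0 (1::real^3)) = 1" "emeasure lborel (box 0 (1::real^3)) = 1"
    by (auto simp: emeasure_lborel_box_eq emeasure_lborel_cbox_eq o inner_commute)
  then have "emeasure lborel ?Q = 1" using emeasure_mono[OF 1(1), of lborel] emeasure_mono[OF 1(2), of lborel] Q by auto
  moreover have "to_T3 \<in> measurable (restrict_space lborel ?Q) borel"
    using meas_to_T3 by (auto intro: measurable_restrict_space1)
  ultimately show ?thesis unfolding Leb_def using Q
    by (subst emeasure_distr) (auto simp: space_restrict_space emeasure_restrict_space)
qed

lemma surj_to_T3: "range to_T3 = UNIV"
proof -
  have "to_T3 (\<chi> i. rep_torus (x $ i)) = x" for x 
    by (simp add: to_T3_def vec_eq_iff Quotient3_abs_rep[OF Quotient3_torus])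
  then show ?thesis by (metis surjI)
qed

lemma to_T3_eq_iff: "to_T3 x = to_T3 y \<longleftrightarrow> (\<forall>i. x $ i - y $ i \<in> \<int>)"
  by (simp add: to_T3_def vec_eq_iff torus.abs_eq_iff)

lemma to_T3_add: "to_T3 (x + y) = to_T3 x + to_T3 y"
  by (simp add: to_T3_def vec_eq_iff plus_torus.abs_eq)

text \<open>Index types for vectors and matrices made of blocks of sizes \<open>1,3\<close> and \<open>1,3,3,3\<close>.\<close>

type_synonym i4 = "1 + 3"
type_synonym i10 = "1 + 3 + 3 + 3"

definition blk4 :: "real \<Rightarrow> real ^ 3 \<Rightarrow> real ^ i4"
  where "blk4 a u = (\<chi> i. case i of Inl _ \<Rightarrow> a | Inr k \<Rightarrow> u $ k)"

definition blk10 :: "real ^ i4 \<Rightarrow> real ^ 3 \<Rightarrow> real ^ 3 \<Rightarrow> real ^ i10"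
  where "blk10 w u v = (\<chi> i. case i of
      Inl k \<Rightarrow> w $ Inl k
    | Inr (Inl k) \<Rightarrow> w $ Inr k
    | Inr (Inr (Inl k)) \<Rightarrow> u $ k
    | Inr (Inr (Inr k)) \<Rightarrow> v $ k)"


section \<open>Differential calculus on the torus\<close>

definition pd :: "3 \<Rightarrow> (T3 \<Rightarrow> 'b::real_normed_vector) \<Rightarrow> T3 \<Rightarrow> 'b"
  where "pd i f x = vector_derivative (\<lambda>s. f (x + to_T3 (s *\<^sub>R axis i 1))) (at 0)"

definition grad :: "(T3 \<Rightarrow> real) \<Rightarrow> T3 \<Rightarrow> real ^ 3"
  where "grad u x = (\<chi> i. pd i u x)"

definition diverg :: "(T3 \<Rightarrow> real ^ 3) \<Rightarrow> T3 \<Rightarrow> real"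
  where "diverg v x = (\<Sum>i\<in>UNIV. pd i (\<lambda>y. v y $ i) x)"

definition curl :: "(T3 \<Rightarrow> real ^ 3) \<Rightarrow> T3 \<Rightarrow> real ^ 3"
  where "curl v x = vector
    [pd 2 (\<lambda>y. v y $ 3) x - pd 3 (\<lambda>y. v y $ 2) x,
     pd 3 (\<lambda>y. v y $ 1) x - pd 1 (\<lambda>y. v y $ 3) x,
     pd 1 (\<lambda>y. v y $ 2) x - pd 2 (\<lambda>y. v y $ 1) x]"

definition jac :: "(T3 \<Rightarrow> real ^ 'n) \<Rightarrow> T3 \<Rightarrow> real ^ 3 ^ 'n"
  where "jac v x = (\<chi> i j. pd j (\<lambda>y. v y $ i) x)"

definition mdiverg :: "(T3 \<Rightarrow> real ^ 3 ^ 3) \<Rightarrow> T3 \<Rightarrow> real ^ 3"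
  where "mdiverg M x = (\<chi> i. \<Sum>j\<in>UNIV. pd j (\<lambda>y. M y $ i $ j) x)"

definition outer :: "real ^ 3 \<Rightarrow> real ^ 3 \<Rightarrow> real ^ 3 ^ 3"
  where "outer a b = (\<chi> i j. a $ i * b $ j)"

text \<open>The time derivative of a field on \<open>[0,T] \<times> \<T>\<^sup>3\<close> is one-sided at the two ends.\<close>

definition dt :: "real \<Rightarrow> (real \<Rightarrow> T3 \<Rightarrow> 'b::real_normed_vector) \<Rightarrow> real \<Rightarrow> T3 \<Rightarrow> 'b"
  where "dt T f t x = vector_derivative (\<lambda>s. f s x) (at t within {0..T})"

primrec Ck_T3 :: "nat \<Rightarrow> (T3 \<Rightarrow> 'b::real_normed_vector) \<Rightarrow> bool"
  where
    "Ck_T3 0 f \<longleftrightarrow> continuous_on UNIV f"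
  | "Ck_T3 (Suc k) f \<longleftrightarrow> continuous_on UNIV f \<and>
      (\<forall>i x. (\<lambda>s. f (x + to_T3 (s *\<^sub>R axis i 1))) differentiable (at 0)) \<and>
      (\<forall>i. Ck_T3 k (pd i f))"

primrec Ck_ST :: "real \<Rightarrow> nat \<Rightarrow> (real \<Rightarrow> T3 \<Rightarrow> 'b::real_normed_vector) \<Rightarrow> bool"
  where
    "Ck_ST T 0 f \<longleftrightarrow> continuous_on ({0..T} \<times> UNIV) (case_prod f)"
  | "Ck_ST T (Suc k) f \<longleftrightarrow> continuous_on ({0..T} \<times> UNIV) (case_prod f) \<and>
      (\<forall>t\<in>{0..T}. \<forall>x. (\<lambda>s. f s x) differentiable (at t within {0..T})) \<and>
      (\<forall>t\<in>{0..T}. \<forall>i x. (\<lambda>s. f t (x + to_T3 (s *\<^sub>R axis i 1))) differentiable (at 0)) \<and>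
      Ck_ST T k (dt T f) \<and> (\<forall>i. Ck_ST T k (\<lambda>t. pd i (f t)))"

definition smooth_T3 :: "(T3 \<Rightarrow> 'b::real_normed_vector) \<Rightarrow> bool"
  where "smooth_T3 f \<longleftrightarrow> (\<forall>k. Ck_T3 k f)"

definition smooth_ST :: "real \<Rightarrow> (real \<Rightarrow> T3 \<Rightarrow> 'b::real_normed_vector) \<Rightarrow> bool"
  where "smooth_ST T f \<longleftrightarrow> (\<forall>k. Ck_ST T k f)"


section \<open>Vector measures\<close>

text \<open>A vector measure on \<open>E\<close> is a function on sets; only its values on the Borel subsets of \<open>E\<close>
  are meaningful. Countable additivity of a finite-dimensional-valued set function already
  implies finiteness of its variation.\<close>

definition vector_measure_on ::
    "'a::topological_space set \<Rightarrow> ('a set \<Rightarrow> 'b::real_normed_vector) \<Rightarrow> bool"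
  where "vector_measure_on E \<nu> \<longleftrightarrow>
    (\<forall>A :: nat \<Rightarrow> 'a set. range A \<subseteq> sets (restrict_space borel E) \<and> disjoint_family A \<longrightarrow>
      (\<lambda>n. \<nu> (A n)) sums \<nu> (\<Union>n. A n))"

definition pos_part :: "'a::topological_space set \<Rightarrow> ('a set \<Rightarrow> real) \<Rightarrow> 'a measure"
  where "pos_part E \<nu> = measure_of E (sets (restrict_space borel E))
    (\<lambda>A. SUP B\<in>{B \<in> sets (restrict_space borel E). B \<subseteq> A}. ennreal (\<nu> B))"

text \<open>Integral of a function over \<open>E\<close> against a signed measure, by the Jordan decomposition.\<close>

definition sintegral :: "'a::topological_space set \<Rightarrow> ('a set \<Rightarrow> real) \<Rightarrow> ('a \<Rightarrow> real) \<Rightarrow> real"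
  where "sintegral E \<nu> f =
    integral\<^sup>L (pos_part E \<nu>) f - integral\<^sup>L (pos_part E (\<lambda>A. - \<nu> A)) f"

definition vintegral ::
    "'a::topological_space set \<Rightarrow> ('a set \<Rightarrow> real ^ 'n) \<Rightarrow> ('a \<Rightarrow> real ^ 'n) \<Rightarrow> real"
  where "vintegral E \<nu> F = (\<Sum>i\<in>UNIV. sintegral E (\<lambda>A. \<nu> A $ i) (\<lambda>x. F x $ i))"

text \<open>The measures \<open>f \<nu>\<close> for a signed measure \<open>\<nu>\<close> and a scalar or vector field \<open>f\<close>.\<close>

definition smult :: "('a::topological_space \<Rightarrow> real) \<Rightarrow> ('a set \<Rightarrow> real) \<Rightarrow> 'a set \<Rightarrow> real"
  where "smult f \<nu> A = sintegral A \<nu> f"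

definition vmult :: "('a::topological_space \<Rightarrow> real ^ 'n) \<Rightarrow> ('a set \<Rightarrow> real) \<Rightarrow> 'a set \<Rightarrow> real ^ 'n"
  where "vmult F \<nu> A = (\<chi> i. sintegral A \<nu> (\<lambda>x. F x $ i))"

definition variation ::
    "('a::topological_space set \<Rightarrow> 'b::real_normed_vector) \<Rightarrow> 'a set \<Rightarrow> ereal"
  where "variation \<nu> A =
    (SUP \<P>\<in>{\<P>. finite \<P> \<and> partition_on A \<P> \<and> \<P> \<subseteq> sets borel}. ereal (\<Sum>B\<in>\<P>. norm (\<nu> B)))"

text \<open>The measure on \<open>\<T>\<^sup>3\<close> with Lebesgue density \<open>f\<close>, and the measure \<open>\<mu>(s) ds\<close> on
  \<open>[0,T] \<times> \<T>\<^sup>3\<close>.\<close>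

definition dens :: "(T3 \<Rightarrow> 'b::{banach, second_countable_topology}) \<Rightarrow> T3 set \<Rightarrow> 'b"
  where "dens f A = (LINT x:A|Leb. f x)"

definition spacetime ::
    "real \<Rightarrow> (real \<Rightarrow> T3 set \<Rightarrow> 'b::{banach, second_countable_topology}) \<Rightarrow> (real \<times> T3) set \<Rightarrow> 'b"
  where "spacetime T \<mu> A = (LINT s:{0..T}|lborel. \<mu> s {x. (s, x) \<in> A})"

definition wstar_continuous :: "real \<Rightarrow> (real \<Rightarrow> T3 set \<Rightarrow> real ^ 'n) \<Rightarrow> bool"
  where "wstar_continuous T \<mu> \<longleftrightarrow>
    (\<forall>t\<in>{0..T}. vector_measure_on UNIV (\<mu> t)) \<and>
    (\<forall>\<phi>. continuous_on UNIV \<phi> \<longrightarrow> continuous_on {0..T} (\<lambda>t. vintegral UNIV (\<mu> t) \<phi>))"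

definition wstar_continuous_scalar :: "real \<Rightarrow> (real \<Rightarrow> T3 set \<Rightarrow> real) \<Rightarrow> bool"
  where "wstar_continuous_scalar T \<mu> \<longleftrightarrow>
    (\<forall>t\<in>{0..T}. vector_measure_on UNIV (\<mu> t)) \<and>
    (\<forall>\<phi>. continuous_on UNIV \<phi> \<longrightarrow> continuous_on {0..T} (\<lambda>t. sintegral UNIV (\<mu> t) \<phi>))"

definition measure_dist :: "(T3 set \<Rightarrow> real ^ i4) \<Rightarrow> (T3 set \<Rightarrow> real ^ i4) \<Rightarrow> ereal"
  where "measure_dist \<mu> \<nu> =
    (SUP f\<in>{f. Ck_T3 1 f \<and> (\<forall>x. norm (f x) \<le> 1) \<and> (\<forall>x. norm (jac f x) \<le> 1)}.
      ereal (vintegral UNIV (\<lambda>A. \<mu> A - \<nu> A) f))"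


section \<open>The augmented Born-Infeld system\<close>

definition ABI_solution ::
    "real \<Rightarrow> (real \<Rightarrow> T3 \<Rightarrow> real) \<Rightarrow> (real \<Rightarrow> T3 \<Rightarrow> real ^ 3) \<Rightarrow> (real \<Rightarrow> T3 \<Rightarrow> real ^ 3)
      \<Rightarrow> (real \<Rightarrow> T3 \<Rightarrow> real ^ 3) \<Rightarrow> bool"
  where "ABI_solution T h B D P \<longleftrightarrow> (\<forall>t\<in>{0..T}. \<forall>x.
    dt T h t x + diverg (P t) x = 0 \<and>
    dt T B t x + curl (\<lambda>y. (cross3 (B t y) (P t y) + D t y) /\<^sub>R h t y) x = 0 \<and>
    diverg (B t) x = 0 \<and>
    diverg (D t) x = 0 \<and>
    dt T D t x + curl (\<lambda>y. (cross3 (D t y) (P t y) - B t y) /\<^sub>R h t y) x = 0 \<and>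
    dt T P t x + mdiverg (\<lambda>y. (outer (P t y) (P t y) - outer (B t y) (B t y)
      - outer (D t y) (D t y) - mat 1) /\<^sub>R h t y) x = 0)"


section \<open>Dissipative solutions of Darcy MHD\<close>

definition \<Lambda> :: "(T3 set \<Rightarrow> real) \<Rightarrow> (T3 set \<Rightarrow> real ^ i4) \<Rightarrow> ereal"
  where "\<Lambda> \<rho> U =
    (SUP (a, A)\<in>{(a, A). continuous_on UNIV a \<and> continuous_on UNIV A \<and>
        (\<forall>x. a x + 1/2 * (norm (A x))\<^sup>2 \<le> 0)}.
      ereal (sintegral UNIV \<rho> a + vintegral UNIV U A))"

text \<open>The symmetric positive semidefinite square root, unique for a matrix that has one.\<close>

definition msqrt :: "real ^ 'n ^ 'n \<Rightarrow> real ^ 'n ^ 'n"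
  where "msqrt M = (THE S. transpose S = S \<and> (\<forall>\<xi>. 0 \<le> \<xi> \<bullet> (S *v \<xi>)) \<and> S ** S = M)"

definition \<Lambda>t ::
    "((real \<times> T3) set \<Rightarrow> real) \<Rightarrow> ((real \<times> T3) set \<Rightarrow> real ^ i10)
      \<Rightarrow> (real \<times> T3 \<Rightarrow> real ^ i10 ^ i10) \<Rightarrow> real \<Rightarrow> real \<Rightarrow> ereal"
  where "\<Lambda>t \<rho> W Q s t =
    (SUP (a, A)\<in>{(a, A). continuous_on ({s..t} \<times> UNIV) a \<and> continuous_on ({s..t} \<times> UNIV) A \<and>
        (\<forall>z\<in>{s..t} \<times> UNIV. a z + 1/2 * (norm (msqrt (matrix_inv (Q z)) *v A z))\<^sup>2 \<le> 0)}.
      ereal (sintegral ({s..t} \<times> UNIV) \<rho> a + vintegral ({s..t} \<times> UNIV) W A))"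

definition Qmat :: "(T3 \<Rightarrow> real ^ 3) \<Rightarrow> (T3 \<Rightarrow> real ^ 3) \<Rightarrow> (T3 \<Rightarrow> real ^ 3) \<Rightarrow> T3 \<Rightarrow> real ^ i10 ^ i10"
  where "Qmat b d v x = (\<chi> i j. case (i, j) of
      (Inl _, Inl _) \<Rightarrow> - 2 * diverg v x
    | (Inl _, Inr (Inl l)) \<Rightarrow> curl d x $ l
    | (Inl _, Inr (Inr (Inl l))) \<Rightarrow> - curl b x $ l
    | (Inl _, Inr (Inr (Inr l))) \<Rightarrow> 0
    | (Inr (Inl k), Inl _) \<Rightarrow> curl d x $ k
    | (Inr (Inl k), Inr (Inl l)) \<Rightarrow> (- jac v x - transpose (jac v x)) $ k $ l
    | (Inr (Inl k), Inr (Inr (Inl l))) \<Rightarrow> 0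
    | (Inr (Inl k), Inr (Inr (Inr l))) \<Rightarrow> (jac b x - transpose (jac b x)) $ k $ l
    | (Inr (Inr (Inl k)), Inl _) \<Rightarrow> - curl b x $ k
    | (Inr (Inr (Inl k)), Inr (Inl l)) \<Rightarrow> 0
    | (Inr (Inr (Inl k)), Inr (Inr (Inl l))) \<Rightarrow> (2 *\<^sub>R mat 1 :: real ^ 3 ^ 3) $ k $ l
    | (Inr (Inr (Inl k)), Inr (Inr (Inr l))) \<Rightarrow> 0
    | (Inr (Inr (Inr k)), Inl _) \<Rightarrow> 0
    | (Inr (Inr (Inr k)), Inr (Inl l)) \<Rightarrow> (transpose (jac b x) - jac b x) $ k $ l
    | (Inr (Inr (Inr k)), Inr (Inr (Inl l))) \<Rightarrow> 0
    | (Inr (Inr (Inr k)), Inr (Inr (Inr l))) \<Rightarrow> (2 *\<^sub>R mat 1 :: real ^ 3 ^ 3) $ k $ l)"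

definition Qr :: "real \<Rightarrow> (T3 \<Rightarrow> real ^ 3) \<Rightarrow> (T3 \<Rightarrow> real ^ 3) \<Rightarrow> (T3 \<Rightarrow> real ^ 3) \<Rightarrow> T3
      \<Rightarrow> real ^ i10 ^ i10"
  where "Qr r b d v x = Qmat b d v x + r *\<^sub>R (\<chi> i j. if i = j then blk10 (blk4 1 1) 0 0 $ i else 0)"

definition Lfield ::
    "real \<Rightarrow> (real \<Rightarrow> T3 \<Rightarrow> real) \<Rightarrow> (real \<Rightarrow> T3 \<Rightarrow> real ^ 3) \<Rightarrow> (real \<Rightarrow> T3 \<Rightarrow> real ^ 3)
      \<Rightarrow> (real \<Rightarrow> T3 \<Rightarrow> real ^ 3) \<Rightarrow> real \<Rightarrow> T3 \<Rightarrow> real ^ i10"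
  where "Lfield T h b d v t x = (let \<tau> = (\<lambda>t x. inverse (h t x)) in
    blk10
      (blk4
        (dt T \<tau> t x - \<tau> t x * diverg (v t) x + v t x \<bullet> grad (\<tau> t) x)
        (dt T b t x + jac (b t) x *v v t x - jac (v t) x *v b t x + \<tau> t x *\<^sub>R curl (d t) x))
      (d t x - \<tau> t x *\<^sub>R curl (b t) x)
      (v t x - jac (b t) x *v b t x - \<tau> t x *\<^sub>R grad (\<tau> t) x))"

text \<open>The relative measures \<open>U(t) = (\<L> - h / h\<^sup>*, B - h b\<^sup>*)\<close> and
  \<open>W = (U, D - h d\<^sup>*, P - h v\<^sup>*)\<close>; in the latter \<open>h\<close> and \<open>U\<close> stand for \<open>h(s) ds\<close> and \<open>U(s) ds\<close>.\<close>

definition Utilde ::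
    "(real \<Rightarrow> T3 set \<Rightarrow> real) \<Rightarrow> (real \<Rightarrow> T3 set \<Rightarrow> real ^ 3)
      \<Rightarrow> (real \<Rightarrow> T3 \<Rightarrow> real) \<Rightarrow> (real \<Rightarrow> T3 \<Rightarrow> real ^ 3) \<Rightarrow> real \<Rightarrow> T3 set \<Rightarrow> real ^ i4"
  where "Utilde h B hs bs t A =
    blk4 (measure Leb A - smult (\<lambda>x. inverse (hs t x)) (h t) A) (B t A - vmult (bs t) (h t) A)"

definition Wtilde ::
    "real \<Rightarrow> (real \<Rightarrow> T3 set \<Rightarrow> real) \<Rightarrow> (real \<Rightarrow> T3 set \<Rightarrow> real ^ 3)
      \<Rightarrow> ((real \<times> T3) set \<Rightarrow> real ^ 3) \<Rightarrow> ((real \<times> T3) set \<Rightarrow> real ^ 3)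
      \<Rightarrow> (real \<Rightarrow> T3 \<Rightarrow> real) \<Rightarrow> (real \<Rightarrow> T3 \<Rightarrow> real ^ 3) \<Rightarrow> (real \<Rightarrow> T3 \<Rightarrow> real ^ 3)
      \<Rightarrow> (real \<Rightarrow> T3 \<Rightarrow> real ^ 3) \<Rightarrow> (real \<times> T3) set \<Rightarrow> real ^ i10"
  where "Wtilde T h B D P hs bs ds vs A =
    blk10 (spacetime T (Utilde h B hs bs) A)
      (D A - vmult (case_prod ds) (spacetime T h) A)
      (P A - vmult (case_prod vs) (spacetime T h) A)"

definition dissipative_solution ::
    "real \<Rightarrow> real \<Rightarrow> (T3 set \<Rightarrow> real) \<Rightarrow> (T3 set \<Rightarrow> real ^ 3)
      \<Rightarrow> (real \<Rightarrow> T3 set \<Rightarrow> real) \<Rightarrow> (real \<Rightarrow> T3 set \<Rightarrow> real ^ 3)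
      \<Rightarrow> ((real \<times> T3) set \<Rightarrow> real ^ 3) \<Rightarrow> ((real \<times> T3) set \<Rightarrow> real ^ 3) \<Rightarrow> bool"
  where "dissipative_solution T K h0 B0 h B D P \<longleftrightarrow>
    wstar_continuous_scalar T h \<and> wstar_continuous T B \<and>
    vector_measure_on ({0..T} \<times> UNIV) D \<and> vector_measure_on ({0..T} \<times> UNIV) P \<and>
    (\<comment> \<open>initial data\<close>
      (\<forall>A\<in>sets borel. h 0 A = h0 A) \<and> (\<forall>A\<in>sets borel. B 0 A = B0 A) \<and>
      \<Lambda> h0 (\<lambda>A. blk4 (measure Leb A) (B0 A)) < \<infinity>) \<and>
    (\<comment> \<open>Hoelder bound\<close>
      (\<forall>t\<in>{0..T}. measure_dist (\<lambda>A. blk4 (h t A) (B t A)) (\<lambda>A. 0) \<le> ereal K) \<and>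
      (\<forall>s\<in>{0..T}. \<forall>t\<in>{0..T}.
        measure_dist (\<lambda>A. blk4 (h t A) (B t A)) (\<lambda>A. blk4 (h s A) (B s A))
          \<le> ereal (K * \<bar>t - s\<bar> powr (1/2)))) \<and>
    (\<comment> \<open>continuity equation and solenoidality\<close>
      \<forall>u. Ck_ST T 1 u \<longrightarrow> (\<forall>t\<in>{0..T}.
        sintegral ({0..t} \<times> UNIV) (spacetime T h) (case_prod (dt T u))
            + vintegral ({0..t} \<times> UNIV) P (\<lambda>(s, x). grad (u s) x)
          = sintegral UNIV (h t) (u t) - sintegral UNIV (h 0) (u 0) \<and>
        vintegral UNIV (B t) (grad (u t)) = 0)) \<and>
    (\<comment> \<open>relative entropy inequality\<close>
      \<forall>t\<in>{0..T}. \<forall>hs bs ds vs r.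
        Ck_ST T 1 hs \<and> (\<forall>s\<in>{0..T}. \<forall>x. 0 < hs s x) \<and>
        Ck_ST T 1 bs \<and> Ck_ST T 1 ds \<and> Ck_ST T 1 vs \<and>
        (\<forall>s\<in>{0..T}. \<forall>x \<xi>. \<xi> \<bullet> \<xi> \<le> \<xi> \<bullet> (Qr r (bs s) (ds s) (vs s) x *v \<xi>)) \<longrightarrow>
        ereal (exp (- r * t)) * \<Lambda> (h t) (Utilde h B hs bs t)
          + \<Lambda>t (spacetime T h) (Wtilde T h B D P hs bs ds vs)
              (\<lambda>(s, x). exp (- r * s) *\<^sub>R Qr r (bs s) (ds s) (vs s) x) 0 t
          + ereal (vintegral ({0..t} \<times> UNIV) (Wtilde T h B D P hs bs ds vs)
              (\<lambda>(s, x). exp (- r * s) *\<^sub>R Lfield T hs bs ds vs s x))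
        \<le> \<Lambda> (h 0) (Utilde h B hs bs 0))"


section \<open>Quadratic change of time\<close>

text \<open>\<open>is_rescaled t0 M N\<close>: \<open>N\<close> is the measure \<open>s M(s\<^sup>2/2)\<close> on \<open>[0,t0] \<times> \<T>\<^sup>3\<close>.\<close>

definition is_rescaled ::
    "real \<Rightarrow> ((real \<times> T3) set \<Rightarrow> real ^ 3) \<Rightarrow> ((real \<times> T3) set \<Rightarrow> real ^ 3) \<Rightarrow> bool"
  where "is_rescaled t0 M N \<longleftrightarrow>
    vector_measure_on ({0..t0} \<times> UNIV) N \<and>
    (\<forall>\<phi>. continuous_on ({0..t0} \<times> UNIV) \<phi> \<longrightarrow>
      vintegral ({0..t0} \<times> UNIV) N \<phi>
        = vintegral ({0..t0\<^sup>2 / 2} \<times> UNIV) M (\<lambda>(s, x). \<phi> (sqrt (2 * s), x)))"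

lemma sets_restrict_borel_sub:
  "A \<in> sets (restrict_space borel E) \<Longrightarrow> A \<subseteq> E"
  using sets.sets_into_space[of A "restrict_space borel E"] by (simp add: space_restrict_space)

lemma sigma_sets_restrict_borel:
  "sigma_sets E (sets (restrict_space borel E)) = sets (restrict_space borel E)"
  using sets.sigma_sets_eq[of "restrict_space borel E"] by (simp add: space_restrict_space)

lemma space_pos_part [simp]: "space (pos_part E \<nu>) = E"
  unfolding pos_part_def by (rule space_measure_of) (auto dest: sets_restrict_borel_sub)

lemma sets_pos_part [simp]: "sets (pos_part E \<nu>) = sets (restrict_space borel E)"
  unfolding pos_part_def
  by (subst sets_measure_of) (auto dest: sets_restrict_borel_sub simp: sigma_sets_restrict_borel)

lemma measure_space_transport:
  assumes g: "g \<in> measurable M N" and ms: "measure_space (space M) (sets M) \<mu>"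
    and eq: "\<And>A. A \<in> sets N \<Longrightarrow> \<mu>' A = \<mu> (g -` A \<inter> space M)"
  shows "measure_space (space N) (sets N) \<mu>'"
  unfolding measure_space_def
proof (intro conjI)
  show "sigma_algebra (space N) (sets N)" by (rule sets.sigma_algebra_axioms)
  show "positive (sets N) \<mu>'"
    using ms eq[of "{}"] by (auto simp: measure_space_def positive_def)
  show "countably_additive (sets N) \<mu>'"
    unfolding countably_additive_def
  proof (intro allI impI)
    fix A :: "nat \<Rightarrow> _" assume A: "range A \<subseteq> sets N" "disjoint_family A" "(\<Union>i. A i) \<in> sets N"
    have ca: "countably_additive (sets M) \<mu>" using ms by (simp add: measure_space_def)
    have r: "range (\<lambda>i. g -` A i \<inter> space M) \<subseteq> sets M"
      using A(1) g by (auto intro: measurable_sets)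
    have d: "disjoint_family (\<lambda>i. g -` A i \<inter> space M)"
      using A(2) by (auto simp: disjoint_family_on_def)
    have "(\<Sum>i. \<mu> (g -` A i \<inter> space M)) = \<mu> (\<Union>i. g -` A i \<inter> space M)"
      using ca r d unfolding countably_additive_def by blast
    moreover have "(\<Union>i. g -` A i \<inter> space M) = g -` (\<Union>i. A i) \<inter> space M" by auto
    ultimately show "(\<Sum>i. \<mu>' (A i)) = \<mu>' (\<Union>i. A i)"
      using A eq by (simp add: range_subsetD)
  qed
qed

lemma pos_part_transport:
  assumes g: "g \<in> measurable (restrict_space borel F) (restrict_space borel E)"
    and k: "k \<in> measurable (restrict_space borel E) (restrict_space borel F)"
    and kg: "\<And>z. z \<in> F \<Longrightarrow> k (g z) = z" and gk: "\<And>z. z \<in> E \<Longrightarrow> g (k z) = z"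
  shows "pos_part E (\<lambda>A. \<nu> (g -` A \<inter> F)) = distr (pos_part F \<nu>) (restrict_space borel E) g"
proof (rule measure_eqI)
  let ?E = "restrict_space borel E" and ?F = "restrict_space borel F"
  have sp: "space ?E = E" "space ?F = F" by (auto simp: space_restrict_space)
  show "sets (pos_part E (\<lambda>A. \<nu> (g -` A \<inter> F))) = sets (distr (pos_part F \<nu>) ?E g)" by simp
  define p where "p = (\<lambda>A. SUP B\<in>{B \<in> sets ?F. B \<subseteq> A}. ennreal (\<nu> B))"
  define q where "q = (\<lambda>A. SUP B\<in>{B \<in> sets ?E. B \<subseteq> A}. ennreal (\<nu> (g -` B \<inter> F)))"
  have gF: "g z \<in> E" if "z \<in> F" for z using measurable_space[OF g] that sp by auto
  have kE: "k z \<in> F" if "z \<in> E" for z using measurable_space[OF k] that sp by auto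
  have gs: "g -` A \<inter> F \<in> sets ?F" if "A \<in> sets ?E" for A
    using measurable_sets[OF g that] sp by simp
  have ks: "k -` A \<inter> E \<in> sets ?E" if "A \<in> sets ?F" for A
    using measurable_sets[OF k that] sp by simp
  have bk: "g -` (k -` B \<inter> E) \<inter> F = B" if "B \<subseteq> F" for B
    using that gF kg by auto
  have pq: "q A = p (g -` A \<inter> F)" if A: "A \<in> sets ?E" for A
  proof -
    have "(\<lambda>B. g -` B \<inter> F) ` {B \<in> sets ?E. B \<subseteq> A} = {B \<in> sets ?F. B \<subseteq> g -` A \<inter> F}"
    proof (intro equalityI subsetI)
      fix B assume "B \<in> (\<lambda>B. g -` B \<inter> F) ` {B \<in> sets ?E. B \<subseteq> A}"
      then show "B \<in> {B \<in> sets ?F. B \<subseteq> g -` A \<inter> F}" using gs by auto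
    next
      fix B assume B: "B \<in> {B \<in> sets ?F. B \<subseteq> g -` A \<inter> F}"
      then have "B = g -` (k -` B \<inter> E) \<inter> F" using bk[of B] by simp
      moreover have "k -` B \<inter> E \<subseteq> A" using B gk by force
      ultimately show "B \<in> (\<lambda>B. g -` B \<inter> F) ` {B \<in> sets ?E. B \<subseteq> A}"
        using B ks by (intro image_eqI[where x = "k -` B \<inter> E"]) auto
    qed
    from this[symmetric] show ?thesis unfolding p_def q_def by (simp only: image_image)
  qed
  have qp: "p B = q (k -` B \<inter> E)" if B: "B \<in> sets ?F" for B
    using pq[OF ks[OF B]] bk[of B] sets_restrict_borel_sub[OF B] by simp
  have ms: "measure_space E (sets ?E) q \<longleftrightarrow> measure_space F (sets ?F) p"
    using measure_space_transport[OF g, of p q] measure_space_transport[OF k, of q p] pq qp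
    by (auto simp: sp)
  fix A assume "A \<in> sets (pos_part E (\<lambda>A. \<nu> (g -` A \<inter> F)))"
  then have A: "A \<in> sets ?E" by simp
  have "emeasure (distr (pos_part F \<nu>) ?E g) A = emeasure (pos_part F \<nu>) (g -` A \<inter> F)"
    using A g by (subst emeasure_distr) (auto simp: measurable_cong_sets[OF sets_pos_part refl])
  also have "\<dots> = (if measure_space F (sets ?F) p then p (g -` A \<inter> F) else 0)"
    unfolding pos_part_def emeasure_measure_of_conv sigma_sets_restrict_borel
    using gs[OF A] by (simp add: p_def)
  also have "\<dots> = (if measure_space E (sets ?E) q then q A else 0)"
    using ms pq[OF A] by simp
  also have "\<dots> = emeasure (pos_part E (\<lambda>A. \<nu> (g -` A \<inter> F))) A"
    unfolding pos_part_def emeasure_measure_of_conv sigma_sets_restrict_borel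
    using A by (simp add: q_def)
  finally show "emeasure (pos_part E (\<lambda>A. \<nu> (g -` A \<inter> F))) A
      = emeasure (distr (pos_part F \<nu>) ?E g) A" ..
qed

lemma sintegral_transport:
  assumes g: "g \<in> measurable (restrict_space borel F) (restrict_space borel E)"
    and k: "k \<in> measurable (restrict_space borel E) (restrict_space borel F)"
    and kg: "\<And>z. z \<in> F \<Longrightarrow> k (g z) = z" and gk: "\<And>z. z \<in> E \<Longrightarrow> g (k z) = z"
    and f: "f \<in> borel_measurable (restrict_space borel E)"
  shows "sintegral E (\<lambda>A. \<nu> (g -` A \<inter> F)) f = sintegral F \<nu> (\<lambda>z. f (g z))"
proof -
  have "integral\<^sup>L (pos_part E (\<lambda>A. \<mu> (g -` A \<inter> F))) f = integral\<^sup>L (pos_part F \<mu>) (\<lambda>z. f (g z))" for \<mu>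
  proof -
    have eq: "pos_part E (\<lambda>A. \<mu> (g -` A \<inter> F)) = distr (pos_part F \<mu>) (restrict_space borel E) g"
      by (rule pos_part_transport[OF g k kg gk])
    have "g \<in> measurable (pos_part F \<mu>) (restrict_space borel E)"
      using g by (simp add: measurable_cong_sets[OF sets_pos_part refl])
    then show ?thesis unfolding eq using f by (rule integral_distr)
  qed
  from this[of \<nu>] this[of "\<lambda>A. - \<nu> A"] show ?thesis by (simp add: sintegral_def)
qed

text \<open>The measure \<open>s M(s\<^sup>2/2)\<close> exists: it is the image of \<open>M\<close> under \<open>(s,x) \<mapsto> (sqrt (2 s), x)\<close>.\<close>

lemma is_rescaled_image:
  assumes t0: "0 \<le> t0" and M: "vector_measure_on ({0..t0\<^sup>2 / 2} \<times> UNIV) M"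
  shows "is_rescaled t0 M
    (\<lambda>A. M ((\<lambda>(s, x). (sqrt (2 * s), x)) -` A \<inter> {0..t0\<^sup>2 / 2} \<times> UNIV))"
proof -
  let ?E = "{0..t0} \<times> (UNIV :: T3 set)" and ?F = "{0..t0\<^sup>2 / 2} \<times> (UNIV :: T3 set)"
  define g :: "real \<times> T3 \<Rightarrow> real \<times> T3" where "g = (\<lambda>(s, x). (sqrt (2 * s), x))"
  define k :: "real \<times> T3 \<Rightarrow> real \<times> T3" where "k = (\<lambda>(s, x). (s\<^sup>2 / 2, x))"
  have gE: "g z \<in> ?E" if "z \<in> ?F" for z
    using that t0 real_sqrt_le_mono[of "2 * fst z" "t0\<^sup>2"] by (auto simp: g_def)
  have kF: "k z \<in> ?F" if "z \<in> ?E" for z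
    using that by (auto simp: k_def intro!: divide_right_mono power_mono)
  have kg: "k (g z) = z" if "z \<in> ?F" for z using that by (auto simp: g_def k_def)
  have gk: "g (k z) = z" if "z \<in> ?E" for z using that by (auto simp: g_def k_def)
  have cg: "continuous_on UNIV g" unfolding g_def case_prod_beta by (intro continuous_intros)
  have ck: "continuous_on UNIV k" unfolding k_def case_prod_beta by (intro continuous_intros) auto
  have g: "g \<in> measurable (restrict_space borel ?F) (restrict_space borel ?E)"
    using gE cg by (intro measurable_restrict_space2 measurable_restrict_space1)
      (auto simp: space_restrict_space borel_measurable_continuous_onI)
  have k: "k \<in> measurable (restrict_space borel ?E) (restrict_space borel ?F)"
    using kF ck by (intro measurable_restrict_space2 measurable_restrict_space1)
      (auto simp: space_restrict_space borel_measurable_continuous_onI)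
  have sp: "space (restrict_space borel ?F) = ?F" by (simp add: space_restrict_space)
  show ?thesis
    unfolding is_rescaled_def g_def[symmetric]
  proof (intro conjI allI impI)
    show "vector_measure_on ?E (\<lambda>A. M (g -` A \<inter> ?F))"
      unfolding vector_measure_on_def
    proof (intro allI impI)
      fix A :: "nat \<Rightarrow> (real \<times> T3) set"
      assume A: "range A \<subseteq> sets (restrict_space borel ?E) \<and> disjoint_family A"
      have "range (\<lambda>n. g -` A n \<inter> ?F) \<subseteq> sets (restrict_space borel ?F)"
        using A measurable_sets[OF g] by (auto simp: sp)
      moreover have "disjoint_family (\<lambda>n. g -` A n \<inter> ?F)"
        using A unfolding disjoint_family_on_def by blast
      ultimately have "(\<lambda>n. M (g -` A n \<inter> ?F)) sums M (\<Union>n. g -` A n \<inter> ?F)"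
        using M unfolding vector_measure_on_def by blast
      moreover have "(\<Union>n. g -` A n \<inter> ?F) = g -` (\<Union>n. A n) \<inter> ?F" by auto
      ultimately show "(\<lambda>n. M (g -` A n \<inter> ?F)) sums M (g -` (\<Union>n. A n) \<inter> ?F)" by simp
    qed
  next
    fix \<phi> :: "real \<times> T3 \<Rightarrow> real ^ 3" assume \<phi>: "continuous_on ?E \<phi>"
    have "sintegral ?E (\<lambda>A. M (g -` A \<inter> ?F) $ i) (\<lambda>z. \<phi> z $ i)
        = sintegral ?F (\<lambda>A. M A $ i) (\<lambda>z. \<phi> (g z) $ i)" for i
      using sintegral_transport[OF g k kg gk, where \<nu> = "\<lambda>A. M A $ i" and f = "\<lambda>z. \<phi> z $ i"]
        \<phi> by (auto intro!: borel_measurable_continuous_on_restrict continuous_intros)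
    then show "vintegral ?E (\<lambda>A. M (g -` A \<inter> ?F)) \<phi> = vintegral ?F M (\<lambda>(s, x). \<phi> (sqrt (2 * s), x))"
      by (simp add: vintegral_def g_def case_prod_beta)
  qed
qed

end

theory Submission imports Defs begin

text \<open>Put \<open>\<theta> = t\<^sup>2/2\<close>. Both solutions are compared with explicit fields that depend only on the initial
  data, and the two comparisons are added.

  \<^bold>\<open>The fields.\<close> Let \<open>\<tau>\<^sub>0 = 1/h\<^sub>0\<close> and \<open>b\<^sub>0 = B\<^sub>0/h\<^sub>0\<close>. The Darcy equations at time zero determine \<open>d\<^sub>1\<close>, \<open>v\<^sub>1\<close>
  (the initial values of \<open>D/h\<close>, \<open>P/h\<close>) and \<open>\<tau>\<^sub>1\<close>, \<open>b\<^sub>1\<close> (the initial time derivatives of \<open>1/h\<close>, \<open>B/h\<close>).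
  The test fields are
  \<open>1/h\<^sup>* = \<tau>\<^sub>0 + \<phi> \<tau>\<^sub>1\<close>, \<open>b\<^sup>* = b\<^sub>0 + \<phi> b\<^sub>1\<close>, \<open>d\<^sup>* = d\<^sub>1\<close>, \<open>v\<^sup>* = v\<^sub>1\<close> with \<open>\<phi>(s) = s/(1 + \<mu> s)\<close>.
  Since \<open>\<phi>\<close> is bounded, they can be used on every interval \<open>[0, T]\<close>, and all constants are independent
  of \<open>T\<close> and of the dissipative solution. By the choice of the coefficients their residual satisfies
  \<open>|L(s)| \<le> C s\<close> (\<open>ex_Lfield_bound\<close>), and the relative measure \<open>U\<close> vanishes at time zero.

  \<^bold>\<open>The Born-Infeld side.\<close> As \<open>D'\<close> and \<open>P'\<close> vanish initially, the time derivatives of \<open>h'\<close> and \<open>B'\<close> do so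
  as well, and a Taylor expansion of the system gives \<open>D' = t h\<^sub>0 d\<^sub>1\<close>, \<open>P' = t h\<^sub>0 v\<^sub>1\<close> and then
  \<open>h' = h\<^sub>0 - \<theta> h\<^sub>0\<^sup>2 \<tau>\<^sub>1\<close>, with the matching formula for \<open>B'\<close>, all up to \<open>O(t\<^sup>3)\<close> (\<open>ABI_expansion\<close>). To this order
  the right-hand sides are \<open>t h\<^sup>* d\<^sub>1\<close>, \<open>t h\<^sup>* v\<^sub>1\<close>, \<open>h\<^sup>*\<close> and \<open>h\<^sup>* b\<^sup>*\<close> at time \<open>\<theta>\<close>
  (\<open>Born_Infeld_vs_test_fields\<close>).

  \<^bold>\<open>The Darcy side.\<close> In the relative entropy inequality on \<open>[0, \<theta>]\<close> the right-hand side is zero, and the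
  residual term is absorbed by the dissipation, at a price \<open>C \<theta>\<^sup>2\<close> times the space-time mass \<open>\<theta> \<integral> h\<^sub>0\<close>
  (\<open>stability\<close>). So both \<open>\<Lambda>(h(\<theta>), U(\<theta>))\<close> and the dissipation are \<open>O(\<theta>\<^sup>3)\<close>. The functional \<open>\<Lambda>\<close> is
  \<open>\<integral> |U|\<^sup>2/(2 h)\<close>, so by the Cauchy-Schwarz inequality, here in the form of competitors \<open>(- l\<^sup>2/2, l F)\<close> with
  an optimised \<open>l\<close>, the variation of \<open>U(\<theta>)\<close> is \<open>O(\<theta>\<^sup>3\<^sup>/\<^sup>2) = O(t\<^sup>3)\<close>, and that of \<open>W\<close> on \<open>[0, \<theta>]\<close> is
  \<open>O(\<theta>\<^sup>3\<^sup>/\<^sup>2 \<theta>\<^sup>1\<^sup>/\<^sup>2) = O(t\<^sup>4)\<close> (\<open>U_estimate\<close>, \<open>W_estimate\<close>). Multiplication by \<open>h\<^sup>*\<close> turns these into estimates for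
  \<open>h - h\<^sup>*\<close>, \<open>B - h\<^sup>* b\<^sup>*\<close>, \<open>D - h\<^sup>* d\<^sub>1\<close> and \<open>P - h\<^sup>* v\<^sub>1\<close> (\<open>density_variation\<close>, \<open>flux_pairing\<close>), and the
  quadratic change of time for \<open>D\<close> and \<open>P\<close> is a substitution in the integral (\<open>rescaled_variation\<close>).

  \<^bold>\<open>Background.\<close> Variations are estimated through pairings with continuous fields (\<open>variation_sum_le\<close>).
  Integration against signed measures is developed through the Jordan decomposition and a monotone
  class argument (\<open>sintegral_eqI\<close>, \<open>sintegral_spacetime\<close>). The square root in the dissipation
  functional exists by the spectral theorem, and only the inequality
  \<open>|\<surd>(Q\<^sup>-\<^sup>1) A|\<^sup>2 \<le> |A|\<^sup>2/c\<close> for \<open>Q \<ge> c\<close> enters (\<open>norm_msqrt_inverse_le\<close>).\<close>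

section \<open>The torus as a compact metric space\<close>

lemma to_torus_eq_iff: "to_torus a = to_torus b \<longleftrightarrow> a - b \<in> \<int>"
  by (simp add: torus.abs_eq_iff)

lemma to_torus_add_int [simp]: "to_torus (a + of_int k) = to_torus a"
  by (simp add: to_torus_eq_iff)

lemma torus_cases: obtains a where "x = to_torus a" "0 \<le> a" "a < 1"
proof -
  obtain b where b: "x = to_torus b" by (metis Quotient3_abs_rep[OF Quotient3_torus])
  have "x = to_torus (frac b)"
    unfolding b by (simp add: to_torus_eq_iff frac_def)
  then show ?thesis by (intro that[of "frac b"]) (auto simp: frac_lt_1)
qed

definition dist_int :: "real \<Rightarrow> real"
  where "dist_int a = \<bar>a - of_int (round a)\<bar>"

lemma dist_int_le: "dist_int a \<le> \<bar>a - of_int k\<bar>"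
  unfolding dist_int_def by (rule round_diff_minimal)

lemma dist_int_shift: "a - b \<in> \<int> \<Longrightarrow> dist_int a = dist_int b"
proof -
  have *: "dist_int a \<le> dist_int b" if "a - b \<in> \<int>" for a b
  proof -
    from that obtain k where k: "a - b = of_int k" by (rule Ints_cases)
    then show ?thesis
      using dist_int_le[of a "round b + k"] by (simp add: dist_int_def algebra_simps)
  qed
  assume "a - b \<in> \<int>"
  moreover from this have "b - a \<in> \<int>" using Ints_minus[of "a - b"] by simp
  ultimately show ?thesis using *[of a b] *[of b a] by simp
qed

text \<open>The quotient topology comes from the distance of the difference of two representatives to the
  nearest integer. The metric provides distance functions to closed sets, from which indicators of
  open sets are approximated by continuous functions.\<close>

instantiation torus :: metric_space
begin

lift_definition dist_torus :: "torus \<Rightarrow> torus \<Rightarrow> real" is "\<lambda>x y. dist_int (x - y)"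
proof -
  fix a b c d :: real assume "a - b \<in> \<int>" "c - d \<in> \<int>"
  then have "(a - b) - (c - d) \<in> \<int>" by (rule Ints_diff)
  moreover have "(a - c) - (b - d) = (a - b) - (c - d)" by simp
  ultimately show "dist_int (a - c) = dist_int (b - d)" by (intro dist_int_shift) (simp only:)
qed

definition uniformity_torus :: "(torus \<times> torus) filter"
  where "uniformity_torus = (INF e\<in>{0 <..}. principal {(x, y). dist x y < e})"

instance
proof
  show "dist x y = 0 \<longleftrightarrow> x = y" for x y :: torus
  proof transfer
    fix x y :: real
    show "dist_int (x - y) = 0 \<longleftrightarrow> x - y \<in> \<int>"
    proof
      assume "dist_int (x - y) = 0"
      then have "x - y = of_int (round (x - y))" by (simp add: dist_int_def)
      then show "x - y \<in> \<int>" by (metis Ints_of_int)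
    next
      assume "x - y \<in> \<int>"
      then have "dist_int (x - y) = dist_int 0" by (intro dist_int_shift) simp
      then show "dist_int (x - y) = 0" by (simp add: dist_int_def)
    qed
  qed
  show "dist x y \<le> dist x z + dist y z" for x y z :: torus
  proof transfer
    fix x y z :: real
    show "dist_int (x - y) \<le> dist_int (x - z) + dist_int (y - z)"
      using dist_int_le[of "x - y" "round (x - z) - round (y - z)"] by (simp add: dist_int_def)
  qed
  show "uniformity = (INF e\<in>{0 <..}. principal {(x, y::torus). dist x y < e})"
    by (rule uniformity_torus_def)
  fix U :: "torus set"
  have "open U \<longleftrightarrow> (\<forall>x\<in>U. \<exists>e>0. \<forall>y. dist x y < e \<longrightarrow> y \<in> U)"
  proof
    assume "open U"
    then have V: "open (to_torus -` U)" by (simp add: open_torus_def)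
    show "\<forall>x\<in>U. \<exists>e>0. \<forall>y. dist x y < e \<longrightarrow> y \<in> U"
    proof
      fix x assume "x \<in> U"
      obtain a where a: "x = to_torus a" using torus_cases by blast
      then obtain e where e: "e > 0" "\<And>b. dist b a < e \<Longrightarrow> to_torus b \<in> U"
        using V \<open>x \<in> U\<close> unfolding open_dist by (metis vimageE vimageI)
      have "y \<in> U" if "dist x y < e" for y
      proof -
        obtain b where b: "y = to_torus b" using torus_cases by blast
        define c where "c = b + of_int (round (a - b))"
        have "dist c a < e"
          using that unfolding a b dist_torus.abs_eq c_def dist_int_def dist_real_def by linarith
        from e(2)[OF this] show ?thesis unfolding b c_def by simp
      qed
      with e(1) show "\<exists>e>0. \<forall>y. dist x y < e \<longrightarrow> y \<in> U" by blast
    qed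
  next
    assume U: "\<forall>x\<in>U. \<exists>e>0. \<forall>y. dist x y < e \<longrightarrow> y \<in> U"
    show "open U" unfolding open_torus_def open_dist
    proof (intro ballI)
      fix a assume "a \<in> to_torus -` U"
      then obtain e where e: "e > 0" "\<And>y. dist (to_torus a) y < e \<Longrightarrow> y \<in> U" using U by auto
      have "to_torus b \<in> U" if "dist b a < e" for b
        using that dist_int_le[of "a - b" 0]
        by (intro e(2)) (simp add: dist_torus.abs_eq dist_real_def abs_minus_commute)
      with e(1) show "\<exists>e>0. \<forall>y. dist y a < e \<longrightarrow> y \<in> to_torus -` U" by auto
    qed
  qed
  also have "\<dots> \<longleftrightarrow> (\<forall>x\<in>U. \<forall>\<^sub>F (x', y) in uniformity. x' = x \<longrightarrow> y \<in> U)"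
  proof -
    have "eventually Q uniformity \<longleftrightarrow> (\<exists>e>0. \<forall>x y. dist x y < e \<longrightarrow> Q (x, y))" for Q :: "torus \<times> torus \<Rightarrow> bool"
      unfolding uniformity_torus_def
    proof (subst eventually_INF_base)
      fix a b :: real assume "a \<in> {0<..}" "b \<in> {0<..}"
      then show "\<exists>c\<in>{0<..}. principal {(x, y::torus). dist x y < c}
          \<le> inf (principal {(x, y). dist x y < a}) (principal {(x, y). dist x y < b})"
        by (intro bexI[of _ "min a b"]) auto
    qed (auto simp: eventually_principal)
    then show ?thesis by auto
  qed
  finally show "open U \<longleftrightarrow> (\<forall>x\<in>U. \<forall>\<^sub>F (x', y) in uniformity. x' = x \<longrightarrow> y \<in> U)" .
qed

end

text \<open>The saturation of \<open>V\<close> is the union of its integer translates.\<close>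

lemma open_to_torus_image:
  assumes "open V" shows "open (to_torus ` V)"
proof -
  have "to_torus -` (to_torus ` V) = (\<Union>k::int. (\<lambda>a. a + of_int k) ` V)"
  proof (intro equalityI subsetI)
    fix a assume "a \<in> to_torus -` (to_torus ` V)"
    then obtain b where b: "b \<in> V" "a - b \<in> \<int>" by (auto simp: to_torus_eq_iff)
    from this(2) obtain k where "a - b = of_int k" by (rule Ints_cases)
    then have "a = b + of_int k" by simp
    with b show "a \<in> (\<Union>k::int. (\<lambda>a. a + of_int k) ` V)" by auto
  qed auto
  moreover have "open (\<Union>k::int. (\<lambda>a. a + of_int k) ` V)"
  proof (intro open_UN ballI)
    fix k :: int
    have "(\<lambda>a. a + of_int k) ` V = (+) (of_int k) ` V" by (intro image_cong) auto
    then show "open ((\<lambda>a. a + of_int k) ` V)" using assms open_translation by metis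
  qed
  ultimately show ?thesis by (simp add: open_torus_def)
qed

lemma open_to_T3_image:
  assumes "open V" shows "open (to_T3 ` V)"
  unfolding open_vec_def
proof (intro ballI)
  fix x assume "x \<in> to_T3 ` V"
  then obtain y where y: "y \<in> V" "x = to_T3 y" by auto
  from assms[unfolded open_vec_def, rule_format, OF y(1)]
  obtain A where A: "\<forall>i. open (A i) \<and> y $ i \<in> A i" "\<forall>z. (\<forall>i. z $ i \<in> A i) \<longrightarrow> z \<in> V" by auto
  have "z \<in> to_T3 ` V" if z: "\<forall>i. z $ i \<in> to_torus ` A i" for z
  proof -
    have "\<forall>i. \<exists>w. w \<in> A i \<and> z $ i = to_torus w" using z by blast
    then obtain w where w: "\<And>i. w i \<in> A i \<and> z $ i = to_torus (w i)" by metis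
    then have "z = to_T3 (\<chi> i. w i)" by (simp add: to_T3_def vec_eq_iff)
    moreover have "(\<chi> i. w i) \<in> V" using A(2) w by simp
    ultimately show ?thesis by blast
  qed
  then show "\<exists>A. (\<forall>i. open (A i) \<and> x $ i \<in> A i) \<and> (\<forall>z. (\<forall>i. z $ i \<in> A i) \<longrightarrow> z \<in> to_T3 ` V)"
    using A(1) y(2) open_to_torus_image by (intro exI[of _ "\<lambda>i. to_torus ` A i"]) (auto simp: to_T3_def)
qed

lemma compact_T3: "compact (UNIV :: T3 set)"
proof -
  have "to_T3 ` cbox 0 1 = UNIV"
  proof (intro equalityI subsetI UNIV_I)
    fix x :: T3
    have "\<exists>w. x $ i = to_torus w \<and> 0 \<le> w \<and> w < 1" for i by (rule torus_cases[of "x $ i"]) auto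
    then obtain w where w: "\<And>i. x $ i = to_torus (w i) \<and> 0 \<le> w i \<and> w i < 1" by metis
    then have "x = to_T3 (\<chi> i. w i)" by (simp add: to_T3_def vec_eq_iff)
    moreover have "(\<chi> i. w i) \<in> cbox 0 1" using w by (simp add: mem_box_cart less_imp_le)
    ultimately show "x \<in> to_T3 ` cbox 0 1" by blast
  qed
  moreover have "compact (to_T3 ` cbox 0 1)"
    by (intro compact_continuous_image continuous_on_subset[OF cont_to_T3]) auto
  ultimately show ?thesis by simp
qed

lemma compact_slab: "compact ({a..b::real} \<times> (UNIV :: T3 set))"
  by (intro compact_Times compact_T3 compact_Icc)

lemma continuous_T3_bounded:
  fixes f :: "T3 \<Rightarrow> 'b::real_normed_vector"
  assumes "continuous_on UNIV f" obtains K where "K > 0" "\<And>x. norm (f x) \<le> K"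
proof -
  have "bounded (range f)"
    by (rule compact_imp_bounded[OF compact_continuous_image[OF assms compact_T3]])
  then obtain K where "K > 0" "\<forall>y\<in>range f. norm y \<le> K" unfolding bounded_pos by auto
  then show ?thesis by (intro that[of K]) auto
qed

lemma continuous_slab_bounded:
  fixes f :: "real \<times> T3 \<Rightarrow> 'b::real_normed_vector"
  assumes "continuous_on ({a..b} \<times> UNIV) f"
  obtains K where "K > 0" "\<And>s x. s \<in> {a..b} \<Longrightarrow> norm (f (s, x)) \<le> K"
proof -
  have "bounded (f ` ({a..b} \<times> UNIV))"
    by (rule compact_imp_bounded[OF compact_continuous_image[OF assms compact_slab]])
  then obtain K where "K > 0" "\<forall>y\<in>f ` ({a..b} \<times> UNIV). norm y \<le> K" unfolding bounded_pos by auto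
  then show ?thesis by (intro that[of K]) auto
qed

text \<open>Open rectangles therefore generate the Borel sets of space-time, which makes Borel sets accessible
  slice by slice. Countability comes from a base of the covering space \<open>\<real> \<times> \<real>\<^sup>3\<close>, whose projection is
  open.\<close>

lemma open_slab_rectangles:
  fixes U :: "(real \<times> T3) set"
  assumes "open U"
  shows "\<exists>R :: nat \<Rightarrow> (real \<times> T3) set. (\<forall>n. \<exists>J V. R n = J \<times> V \<and> open J \<and> open V) \<and> U = (\<Union>n. R n)"
proof -
  define p where "p = (\<lambda>(s::real, y). (s, to_T3 y))"
  have cp: "continuous_on UNIV p" unfolding p_def case_prod_beta
    by (intro continuous_intros continuous_on_compose2[OF cont_to_T3]) auto
  have V: "open (p -` U)" using assms cp by (simp add: continuous_on_open_vimage)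
  obtain B1 :: "real set set" and B2 :: "(real^3) set set"
    where B: "countable B1" "topological_basis B1" "countable B2" "topological_basis B2"
    by (meson ex_countable_basis)
  define S where "S = {(J, V). J \<in> B1 \<and> V \<in> B2 \<and> J \<times> V \<subseteq> p -` U}"
  have cS: "countable S"
    by (rule countable_subset[of _ "B1 \<times> B2"]) (use B in \<open>auto simp: S_def\<close>)
  define G where "G = insert {} ((\<lambda>(J, V). J \<times> to_T3 ` V) ` S)"
  have cG: "countable G" "G \<noteq> {}" using cS by (auto simp: G_def)
  have "U \<subseteq> \<Union> G"
  proof
    fix z assume "z \<in> U"
    obtain s x where z: "z = (s, x)" by fastforce
    obtain y where y: "x = to_T3 y" using surj_to_T3 by (metis surjD)
    have "(s, y) \<in> p -` U" using \<open>z \<in> U\<close> z y by (simp add: p_def)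
    then obtain A C where AC: "open A" "open C" "s \<in> A" "y \<in> C" "A \<times> C \<subseteq> p -` U"
      using V by (metis open_prod_elim mem_Sigma_iff)
    obtain J where J: "J \<in> B1" "s \<in> J" "J \<subseteq> A" using B(2) AC topological_basisE by metis
    obtain W where W: "W \<in> B2" "y \<in> W" "W \<subseteq> C" using B(4) AC topological_basisE by metis
    have "(J, W) \<in> S" using J W AC by (auto simp: S_def)
    then show "z \<in> \<Union> G" using J W z y by (force simp: G_def)
  qed
  moreover have "\<Union> G \<subseteq> U" by (fastforce simp: G_def S_def p_def)
  ultimately have U: "U = \<Union> G" by auto
  have rect: "\<exists>J V. R = J \<times> V \<and> open J \<and> open V" if "R \<in> G" for R
  proof -
    from that consider "R = {}" | J W where "(J, W) \<in> S" "R = J \<times> to_T3 ` W" by (auto simp: G_def)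
    then show ?thesis
    proof cases
      case 1 then show ?thesis by (intro exI[of _ "{}"]) auto
    next
      case 2
      then have "open J" "open W" using B by (auto simp: S_def intro: topological_basis_open)
      then show ?thesis using 2 open_to_T3_image by blast
    qed
  qed
  show ?thesis
  proof (intro exI[of _ "from_nat_into G"] conjI allI)
    show "\<exists>J V. from_nat_into G n = J \<times> V \<and> open J \<and> open V" for n
      by (rule rect[OF from_nat_into[OF cG(2)]])
    show "U = (\<Union>n. from_nat_into G n)" using U range_from_nat_into[OF cG(2,1)] by simp
  qed
qed

section \<open>Integration against signed measures\<close>

abbreviation bsets :: "'a::topological_space set \<Rightarrow> 'a set set"
  where "bsets E \<equiv> sets (restrict_space borel E)"

text \<open>The domain of integration against signed measures. Only the values on \<open>E\<close> matter, so a function may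
  be arbitrary elsewhere.\<close>

definition bounded_measurable :: "'a::topological_space set \<Rightarrow> ('a \<Rightarrow> real) \<Rightarrow> bool"
  where "bounded_measurable E f \<longleftrightarrow>
    f \<in> borel_measurable (restrict_space borel E) \<and> (\<exists>K. \<forall>x\<in>E. \<bar>f x\<bar> \<le> K)"

lemma bounded_measurableI:
  "f \<in> borel_measurable (restrict_space borel E) \<Longrightarrow> (\<And>x. x \<in> E \<Longrightarrow> \<bar>f x\<bar> \<le> K) \<Longrightarrow> bounded_measurable E f"
  by (auto simp: bounded_measurable_def)

lemma bounded_measurableE:
  assumes "bounded_measurable E f" obtains K where "K > 0" "\<And>x. x \<in> E \<Longrightarrow> \<bar>f x\<bar> \<le> K"
proof -
  obtain K where "\<forall>x\<in>E. \<bar>f x\<bar> \<le> K" using assms unfolding bounded_measurable_def by auto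
  then show ?thesis by (intro that[of "max K 1"]) force+
qed

lemma bounded_measurableD: "bounded_measurable E f \<Longrightarrow> \<exists>K>0. \<forall>x\<in>E. \<bar>f x\<bar> \<le> K"
  using bounded_measurableE[of E f "\<exists>K>0. \<forall>x\<in>E. \<bar>f x\<bar> \<le> K"] by blast

lemma bounded_measurable_measurable [dest]:
  "bounded_measurable E f \<Longrightarrow> f \<in> borel_measurable (restrict_space borel E)"
  by (simp add: bounded_measurable_def)

lemma bounded_measurable_const [simp, intro]: "bounded_measurable E (\<lambda>x. c)"
  by (auto simp: bounded_measurable_def)

lemma bounded_measurable_indicator [intro]:
  "A \<in> bsets E \<Longrightarrow> bounded_measurable E (indicator A)"
  by (rule bounded_measurableI[where K = 1]) (auto simp: indicator_def)

lemma bounded_measurable_add [intro]: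
  assumes "bounded_measurable E f" "bounded_measurable E g"
  shows "bounded_measurable E (\<lambda>x. f x + g x)"
proof -
  obtain K where K: "\<And>x. x \<in> E \<Longrightarrow> \<bar>f x\<bar> \<le> K" using bounded_measurableD[OF assms(1)] by blast
  obtain L where L: "\<And>x. x \<in> E \<Longrightarrow> \<bar>g x\<bar> \<le> L" using bounded_measurableD[OF assms(2)] by blast
  show ?thesis
  proof (rule bounded_measurableI)
    show "\<bar>f x + g x\<bar> \<le> K + L" if "x \<in> E" for x using K[OF that] L[OF that] by linarith
  qed (use assms in \<open>auto intro: borel_measurable_add\<close>)
qed

lemma bounded_measurable_mult [intro]:
  assumes "bounded_measurable E f" "bounded_measurable E g"
  shows "bounded_measurable E (\<lambda>x. f x * g x)"
proof -
  obtain K where K: "\<And>x. x \<in> E \<Longrightarrow> \<bar>f x\<bar> \<le> K" using bounded_measurableD[OF assms(1)] by blast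
  obtain L where L: "\<And>x. x \<in> E \<Longrightarrow> \<bar>g x\<bar> \<le> L" using bounded_measurableD[OF assms(2)] by blast
  show ?thesis
  proof (rule bounded_measurableI)
    show "\<bar>f x * g x\<bar> \<le> K * L" if "x \<in> E" for x
      unfolding abs_mult using K[OF that] L[OF that] by (intro mult_mono) auto
  qed (use assms in \<open>auto intro: borel_measurable_times\<close>)
qed

lemma bounded_measurable_cmult [intro]:
  "bounded_measurable E f \<Longrightarrow> bounded_measurable E (\<lambda>x. c * f x)"
  by (intro bounded_measurable_mult) auto

lemma bounded_measurable_minus [intro]:
  "bounded_measurable E f \<Longrightarrow> bounded_measurable E (\<lambda>x. - f x)"
  using bounded_measurable_cmult[of E f "-1"] by simp

lemma bounded_measurable_diff [intro]:
  "bounded_measurable E f \<Longrightarrow> bounded_measurable E g \<Longrightarrow> bounded_measurable E (\<lambda>x. f x - g x)"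
  using bounded_measurable_add[of E f "\<lambda>x. - g x"] by auto

lemma bounded_measurable_sum [intro]:
  "(\<And>i. i \<in> I \<Longrightarrow> bounded_measurable E (f i)) \<Longrightarrow> bounded_measurable E (\<lambda>x. \<Sum>i\<in>I. f i x)"
  by (induction I rule: infinite_finite_induct) auto

lemma bounded_measurable_continuous:
  assumes "compact E" "continuous_on E f" shows "bounded_measurable E f"
proof -
  have "bounded (f ` E)" by (rule compact_imp_bounded[OF compact_continuous_image[OF assms(2,1)]])
  then obtain K where "\<forall>y\<in>f ` E. norm y \<le> K" unfolding bounded_iff by auto
  then show ?thesis
    by (intro bounded_measurableI[where K = K] borel_measurable_continuous_on_restrict[OF assms(2)]) auto
qed

lemma bsets_Int: "E \<in> sets borel \<Longrightarrow> A \<in> bsets E \<longleftrightarrow> A \<in> sets borel \<and> A \<subseteq> E"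
  by (auto simp: sets_restrict_space_iff)

lemma bsets_iff: "A \<in> bsets E \<longleftrightarrow> (\<exists>B\<in>sets borel. A = E \<inter> B)"
  by (simp add: sets_restrict_space image_iff)

lemma bsets_mono:
  assumes "A \<in> bsets E" "B \<in> bsets A" shows "B \<in> bsets E"
proof -
  obtain C D where "C \<in> sets borel" "A = E \<inter> C" "D \<in> sets borel" "B = A \<inter> D"
    using assms unfolding bsets_iff by auto
  then show ?thesis unfolding bsets_iff by (intro bexI[of _ "C \<inter> D"]) auto
qed

lemma bsets_trace:
  assumes "A \<in> bsets E" shows "B \<in> bsets A \<longleftrightarrow> B \<in> bsets E \<and> B \<subseteq> A"
proof
  assume "B \<in> bsets A"
  then show "B \<in> bsets E \<and> B \<subseteq> A" using bsets_mono[OF assms] sets_restrict_borel_sub by blast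
next
  assume B: "B \<in> bsets E \<and> B \<subseteq> A"
  then obtain C where "C \<in> sets borel" "B = E \<inter> C" unfolding bsets_iff by auto
  moreover from this B assms have "B = A \<inter> C" using sets_restrict_borel_sub by blast
  ultimately show "B \<in> bsets A" unfolding bsets_iff by auto
qed

text \<open>A monotone class principle: bounded Borel functions are generated by indicators under linear
  combinations and bounded pointwise limits. The approximants are
  \<open>\<lfloor>(n + 1) f\<rfloor> / (n + 1)\<close>, which take finitely many values because \<open>f\<close> is bounded.\<close>

lemma bounded_measurable_induct [consumes 1, case_names indicator add scale lim]:
  fixes f :: "'a::topological_space \<Rightarrow> real"
  assumes f: "bounded_measurable E f"
    and ind: "\<And>A. A \<in> bsets E \<Longrightarrow> P (indicator A)"
    and add: "\<And>f g. bounded_measurable E f \<Longrightarrow> bounded_measurable E g \<Longrightarrow> P f \<Longrightarrow> P g \<Longrightarrow> P (\<lambda>x. f x + g x)"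
    and scale: "\<And>c f. bounded_measurable E f \<Longrightarrow> P f \<Longrightarrow> P (\<lambda>x. c * f x)"
    and lim: "\<And>F f K. (\<And>n::nat. bounded_measurable E (F n)) \<Longrightarrow> (\<And>n. P (F n)) \<Longrightarrow> bounded_measurable E f
      \<Longrightarrow> (\<And>n x. x \<in> E \<Longrightarrow> \<bar>F n x\<bar> \<le> K) \<Longrightarrow> (\<And>x. x \<in> E \<Longrightarrow> (\<lambda>n. F n x) \<longlonglongrightarrow> f x) \<Longrightarrow> P f"
  shows "P f"
proof -
  obtain K where K: "K > 0" "\<And>x. x \<in> E \<Longrightarrow> \<bar>f x\<bar> \<le> K" using bounded_measurableD[OF f] by blast
  define A where "A n k = {x \<in> E. \<lfloor>real (Suc n) * f x\<rfloor> = k}" for n :: nat and k :: int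
  have mA: "A n k \<in> bsets E" for n k
  proof -
    have "f \<in> borel_measurable (restrict_space borel E)" using f by auto
    then have "{x \<in> space (restrict_space borel E). \<lfloor>real (Suc n) * f x\<rfloor> = k} \<in> bsets E"
      by measurable
    then show ?thesis by (simp add: A_def space_restrict_space)
  qed
  define N where "N n = \<lceil>real (Suc n) * K\<rceil> + 1" for n :: nat
  define F where "F n x = (\<Sum>k\<in>{- N n..N n}. (of_int k / real (Suc n)) * indicator (A n k) x)" for n x
  have bF: "bounded_measurable E (F n)" for n
    unfolding F_def using mA by (intro bounded_measurable_sum bounded_measurable_cmult) auto
  have z: "P (\<lambda>x. 0)" using ind[of "{}"] by (simp add: indicator_def[abs_def])
  have PF: "P (F n)" for n
  proof -
    have "P (\<lambda>x. \<Sum>k\<in>S. (of_int k / real (Suc n)) * indicator (A n k) x)" if "finite S" for S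
      using that
    proof (induction S)
      case (insert k S)
      have "P (\<lambda>x. (of_int k / real (Suc n)) * indicator (A n k) x
          + (\<Sum>k\<in>S. (of_int k / real (Suc n)) * indicator (A n k) x))"
        using mA insert(3) by (intro add scale ind bounded_measurable_sum bounded_measurable_cmult) auto
      then show ?case using insert(1,2) by simp
    qed (simp add: z)
    then show ?thesis unfolding F_def by simp
  qed
  have Fv: "F n x = of_int \<lfloor>real (Suc n) * f x\<rfloor> / real (Suc n)" if x: "x \<in> E" for n x
  proof -
    let ?k = "\<lfloor>real (Suc n) * f x\<rfloor>"
    have "\<bar>real (Suc n) * f x\<bar> \<le> real (Suc n) * K"
      using K(2)[OF x] unfolding abs_mult by (intro mult_mono) auto
    then have k: "?k \<in> {- N n..N n}" unfolding N_def by (auto; linarith)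
    have "F n x = (\<Sum>k\<in>{- N n..N n}. if k = ?k then of_int k / real (Suc n) else 0)"
      unfolding F_def using x by (intro sum.cong) (auto simp: A_def indicator_def)
    then show ?thesis using k by simp
  qed
  have close: "\<bar>F n x - f x\<bar> \<le> 1 / real (Suc n)" if x: "x \<in> E" for n x
  proof -
    have e: "F n x - f x = (of_int \<lfloor>real (Suc n) * f x\<rfloor> - real (Suc n) * f x) / real (Suc n)"
      unfolding Fv[OF x] by (simp add: diff_divide_distrib)
    have "\<bar>of_int \<lfloor>real (Suc n) * f x\<rfloor> - real (Suc n) * f x\<bar> \<le> 1" by linarith
    then show ?thesis unfolding e abs_divide by (simp add: divide_right_mono)
  qed
  show ?thesis
  proof (rule lim[OF bF PF f])
    show "\<bar>F n x\<bar> \<le> K + 1" if "x \<in> E" for n x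
    proof -
      have "1 / real (Suc n) \<le> 1" by simp
      then show ?thesis using close[OF that, of n] K(2)[OF that] by linarith
    qed
    show "(\<lambda>n. F n x) \<longlonglongrightarrow> f x" if "x \<in> E" for x
    proof -
      have "(\<lambda>n. F n x - f x) \<longlonglongrightarrow> 0"
        by (rule Lim_null_comparison[OF _ LIMSEQ_inverse_real_of_nat])
          (use close[OF that] in \<open>simp add: inverse_eq_divide\<close>)
      then show ?thesis by (simp add: LIM_zero_iff)
    qed
  qed
qed

subsection \<open>Jordan decomposition\<close>

lemma vm_sums:
  "vector_measure_on E \<nu> \<Longrightarrow> range A \<subseteq> bsets E \<Longrightarrow> disjoint_family A \<Longrightarrow> (\<lambda>n. \<nu> (A n)) sums \<nu> (\<Union>n. A n)"
  by (auto simp: vector_measure_on_def)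

lemma vm_empty:
  assumes "vector_measure_on E \<nu>" shows "\<nu> {} = 0"
proof -
  have "(\<lambda>n::nat. \<nu> {}) sums \<nu> (\<Union>n::nat. {})"
    by (rule vm_sums[OF assms]) (auto simp: disjoint_family_on_def)
  then have "(\<lambda>n::nat. \<nu> {}) \<longlonglongrightarrow> 0" by (intro summable_LIMSEQ_zero) (auto simp: sums_iff)
  then show ?thesis by (simp add: LIMSEQ_const_iff)
qed

lemma vm_Un:
  assumes "vector_measure_on E \<nu>" "A \<in> bsets E" "B \<in> bsets E" "A \<inter> B = {}"
  shows "\<nu> (A \<union> B) = \<nu> A + \<nu> B"
proof -
  have "(\<lambda>n. \<nu> (binaryset A B n)) sums \<nu> (\<Union>n. binaryset A B n)"
    using assms by (intro vm_sums) (auto simp: range_binaryset_eq disjoint_family_on_def binaryset_def)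
  moreover have "(\<lambda>n. \<nu> (binaryset A B n)) sums (\<nu> A + \<nu> B)"
    by (rule binaryset_sums) (rule vm_empty[OF assms(1)])
  ultimately show ?thesis by (simp add: UN_binaryset_eq sums_unique2)
qed

lemma vm_Diff:
  assumes "vector_measure_on E \<nu>" "A \<in> bsets E" "B \<in> bsets E" "B \<subseteq> A"
  shows "\<nu> (A - B) = \<nu> A - \<nu> B"
proof -
  have "(A - B) \<inter> B = {}" "(A - B) \<union> B = A" using assms(4) by blast+
  then show ?thesis using vm_Un[OF assms(1), of "A - B" B] assms(2,3) by (simp add: sets.Diff)
qed

lemma vm_split:
  assumes "vector_measure_on E \<nu>" "A \<in> bsets E" "B \<in> bsets E"
  shows "\<nu> A = \<nu> (A \<inter> B) + \<nu> (A - B)"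
proof -
  have "A \<inter> B \<union> (A - B) = A" by blast
  then show ?thesis using vm_Un[OF assms(1), of "A \<inter> B" "A - B"] assms by auto
qed

lemma vm_subset:
  fixes \<nu> :: "'a::topological_space set \<Rightarrow> 'b::real_normed_vector"
  assumes "vector_measure_on E \<nu>" "A \<in> bsets E" shows "vector_measure_on A \<nu>"
  unfolding vector_measure_on_def
proof (intro allI impI, elim conjE)
  fix B :: "nat \<Rightarrow> 'a set" assume B: "range B \<subseteq> bsets A" "disjoint_family B"
  then have "range B \<subseteq> bsets E" using bsets_mono[OF assms(2)] by auto
  from vm_sums[OF assms(1) this B(2)] show "(\<lambda>n. \<nu> (B n)) sums \<nu> (\<Union>n. B n)" .
qed

lemma vm_bounded_linear:
  assumes "bounded_linear g" "vector_measure_on E \<nu>"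
  shows "vector_measure_on E (\<lambda>A. g (\<nu> A))"
  unfolding vector_measure_on_def
proof (intro allI impI, elim conjE)
  fix A :: "nat \<Rightarrow> _ set" assume A: "range A \<subseteq> bsets E" "disjoint_family A"
  show "(\<lambda>n. g (\<nu> (A n))) sums g (\<nu> (\<Union>n. A n))"
    by (rule bounded_linear.sums[OF assms(1) vm_sums[OF assms(2) A]])
qed

lemma vm_minus:
  fixes \<nu> :: "'a::topological_space set \<Rightarrow> 'b::real_normed_vector"
  shows "vector_measure_on E \<nu> \<Longrightarrow> vector_measure_on E (\<lambda>A. - \<nu> A)"
  by (rule vm_bounded_linear[OF bounded_linear_minus[OF bounded_linear_ident]])

lemma vm_nth:
  fixes \<nu> :: "'a::topological_space set \<Rightarrow> real ^ 'n"
  shows "vector_measure_on E \<nu> \<Longrightarrow> vector_measure_on E (\<lambda>A. \<nu> A $ i)"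
  by (rule vm_bounded_linear[OF bounded_linear_vec_nth])

text \<open>If the values were unbounded on some set, then splitting that set would keep one unbounded
  half while the other half carries mass at least \<open>1\<close> in absolute value; iterating contradicts
  countable additivity.\<close>

lemma vm_bdd_above:
  fixes \<nu> :: "'a::topological_space set \<Rightarrow> real"
  assumes \<nu>: "vector_measure_on E \<nu>"
  shows "\<exists>K. \<forall>A\<in>bsets E. \<nu> A \<le> K"
proof (rule ccontr)
  assume neg: "\<not> (\<exists>K. \<forall>A\<in>bsets E. \<nu> A \<le> K)"
  define unb where "unb A \<longleftrightarrow> A \<in> bsets E \<and> (\<forall>K. \<exists>B\<in>bsets E. B \<subseteq> A \<and> \<nu> B > K)" for A
  have step: "\<exists>A'. unb A' \<and> A' \<subseteq> A \<and> \<bar>\<nu> (A - A')\<bar> > 1" if A: "unb A" for A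
  proof -
    obtain B where B: "B \<in> bsets E" "B \<subseteq> A" "\<nu> B > 1 + \<bar>\<nu> A\<bar>" using A unfolding unb_def by blast
    have mA: "A \<in> bsets E" using A by (simp add: unb_def)
    have d: "\<nu> (A - B) = \<nu> A - \<nu> B" by (rule vm_Diff[OF \<nu> mA B(1,2)])
    have "unb B \<or> unb (A - B)"
    proof (rule ccontr)
      assume "\<not> (unb B \<or> unb (A - B))"
      then have n: "\<not> unb B" "\<not> unb (A - B)" by auto
      have m: "A - B \<in> bsets E" using mA B(1) by (rule sets.Diff)
      obtain K1 where K1: "\<And>C. C \<in> bsets E \<Longrightarrow> C \<subseteq> B \<Longrightarrow> \<nu> C \<le> K1"
        using n(1) B(1) unfolding unb_def by (meson not_le)
      obtain K2 where K2: "\<And>C. C \<in> bsets E \<Longrightarrow> C \<subseteq> A - B \<Longrightarrow> \<nu> C \<le> K2"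
        using n(2) m unfolding unb_def by (meson not_le)
      note K = K1 K2
      obtain C where C: "C \<in> bsets E" "C \<subseteq> A" "\<nu> C > K1 + K2" using A unfolding unb_def by blast
      have "\<nu> C = \<nu> (C \<inter> B) + \<nu> (C - B)" by (rule vm_split[OF \<nu> C(1) B(1)])
      moreover have "\<nu> (C \<inter> B) \<le> K1" using C B by (intro K(1)) auto
      moreover have "\<nu> (C - B) \<le> K2" using C B by (intro K(2)) auto
      ultimately show False using C(3) by linarith
    qed
    then show ?thesis
    proof
      assume "unb B" then show ?thesis using B d by (intro exI[of _ B]) auto
    next
      assume "unb (A - B)"
      moreover have "A - (A - B) = B" using B(2) by blast
      ultimately show ?thesis using B by (intro exI[of _ "A - B"]) auto
    qed
  qed
  have "E \<in> bsets E" using sets.top[of "restrict_space borel E"] by (simp add: space_restrict_space)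
  moreover have "\<exists>B\<in>bsets E. B \<subseteq> E \<and> \<nu> B > K" for K
    using neg sets_restrict_borel_sub[of _ E] by (meson not_le)
  ultimately have u0: "unb E" unfolding unb_def by simp
  have "\<exists>A. \<forall>n. unb (A n) \<and> (A (Suc n) \<subseteq> A n \<and> \<bar>\<nu> (A n - A (Suc n))\<bar> > 1)"
  proof (rule dependent_nat_choice)
    show "\<exists>A. unb A" using u0 by (rule exI)
    show "\<exists>B. unb B \<and> B \<subseteq> A \<and> \<bar>\<nu> (A - B)\<bar> > 1" if "unb A" for A using step[OF that] .
  qed
  then obtain A where A: "\<And>n. unb (A n)" "\<And>n. A (Suc n) \<subseteq> A n \<and> \<bar>\<nu> (A n - A (Suc n))\<bar> > 1"
    by metis
  define D where "D n = A n - A (Suc n)" for n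
  have dec: "A m \<subseteq> A n" if "n \<le> m" for m n using that A(2) by (metis lift_Suc_antimono_le)
  have disj: "disjoint_family D"
  proof -
    have "D m \<inter> D n = {}" if "m < n" for m n using dec[of "Suc m" n] that by (auto simp: D_def)
    then show ?thesis unfolding disjoint_family_on_def by (metis inf_commute linorder_neqE_nat)
  qed
  have "(\<lambda>n. \<nu> (D n)) sums \<nu> (\<Union>n. D n)"
  proof (rule vm_sums[OF \<nu> _ disj])
    have "D n \<in> bsets E" for n using A(1)[of n] A(1)[of "Suc n"] unfolding D_def unb_def by (intro sets.Diff) auto
    then show "range D \<subseteq> bsets E" by auto
  qed
  then have "(\<lambda>n. \<nu> (D n)) \<longlonglongrightarrow> 0" by (intro summable_LIMSEQ_zero) (auto simp: sums_iff)
  then have "\<forall>\<^sub>F n in sequentially. \<bar>\<nu> (D n)\<bar> < 1"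
    using order_tendstoD(2)[OF tendsto_rabs_zero[of "\<lambda>n. \<nu> (D n)"], of sequentially 1] by simp
  then obtain n where "\<bar>\<nu> (D n)\<bar> < 1" by (auto simp: eventually_sequentially)
  then show False using A(2)[of n] by (simp add: D_def)
qed

definition upper_variation :: "'a::topological_space set \<Rightarrow> ('a set \<Rightarrow> real) \<Rightarrow> 'a set \<Rightarrow> real"
  where "upper_variation E \<nu> A = (SUP B\<in>{B \<in> bsets E. B \<subseteq> A}. \<nu> B)"

context
  fixes E :: "'a::topological_space set" and \<nu> :: "'a set \<Rightarrow> real"
  assumes \<nu>: "vector_measure_on E \<nu>"
begin

lemma upper_variation_bdd: "bdd_above (\<nu> ` {B \<in> bsets E. B \<subseteq> A})"
  using vm_bdd_above[OF \<nu>] by (auto simp: bdd_above_def)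

lemma upper_variation_ge: "B \<in> bsets E \<Longrightarrow> B \<subseteq> A \<Longrightarrow> \<nu> B \<le> upper_variation E \<nu> A"
  unfolding upper_variation_def by (intro cSUP_upper upper_variation_bdd) auto

lemma upper_variation_least:
  "(\<And>B. B \<in> bsets E \<Longrightarrow> B \<subseteq> A \<Longrightarrow> \<nu> B \<le> c) \<Longrightarrow> upper_variation E \<nu> A \<le> c"
  unfolding upper_variation_def by (intro cSUP_least) auto

lemma upper_variation_nonneg: "0 \<le> upper_variation E \<nu> A"
  using upper_variation_ge[of "{}" A] vm_empty[OF \<nu>] by simp

lemma upper_variation_mono: "A \<subseteq> B \<Longrightarrow> upper_variation E \<nu> A \<le> upper_variation E \<nu> B"
  by (intro upper_variation_least upper_variation_ge) auto

lemma upper_variation_superadditive: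
  assumes "A \<inter> B = {}"
  shows "upper_variation E \<nu> A + upper_variation E \<nu> B \<le> upper_variation E \<nu> (A \<union> B)"
proof -
  have 1: "\<nu> C + \<nu> D \<le> upper_variation E \<nu> (A \<union> B)"
    if "C \<in> bsets E" "C \<subseteq> A" "D \<in> bsets E" "D \<subseteq> B" for C D
  proof -
    have "\<nu> (C \<union> D) = \<nu> C + \<nu> D" using that assms by (intro vm_Un[OF \<nu>]) auto
    moreover have "\<nu> (C \<union> D) \<le> upper_variation E \<nu> (A \<union> B)" using that by (intro upper_variation_ge) auto
    ultimately show ?thesis by simp
  qed
  have "upper_variation E \<nu> A \<le> upper_variation E \<nu> (A \<union> B) - \<nu> D" if "D \<in> bsets E" "D \<subseteq> B" for D
    using 1[OF _ _ that] by (intro upper_variation_least) (simp add: algebra_simps)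
  then have "upper_variation E \<nu> B \<le> upper_variation E \<nu> (A \<union> B) - upper_variation E \<nu> A"
    by (intro upper_variation_least) (simp add: algebra_simps)
  then show ?thesis by simp
qed

lemma SUP_ennreal_upper_variation:
  "(SUP B\<in>{B \<in> bsets E. B \<subseteq> A}. ennreal (\<nu> B)) = ennreal (upper_variation E \<nu> A)"
proof (rule antisym)
  let ?p = "SUP B\<in>{B \<in> bsets E. B \<subseteq> A}. ennreal (\<nu> B)"
  show le: "?p \<le> ennreal (upper_variation E \<nu> A)"
    by (intro SUP_least ennreal_leI) (auto intro: upper_variation_ge)
  then obtain c where c: "?p = ennreal c" "0 \<le> c" by (cases ?p) (simp_all add: top_unique)
  have "\<nu> B \<le> c" if "B \<in> bsets E" "B \<subseteq> A" for B
  proof -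
    have "ennreal (\<nu> B) \<le> ennreal c" unfolding c(1)[symmetric] using that by (intro SUP_upper) auto
    then show ?thesis using c(2) by (simp add: ennreal_le_iff)
  qed
  then show "ennreal (upper_variation E \<nu> A) \<le> ?p"
    unfolding c(1) by (intro ennreal_leI upper_variation_least)
qed

text \<open>Superadditivity gives one inequality. For the other, a competitor \<open>B\<close> in the union is cut into the
  pieces \<open>B \<inter> A\<^sub>i\<close>, and the countable additivity of \<open>\<nu>\<close> reassembles them.\<close>

lemma upper_variation_countably_additive:
  "countably_additive (bsets E) (\<lambda>A. ennreal (upper_variation E \<nu> A))"
  unfolding countably_additive_def
proof (intro allI impI)
  fix A :: "nat \<Rightarrow> 'a set" assume A: "range A \<subseteq> bsets E" "disjoint_family A" "(\<Union>i. A i) \<in> bsets E"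
  let ?q = "upper_variation E \<nu>"
  have part: "(\<Sum>i<n. ?q (A i)) \<le> ?q (\<Union>i<n. A i)" for n
  proof (induction n)
    case 0 then show ?case by (simp add: upper_variation_nonneg)
  next
    case (Suc n)
    have "A i \<inter> A n = {}" if "i < n" for i using A(2) that unfolding disjoint_family_on_def by simp
    then have d: "(\<Union>i<n. A i) \<inter> A n = {}" by blast
    have e: "(\<Union>i<Suc n. A i) = (\<Union>i<n. A i) \<union> A n" by (simp add: lessThan_Suc Un_commute)
    show ?case unfolding e using upper_variation_superadditive[OF d] Suc by simp
  qed
  show "(\<Sum>i. ennreal (?q (A i))) = ennreal (?q (\<Union>i. A i))"
  proof (rule antisym)
    have "(\<Sum>i<n. ennreal (?q (A i))) \<le> ennreal (?q (\<Union>i. A i))" for n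
    proof -
      have "(\<Sum>i<n. ?q (A i)) \<le> ?q (\<Union>i. A i)"
        by (rule order_trans[OF part]) (intro upper_variation_mono, auto)
      then show ?thesis by (simp add: upper_variation_nonneg ennreal_leI)
    qed
    then show "(\<Sum>i. ennreal (?q (A i))) \<le> ennreal (?q (\<Union>i. A i))"
      by (intro suminf_le_const) (auto intro: summableI)
    have "ennreal (\<nu> B) \<le> (\<Sum>i. ennreal (?q (A i)))" if B: "B \<in> bsets E" "B \<subseteq> (\<Union>i. A i)" for B
    proof (rule LIMSEQ_le_const2)
      have "(\<lambda>i. \<nu> (B \<inter> A i)) sums \<nu> (\<Union>i. B \<inter> A i)"
      proof (rule vm_sums[OF \<nu>])
        show "range (\<lambda>i. B \<inter> A i) \<subseteq> bsets E" using A(1) B(1) by (auto intro!: sets.Int)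
        show "disjoint_family (\<lambda>i. B \<inter> A i)" using A(2) unfolding disjoint_family_on_def by blast
      qed
      moreover have "(\<Union>i. B \<inter> A i) = B" using B by auto
      ultimately show "(\<lambda>n. ennreal (\<Sum>i<n. \<nu> (B \<inter> A i))) \<longlonglongrightarrow> ennreal (\<nu> B)"
        unfolding sums_def by (intro tendsto_ennrealI) simp
      have "ennreal (\<Sum>i<n. \<nu> (B \<inter> A i)) \<le> (\<Sum>i. ennreal (?q (A i)))" for n
      proof -
        have "(\<Sum>i<n. \<nu> (B \<inter> A i)) \<le> (\<Sum>i<n. ?q (A i))"
          using A B by (intro sum_mono upper_variation_ge) auto
        then have "ennreal (\<Sum>i<n. \<nu> (B \<inter> A i)) \<le> (\<Sum>i<n. ennreal (?q (A i)))"
          by (simp add: upper_variation_nonneg ennreal_leI)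
        also have "\<dots> \<le> (\<Sum>i. ennreal (?q (A i)))" by (intro sum_le_suminf) (auto intro: summableI)
        finally show ?thesis .
      qed
      then show "\<exists>N. \<forall>n\<ge>N. ennreal (\<Sum>i<n. \<nu> (B \<inter> A i)) \<le> (\<Sum>i. ennreal (?q (A i)))" by blast
    qed
    then show "ennreal (?q (\<Union>i. A i)) \<le> (\<Sum>i. ennreal (?q (A i)))"
      unfolding SUP_ennreal_upper_variation[symmetric] by (intro SUP_least) auto
  qed
qed

lemma emeasure_pos_part:
  assumes "A \<in> bsets E"
  shows "emeasure (pos_part E \<nu>) A = ennreal (upper_variation E \<nu> A)"
proof (rule emeasure_measure_of[OF pos_part_def[of E \<nu>, unfolded SUP_ennreal_upper_variation]])
  show "bsets E \<subseteq> Pow E" by (auto dest: sets_restrict_borel_sub)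
  show "positive (sets (pos_part E \<nu>)) (\<lambda>A. ennreal (upper_variation E \<nu> A))"
    using upper_variation_least[of "{}" 0] vm_empty[OF \<nu>] upper_variation_nonneg[of "{}"]
    by (auto simp: positive_def)
qed (simp_all add: upper_variation_countably_additive assms)

lemma measure_pos_part: "A \<in> bsets E \<Longrightarrow> measure (pos_part E \<nu>) A = upper_variation E \<nu> A"
  by (simp add: measure_def emeasure_pos_part upper_variation_nonneg)

lemma finite_measure_pos_part: "finite_measure (pos_part E \<nu>)"
proof
  have "E \<in> bsets E" using sets.top[of "restrict_space borel E"] by (simp add: space_restrict_space)
  then show "emeasure (pos_part E \<nu>) (space (pos_part E \<nu>)) \<noteq> \<infinity>" by (simp add: emeasure_pos_part)
qed

end

lemma upper_variation_minus_le:
  assumes \<nu>: "vector_measure_on E (\<nu> :: _ \<Rightarrow> real)" and A: "A \<in> bsets E"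
  shows "upper_variation E \<nu> A \<le> \<nu> A + upper_variation E (\<lambda>A. - \<nu> A) A"
proof (rule upper_variation_least[OF \<nu>])
  fix B assume B: "B \<in> bsets E" "B \<subseteq> A"
  have "- \<nu> (A - B) \<le> upper_variation E (\<lambda>A. - \<nu> A) A"
    using A B by (intro upper_variation_ge[OF vm_minus[OF \<nu>]]) auto
  then show "\<nu> B \<le> \<nu> A + upper_variation E (\<lambda>A. - \<nu> A) A" using vm_Diff[OF \<nu> A B] by simp
qed

text \<open>Complementation \<open>B \<mapsto> A - B\<close> exchanges the competitors for the positive and the negative part, and
  changes the value by \<open>\<nu> A\<close>.\<close>

theorem Jordan_decomposition:
  assumes \<nu>: "vector_measure_on E (\<nu> :: _ \<Rightarrow> real)" and A: "A \<in> bsets E"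
  shows "measure (pos_part E \<nu>) A - measure (pos_part E (\<lambda>A. - \<nu> A)) A = \<nu> A"
  using upper_variation_minus_le[OF \<nu> A] upper_variation_minus_le[OF vm_minus[OF \<nu>] A]
  by (simp add: measure_pos_part[OF \<nu> A] measure_pos_part[OF vm_minus[OF \<nu>] A])

subsection \<open>Bounded integrals and vector measures\<close>

text \<open>Linear functionals that are continuous under bounded pointwise convergence. They are the integrals
  against signed measures, but they can be restricted, weighted, subtracted and iterated without any
  reference to Jordan decompositions, which do not behave well under these operations.\<close>

definition bounded_integral :: "'a::topological_space set \<Rightarrow> (('a \<Rightarrow> real) \<Rightarrow> real) \<Rightarrow> bool"
  where "bounded_integral E I \<longleftrightarrow>
    (\<forall>f g. bounded_measurable E f \<longrightarrow> bounded_measurable E g \<longrightarrow> I (\<lambda>x. f x + g x) = I f + I g) \<and>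
    (\<forall>c f. bounded_measurable E f \<longrightarrow> I (\<lambda>x. c * f x) = c * I f) \<and>
    (\<forall>F f K. (\<forall>n::nat. bounded_measurable E (F n)) \<longrightarrow> bounded_measurable E f \<longrightarrow>
      (\<forall>n. \<forall>x\<in>E. \<bar>F n x\<bar> \<le> K) \<longrightarrow> (\<forall>x\<in>E. (\<lambda>n. F n x) \<longlonglongrightarrow> f x) \<longrightarrow>
      (\<lambda>n. I (F n)) \<longlonglongrightarrow> I f)"

lemma bounded_integralI:
  assumes "\<And>f g. bounded_measurable E f \<Longrightarrow> bounded_measurable E g \<Longrightarrow> I (\<lambda>x. f x + g x) = I f + I g"
    and "\<And>c f. bounded_measurable E f \<Longrightarrow> I (\<lambda>x. c * f x) = c * I f"
    and "\<And>F f K. (\<And>n::nat. bounded_measurable E (F n)) \<Longrightarrow> bounded_measurable E f \<Longrightarrow>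
      (\<And>n x. x \<in> E \<Longrightarrow> \<bar>F n x\<bar> \<le> K) \<Longrightarrow> (\<And>x. x \<in> E \<Longrightarrow> (\<lambda>n. F n x) \<longlonglongrightarrow> f x) \<Longrightarrow>
      (\<lambda>n. I (F n)) \<longlonglongrightarrow> I f"
  shows "bounded_integral E I"
  using assms(1,2) unfolding bounded_integral_def
  by (intro conjI allI impI assms(3)) auto

lemma bounded_integral_add:
  "bounded_integral E I \<Longrightarrow> bounded_measurable E f \<Longrightarrow> bounded_measurable E g \<Longrightarrow> I (\<lambda>x. f x + g x) = I f + I g"
  by (simp add: bounded_integral_def)

lemma bounded_integral_scale:
  "bounded_integral E I \<Longrightarrow> bounded_measurable E f \<Longrightarrow> I (\<lambda>x. c * f x) = c * I f"
  by (simp add: bounded_integral_def)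

lemma bounded_integral_lim:
  assumes "bounded_integral E I" "\<And>n::nat. bounded_measurable E (F n)" "bounded_measurable E f"
    "\<And>n x. x \<in> E \<Longrightarrow> \<bar>F n x\<bar> \<le> K" "\<And>x. x \<in> E \<Longrightarrow> (\<lambda>n. F n x) \<longlonglongrightarrow> f x"
  shows "(\<lambda>n. I (F n)) \<longlonglongrightarrow> I f"
  using assms(1)[unfolded bounded_integral_def, THEN conjunct2, THEN conjunct2, rule_format, of F f K] assms(2-)
  by simp

lemma bounded_integral_diff:
  assumes "bounded_integral E I" "bounded_measurable E f" "bounded_measurable E g"
  shows "I (\<lambda>x. f x - g x) = I f - I g"
  using bounded_integral_add[OF assms(1,2), of "\<lambda>x. (-1) * g x"]
    bounded_integral_scale[OF assms(1,3), of "-1"] bounded_measurable_cmult[OF assms(3), of "-1"] by simp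

lemma bounded_integral_zero: "bounded_integral E I \<Longrightarrow> I (\<lambda>x. 0) = 0"
  using bounded_integral_scale[of E I "\<lambda>x. 0" 0] by simp

lemma bounded_integral_const: "bounded_integral E I \<Longrightarrow> I (\<lambda>x. c) = c * I (\<lambda>x. 1)"
  using bounded_integral_scale[of E I "\<lambda>x. 1" c] by simp

lemma bounded_integral_sum:
  assumes "bounded_integral E I" "\<And>i. i \<in> S \<Longrightarrow> bounded_measurable E (f i)"
  shows "I (\<lambda>x. \<Sum>i\<in>S. f i x) = (\<Sum>i\<in>S. I (f i))"
  using assms(2)
proof (induction S rule: infinite_finite_induct)
  case (insert i S)
  have "I (\<lambda>x. f i x + (\<Sum>i\<in>S. f i x)) = I (f i) + I (\<lambda>x. \<Sum>i\<in>S. f i x)"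
    using insert(4) by (intro bounded_integral_add[OF assms(1)] bounded_measurable_sum) auto
  then show ?case using insert by simp
qed (simp_all add: bounded_integral_zero[OF assms(1)])

text \<open>The constant sequence \<open>f\<close> converges to \<open>g\<close> on \<open>E\<close>, so continuity alone shows that the functional
  only sees values on \<open>E\<close>.\<close>

lemma bounded_integral_cong:
  assumes I: "bounded_integral E I" and f: "bounded_measurable E f" and eq: "\<And>x. x \<in> E \<Longrightarrow> f x = g x"
  shows "I f = I g"
proof -
  obtain K where K: "\<forall>x\<in>E. \<bar>f x\<bar> \<le> K" using bounded_measurableD[OF f] by auto
  have "g \<in> borel_measurable (restrict_space borel E)"
    using bounded_measurable_measurable[OF f] eq by (subst measurable_cong[of _ g f]) (auto simp: space_restrict_space)
  then have g: "bounded_measurable E g" using K eq by (intro bounded_measurableI[where K = K]) auto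
  have "(\<lambda>n::nat. I f) \<longlonglongrightarrow> I g"
    by (rule bounded_integral_lim[OF I f g, where K = K]) (use K eq in auto)
  then show ?thesis by (simp add: LIMSEQ_const_iff)
qed

lemma bounded_integral_minus_fun:
  assumes "bounded_integral E I" "bounded_integral E J" shows "bounded_integral E (\<lambda>f. I f - J f)"
proof (rule bounded_integralI)
  show "I (\<lambda>x. f x + g x) - J (\<lambda>x. f x + g x) = I f - J f + (I g - J g)"
    if "bounded_measurable E f" "bounded_measurable E g" for f g
    using bounded_integral_add[OF assms(1) that] bounded_integral_add[OF assms(2) that] by simp
  show "I (\<lambda>x. c * f x) - J (\<lambda>x. c * f x) = c * (I f - J f)" if "bounded_measurable E f" for c f
    using bounded_integral_scale[OF assms(1) that] bounded_integral_scale[OF assms(2) that] by (simp add: algebra_simps)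
qed (intro tendsto_diff bounded_integral_lim[OF assms(1)] bounded_integral_lim[OF assms(2)], assumption+)

lemma bounded_integral_weight:
  assumes I: "bounded_integral E I" and g: "bounded_measurable E g"
  shows "bounded_integral E (\<lambda>f. I (\<lambda>x. g x * f x))"
proof (rule bounded_integralI)
  show "I (\<lambda>x. g x * (f x + f' x)) = I (\<lambda>x. g x * f x) + I (\<lambda>x. g x * f' x)"
    if "bounded_measurable E f" "bounded_measurable E f'" for f f'
    using bounded_integral_add[OF I, of "\<lambda>x. g x * f x" "\<lambda>x. g x * f' x"] that g
    by (simp add: distrib_left bounded_measurable_mult)
  show "I (\<lambda>x. g x * (c * f x)) = c * I (\<lambda>x. g x * f x)" if "bounded_measurable E f" for c f
    using bounded_integral_scale[OF I, of "\<lambda>x. g x * f x" c] that g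
    by (simp add: bounded_measurable_mult mult.left_commute)
  fix F :: "nat \<Rightarrow> 'a \<Rightarrow> real" and f K
  assume F: "\<And>n. bounded_measurable E (F n)" "bounded_measurable E f" "\<And>n x. x \<in> E \<Longrightarrow> \<bar>F n x\<bar> \<le> K"
    "\<And>x. x \<in> E \<Longrightarrow> (\<lambda>n. F n x) \<longlonglongrightarrow> f x"
  obtain L where L: "\<And>x. x \<in> E \<Longrightarrow> \<bar>g x\<bar> \<le> L" using bounded_measurableD[OF g] by auto
  show "(\<lambda>n. I (\<lambda>x. g x * F n x)) \<longlonglongrightarrow> I (\<lambda>x. g x * f x)"
  proof (rule bounded_integral_lim[OF I])
    show "\<bar>g x * F n x\<bar> \<le> L * K" if "x \<in> E" for n x
      unfolding abs_mult using L[OF that] F(3)[OF that, of n] by (intro mult_mono) auto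
  qed (auto intro!: bounded_measurable_mult g F tendsto_mult)
qed

lemma bounded_measurable_subset:
  assumes f: "bounded_measurable E f" and A: "A \<subseteq> E" shows "bounded_measurable A f"
proof -
  obtain K where K: "\<forall>x\<in>E. \<bar>f x\<bar> \<le> K" using bounded_measurableD[OF f] by auto
  have "f \<in> borel_measurable (restrict_space borel A)"
  proof (rule measurableI)
    fix S :: "real set" assume S: "S \<in> sets borel"
    have "f -` S \<inter> E \<in> bsets E"
      using measurable_sets[OF bounded_measurable_measurable[OF f] S] by (simp add: space_restrict_space)
    then obtain B where B: "B \<in> sets borel" "f -` S \<inter> E = E \<inter> B" unfolding bsets_iff by auto
    then have "f -` S \<inter> A = A \<inter> B" using A by blast
    with B show "f -` S \<inter> space (restrict_space borel A) \<in> bsets A"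
      unfolding bsets_iff by (auto simp: space_restrict_space)
  qed simp
  then show ?thesis using K A by (intro bounded_measurableI[where K = K]) auto
qed

lemma bounded_measurable_extend:
  assumes A: "A \<in> bsets E" and f: "bounded_measurable A f"
  shows "bounded_measurable E (\<lambda>x. indicator A x * f x)"
proof -
  obtain K where K: "K > 0" "\<forall>x\<in>A. \<bar>f x\<bar> \<le> K" using bounded_measurableD[OF f] by auto
  have AE: "A \<subseteq> E" using A by (rule sets_restrict_borel_sub)
  have "sets (restrict_space (restrict_space borel E) A) = bsets A"
  proof (intro equalityI subsetI)
    fix B assume "B \<in> sets (restrict_space (restrict_space borel E) A)"
    then obtain C where "C \<in> bsets E" "B = A \<inter> C" by (auto simp: sets_restrict_space[of "restrict_space borel E"])
    then show "B \<in> bsets A" using A by (simp add: bsets_trace sets.Int)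
  next
    fix B assume "B \<in> bsets A"
    then have "B \<in> bsets E" "B = A \<inter> B" using A by (auto simp: bsets_trace)
    then show "B \<in> sets (restrict_space (restrict_space borel E) A)"
      by (auto simp: sets_restrict_space[of "restrict_space borel E"])
  qed
  from measurable_cong_sets[OF this refl, of "borel :: real measure"]
  have "f \<in> borel_measurable (restrict_space (restrict_space borel E) A)"
    using bounded_measurable_measurable[OF f] by (simp only:)
  then have "(\<lambda>x. f x * indicator A x) \<in> borel_measurable (restrict_space borel E)"
    using A AE by (subst (asm) borel_measurable_restrict_space_iff) (auto simp: space_restrict_space Int_absorb2 mult.commute)
  then show ?thesis
    using K by (intro bounded_measurableI[where K = K]) (auto simp: mult.commute indicator_def)
qed

lemma bounded_integral_restrict:
  assumes I: "bounded_integral E I" and A: "A \<in> bsets E"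
  shows "bounded_integral A (\<lambda>f. I (\<lambda>x. indicator A x * f x))"
proof (rule bounded_integralI)
  show "I (\<lambda>x. indicator A x * (f x + f' x)) = I (\<lambda>x. indicator A x * f x) + I (\<lambda>x. indicator A x * f' x)"
    if "bounded_measurable A f" "bounded_measurable A f'" for f f'
    using bounded_integral_add[OF I bounded_measurable_extend[OF A that(1)] bounded_measurable_extend[OF A that(2)]]
    by (simp add: distrib_left)
  show "I (\<lambda>x. indicator A x * (c * f x)) = c * I (\<lambda>x. indicator A x * f x)" if "bounded_measurable A f" for c f
    using bounded_integral_scale[OF I bounded_measurable_extend[OF A that], of c] by (simp add: mult.left_commute)
  fix F :: "nat \<Rightarrow> 'a \<Rightarrow> real" and f K
  assume F: "\<And>n. bounded_measurable A (F n)" "bounded_measurable A f" "\<And>n x. x \<in> A \<Longrightarrow> \<bar>F n x\<bar> \<le> K"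
    "\<And>x. x \<in> A \<Longrightarrow> (\<lambda>n. F n x) \<longlonglongrightarrow> f x"
  show "(\<lambda>n. I (\<lambda>x. indicator A x * F n x)) \<longlonglongrightarrow> I (\<lambda>x. indicator A x * f x)"
  proof (rule bounded_integral_lim[OF I])
    show "\<bar>indicator A x * F n x\<bar> \<le> \<bar>K\<bar>" for n x
      using F(3)[of x n] by (auto simp: indicator_def)
    show "(\<lambda>n. indicator A x * F n x) \<longlonglongrightarrow> indicator A x * f x" for x
      using F(4)[of x] by (cases "x \<in> A") auto
  qed (auto intro!: bounded_measurable_extend A F)
qed

lemma bounded_measurable_integrable:
  assumes "finite_measure M" "sets M = bsets E" "bounded_measurable E f"
  shows "integrable M f"
proof -
  obtain K where K: "\<forall>x\<in>E. \<bar>f x\<bar> \<le> K" using bounded_measurableD[OF assms(3)] by auto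
  have "space M = E" using sets_eq_imp_space_eq[OF assms(2)] by (simp add: space_restrict_space)
  moreover have "f \<in> borel_measurable M"
    unfolding measurable_cong_sets[OF assms(2) refl] by (rule bounded_measurable_measurable[OF assms(3)])
  ultimately show ?thesis using K
    by (intro finite_measure.integrable_const_bound[OF assms(1), where B = K]) auto
qed

lemma bounded_integral_measure:
  assumes M: "finite_measure M" "sets M = bsets E" shows "bounded_integral E (integral\<^sup>L M)"
proof (rule bounded_integralI)
  note int = bounded_measurable_integrable[OF M]
  show "integral\<^sup>L M (\<lambda>x. f x + g x) = integral\<^sup>L M f + integral\<^sup>L M g"
    if "bounded_measurable E f" "bounded_measurable E g" for f g
    using that int by (intro Bochner_Integration.integral_add) auto
  show "integral\<^sup>L M (\<lambda>x. c * f x) = c * integral\<^sup>L M f" if "bounded_measurable E f" for c f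
    by simp
  fix F :: "nat \<Rightarrow> 'a \<Rightarrow> real" and f K
  assume F: "\<And>n. bounded_measurable E (F n)" "bounded_measurable E f" "\<And>n x. x \<in> E \<Longrightarrow> \<bar>F n x\<bar> \<le> K"
    "\<And>x. x \<in> E \<Longrightarrow> (\<lambda>n. F n x) \<longlonglongrightarrow> f x"
  have sp: "space M = E" using sets_eq_imp_space_eq[OF M(2)] by (simp add: space_restrict_space)
  show "(\<lambda>n. integral\<^sup>L M (F n)) \<longlonglongrightarrow> integral\<^sup>L M f"
  proof (rule integral_dominated_convergence[where w = "\<lambda>x. K"])
    show "integrable M (\<lambda>x. K)" by (rule finite_measure.integrable_const[OF M(1)])
  qed (use F int sp in \<open>auto intro!: borel_measurable_integrable\<close>)
qed

theorem bounded_integral_sintegral: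
  assumes \<nu>: "vector_measure_on E \<nu>" shows "bounded_integral E (sintegral E \<nu>)"
  unfolding sintegral_def[abs_def]
  by (intro bounded_integral_minus_fun bounded_integral_measure finite_measure_pos_part \<nu> vm_minus sets_pos_part)

lemma sintegral_indicator:
  assumes "vector_measure_on E \<nu>" "A \<in> bsets E" shows "sintegral E \<nu> (indicator A) = \<nu> A"
  unfolding sintegral_def using Jordan_decomposition[OF assms] sets_restrict_borel_sub[OF assms(2)]
  by (simp add: Int_absorb2)

lemma vector_measure_bounded_integral:
  assumes I: "bounded_integral E I" shows "vector_measure_on E (\<lambda>A. I (indicator A))"
  unfolding vector_measure_on_def
proof (intro allI impI, elim conjE)
  fix A :: "nat \<Rightarrow> 'a set" assume A: "range A \<subseteq> bsets E" "disjoint_family A"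
  have b: "bounded_measurable E (indicator (\<Union>i\<in>S. A i))" for S
    using A(1) by (intro bounded_measurable_indicator sets.countable_UN'') auto
  have eq: "(\<Sum>i<n. I (indicator (A i))) = I (indicator (\<Union>i<n. A i))" for n
  proof (induction n)
    case 0 then show ?case using bounded_integral_zero[OF I] by (simp add: indicator_def[abs_def])
  next
    case (Suc n)
    have "A i \<inter> A n = {}" if "i < n" for i using A(2) that unfolding disjoint_family_on_def by simp
    then have d: "indicator (\<Union>i<Suc n. A i) = (\<lambda>x. indicator (\<Union>i<n. A i) x + indicator (A n) x :: real)"
      by (intro ext) (auto simp: indicator_def lessThan_Suc)
    have "bounded_measurable E (indicator (A n))" using A(1) by auto
    from bounded_integral_add[OF I b this] Suc show ?case unfolding d by simp
  qed
  show "(\<lambda>n. I (indicator (A n))) sums I (indicator (\<Union>n. A n))"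
    unfolding sums_def eq
  proof (rule bounded_integral_lim[OF I b b, where K = 1])
    show "\<bar>indicator (\<Union>i<n. A i) x :: real\<bar> \<le> 1" for n x by (simp add: indicator_def)
    show "(\<lambda>n. indicator (\<Union>i<n. A i) x :: real) \<longlonglongrightarrow> indicator (\<Union>n. A n) x" for x
      by (rule LIMSEQ_indicator_UN)
  qed
qed

lemma vm_cong:
  assumes "\<And>A. A \<in> bsets E \<Longrightarrow> \<nu> A = \<mu> A" "vector_measure_on E \<mu>"
  shows "vector_measure_on E \<nu>"
  unfolding vector_measure_on_def
proof (intro allI impI, elim conjE)
  fix A :: "nat \<Rightarrow> _ set" assume A: "range A \<subseteq> bsets E" "disjoint_family A"
  then have "(\<Union>n. A n) \<in> bsets E" by (intro sets.countable_UN) auto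
  moreover have "A n \<in> bsets E" for n using A by auto
  ultimately show "(\<lambda>n. \<nu> (A n)) sums \<nu> (\<Union>n. A n)" using vm_sums[OF assms(2) A] assms(1) by simp
qed

text \<open>By the monotone class principle a bounded integral is determined by its values on indicators. The
  rules below for changing, subtracting, restricting and multiplying measures are all instances.\<close>

theorem sintegral_eqI:
  assumes I: "bounded_integral E I" and eq: "\<And>A. A \<in> bsets E \<Longrightarrow> \<nu> A = I (indicator A)"
  shows "vector_measure_on E \<nu>" and "bounded_measurable E f \<Longrightarrow> sintegral E \<nu> f = I f"
proof -
  show \<nu>: "vector_measure_on E \<nu>" by (rule vm_cong[OF eq vector_measure_bounded_integral[OF I]])
  note S = bounded_integral_sintegral[OF \<nu>]
  assume "bounded_measurable E f"
  then show "sintegral E \<nu> f = I f"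
  proof (induction rule: bounded_measurable_induct)
    case (indicator A) then show ?case using sintegral_indicator[OF \<nu>] eq by simp
  next
    case (add f g) then show ?case using bounded_integral_add[OF S] bounded_integral_add[OF I] by simp
  next
    case (scale c f) then show ?case using bounded_integral_scale[OF S] bounded_integral_scale[OF I] by simp
  next
    case (lim F f K)
    have "(\<lambda>n. sintegral E \<nu> (F n)) \<longlonglongrightarrow> sintegral E \<nu> f"
      by (rule bounded_integral_lim[OF S, where K = K]) (use lim in auto)
    moreover have "(\<lambda>n. I (F n)) \<longlonglongrightarrow> I f"
      by (rule bounded_integral_lim[OF I, where K = K]) (use lim in auto)
    moreover have "sintegral E \<nu> (F n) = I (F n)" for n using lim by blast
    ultimately show ?case using LIMSEQ_unique by simp
  qed
qed

lemma sintegral_cong_measure: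
  assumes "vector_measure_on E \<mu>" "\<And>A. A \<in> bsets E \<Longrightarrow> \<nu> A = \<mu> A" "bounded_measurable E f"
  shows "sintegral E \<nu> f = sintegral E \<mu> f"
  by (rule sintegral_eqI(2)[OF bounded_integral_sintegral[OF assms(1)] _ assms(3)])
    (simp add: assms(2) sintegral_indicator[OF assms(1)])

lemma sintegral_diff_measure:
  assumes "vector_measure_on E \<mu>" "vector_measure_on E \<nu>"
  shows "vector_measure_on E (\<lambda>A. \<mu> A - \<nu> A)"
    and "bounded_measurable E f \<Longrightarrow> sintegral E (\<lambda>A. \<mu> A - \<nu> A) f = sintegral E \<mu> f - sintegral E \<nu> f"
  by (rule sintegral_eqI[OF bounded_integral_minus_fun[OF assms[THEN bounded_integral_sintegral]]];
      simp add: assms sintegral_indicator)+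

lemma sintegral_subset:
  assumes \<nu>: "vector_measure_on E \<nu>" and A: "A \<in> bsets E" and f: "bounded_measurable A f"
  shows "sintegral A \<nu> f = sintegral E \<nu> (\<lambda>x. indicator A x * f x)"
proof (rule sintegral_eqI(2)[OF bounded_integral_restrict[OF bounded_integral_sintegral[OF \<nu>] A] _ f])
  fix B assume B: "B \<in> bsets A"
  then have "(\<lambda>x. indicator A x * indicator B x :: real) = indicator B"
    using bsets_trace[OF A] by (intro ext) (auto simp: indicator_def)
  then show "\<nu> B = sintegral E \<nu> (\<lambda>x. indicator A x * indicator B x)"
    using sintegral_indicator[OF \<nu>] bsets_mono[OF A B] by simp
qed

lemma sintegral_smult:
  assumes \<nu>: "vector_measure_on E \<nu>" and g: "bounded_measurable E g"
  shows "vector_measure_on E (\<lambda>A. sintegral A \<nu> g)"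
    and "bounded_measurable E f \<Longrightarrow> sintegral E (\<lambda>A. sintegral A \<nu> g) f = sintegral E \<nu> (\<lambda>x. g x * f x)"
proof -
  note w = bounded_integral_weight[OF bounded_integral_sintegral[OF \<nu>] g]
  have e: "sintegral A \<nu> g = sintegral E \<nu> (\<lambda>x. g x * indicator A x)" if "A \<in> bsets E" for A
    using sintegral_subset[OF \<nu> that bounded_measurable_subset[OF g sets_restrict_borel_sub[OF that]]]
    by (simp add: mult.commute)
  show "vector_measure_on E (\<lambda>A. sintegral A \<nu> g)" by (rule sintegral_eqI(1)[OF w e])
  show "sintegral E (\<lambda>A. sintegral A \<nu> g) f = sintegral E \<nu> (\<lambda>x. g x * f x)" if "bounded_measurable E f"
    by (rule sintegral_eqI(2)[OF w e that])
qed

definition jordan_parts :: "'a::topological_space set \<Rightarrow> ('a set \<Rightarrow> real) \<Rightarrow> 'a measure set"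
  where "jordan_parts E \<nu> = {pos_part E \<nu>, pos_part E (\<lambda>A. - \<nu> A)}"

lemma jordan_parts:
  assumes "vector_measure_on E \<nu>" "M \<in> jordan_parts E \<nu>" shows "finite_measure M" "sets M = bsets E"
  using assms finite_measure_pos_part vm_minus by (auto simp: jordan_parts_def)

text \<open>The factor \<open>2\<close> comes from estimating the two Jordan parts separately.\<close>

lemma abs_sintegral_le:
  assumes \<nu>: "vector_measure_on E \<nu>"
    and b: "\<And>M. M \<in> jordan_parts E \<nu> \<Longrightarrow> integral\<^sup>L M (\<lambda>x. \<bar>f x\<bar>) \<le> c"
  shows "\<bar>sintegral E \<nu> f\<bar> \<le> 2 * c"
proof -
  have "\<bar>integral\<^sup>L M f\<bar> \<le> c" if "M \<in> jordan_parts E \<nu>" for M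
    using integral_abs_bound[of M f] b[OF that] by linarith
  then have "\<bar>integral\<^sup>L (pos_part E \<nu>) f\<bar> \<le> c" "\<bar>integral\<^sup>L (pos_part E (\<lambda>A. - \<nu> A)) f\<bar> \<le> c"
    by (auto simp: jordan_parts_def)
  then show ?thesis unfolding sintegral_def by linarith
qed

lemma abs_sintegral_le_bound:
  assumes \<nu>: "vector_measure_on E \<nu>" and K: "\<And>A. A \<in> bsets E \<Longrightarrow> \<bar>\<nu> A\<bar> \<le> K"
    and f: "bounded_measurable E f" "\<And>x. x \<in> E \<Longrightarrow> \<bar>f x\<bar> \<le> c" and c: "0 \<le> c"
  shows "\<bar>sintegral E \<nu> f\<bar> \<le> 2 * (K * c)"
proof (rule abs_sintegral_le[OF \<nu>])
  fix M assume M: "M \<in> jordan_parts E \<nu>"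
  have E: "E \<in> bsets E" using sets.top[of "restrict_space borel E"] by (simp add: space_restrict_space)
  note fin = jordan_parts[OF \<nu> M]
  have sp: "space M = E" using sets_eq_imp_space_eq[OF fin(2)] by (simp add: space_restrict_space)
  have K': "\<nu> A \<le> K" "- \<nu> A \<le> K" if "A \<in> bsets E" for A using K[OF that] by linarith+
  have "measure M E \<le> K"
  proof -
    have "M = pos_part E \<nu> \<or> M = pos_part E (\<lambda>A. - \<nu> A)" using M by (auto simp: jordan_parts_def)
    then show ?thesis
      using measure_pos_part[OF \<nu> E] measure_pos_part[OF vm_minus[OF \<nu>] E]
        upper_variation_least[OF \<nu>, of E K] upper_variation_least[OF vm_minus[OF \<nu>], of E K] K' by auto
  qed
  have fa: "integrable M (\<lambda>x. \<bar>f x\<bar>)"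
    using bounded_measurable_integrable[OF fin f(1)] by (rule integrable_abs)
  have "integral\<^sup>L M (\<lambda>x. \<bar>f x\<bar>) \<le> integral\<^sup>L M (\<lambda>x. c)"
    using f(2) sp fa finite_measure.integrable_const[OF fin(1)] by (intro integral_mono) auto
  also have "\<dots> = measure M E * c" using sp by simp
  also have "\<dots> \<le> K * c" using \<open>measure M E \<le> K\<close> c by (rule mult_right_mono)
  finally show "integral\<^sup>L M (\<lambda>x. \<bar>f x\<bar>) \<le> K * c" .
qed

subsection \<open>Approximation by continuous functions and total variation\<close>

lemma open_indicator_limit:
  fixes U :: "'a::metric_space set"
  assumes "open U"
  shows "\<exists>g :: nat \<Rightarrow> 'a \<Rightarrow> real. (\<forall>n. continuous_on UNIV (g n) \<and> (\<forall>x. 0 \<le> g n x \<and> g n x \<le> 1)) \<and>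
    (\<forall>x. (\<lambda>n. g n x) \<longlonglongrightarrow> indicator U x)"
proof (cases "U = UNIV")
  case True then show ?thesis by (intro exI[of _ "\<lambda>n x. 1"]) auto
next
  case False
  define g where "g n x = min 1 (real n * infdist x (- U))" for n x
  have "continuous_on UNIV (g n)" for n unfolding g_def by (intro continuous_intros)
  moreover have "0 \<le> g n x \<and> g n x \<le> 1" for n x unfolding g_def using infdist_nonneg[of x "- U"] by simp
  moreover have "(\<lambda>n. g n x) \<longlonglongrightarrow> indicator U x" for x
  proof (cases "x \<in> U")
    case True
    have "infdist x (- U) \<noteq> 0"
      using in_closed_iff_infdist_zero[of "- U" x] False True assms by auto
    then have p: "infdist x (- U) > 0" using infdist_nonneg[of x "- U"] by linarith
    obtain N where N: "real N * infdist x (- U) > 1" using p ex_less_of_nat_mult by blast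
    have "g n x = 1" if "n \<ge> N" for n
    proof -
      have "real N * infdist x (- U) \<le> real n * infdist x (- U)" using that p by (intro mult_right_mono) auto
      then show ?thesis using N by (simp add: g_def)
    qed
    then have "\<forall>\<^sub>F n in sequentially. g n x = 1" by (auto simp: eventually_sequentially)
    then show ?thesis using True by (simp add: tendsto_eventually)
  next
    case False
    then have "infdist x (- U) = 0" by simp
    then show ?thesis using False by (simp add: g_def)
  qed
  ultimately show ?thesis by (intro exI[of _ g]) auto
qed

text \<open>A single function \<open>g\<close> has to serve all measures of the family: for a vector measure, the Jordan
  parts of all its components.\<close>

definition approximable :: "'a::metric_space set \<Rightarrow> 'a measure set \<Rightarrow> 'a set \<Rightarrow> bool"
  where "approximable E \<F> B \<longleftrightarrow> (\<forall>e>0. \<exists>g :: 'a \<Rightarrow> real. continuous_on E g \<and> (\<forall>x. 0 \<le> g x \<and> g x \<le> 1) \<and>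
    (\<forall>M\<in>\<F>. integral\<^sup>L M (\<lambda>x. \<bar>g x - indicator B x\<bar>) < e))"

lemma bounded_measurable_abs [intro]: "bounded_measurable E f \<Longrightarrow> bounded_measurable E (\<lambda>x. \<bar>f x\<bar>)"
  unfolding bounded_measurable_def by (auto intro: borel_measurable_abs)

lemma bounded_measurable_unit:
  "continuous_on E g \<Longrightarrow> (\<And>x. 0 \<le> g x \<and> g x \<le> (1::real)) \<Longrightarrow> bounded_measurable E g"
  by (rule bounded_measurableI[where K = 1]) (auto intro!: borel_measurable_continuous_on_restrict simp: abs_le_iff order_trans[of _ 0])

lemma bounded_measurable_indicator_borel [intro]:
  "B \<in> sets borel \<Longrightarrow> bounded_measurable E (indicator B)"
  by (rule bounded_measurableI[where K = 1]) (auto simp: indicator_def intro!: measurable_restrict_space1)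

text \<open>The approximable sets form a \<open>\<sigma>\<close>-algebra containing the open sets. A countable union is first
  replaced by a finite one, and a finite union is handled by taking maxima.\<close>

lemma borel_approximable:
  fixes E :: "'a::metric_space set"
  assumes fin: "finite \<F>" and M: "\<And>M. M \<in> \<F> \<Longrightarrow> finite_measure M \<and> sets M = bsets E"
    and B: "B \<in> sets borel"
  shows "approximable E \<F> B"
proof -
  note BI = bounded_integral_measure[OF M[THEN conjunct1] M[THEN conjunct2]]
  note int = bounded_measurable_integrable[OF M[THEN conjunct1] M[THEN conjunct2]]
  have conv: "\<forall>\<^sub>F n in sequentially. \<forall>M\<in>\<F>. integral\<^sup>L M (\<lambda>x. \<bar>g n x - indicator B x\<bar>) < e"
    if e: "e > 0" and g: "\<And>n::nat. bounded_measurable E (g n)" "\<And>n x. 0 \<le> g n x \<and> g n x \<le> 1"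
      "\<And>x. (\<lambda>n. g n x) \<longlonglongrightarrow> indicator B x" and B: "B \<in> sets borel" for g B e
  proof (rule eventually_ball_finite[OF fin], intro ballI)
    fix M assume MF: "M \<in> \<F>"
    have "(\<lambda>n. integral\<^sup>L M (\<lambda>x. \<bar>g n x - indicator B x\<bar>)) \<longlonglongrightarrow> integral\<^sup>L M (\<lambda>x. 0)"
    proof (rule bounded_integral_lim[OF BI[OF MF MF], where K = 1])
      show "\<bar>\<bar>g n x - indicator B x\<bar>\<bar> \<le> 1" for n x using g(2)[of n x] by (auto simp: indicator_def)
      show "(\<lambda>n. \<bar>g n x - indicator B x\<bar>) \<longlonglongrightarrow> 0" for x
        using g(3)[of x] by (intro tendsto_rabs_zero) (simp add: LIM_zero)
    qed (auto intro!: bounded_measurable_abs bounded_measurable_diff g B)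
    then show "\<forall>\<^sub>F n in sequentially. integral\<^sup>L M (\<lambda>x. \<bar>g n x - indicator B x\<bar>) < e"
      using e by (auto dest: order_tendstoD(2))
  qed
  have mono2: "integral\<^sup>L M f \<le> integral\<^sup>L M g + integral\<^sup>L M h"
    if "M \<in> \<F>" "bounded_measurable E f" "bounded_measurable E g" "bounded_measurable E h"
      "\<And>x. f x \<le> g x + h x" for M f g h
  proof -
    have "integral\<^sup>L M f \<le> integral\<^sup>L M (\<lambda>x. g x + h x)"
      using that int[OF that(1) that(1)] by (intro integral_mono) auto
    then show ?thesis using that int[OF that(1) that(1)] by simp
  qed
  have "B \<in> sigma_sets UNIV {S. open S}" using B by (simp add: borel_def)
  then show ?thesis
  proof (induction rule: sigma_sets.induct)
    case (Basic U)
    then have U: "open U" by simp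
    obtain g :: "nat \<Rightarrow> 'a \<Rightarrow> real" where g: "\<And>n. continuous_on UNIV (g n)" "\<And>n x. 0 \<le> g n x \<and> g n x \<le> 1"
      "\<And>x. (\<lambda>n. g n x) \<longlonglongrightarrow> indicator U x" using open_indicator_limit[OF U] by blast
    have c: "continuous_on E (g n)" for n using g(1) continuous_on_subset by blast
    show ?case unfolding approximable_def
    proof (intro allI impI)
      fix e :: real assume "e > 0"
      have "U \<in> sets borel" using U by simp
      from conv[OF \<open>e > 0\<close> bounded_measurable_unit[OF c g(2)] g(2,3) this]
      obtain n where "\<forall>M\<in>\<F>. integral\<^sup>L M (\<lambda>x. \<bar>g n x - indicator U x\<bar>) < e"
        by (auto simp: eventually_sequentially)
      then show "\<exists>g. continuous_on E g \<and> (\<forall>x. 0 \<le> g x \<and> g x \<le> 1) \<and>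
          (\<forall>M\<in>\<F>. integral\<^sup>L M (\<lambda>x. \<bar>g x - indicator U x\<bar>) < e)" using c g(2) by blast
    qed
  next
    case Empty
    show ?case unfolding approximable_def by (intro allI impI exI[of _ "\<lambda>x. 0"]) auto
  next
    case (Compl B)
    show ?case unfolding approximable_def
    proof (intro allI impI)
      fix e :: real assume "e > 0"
      then obtain g where g: "continuous_on E g" "\<forall>x. 0 \<le> g x \<and> g x \<le> 1"
        "\<forall>M\<in>\<F>. integral\<^sup>L M (\<lambda>x. \<bar>g x - indicator B x\<bar>) < e" using Compl(2) unfolding approximable_def by blast
      have "\<bar>(1 - g x) - indicator (UNIV - B) x\<bar> = \<bar>g x - indicator B x\<bar>" for x
        by (auto simp: indicator_def)
      then show "\<exists>g. continuous_on E g \<and> (\<forall>x. 0 \<le> g x \<and> g x \<le> 1) \<and>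
          (\<forall>M\<in>\<F>. integral\<^sup>L M (\<lambda>x. \<bar>g x - indicator (UNIV - B) x\<bar>) < e)"
        using g by (intro exI[of _ "\<lambda>x. 1 - g x"]) (auto intro!: continuous_intros)
    qed
  next
    case (Union A)
    have mA: "A i \<in> sets borel" for i using Union(1) by (simp add: borel_def)
    have app2: "approximable E \<F> (A1 \<union> A2)"
      if A: "approximable E \<F> A1" "approximable E \<F> A2" "A1 \<in> sets borel" "A2 \<in> sets borel" for A1 A2
      unfolding approximable_def
    proof (intro allI impI)
      fix e :: real assume "e > 0"
      then have e2: "e / 2 > 0" by simp
      obtain g1 where g1: "continuous_on E g1" "\<forall>x. 0 \<le> g1 x \<and> g1 x \<le> 1"
        "\<forall>M\<in>\<F>. integral\<^sup>L M (\<lambda>x. \<bar>g1 x - indicator A1 x\<bar>) < e / 2" using A(1) e2 unfolding approximable_def by blast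
      obtain g2 where g2: "continuous_on E g2" "\<forall>x. 0 \<le> g2 x \<and> g2 x \<le> 1"
        "\<forall>M\<in>\<F>. integral\<^sup>L M (\<lambda>x. \<bar>g2 x - indicator A2 x\<bar>) < e / 2" using A(2) e2 unfolding approximable_def by blast
      let ?g = "\<lambda>x. max (g1 x) (g2 x)"
      have g: "continuous_on E ?g" "\<forall>x. 0 \<le> ?g x \<and> ?g x \<le> 1"
        using g1 g2 by (auto intro!: continuous_intros simp: le_max_iff_disj)
      have b: "bounded_measurable E (\<lambda>x. \<bar>k x - indicator B x\<bar>)"
        if "continuous_on E k" "\<forall>x. 0 \<le> k x \<and> k x \<le> 1" "B \<in> sets borel" for k B
        using that by (intro bounded_measurable_abs bounded_measurable_diff bounded_measurable_indicator_borel)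
          (auto intro: bounded_measurable_unit)
      have mU: "A1 \<union> A2 \<in> sets borel" using A by auto
      have "integral\<^sup>L M (\<lambda>x. \<bar>?g x - indicator (A1 \<union> A2) x\<bar>) < e" if MF: "M \<in> \<F>" for M
      proof -
        have "integral\<^sup>L M (\<lambda>x. \<bar>?g x - indicator (A1 \<union> A2) x\<bar>)
          \<le> integral\<^sup>L M (\<lambda>x. \<bar>g1 x - indicator A1 x\<bar>) + integral\<^sup>L M (\<lambda>x. \<bar>g2 x - indicator A2 x\<bar>)"
        proof (rule mono2[OF MF])
          show "\<bar>?g x - indicator (A1 \<union> A2) x\<bar> \<le> \<bar>g1 x - indicator A1 x\<bar> + \<bar>g2 x - indicator A2 x\<bar>" for x
            using g1(2)[rule_format, of x] g2(2)[rule_format, of x] by (auto simp: indicator_def max_def)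
        qed (rule b[OF g mU] b[OF g1(1,2) A(3)] b[OF g2(1,2) A(4)])+
        then show ?thesis using g1(3) g2(3) MF by fastforce
      qed
      then show "\<exists>g. continuous_on E g \<and> (\<forall>x. 0 \<le> g x \<and> g x \<le> 1) \<and>
          (\<forall>M\<in>\<F>. integral\<^sup>L M (\<lambda>x. \<bar>g x - indicator (A1 \<union> A2) x\<bar>) < e)" using g by blast
    qed
    have appn: "approximable E \<F> (\<Union>i<n. A i)" for n
    proof (induction n)
      case 0 then show ?case unfolding approximable_def by (intro allI impI exI[of _ "\<lambda>x. 0"]) auto
    next
      case (Suc n)
      have "(\<Union>i<Suc n. A i) = (\<Union>i<n. A i) \<union> A n" by (simp add: lessThan_Suc Un_commute)
      moreover have "(\<Union>i<n. A i) \<in> sets borel" using mA by auto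
      ultimately show ?case using app2[OF Suc Union(2)] mA by simp
    qed
    show ?case unfolding approximable_def
    proof (intro allI impI)
      fix e :: real assume "e > 0"
      then have e2: "e / 2 > 0" by simp
      have mU: "(\<Union>i<n. A i) \<in> sets borel" "(\<Union>i. A i) \<in> sets borel" for n using mA by auto
      have "\<forall>\<^sub>F n in sequentially. \<forall>M\<in>\<F>. integral\<^sup>L M (\<lambda>x. \<bar>indicator (\<Union>i<n. A i) x - indicator (\<Union>i. A i) x\<bar>) < e / 2"
      proof (rule conv[OF e2])
        show "bounded_measurable E (indicator (\<Union>i<n. A i))" for n by (intro bounded_measurable_indicator_borel mU)
        show "0 \<le> (indicator (\<Union>i<n. A i) x :: real) \<and> indicator (\<Union>i<n. A i) x \<le> (1 :: real)" for n x
          by (simp add: indicator_def)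
      qed (rule LIMSEQ_indicator_UN mU)+
      then obtain n where n: "\<forall>M\<in>\<F>. integral\<^sup>L M (\<lambda>x. \<bar>indicator (\<Union>i<n. A i) x - indicator (\<Union>i. A i) x\<bar>) < e / 2"
        by (auto simp: eventually_sequentially)
      obtain g where g: "continuous_on E g" "\<forall>x. 0 \<le> g x \<and> g x \<le> 1"
        "\<forall>M\<in>\<F>. integral\<^sup>L M (\<lambda>x. \<bar>g x - indicator (\<Union>i<n. A i) x\<bar>) < e / 2"
        using appn[of n] e2 unfolding approximable_def by blast
      have "integral\<^sup>L M (\<lambda>x. \<bar>g x - indicator (\<Union>i. A i) x\<bar>) < e" if MF: "M \<in> \<F>" for M
      proof -
        have "integral\<^sup>L M (\<lambda>x. \<bar>g x - indicator (\<Union>i. A i) x\<bar>)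
          \<le> integral\<^sup>L M (\<lambda>x. \<bar>g x - indicator (\<Union>i<n. A i) x\<bar>)
            + integral\<^sup>L M (\<lambda>x. \<bar>indicator (\<Union>i<n. A i) x - indicator (\<Union>i. A i) x\<bar>)"
        proof (rule mono2[OF MF])
          have bg: "bounded_measurable E g" using g(1,2) by (intro bounded_measurable_unit) auto
          have bU: "bounded_measurable E (indicator (\<Union>i<n. A i))" "bounded_measurable E (indicator (\<Union>i. A i))"
            by (intro bounded_measurable_indicator_borel mU)+
          show "bounded_measurable E (\<lambda>x. \<bar>g x - indicator (\<Union>i. A i) x\<bar>)"
            "bounded_measurable E (\<lambda>x. \<bar>g x - indicator (\<Union>i<n. A i) x\<bar>)"
            "bounded_measurable E (\<lambda>x. \<bar>indicator (\<Union>i<n. A i) x - indicator (\<Union>i. A i) x\<bar>)"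
            by (rule bounded_measurable_abs[OF bounded_measurable_diff], fact, fact)+
          show "\<bar>g x - indicator (\<Union>i. A i) x\<bar> \<le> \<bar>g x - indicator (\<Union>i<n. A i) x\<bar>
              + \<bar>indicator (\<Union>i<n. A i) x - indicator (\<Union>i. A i) x\<bar>" for x by linarith
        qed
        then show ?thesis using g(3) n MF by fastforce
      qed
      then show "\<exists>g. continuous_on E g \<and> (\<forall>x. 0 \<le> g x \<and> g x \<le> 1) \<and>
          (\<forall>M\<in>\<F>. integral\<^sup>L M (\<lambda>x. \<bar>g x - indicator (\<Union>i. A i) x\<bar>) < e)" using g by blast
    qed
  qed
qed

text \<open>Duality: pairing with continuous fields of norm at most one controls the variation. The field
  that would give the variation exactly is \<open>\<Sum>B. 1\<^sub>B sgn (W B)\<close>; it is approximated by continuous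
  fields, and projecting these onto the unit ball does not increase the error.\<close>

theorem variation_sum_le:
  fixes E :: "'a::metric_space set" and W :: "'a set \<Rightarrow> real ^ 'n"
  assumes W: "vector_measure_on E W"
    and bound: "\<And>f. continuous_on E f \<Longrightarrow> (\<And>x. norm (f x) \<le> 1) \<Longrightarrow> vintegral E W f \<le> K"
    and P: "finite \<P>" "\<P> \<subseteq> bsets E" "disjoint \<P>"
  shows "(\<Sum>B\<in>\<P>. norm (W B)) \<le> K"
proof (rule field_le_epsilon)
  fix e :: real assume e: "e > 0"
  define \<F> where "\<F> = (\<Union>i. jordan_parts E (\<lambda>A. W A $ i))"
  have finF: "finite \<F>" by (auto simp: \<F>_def jordan_parts_def)
  have mF: "finite_measure M \<and> sets M = bsets E" if "M \<in> \<F>" for M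
    using that jordan_parts[OF vm_nth[OF W]] unfolding \<F>_def by blast
  define N where "N = real (CARD('n)) * 2 * (real (card \<P>) + 1)"
  have N: "N > 0" unfolding N_def by simp
  define d where "d = e / N"
  have d: "d > 0" using e N by (simp add: d_def)
  have "\<exists>g. continuous_on E g \<and> (\<forall>x. 0 \<le> g x \<and> g x \<le> 1) \<and>
      (\<forall>M\<in>\<F>. integral\<^sup>L M (\<lambda>x. \<bar>g x - indicator B x\<bar>) < d)" if B: "B \<in> \<P>" for B
  proof -
    from B P(2) have "B \<in> bsets E" by (rule subsetD[rotated])
    then obtain C where C: "C \<in> sets borel" "B = E \<inter> C" unfolding bsets_iff by (elim bexE)
    obtain g where g: "continuous_on E g" "\<forall>x. 0 \<le> g x \<and> g x \<le> 1"
      "\<forall>M\<in>\<F>. integral\<^sup>L M (\<lambda>x. \<bar>g x - indicator C x\<bar>) < d"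
      using borel_approximable[OF finF mF C(1)] d unfolding approximable_def by blast
    have "integral\<^sup>L M (\<lambda>x. \<bar>g x - indicator B x\<bar>) = integral\<^sup>L M (\<lambda>x. \<bar>g x - indicator C x\<bar>)" if "M \<in> \<F>" for M
    proof -
      have "space M = E" using sets_eq_imp_space_eq[OF mF[OF that, THEN conjunct2]] by (simp add: space_restrict_space)
      then show ?thesis using C(2) by (intro Bochner_Integration.integral_cong refl) (auto simp: indicator_def)
    qed
    with g show ?thesis by (intro exI[of _ g]) simp
  qed
  then obtain g where g: "\<And>B. B \<in> \<P> \<Longrightarrow> continuous_on E (g B)" "\<And>B x. B \<in> \<P> \<Longrightarrow> 0 \<le> g B x \<and> g B x \<le> 1"
    "\<And>B M. B \<in> \<P> \<Longrightarrow> M \<in> \<F> \<Longrightarrow> integral\<^sup>L M (\<lambda>x. \<bar>g B x - indicator B x\<bar>) < d" by metis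
  define u where "u B = sgn (W B)" for B
  have nu: "norm (u B) \<le> 1" for B by (simp add: u_def norm_sgn)
  define F where "F x = (\<Sum>B\<in>\<P>. indicator B x *\<^sub>R u B)" for x
  define f where "f x = closest_point (cball 0 1) (\<Sum>B\<in>\<P>. g B x *\<^sub>R u B)" for x
  have cb: "convex (cball (0::real^'n) 1)" "closed (cball (0::real^'n) 1)" "cball (0::real^'n) 1 \<noteq> {}" by auto
  have cf: "continuous_on E f" unfolding f_def
    by (intro continuous_on_compose2[OF continuous_on_closest_point[OF cb, of UNIV]] continuous_intros g(1)) auto
  have nf: "norm (f x) \<le> 1" for x
    using closest_point_in_set[OF cb(2,3), of "\<Sum>B\<in>\<P>. g B x *\<^sub>R u B"] by (simp add: f_def)
  have F1: "F x \<in> cball 0 1" for x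
  proof (cases "\<exists>B\<in>\<P>. x \<in> B")
    case True
    then obtain B where B: "B \<in> \<P>" "x \<in> B" by blast
    have un: "C = B" if "C \<in> \<P>" "x \<in> C" for C using P(3) B that unfolding disjoint_def by blast
    have "indicator C x *\<^sub>R u C = (if C = B then u B else 0)" if "C \<in> \<P>" for C
      using un[OF that] B(2) by (cases "x \<in> C") auto
    then have "F x = (\<Sum>C\<in>\<P>. if C = B then u B else 0)"
      unfolding F_def by (rule sum.cong[OF refl])
    then show ?thesis using B P(1) nu by simp
  next
    case False
    then have "F x = 0" unfolding F_def by (intro sum.neutral) (auto simp: indicator_def)
    then show ?thesis by simp
  qed
  have close: "norm (f x - F x) \<le> (\<Sum>B\<in>\<P>. \<bar>g B x - indicator B x\<bar>)" for x
  proof -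
    have "dist (f x) (F x) \<le> dist (\<Sum>B\<in>\<P>. g B x *\<^sub>R u B) (F x)"
      using closest_point_lipschitz[OF cb, of "\<Sum>B\<in>\<P>. g B x *\<^sub>R u B" "F x"] closest_point_self[OF F1]
      by (simp add: f_def)
    also have "\<dots> = norm (\<Sum>B\<in>\<P>. (g B x - indicator B x) *\<^sub>R u B)"
      by (simp add: dist_norm F_def sum_subtractf[symmetric] scaleR_diff_left)
    also have "\<dots> \<le> (\<Sum>B\<in>\<P>. norm ((g B x - indicator B x) *\<^sub>R u B))" by (rule norm_sum)
    also have "\<dots> \<le> (\<Sum>B\<in>\<P>. \<bar>g B x - indicator B x\<bar>)"
      using nu by (intro sum_mono) (simp add: mult_left_le)
    finally show ?thesis by (simp add: dist_norm)
  qed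
  have bg: "bounded_measurable E (g B)" if "B \<in> \<P>" for B using g(1,2)[OF that] by (intro bounded_measurable_unit)
  have bi: "bounded_measurable E (indicator B)" if "B \<in> \<P>" for B using that P(2) by auto
  have bF: "bounded_measurable E (\<lambda>x. F x $ i)" for i
    unfolding F_def sum_component vector_scaleR_component using bi
    by (intro bounded_measurable_sum bounded_measurable_mult) auto
  have bf: "bounded_measurable E (\<lambda>x. f x $ i)" for i
  proof (rule bounded_measurableI)
    show "(\<lambda>x. f x $ i) \<in> borel_measurable (restrict_space borel E)"
      by (intro borel_measurable_continuous_on_restrict continuous_intros cf)
    show "\<bar>f x $ i\<bar> \<le> 1" for x using component_le_norm_cart[of "f x" i] nf[of x] by linarith
  qed
  have vF: "vintegral E W F = (\<Sum>B\<in>\<P>. norm (W B))"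
  proof -
    have "sintegral E (\<lambda>A. W A $ i) (\<lambda>x. F x $ i) = (\<Sum>B\<in>\<P>. u B $ i * W B $ i)" for i
    proof -
      note BI = bounded_integral_sintegral[OF vm_nth[OF W, of i]]
      have "sintegral E (\<lambda>A. W A $ i) (\<lambda>x. F x $ i)
          = sintegral E (\<lambda>A. W A $ i) (\<lambda>x. \<Sum>B\<in>\<P>. u B $ i * indicator B x)"
        by (simp add: F_def mult.commute)
      also have "\<dots> = (\<Sum>B\<in>\<P>. sintegral E (\<lambda>A. W A $ i) (\<lambda>x. u B $ i * indicator B x))"
        using bi by (intro bounded_integral_sum[OF BI] bounded_measurable_cmult)
      also have "\<dots> = (\<Sum>B\<in>\<P>. u B $ i * W B $ i)"
        using bi P(2) by (intro sum.cong refl) (simp add: bounded_integral_scale[OF BI] sintegral_indicator[OF vm_nth[OF W]] subset_eq)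
      finally show ?thesis .
    qed
    then have "vintegral E W F = (\<Sum>i\<in>UNIV. \<Sum>B\<in>\<P>. u B $ i * W B $ i)" by (simp add: vintegral_def)
    also have "\<dots> = (\<Sum>B\<in>\<P>. u B \<bullet> W B)" by (subst sum.swap) (simp add: inner_vec_def)
    also have "\<dots> = (\<Sum>B\<in>\<P>. norm (W B))"
      by (intro sum.cong refl) (simp add: u_def sgn_div_norm dot_square_norm power2_eq_square, metis left_inverse norm_eq_zero)
    finally show ?thesis .
  qed
  have diff: "\<bar>sintegral E (\<lambda>A. W A $ i) (\<lambda>x. f x $ i) - sintegral E (\<lambda>A. W A $ i) (\<lambda>x. F x $ i)\<bar> \<le> 2 * (real (card \<P>) * d)" for i
  proof -
    note BI = bounded_integral_sintegral[OF vm_nth[OF W, of i]]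
    have "\<bar>sintegral E (\<lambda>A. W A $ i) (\<lambda>x. f x $ i - F x $ i)\<bar> \<le> 2 * (real (card \<P>) * d)"
    proof (rule abs_sintegral_le[OF vm_nth[OF W]])
      fix M assume M: "M \<in> jordan_parts E (\<lambda>A. W A $ i)"
      then have MF: "M \<in> \<F>" by (auto simp: \<F>_def)
      note int = bounded_measurable_integrable[OF mF[OF MF, THEN conjunct1] mF[OF MF, THEN conjunct2]]
      have i1: "integrable M (\<lambda>x. \<bar>g B x - indicator B x\<bar>)" if "B \<in> \<P>" for B
        using bg bi that by (intro int bounded_measurable_abs bounded_measurable_diff)
      have "integral\<^sup>L M (\<lambda>x. \<bar>f x $ i - F x $ i\<bar>) \<le> integral\<^sup>L M (\<lambda>x. \<Sum>B\<in>\<P>. \<bar>g B x - indicator B x\<bar>)"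
      proof (rule integral_mono)
        show "integrable M (\<lambda>x. \<bar>f x $ i - F x $ i\<bar>)" using bf bF by (intro int bounded_measurable_abs bounded_measurable_diff)
        show "integrable M (\<lambda>x. \<Sum>B\<in>\<P>. \<bar>g B x - indicator B x\<bar>)" using i1 by auto
        show "\<bar>f x $ i - F x $ i\<bar> \<le> (\<Sum>B\<in>\<P>. \<bar>g B x - indicator B x\<bar>)" for x
          using component_le_norm_cart[of "f x - F x" i] close[of x] by (simp add: vector_minus_component)
      qed
      also have "\<dots> = (\<Sum>B\<in>\<P>. integral\<^sup>L M (\<lambda>x. \<bar>g B x - indicator B x\<bar>))" using i1 by simp
      also have "\<dots> \<le> (\<Sum>B\<in>\<P>. d)" using g(3) MF by (intro sum_mono less_imp_le) auto
      finally show "integral\<^sup>L M (\<lambda>x. \<bar>f x $ i - F x $ i\<bar>) \<le> real (card \<P>) * d" by simp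
    qed
    then show ?thesis using bounded_integral_diff[OF BI bf bF] by simp
  qed
  have "vintegral E W F - vintegral E W f \<le> (\<Sum>i\<in>(UNIV::'n set). 2 * (real (card \<P>) * d))"
    unfolding vintegral_def sum_subtractf[symmetric] using diff by (intro sum_mono) (smt (verit) abs_le_iff)
  also have "\<dots> \<le> N * d" using d by (simp add: N_def algebra_simps)
  also have "\<dots> = e" using N by (simp add: d_def)
  finally show "(\<Sum>B\<in>\<P>. norm (W B)) \<le> K + e" using bound[OF cf nf] vF by simp
qed

section \<open>Densities and measures on space-time\<close>

lemma sets_Leb [simp, measurable_cong]: "sets Leb = sets borel" by (simp add: Leb_def)

lemma space_Leb [simp]: "space Leb = UNIV" by (simp add: Leb_def)

lemma finite_measure_Leb: "finite_measure Leb"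
  by standard (simp add: emeasure_Leb_UNIV)

lemma measure_Leb_UNIV [simp]: "measure Leb UNIV = 1" by (simp add: measure_def emeasure_Leb_UNIV)

lemma bounded_integral_Leb: "bounded_integral UNIV (integral\<^sup>L Leb)"
  by (rule bounded_integral_measure[OF finite_measure_Leb]) simp

lemma integrable_Leb: "bounded_measurable UNIV f \<Longrightarrow> integrable Leb f"
  by (rule bounded_measurable_integrable[OF finite_measure_Leb, of UNIV]) simp_all

lemma sintegral_Leb:
  shows "vector_measure_on UNIV (measure Leb)"
    and "bounded_measurable UNIV f \<Longrightarrow> sintegral UNIV (measure Leb) f = integral\<^sup>L Leb f"
  by (rule sintegral_eqI[OF bounded_integral_Leb]; simp)+

lemma dens_eq_smult: 
  fixes g :: "T3 \<Rightarrow> real"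
  assumes "bounded_measurable UNIV g" "A \<in> sets borel"
  shows "dens g A = sintegral A (measure Leb) g"
proof -
  have "bounded_measurable A g" by (rule bounded_measurable_subset[OF assms(1)]) simp
  then have "sintegral A (measure Leb) g = integral\<^sup>L Leb (\<lambda>x. indicator A x * g x)"
    using sintegral_subset[OF sintegral_Leb(1), of A g] sintegral_Leb(2)[OF bounded_measurable_extend[of A UNIV g]]
      assms(2) by simp
  then show ?thesis by (simp add: dens_def set_lebesgue_integral_def)
qed

lemma sintegral_dens:
  fixes g :: "T3 \<Rightarrow> real"
  assumes g: "bounded_measurable UNIV g"
  shows "vector_measure_on UNIV (dens g)"
    and "bounded_measurable UNIV f \<Longrightarrow> sintegral UNIV (dens g) f = integral\<^sup>L Leb (\<lambda>x. g x * f x)"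
proof -
  show *: "vector_measure_on UNIV (dens g)"
    by (rule vm_cong[OF _ sintegral_smult(1)[OF sintegral_Leb(1) g]]) (simp add: dens_eq_smult[OF g])
  show "sintegral UNIV (dens g) f = integral\<^sup>L Leb (\<lambda>x. g x * f x)" if f: "bounded_measurable UNIV f"
  proof -
    have "sintegral UNIV (dens g) f = sintegral UNIV (\<lambda>A. sintegral A (measure Leb) g) f"
      by (rule sintegral_cong_measure[OF sintegral_smult(1)[OF sintegral_Leb(1) g] _ f]) (simp add: dens_eq_smult[OF g])
    also have "\<dots> = sintegral UNIV (measure Leb) (\<lambda>x. g x * f x)"
      by (rule sintegral_smult(2)[OF sintegral_Leb(1) g f])
    also have "\<dots> = integral\<^sup>L Leb (\<lambda>x. g x * f x)" using f g by (intro sintegral_Leb(2)) auto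
    finally show ?thesis .
  qed
qed

lemma dens_nth:
  fixes F :: "T3 \<Rightarrow> real ^ 'n"
  assumes "\<And>i. bounded_measurable UNIV (\<lambda>x. F x $ i)" "A \<in> sets borel"
  shows "dens F A $ i = dens (\<lambda>x. F x $ i) A"
proof -
  have "integrable Leb F"
  proof -
    have "integrable Leb (\<lambda>x. \<Sum>i\<in>UNIV. F x $ i *\<^sub>R axis i (1::real))"
      using integrable_Leb[OF assms(1)] by (intro Bochner_Integration.integrable_sum integrable_scaleR_left) auto
    moreover have "(\<Sum>i\<in>UNIV. F x $ i *\<^sub>R axis i (1::real)) = F x" for x
      using basis_expansion[of "F x"] by (simp only: scalar_mult_eq_scaleR)
    ultimately show ?thesis by (simp only:)
  qed
  then have "integrable Leb (\<lambda>x. indicator A x *\<^sub>R F x)" using assms(2) by (intro integrable_mult_indicator) auto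
  from integral_bounded_linear[OF bounded_linear_vec_nth[of i] this] show ?thesis
    by (simp add: dens_def set_lebesgue_integral_def)
qed

subsection \<open>Kernels\<close>

text \<open>A measurable, uniformly bounded family of signed measures: what is needed for \<open>\<mu>(s) ds\<close> to be a
  measure on space-time.\<close>

definition measure_kernel :: "real \<Rightarrow> real \<Rightarrow> (real \<Rightarrow> T3 set \<Rightarrow> real) \<Rightarrow> bool"
  where "measure_kernel T K \<mu> \<longleftrightarrow> (\<forall>s\<in>{0..T}. vector_measure_on UNIV (\<mu> s) \<and> (\<forall>A\<in>sets borel. \<bar>\<mu> s A\<bar> \<le> K)) \<and>
    (\<forall>A\<in>sets borel. (\<lambda>s. \<mu> s A) \<in> borel_measurable (restrict_space borel {0..T}))"

lemma kernelI:
  assumes "\<And>s. s \<in> {0..T} \<Longrightarrow> vector_measure_on UNIV (\<mu> s)"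
    "\<And>s A. s \<in> {0..T} \<Longrightarrow> A \<in> sets borel \<Longrightarrow> \<bar>\<mu> s A\<bar> \<le> K"
    "\<And>A. A \<in> sets borel \<Longrightarrow> (\<lambda>s. \<mu> s A) \<in> borel_measurable (restrict_space borel {0..T})"
  shows "measure_kernel T K \<mu>"
  using assms unfolding measure_kernel_def by blast

lemma kernelD:
  assumes "measure_kernel T K \<mu>"
  shows "s \<in> {0..T} \<Longrightarrow> vector_measure_on UNIV (\<mu> s)"
    "s \<in> {0..T} \<Longrightarrow> A \<in> sets borel \<Longrightarrow> \<bar>\<mu> s A\<bar> \<le> K"
    "A \<in> sets borel \<Longrightarrow> (\<lambda>s. \<mu> s A) \<in> borel_measurable (restrict_space borel {0..T})"
  using assms unfolding measure_kernel_def by blast+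

lemma measurable_Icc_mono:
  assumes "f \<in> borel_measurable (restrict_space borel {0..T})" "\<theta> \<le> (T::real)"
  shows "f \<in> borel_measurable (restrict_space borel {0..\<theta>})"
proof -
  have "restrict_space (restrict_space borel {0..T}) {0..\<theta>} = restrict_space borel {0..\<theta>}"
    using assms(2) by (subst restrict_restrict_space) (auto intro!: arg_cong[where f = "restrict_space borel"])
  then show ?thesis using measurable_restrict_space1[OF assms(1), of "{0..\<theta>}"] by simp
qed

lemma kernel_mono: "measure_kernel T K \<mu> \<Longrightarrow> \<theta> \<le> T \<Longrightarrow> measure_kernel \<theta> K \<mu>"
  by (rule kernelI) (auto intro: measurable_Icc_mono kernelD)

lemma measurable_slice [measurable]: "Pair s \<in> borel_measurable (borel :: T3 measure)"
  by (intro borel_measurable_continuous_onI continuous_intros)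

lemma slice_sets: "B \<in> sets borel \<Longrightarrow> {x. (s::real, x) \<in> B} \<in> sets (borel :: T3 measure)"
  using measurable_sets[OF measurable_slice[of s], of B] by (simp add: vimage_def)

lemma bounded_measurable_slice:
  assumes f: "bounded_measurable ({0..T} \<times> UNIV) f" and s: "s \<in> {0..T}"
  shows "bounded_measurable (UNIV :: T3 set) (\<lambda>x. f (s, x))"
proof -
  obtain K where K: "\<forall>z\<in>{0..T} \<times> UNIV. \<bar>f z\<bar> \<le> K" using bounded_measurableD[OF f] by auto
  have "Pair s \<in> measurable borel (restrict_space borel ({0..T} \<times> (UNIV :: T3 set)))"
    using s by (intro measurable_restrict_space2 measurable_slice) auto
  from measurable_compose[OF this bounded_measurable_measurable[OF f]]
  show ?thesis using K s by (intro bounded_measurableI[where K = K]) auto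
qed

lemma sets_borel_rectangles:
  "sets (borel :: (real \<times> T3) measure) = sigma_sets UNIV {J \<times> V |J V. open J \<and> open V}"
proof (intro equalityI subsetI)
  fix B :: "(real \<times> T3) set" assume "B \<in> sets borel"
  then have "B \<in> sigma_sets UNIV {S. open S}" by (simp add: borel_def)
  then show "B \<in> sigma_sets UNIV {J \<times> V |J V. open J \<and> open V}"
  proof (induction rule: sigma_sets.induct)
    case (Basic U)
    then have "open U" by simp
    from open_slab_rectangles[OF this] obtain R :: "nat \<Rightarrow> (real \<times> T3) set"
      where R: "\<And>n. \<exists>J V. R n = J \<times> V \<and> open J \<and> open V" "U = (\<Union>n. R n)" by blast
    have "R n \<in> sigma_sets UNIV {J \<times> V |J V. open J \<and> open V}" for n
      using R(1)[of n] by (intro sigma_sets.Basic) blast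
    then show ?case unfolding R(2) by (rule sigma_sets.Union)
  qed (auto intro: sigma_sets.intros)
next
  fix B :: "(real \<times> T3) set" assume "B \<in> sigma_sets UNIV {J \<times> V |J V. open J \<and> open V}"
  then show "B \<in> sets borel"
  proof (induction rule: sigma_sets.induct)
    case (Basic U) then show ?case by (auto intro!: borel_open open_Times)
  next
    case (Compl B) then show ?case using sets.compl_sets[of B borel] by simp
  qed auto
qed

text \<open>The slices of a rectangle \<open>J \<times> V\<close> have measure \<open>1\<^sub>J(s) \<mu>(s)(V)\<close>; a Dynkin argument passes from
  rectangles to all Borel sets.\<close>

lemma kernel_slice_measurable:
  assumes k: "measure_kernel T K \<mu>" and B: "B \<in> sets borel"
  shows "(\<lambda>s. \<mu> s {x. (s, x) \<in> B}) \<in> borel_measurable (restrict_space borel {0..T})"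
proof -
  let ?G = "{J \<times> V |J V. open J \<and> open V} :: (real \<times> T3) set set"
  let ?M = "restrict_space borel {0..T}"
  have st: "Int_stable ?G" unfolding Int_stable_def
  proof (intro ballI)
    fix a b assume "a \<in> ?G" "b \<in> ?G"
    then obtain J V J' V' where "a = J \<times> V" "b = J' \<times> V'" "open J" "open V" "open J'" "open V'" by auto
    then show "a \<inter> b \<in> ?G" by (intro CollectI exI[of _ "J \<inter> J'"] exI[of _ "V \<inter> V'"]) auto
  qed
  note vm = kernelD(1)[OF k]
  have BG: "B \<in> sigma_sets UNIV ?G" using B sets_borel_rectangles by simp
  have "?G \<subseteq> Pow UNIV" by simp
  from st this BG show ?thesis
  proof (induction rule: sigma_sets_induct_disjoint)
    case (basic A)
    then obtain J V where A: "A = J \<times> V" "open J" "open V" by auto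
    have "(\<lambda>s. indicator J s * \<mu> s V) \<in> borel_measurable ?M"
      using A kernelD(3)[OF k, of V]
      by (intro borel_measurable_times measurable_restrict_space1[OF borel_measurable_indicator]) auto
    moreover have "\<mu> s {x. (s, x) \<in> A} = indicator J s * \<mu> s V" if "s \<in> space ?M" for s
      using vm_empty[OF vm, of s] that unfolding A by (auto simp: indicator_def space_restrict_space)
    ultimately show ?case by (subst measurable_cong[where g = "\<lambda>s. indicator J s * \<mu> s V"]) auto
  next
    case empty
    have "\<mu> s {x. (s, x) \<in> {}} = 0" if "s \<in> space ?M" for s
      using vm_empty[OF vm, of s] that by (auto simp: space_restrict_space)
    then show ?case by (subst measurable_cong[where g = "\<lambda>s. 0"]) auto
  next
    case (compl A)
    then have A: "A \<in> sets borel" using sets_borel_rectangles by simp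
    have "(\<lambda>s. \<mu> s UNIV - \<mu> s {x. (s, x) \<in> A}) \<in> borel_measurable ?M"
      using kernelD(3)[OF k, of UNIV] compl by (intro borel_measurable_diff) auto
    moreover have "\<mu> s {x. (s, x) \<in> UNIV - A} = \<mu> s UNIV - \<mu> s {x. (s, x) \<in> A}" if "s \<in> space ?M" for s
    proof -
      have "{x. (s, x) \<in> UNIV - A} = UNIV - {x. (s, x) \<in> A}" by auto
      then show ?thesis using vm_Diff[OF vm, of s UNIV "{x. (s, x) \<in> A}"] that slice_sets[OF A]
        by (simp add: space_restrict_space)
    qed
    ultimately show ?case by (subst measurable_cong[where g = "\<lambda>s. \<mu> s UNIV - \<mu> s {x. (s, x) \<in> A}"]) auto
  next
    case (union A)
    have A: "A n \<in> sets borel" for n using union(2) sets_borel_rectangles by auto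
    have "(\<lambda>s. \<Sum>n. \<mu> s {x. (s, x) \<in> A n}) \<in> borel_measurable ?M"
      using union(3) by (intro borel_measurable_suminf)
    moreover have "\<mu> s {x. (s, x) \<in> (\<Union>n. A n)} = (\<Sum>n. \<mu> s {x. (s, x) \<in> A n})" if "s \<in> space ?M" for s
    proof -
      have d: "disjoint_family (\<lambda>n. {x. (s, x) \<in> A n})"
        using union(1) unfolding disjoint_family_on_def by blast
      have "(\<lambda>n. \<mu> s {x. (s, x) \<in> A n}) sums \<mu> s (\<Union>n. {x. (s, x) \<in> A n})"
        using that slice_sets[OF A] by (intro vm_sums[OF vm _ d]) (auto simp: space_restrict_space)
      moreover have "(\<Union>n. {x. (s, x) \<in> A n}) = {x. (s, x) \<in> (\<Union>n. A n)}" by auto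
      ultimately show ?thesis by (simp add: sums_iff)
    qed
    ultimately show ?case by (subst measurable_cong[where g = "\<lambda>s. \<Sum>n. \<mu> s {x. (s, x) \<in> A n}"]) auto
  qed
qed

lemma kernel_integral_measurable:
  assumes k: "measure_kernel T K \<mu>" and f: "bounded_measurable ({0..T} \<times> UNIV) f"
  shows "(\<lambda>s. sintegral UNIV (\<mu> s) (\<lambda>x. f (s, x))) \<in> borel_measurable (restrict_space borel {0..T})"
  using f
proof (induction rule: bounded_measurable_induct)
  let ?M = "restrict_space borel {0..T}"
  note BI = bounded_integral_sintegral[OF kernelD(1)[OF k]]
  {
    case (indicator A)
    then have A: "A \<in> sets borel" by (subst (asm) bsets_Int) (auto intro!: borel_closed closed_Times)
    have "sintegral UNIV (\<mu> s) (\<lambda>x. indicator A (s, x)) = \<mu> s {x. (s, x) \<in> A}" if "s \<in> space ?M" for s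
    proof -
      have "(\<lambda>x. indicator A (s, x)) = (indicator {x. (s, x) \<in> A} :: T3 \<Rightarrow> real)"
        by (auto simp: indicator_def fun_eq_iff)
      then show ?thesis using sintegral_indicator[OF kernelD(1)[OF k]] slice_sets[OF A] that
        by (simp add: space_restrict_space)
    qed
    with kernel_slice_measurable[OF k A] show ?case
      by (subst measurable_cong[where g = "\<lambda>s. \<mu> s {x. (s, x) \<in> A}"]) auto
  next
    case (add f g)
    have "sintegral UNIV (\<mu> s) (\<lambda>x. f (s, x) + g (s, x))
        = sintegral UNIV (\<mu> s) (\<lambda>x. f (s, x)) + sintegral UNIV (\<mu> s) (\<lambda>x. g (s, x))" if "s \<in> space ?M" for s
      using that add by (intro bounded_integral_add[OF BI] bounded_measurable_slice) (auto simp: space_restrict_space)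
    then show ?case using borel_measurable_add[OF add(3,4)] by (subst measurable_cong) auto
  next
    case (scale c f)
    have "sintegral UNIV (\<mu> s) (\<lambda>x. c * f (s, x)) = c * sintegral UNIV (\<mu> s) (\<lambda>x. f (s, x))"
      if "s \<in> space ?M" for s
      using that scale by (intro bounded_integral_scale[OF BI] bounded_measurable_slice) (auto simp: space_restrict_space)
    then show ?case using borel_measurable_times[OF borel_measurable_const[of c] scale(2)] by (subst measurable_cong) auto
  next
    case (lim F f K')
    show ?case
    proof (rule borel_measurable_LIMSEQ_real)
      show "(\<lambda>s. sintegral UNIV (\<mu> s) (\<lambda>x. F n (s, x))) \<in> borel_measurable ?M" for n using lim by blast
      fix s assume "s \<in> space ?M"
      then have s: "s \<in> {0..T}" by (simp add: space_restrict_space)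
      show "(\<lambda>n. sintegral UNIV (\<mu> s) (\<lambda>x. F n (s, x))) \<longlonglongrightarrow> sintegral UNIV (\<mu> s) (\<lambda>x. f (s, x))"
        by (rule bounded_integral_lim[OF BI[OF s], where K = K'])
          (use lim s in \<open>auto intro!: bounded_measurable_slice[OF _ s]\<close>)
    qed
  }
qed

lemma kernel_integral_bounded:
  assumes k: "measure_kernel T K \<mu>" and f: "bounded_measurable ({0..T} \<times> UNIV) f"
  shows "bounded_measurable {0..T} (\<lambda>s. sintegral UNIV (\<mu> s) (\<lambda>x. f (s, x)))"
proof -
  obtain c where c: "c > 0" "\<forall>z\<in>{0..T} \<times> UNIV. \<bar>f z\<bar> \<le> c" using bounded_measurableD[OF f] by auto
  show ?thesis
  proof (rule bounded_measurableI[OF kernel_integral_measurable[OF k f]])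
    fix s assume s: "s \<in> {0..T}"
    show "\<bar>sintegral UNIV (\<mu> s) (\<lambda>x. f (s, x))\<bar> \<le> 2 * (K * c)"
      using s c kernelD(2)[OF k s]
      by (intro abs_sintegral_le_bound[OF kernelD(1)[OF k s]] bounded_measurable_slice[OF f s]) auto
  qed
qed

abbreviation time_measure :: "real \<Rightarrow> real measure"
  where "time_measure \<theta> \<equiv> restrict_space lborel {0..\<theta>}"

lemma sets_time_measure: "sets (time_measure \<theta>) = bsets {0..\<theta>}"
  by (simp add: sets_restrict_space)

lemma finite_time_measure: "finite_measure (time_measure \<theta>)"
  by standard (simp add: emeasure_restrict_space space_restrict_space emeasure_lborel_Icc_eq)

lemma measure_time_measure: "0 \<le> \<theta> \<Longrightarrow> measure (time_measure \<theta>) {0..\<theta>} = \<theta>"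
  by (simp add: measure_restrict_space)

lemma space_time_measure: "space (time_measure \<theta>) = {0..\<theta>}" by (simp add: space_restrict_space)

lemmas bounded_integral_time = bounded_integral_measure[OF finite_time_measure sets_time_measure]

text \<open>Fubini for kernels: the iterated integral is a bounded integral, and on indicators it is the
  definition of \<open>\<mu>(s) ds\<close>.\<close>

theorem sintegral_spacetime:
  assumes k: "measure_kernel T K \<mu>" and \<theta>: "\<theta> \<le> T"
  shows "vector_measure_on ({0..\<theta>} \<times> UNIV) (spacetime T \<mu>)"
    and "bounded_measurable ({0..\<theta>} \<times> UNIV) f \<Longrightarrow> sintegral ({0..\<theta>} \<times> UNIV) (spacetime T \<mu>) f
      = integral\<^sup>L (time_measure \<theta>) (\<lambda>s. sintegral UNIV (\<mu> s) (\<lambda>x. f (s, x)))"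
proof -
  let ?E = "{0..\<theta>} \<times> (UNIV :: T3 set)"
  let ?I = "\<lambda>f. integral\<^sup>L (time_measure \<theta>) (\<lambda>s. sintegral UNIV (\<mu> s) (\<lambda>x. f (s, x)))"
  note k' = kernel_mono[OF k \<theta>]
  note BI = bounded_integral_sintegral[OF kernelD(1)[OF k']]
  note b = kernel_integral_bounded[OF k']
  note ct = bounded_integral_cong[OF bounded_integral_time b]
  have I: "bounded_integral ?E ?I"
  proof (rule bounded_integralI)
    fix f g assume fg: "bounded_measurable ?E f" "bounded_measurable ?E g"
    have "?I (\<lambda>z. f z + g z) = integral\<^sup>L (time_measure \<theta>)
        (\<lambda>s. sintegral UNIV (\<mu> s) (\<lambda>x. f (s, x)) + sintegral UNIV (\<mu> s) (\<lambda>x. g (s, x)))"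
      using fg by (intro ct bounded_measurable_add bounded_integral_add[OF BI] bounded_measurable_slice)
    then show "?I (\<lambda>z. f z + g z) = ?I f + ?I g"
      using bounded_integral_add[OF bounded_integral_time b[OF fg(1)] b[OF fg(2)]] by simp
  next
    fix c f assume f: "bounded_measurable ?E f"
    have "?I (\<lambda>z. c * f z) = integral\<^sup>L (time_measure \<theta>) (\<lambda>s. c * sintegral UNIV (\<mu> s) (\<lambda>x. f (s, x)))"
      using f by (intro ct bounded_measurable_cmult bounded_integral_scale[OF BI] bounded_measurable_slice)
    then show "?I (\<lambda>z. c * f z) = c * ?I f" by simp
  next
    fix F :: "nat \<Rightarrow> real \<times> T3 \<Rightarrow> real" and f c
    assume F: "\<And>n. bounded_measurable ?E (F n)" "bounded_measurable ?E f" "\<And>n x. x \<in> ?E \<Longrightarrow> \<bar>F n x\<bar> \<le> c"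
      "\<And>x. x \<in> ?E \<Longrightarrow> (\<lambda>n. F n x) \<longlonglongrightarrow> f x"
    show "(\<lambda>n. ?I (F n)) \<longlonglongrightarrow> ?I f"
    proof (rule bounded_integral_lim[OF bounded_integral_time b[OF F(1)] b[OF F(2)], where K = "2 * (K * \<bar>c\<bar>)"])
      fix n s assume s: "s \<in> {0..\<theta>}"
      have "\<bar>F n (s, x)\<bar> \<le> \<bar>c\<bar>" for x using F(3)[of "(s, x)" n] s by simp
      then show "\<bar>sintegral UNIV (\<mu> s) (\<lambda>x. F n (s, x))\<bar> \<le> 2 * (K * \<bar>c\<bar>)"
        using kernelD(2)[OF k' s] F(1)
        by (intro abs_sintegral_le_bound[OF kernelD(1)[OF k' s]] bounded_measurable_slice[OF _ s]) auto
    next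
      fix s assume s: "s \<in> {0..\<theta>}"
      show "(\<lambda>n. sintegral UNIV (\<mu> s) (\<lambda>x. F n (s, x))) \<longlonglongrightarrow> sintegral UNIV (\<mu> s) (\<lambda>x. f (s, x))"
        by (rule bounded_integral_lim[OF BI[OF s], where K = c])
          (use F s in \<open>auto intro!: bounded_measurable_slice[OF _ s]\<close>)
    qed
  qed
  have eq: "spacetime T \<mu> A = ?I (indicator A)" if A: "A \<in> bsets ?E" for A
  proof -
    have A': "A \<in> sets borel" "A \<subseteq> ?E" using A by (subst (asm) bsets_Int; auto intro!: borel_closed closed_Times)+
    have "spacetime T \<mu> A = integral\<^sup>L lborel (\<lambda>s. indicator {0..\<theta>} s *\<^sub>R \<mu> s {x. (s, x) \<in> A})"
      unfolding spacetime_def set_lebesgue_integral_def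
    proof (intro Bochner_Integration.integral_cong refl)
      fix s
      show "indicator {0..T} s *\<^sub>R \<mu> s {x. (s, x) \<in> A} = indicator {0..\<theta>} s *\<^sub>R \<mu> s {x. (s, x) \<in> A}"
      proof (cases "s \<in> {0..T} \<and> s \<notin> {0..\<theta>}")
        case True
        then have "{x. (s, x) \<in> A} = {}" using A' by auto
        then show ?thesis using vm_empty[OF kernelD(1)[OF k]] True by simp
      qed (use \<theta> in \<open>auto simp: indicator_def\<close>)
    qed
    also have "\<dots> = integral\<^sup>L (time_measure \<theta>) (\<lambda>s. \<mu> s {x. (s, x) \<in> A})"
      by (subst integral_restrict_space) auto
    also have "\<dots> = ?I (indicator A)"
    proof (intro Bochner_Integration.integral_cong refl)
      fix s assume "s \<in> space (time_measure \<theta>)"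
      then have s: "s \<in> {0..\<theta>}" by (simp add: space_time_measure)
      have "(\<lambda>x. indicator A (s, x)) = (indicator {x. (s, x) \<in> A} :: T3 \<Rightarrow> real)"
        by (auto simp: indicator_def fun_eq_iff)
      then show "\<mu> s {x. (s, x) \<in> A} = sintegral UNIV (\<mu> s) (\<lambda>x. indicator A (s, x))"
        using sintegral_indicator[OF kernelD(1)[OF k' s]] slice_sets[OF A'(1)] by simp
    qed
    finally show ?thesis .
  qed
  show "vector_measure_on ?E (spacetime T \<mu>)" by (rule sintegral_eqI(1)[OF I eq])
  show "sintegral ?E (spacetime T \<mu>) f = ?I f" if "bounded_measurable ?E f" by (rule sintegral_eqI(2)[OF I eq that])
qed

lemma kernel_const:
  assumes "vector_measure_on UNIV \<nu>" "\<And>A. A \<in> sets borel \<Longrightarrow> \<bar>\<nu> A\<bar> \<le> K"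
  shows "measure_kernel T K (\<lambda>s. \<nu>)"
  using assms by (intro kernelI) auto

lemma kernel_Leb: "measure_kernel T 1 (\<lambda>s. measure Leb)"
  by (rule kernel_const[OF sintegral_Leb(1)]) (use finite_measure.bounded_measure[OF finite_measure_Leb] in simp)

lemma kernel_diff:
  assumes "measure_kernel T K \<mu>" "measure_kernel T L \<nu>" shows "measure_kernel T (K + L) (\<lambda>s A. \<mu> s A - \<nu> s A)"
proof (rule kernelI)
  show "vector_measure_on UNIV (\<lambda>A. \<mu> s A - \<nu> s A)" if "s \<in> {0..T}" for s
    by (rule sintegral_diff_measure(1)[OF kernelD(1)[OF assms(1) that] kernelD(1)[OF assms(2) that]])
  show "\<bar>\<mu> s A - \<nu> s A\<bar> \<le> K + L" if "s \<in> {0..T}" "A \<in> sets borel" for s A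
    using kernelD(2)[OF assms(1) that] kernelD(2)[OF assms(2) that] by linarith
qed (intro borel_measurable_diff kernelD(3)[OF assms(1)] kernelD(3)[OF assms(2)])

lemma kernel_smult:
  assumes k: "measure_kernel T K \<mu>" and g: "bounded_measurable ({0..T} \<times> UNIV) (\<lambda>(s, x). g s x)"
  shows "\<exists>L. measure_kernel T L (\<lambda>s A. sintegral A (\<mu> s) (g s))"
proof -
  obtain c where c: "c > 0" "\<forall>z\<in>{0..T} \<times> UNIV. \<bar>(\<lambda>(s, x). g s x) z\<bar> \<le> c" using bounded_measurableD[OF g] by blast
  have gs: "bounded_measurable UNIV (g s)" if "s \<in> {0..T}" for s using bounded_measurable_slice[OF g that] by simp
  have bA: "bounded_measurable ({0..T} \<times> UNIV) (\<lambda>z. indicator A (snd z))" if "A \<in> sets borel" for A :: "T3 set"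
  proof (rule bounded_measurableI[where K = 1])
    have "snd \<in> borel_measurable (borel :: (real \<times> T3) measure)"
      by (intro borel_measurable_continuous_onI continuous_intros)
    from measurable_compose[OF this borel_measurable_indicator[OF that]]
    show "(\<lambda>z. indicator A (snd z) :: real) \<in> borel_measurable (restrict_space borel ({0..T} \<times> UNIV))"
      by (intro measurable_restrict_space1) simp
  qed (simp add: indicator_def)
  have e: "sintegral A (\<mu> s) (g s) = sintegral UNIV (\<mu> s) (\<lambda>x. indicator A x * g s x)"
    if "s \<in> {0..T}" "A \<in> sets borel" for s A
    by (rule sintegral_subset[OF kernelD(1)[OF k that(1)] _ bounded_measurable_subset[OF gs[OF that(1)]]]) (use that in auto)
  have "measure_kernel T (2 * (K * c)) (\<lambda>s A. sintegral A (\<mu> s) (g s))"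
  proof (rule kernelI)
    show "vector_measure_on UNIV (\<lambda>A. sintegral A (\<mu> s) (g s))" if "s \<in> {0..T}" for s
      by (rule sintegral_smult(1)[OF kernelD(1)[OF k that] gs[OF that]])
    show "\<bar>sintegral A (\<mu> s) (g s)\<bar> \<le> 2 * (K * c)" if s: "s \<in> {0..T}" and A: "A \<in> sets borel" for s A
      unfolding e[OF s A]
    proof (rule abs_sintegral_le_bound[OF kernelD(1)[OF k s]])
      show "bounded_measurable UNIV (\<lambda>x. indicator A x * g s x)"
        using A gs[OF s] by (intro bounded_measurable_mult bounded_measurable_indicator) auto
      have "\<bar>g s x\<bar> \<le> c" for x using c s by auto
      then show "\<bar>indicator A x * g s x\<bar> \<le> c" for x using c(1) by (auto simp: indicator_def)
    qed (use c kernelD(2)[OF k s] in auto)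
    fix A :: "T3 set" assume A: "A \<in> sets borel"
    have "(\<lambda>s. sintegral UNIV (\<mu> s) (\<lambda>x. indicator A (snd (s, x)) * (\<lambda>(s, x). g s x) (s, x)))
        \<in> borel_measurable (restrict_space borel {0..T})"
      by (rule kernel_integral_measurable[OF k bounded_measurable_mult[OF bA[OF A] g]])
    then show "(\<lambda>s. sintegral A (\<mu> s) (g s)) \<in> borel_measurable (restrict_space borel {0..T})"
      using e[OF _ A] by (subst measurable_cong) (auto simp: space_restrict_space)
  qed
  then show ?thesis by blast
qed

text \<open>Indicators of open sets are limits of continuous functions, against which the integral is even
  continuous in time; a Dynkin argument covers the remaining Borel sets.\<close>

lemma kernel_weak_star:
  assumes vm: "\<And>s. s \<in> {0..T} \<Longrightarrow> vector_measure_on UNIV (\<mu> s)"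
    and cont: "\<And>\<phi>. continuous_on UNIV \<phi> \<Longrightarrow> continuous_on {0..T} (\<lambda>s. sintegral UNIV (\<mu> s) \<phi>)"
    and K: "\<And>s A. s \<in> {0..T} \<Longrightarrow> A \<in> sets borel \<Longrightarrow> \<bar>\<mu> s A\<bar> \<le> K"
  shows "measure_kernel T K \<mu>"
proof (rule kernelI[OF vm K])
  let ?M = "restrict_space borel {0..T}"
  fix A :: "T3 set" assume A: "A \<in> sets borel"
  have sb: "sigma_sets UNIV {S :: T3 set. open S} = sets borel" by (simp add: borel_def)
  have "Int_stable {S :: T3 set. open S}" "{S :: T3 set. open S} \<subseteq> Pow UNIV" by (auto simp: Int_stable_def)
  moreover have "A \<in> sigma_sets UNIV {S. open S}" using A sb by simp
  ultimately show "(\<lambda>s. \<mu> s A) \<in> borel_measurable ?M"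
  proof (induction rule: sigma_sets_induct_disjoint)
    case (basic U)
    then have U: "open U" by simp
    obtain g :: "nat \<Rightarrow> T3 \<Rightarrow> real" where g: "\<And>n. continuous_on UNIV (g n)" "\<And>n x. 0 \<le> g n x \<and> g n x \<le> 1"
      "\<And>x. (\<lambda>n. g n x) \<longlonglongrightarrow> indicator U x" using open_indicator_limit[OF U] by blast
    show ?case
    proof (rule borel_measurable_LIMSEQ_real)
      show "(\<lambda>s. sintegral UNIV (\<mu> s) (g n)) \<in> borel_measurable ?M" for n
        by (rule borel_measurable_continuous_on_restrict[OF cont[OF g(1)]])
      fix s assume "s \<in> space ?M"
      then have s: "s \<in> {0..T}" by (simp add: space_restrict_space)
      have "(\<lambda>n. sintegral UNIV (\<mu> s) (g n)) \<longlonglongrightarrow> sintegral UNIV (\<mu> s) (indicator U)"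
      proof (rule bounded_integral_lim[OF bounded_integral_sintegral[OF vm[OF s]], where K = 1])
        show "bounded_measurable UNIV (g n)" for n by (rule bounded_measurable_unit[OF g(1,2)])
        show "bounded_measurable UNIV (indicator U)" using U by (intro bounded_measurable_indicator) simp
        show "\<bar>g n x\<bar> \<le> 1" for n x using g(2)[of n x] by simp
      qed (rule g(3))
      then show "(\<lambda>n. sintegral UNIV (\<mu> s) (g n)) \<longlonglongrightarrow> \<mu> s U"
        using sintegral_indicator[OF vm[OF s], of U] U by simp
    qed
  next
    case empty
    then show ?case using vm_empty[OF vm] by (subst measurable_cong[where g = "\<lambda>s. 0"]) (auto simp: space_restrict_space)
  next
    case (compl A)
    have UN: "(\<lambda>s. \<mu> s UNIV) \<in> borel_measurable ?M"
    proof (subst measurable_cong)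
      show "\<mu> s UNIV = sintegral UNIV (\<mu> s) (\<lambda>x. 1)" if "s \<in> space ?M" for s
        using sintegral_indicator[OF vm[of s], of UNIV] that by (simp add: space_restrict_space)
      show "(\<lambda>s. sintegral UNIV (\<mu> s) (\<lambda>x. 1)) \<in> borel_measurable ?M"
        by (rule borel_measurable_continuous_on_restrict[OF cont]) auto
    qed
    have "\<mu> s (UNIV - A) = \<mu> s UNIV - \<mu> s A" if "s \<in> space ?M" for s
      using that compl(1) sb by (intro vm_Diff[OF vm]) (auto simp: space_restrict_space)
    then show ?case using borel_measurable_diff[OF UN compl(2)] by (subst measurable_cong) auto
  next
    case (union A)
    have "\<mu> s (\<Union>n. A n) = (\<Sum>n. \<mu> s (A n))" if "s \<in> space ?M" for s
      using vm_sums[OF vm _ union(1), of s] union(2) sb that by (simp add: space_restrict_space sums_iff)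
    then show ?case using borel_measurable_suminf[of "\<lambda>n s. \<mu> s (A n)", OF union(3)] by (subst measurable_cong) auto
  qed
qed

section \<open>Variation by duality\<close>

lemma variation_leI:
  assumes A: "A \<in> sets borel"
    and le: "\<And>\<P>. finite \<P> \<Longrightarrow> \<P> \<subseteq> bsets A \<Longrightarrow> disjoint \<P> \<Longrightarrow> (\<Sum>B\<in>\<P>. norm (\<nu> B)) \<le> K"
  shows "variation \<nu> A \<le> ereal K"
  unfolding variation_def
proof (rule SUP_least)
  fix \<P> assume "\<P> \<in> {\<P>. finite \<P> \<and> partition_on A \<P> \<and> \<P> \<subseteq> sets borel}"
  then have P: "finite \<P>" "\<Union>\<P> = A" "disjoint \<P>" "\<P> \<subseteq> sets borel" by (auto simp: partition_on_def)
  have "\<P> \<subseteq> bsets A"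
  proof
    fix B assume "B \<in> \<P>"
    then have "B \<in> sets borel" "B \<subseteq> A" using P(2,4) by auto
    then show "B \<in> bsets A" by (simp add: bsets_Int[OF A])
  qed
  then show "ereal (\<Sum>B\<in>\<P>. norm (\<nu> B)) \<le> ereal K" using le[OF P(1) _ P(3)] by simp
qed

lemma variation_le_dual:
  fixes W :: "'a::metric_space set \<Rightarrow> real ^ 'n"
  assumes "E \<in> sets borel" "vector_measure_on E W"
    and "\<And>f. continuous_on E f \<Longrightarrow> (\<And>x. norm (f x) \<le> 1) \<Longrightarrow> vintegral E W f \<le> K"
  shows "variation W E \<le> ereal K"
  using variation_sum_le[OF assms(2,3)] by (intro variation_leI[OF assms(1)]) auto

lemma variation_le_dual_scalar:
  fixes \<nu> :: "'a::metric_space set \<Rightarrow> real"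
  assumes E: "E \<in> sets borel" and \<nu>: "vector_measure_on E \<nu>"
    and le: "\<And>f. continuous_on E f \<Longrightarrow> (\<And>x. \<bar>f x\<bar> \<le> 1) \<Longrightarrow> sintegral E \<nu> f \<le> K"
  shows "variation \<nu> E \<le> ereal K"
proof (rule variation_leI[OF E])
  fix \<P> assume P: "finite \<P>" "\<P> \<subseteq> bsets E" "disjoint \<P>"
  define W :: "'a set \<Rightarrow> real ^ 1" where "W = (\<lambda>A. axis 1 (\<nu> A))"
  have "bounded_linear (\<lambda>a::real. axis (1::1) a)"
  proof (rule bounded_linear_intro[where K = 1])
    show "axis (1::1) (a + b) = axis 1 a + axis 1 b" for a b :: real by (simp add: vec_eq_iff axis_def)
    show "axis (1::1) (c *\<^sub>R a) = c *\<^sub>R axis 1 a" for c a :: real by (simp add: vec_eq_iff axis_def)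
    show "norm (axis (1::1) a) \<le> norm a * 1" for a :: real by (simp add: norm_real axis_def)
  qed
  from vm_bounded_linear[OF this \<nu>] have W: "vector_measure_on E W" by (simp add: W_def)
  have "(\<Sum>B\<in>\<P>. norm (W B)) \<le> K"
  proof (rule variation_sum_le[OF W _ P])
    fix f :: "'a \<Rightarrow> real ^ 1" assume f: "continuous_on E f" "\<And>x. norm (f x) \<le> 1"
    have "vintegral E W f = sintegral E \<nu> (\<lambda>x. f x $ 1)" by (simp add: vintegral_def W_def)
    also have "\<dots> \<le> K"
    proof (rule le)
      show "continuous_on E (\<lambda>x. f x $ 1)" by (intro continuous_intros f)
      show "\<bar>f x $ 1\<bar> \<le> 1" for x using component_le_norm_cart[of "f x" 1] f(2)[of x] by linarith
    qed
    finally show "vintegral E W f \<le> K" .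
  qed
  then show "(\<Sum>B\<in>\<P>. norm (\<nu> B)) \<le> K" by (simp add: W_def norm_real axis_def)
qed

subsection \<open>Vector integrals\<close>

definition vbounded_measurable :: "'a::topological_space set \<Rightarrow> ('a \<Rightarrow> real ^ 'n) \<Rightarrow> bool"
  where "vbounded_measurable E F \<longleftrightarrow> (\<forall>i. bounded_measurable E (\<lambda>x. F x $ i))"

lemma vbounded_measurableD: "vbounded_measurable E F \<Longrightarrow> bounded_measurable E (\<lambda>x. F x $ i)"
  by (simp add: vbounded_measurable_def)

lemma vbounded_measurable_continuous:
  assumes "compact E" "continuous_on E F" shows "vbounded_measurable E F"
  unfolding vbounded_measurable_def
  by (intro allI bounded_measurable_continuous[OF assms(1)] continuous_intros assms(2))

lemma vintegral_add:
  assumes "vector_measure_on E W" "vbounded_measurable E F" "vbounded_measurable E G"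
  shows "vintegral E W (\<lambda>x. F x + G x) = vintegral E W F + vintegral E W G"
  unfolding vintegral_def sum.distrib[symmetric]
  using bounded_integral_add[OF bounded_integral_sintegral[OF vm_nth[OF assms(1)]]
    vbounded_measurableD[OF assms(2)] vbounded_measurableD[OF assms(3)]] by simp

lemma vintegral_scale:
  assumes "vector_measure_on E W" "vbounded_measurable E F"
  shows "vintegral E W (\<lambda>x. c *\<^sub>R F x) = c * vintegral E W F"
  unfolding vintegral_def sum_distrib_left
  using bounded_integral_scale[OF bounded_integral_sintegral[OF vm_nth[OF assms(1)]]
    vbounded_measurableD[OF assms(2)]] by simp

lemma vintegral_zero [simp]: "vintegral E W (\<lambda>x. 0) = 0"
  by (simp add: vintegral_def sintegral_def)

lemma vintegral_diff_measure:
  fixes \<mu> \<nu> :: "'a::topological_space set \<Rightarrow> real ^ 'n"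
  assumes "vector_measure_on E \<mu>" "vector_measure_on E \<nu>"
  shows "vector_measure_on E (\<lambda>A. \<mu> A - \<nu> A)"
    and "vbounded_measurable E F \<Longrightarrow> vintegral E (\<lambda>A. \<mu> A - \<nu> A) F = vintegral E \<mu> F - vintegral E \<nu> F"
proof -
  show "vector_measure_on E (\<lambda>A. \<mu> A - \<nu> A)"
    unfolding vector_measure_on_def
  proof (intro allI impI, elim conjE)
    fix A :: "nat \<Rightarrow> 'a set" assume A: "range A \<subseteq> bsets E" "disjoint_family A"
    show "(\<lambda>n. \<mu> (A n) - \<nu> (A n)) sums (\<mu> (\<Union>n. A n) - \<nu> (\<Union>n. A n))"
      by (intro sums_diff vm_sums[OF assms(1) A] vm_sums[OF assms(2) A])
  qed
  show "vintegral E (\<lambda>A. \<mu> A - \<nu> A) F = vintegral E \<mu> F - vintegral E \<nu> F" if "vbounded_measurable E F"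
    unfolding vintegral_def sum_subtractf[symmetric]
    using sintegral_diff_measure(2)[OF vm_nth[OF assms(1)] vm_nth[OF assms(2)] vbounded_measurableD[OF that]]
    by simp
qed

lemma vector_measure_onI_nth:
  fixes W :: "'a::topological_space set \<Rightarrow> real ^ 'n"
  assumes "\<And>i. vector_measure_on E (\<lambda>A. W A $ i)"
  shows "vector_measure_on E W"
  unfolding vector_measure_on_def
proof (intro allI impI, elim conjE)
  fix A :: "nat \<Rightarrow> 'a set" assume A: "range A \<subseteq> bsets E" "disjoint_family A"
  have "(\<lambda>n. \<Sum>i<n. W (A i)) \<longlonglongrightarrow> W (\<Union>n. A n)"
  proof (rule vec_tendstoI)
    show "(\<lambda>n. (\<Sum>i<n. W (A i)) $ j) \<longlonglongrightarrow> W (\<Union>n. A n) $ j" for j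
      using vm_sums[OF assms A, of j] by (simp add: sums_def sum_component)
  qed
  then show "(\<lambda>n. W (A n)) sums W (\<Union>n. A n)" by (simp add: sums_def)
qed

lemma vmult_nth [simp]: "vmult F \<nu> A $ i = sintegral A \<nu> (\<lambda>x. F x $ i)" by (simp add: vmult_def)

lemma UNIV_i4: "(UNIV :: i4 set) = insert (Inl 1) (Inr ` UNIV)"
proof -
  have "x \<in> insert (Inl 1) (Inr ` UNIV)" for x :: i4 by (cases x) auto
  then show ?thesis by blast
qed

lemma UNIV_i10: "(UNIV :: i10 set) = insert (Inl 1) (Inr ` (Inl ` UNIV \<union> Inr ` (Inl ` UNIV \<union> Inr ` UNIV)))"
proof -
  have "x \<in> insert (Inl 1) (Inr ` (Inl ` UNIV \<union> Inr ` (Inl ` UNIV \<union> Inr ` UNIV)))" for x :: i10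
  proof (cases x)
    case (Inr y)
    then show ?thesis
    proof (cases y)
      case (Inr z) with \<open>x = Inr y\<close> show ?thesis by (cases z) auto
    qed auto
  qed auto
  then show ?thesis by blast
qed

lemma sum_i4: "(\<Sum>i\<in>(UNIV :: i4 set). f i) = f (Inl 1) + (\<Sum>k\<in>UNIV. f (Inr k))" for f :: "i4 \<Rightarrow> real"
  unfolding UNIV_i4 by (subst sum.insert) (auto simp: sum.reindex)

lemma sum_i10:
  "(\<Sum>i\<in>(UNIV :: i10 set). f i) = f (Inl 1) + (\<Sum>k\<in>UNIV. f (Inr (Inl k)))
    + (\<Sum>k\<in>UNIV. f (Inr (Inr (Inl k)))) + (\<Sum>k\<in>UNIV. f (Inr (Inr (Inr k))))" for f :: "i10 \<Rightarrow> real"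
proof -
  have "sum f UNIV = f (Inl 1) + sum f (Inr ` (Inl ` UNIV \<union> Inr ` (Inl ` UNIV \<union> Inr ` UNIV)))"
    unfolding UNIV_i10 by (subst sum.insert) auto
  also have "sum f (Inr ` (Inl ` UNIV \<union> Inr ` (Inl ` UNIV \<union> Inr ` UNIV)))
      = sum (\<lambda>y. f (Inr y)) (Inl ` UNIV \<union> Inr ` (Inl ` UNIV \<union> Inr ` UNIV))"
    by (subst sum.reindex) auto
  also have "\<dots> = sum (\<lambda>y. f (Inr y)) (Inl ` UNIV) + sum (\<lambda>y. f (Inr y)) (Inr ` (Inl ` UNIV \<union> Inr ` UNIV))"
    by (rule sum.union_disjoint) auto
  also have "sum (\<lambda>y. f (Inr y)) (Inl ` UNIV) = (\<Sum>k\<in>UNIV. f (Inr (Inl k)))" by (subst sum.reindex) auto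
  also have "sum (\<lambda>y. f (Inr y)) (Inr ` (Inl ` UNIV \<union> Inr ` UNIV))
      = sum (\<lambda>y. f (Inr (Inr y))) (Inl ` UNIV \<union> Inr ` UNIV)" by (subst sum.reindex) auto
  also have "\<dots> = sum (\<lambda>y. f (Inr (Inr y))) (Inl ` UNIV) + sum (\<lambda>y. f (Inr (Inr y))) (Inr ` UNIV)"
    by (rule sum.union_disjoint) auto
  also have "sum (\<lambda>y. f (Inr (Inr y))) (Inl ` UNIV) = (\<Sum>k\<in>UNIV. f (Inr (Inr (Inl k))))" by (subst sum.reindex) auto
  also have "sum (\<lambda>y. f (Inr (Inr y))) (Inr ` UNIV) = (\<Sum>k\<in>UNIV. f (Inr (Inr (Inr k))))" by (subst sum.reindex) auto
  finally show ?thesis by (simp add: add.assoc)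
qed

lemma blk4_nth [simp]: "blk4 a u $ Inl k = a" "blk4 a u $ Inr l = u $ l" by (simp_all add: blk4_def)

lemma blk10_nth [simp]: "blk10 w u v $ Inl k = w $ Inl k" "blk10 w u v $ Inr (Inl l) = w $ Inr l"
  "blk10 w u v $ Inr (Inr (Inl l)) = u $ l" "blk10 w u v $ Inr (Inr (Inr l)) = v $ l"
  by (simp_all add: blk10_def)

lemma norm_sum_squares: "(norm (x :: real ^ 'n))\<^sup>2 = (\<Sum>i\<in>UNIV. (x $ i)\<^sup>2)"
  by (simp add: norm_vec_def L2_set_def sum_nonneg)

lemma norm_blk4: "(norm (blk4 a u))\<^sup>2 = a\<^sup>2 + (norm u)\<^sup>2"
  by (simp add: norm_sum_squares sum_i4)

lemma norm_blk10: "(norm (blk10 w u v))\<^sup>2 = (norm w)\<^sup>2 + (norm u)\<^sup>2 + (norm v)\<^sup>2"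
  by (simp add: norm_sum_squares sum_i4 sum_i10)

lemma norm_blk4_le: "norm (blk4 a u) \<le> \<bar>a\<bar> + norm u"
proof -
  have "(norm (blk4 a u))\<^sup>2 \<le> (\<bar>a\<bar> + norm u)\<^sup>2" by (simp add: norm_blk4 power2_sum)
  then show ?thesis by (rule power2_le_imp_le) simp
qed

lemma norm_blk10_le: "norm (blk10 w u v) \<le> norm w + norm u + norm v"
proof -
  have "(norm (blk10 w u v))\<^sup>2 \<le> (norm w + norm u + norm v)\<^sup>2"
    unfolding norm_blk10 by (simp add: power2_eq_square algebra_simps)
  then show ?thesis by (rule power2_le_imp_le) simp
qed

lemma continuous_on_vecI:
  fixes f :: "'a::topological_space \<Rightarrow> real ^ 'n"
  assumes "\<And>i. continuous_on S (\<lambda>x. f x $ i)" shows "continuous_on S f"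
proof -
  have "continuous_on S (\<lambda>x. \<chi> i. f x $ i)" by (intro continuous_on_vec_lambda assms)
  then show ?thesis by simp
qed

lemma continuous_on_blk4 [continuous_intros]:
  assumes "continuous_on S a" "continuous_on S u" shows "continuous_on S (\<lambda>x. blk4 (a x) (u x))"
proof (rule continuous_on_vecI)
  fix i :: i4 show "continuous_on S (\<lambda>x. blk4 (a x) (u x) $ i)"
    by (cases i) (auto intro!: continuous_intros assms)
qed

lemma continuous_on_blk10 [continuous_intros]:
  assumes "continuous_on S w" "continuous_on S u" "continuous_on S v"
  shows "continuous_on S (\<lambda>x. blk10 (w x) (u x) (v x))"
proof (rule continuous_on_vecI)
  fix i :: i10 have "i \<in> insert (Inl 1) (Inr ` (Inl ` UNIV \<union> Inr ` (Inl ` UNIV \<union> Inr ` UNIV)))"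
    using UNIV_i10 by blast
  then show "continuous_on S (\<lambda>x. blk10 (w x) (u x) (v x) $ i)"
    by (elim insertE imageE UnE) (simp_all add: assms continuous_on_component)
qed

subsection \<open>Uniqueness of the rescaled measure\<close>

text \<open>Rescaling is prescribed by test functions. Two solutions have the same integrals of continuous
  functions, so their difference has vanishing variation by duality; the push-forward under
  \<open>s \<mapsto> \<surd>(2 s)\<close> is one of them.\<close>

lemma rescaled_unique:
  assumes t0: "0 \<le> t0" and M: "vector_measure_on ({0..t0\<^sup>2 / 2} \<times> UNIV) M"
    and N: "is_rescaled t0 M N" and A: "A \<in> bsets ({0..t0} \<times> UNIV)"
  shows "N A = M ((\<lambda>(s, x). (sqrt (2 * s), x)) -` A \<inter> {0..t0\<^sup>2 / 2} \<times> UNIV)"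
proof -
  let ?E = "{0..t0} \<times> (UNIV :: T3 set)"
  define R where "R A = M ((\<lambda>(s, x). (sqrt (2 * s), x)) -` A \<inter> {0..t0\<^sup>2 / 2} \<times> UNIV)" for A
  have R: "is_rescaled t0 M R" unfolding R_def by (rule is_rescaled_image[OF t0 M])
  have vm: "vector_measure_on ?E N" "vector_measure_on ?E R" using N R by (auto simp: is_rescaled_def)
  have "(\<Sum>B\<in>{A}. norm (N B - R B)) \<le> 0"
  proof (rule variation_sum_le[OF vintegral_diff_measure(1)[OF vm]])
    fix f :: "real \<times> T3 \<Rightarrow> real ^ 3" assume f: "continuous_on ?E f"
    have "vintegral ?E N f = vintegral ?E R f" using N R f by (simp add: is_rescaled_def)
    then show "vintegral ?E (\<lambda>A. N A - R A) f \<le> 0"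
      using vintegral_diff_measure(2)[OF vm vbounded_measurable_continuous[OF compact_slab f]] by simp
  qed (use A in auto)
  then show ?thesis by (simp add: R_def)
qed

section \<open>Square roots of positive semidefinite matrices\<close>

lemma symmetric_matrix_inner:
  fixes A :: "real ^ 'n ^ 'n"
  shows "transpose A = A \<longleftrightarrow> (\<forall>x y. x \<bullet> (A *v y) = (A *v x) \<bullet> y)"
proof
  assume A: "transpose A = A"
  have "x \<bullet> (A *v y) = (A *v x) \<bullet> y" for x y
    using dot_lmul_matrix[of x A y] A by (metis vector_transpose_matrix)
  then show "\<forall>x y. x \<bullet> (A *v y) = (A *v x) \<bullet> y" by blast
next
  assume *: "\<forall>x y. x \<bullet> (A *v y) = (A *v x) \<bullet> y"
  have e: "axis i 1 \<bullet> (A *v axis j 1) = A $ i $ j" for i j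
    by (simp add: matrix_vector_mult_basis column_def inner_axis')
  have "A $ j $ i = A $ i $ j" for i j
    using *[rule_format, of "axis i 1" "axis j 1"] e[of i j] e[of j i] by (simp add: inner_commute)
  then show "transpose A = A" by (simp add: transpose_def vec_eq_iff)
qed

text \<open>A maximiser of the Rayleigh quotient on the unit sphere of an invariant subspace is an
  eigenvector: the residual \<open>y = f x - \<lambda> x\<close> is a direction in which the quotient would increase.\<close>

lemma selfadjoint_eigenvector:
  fixes f :: "'a::euclidean_space \<Rightarrow> 'a"
  assumes f: "linear f" "\<And>x y. x \<bullet> f y = f x \<bullet> y" and S: "subspace S" "f ` S \<subseteq> S" "S \<noteq> {0}"
  shows "\<exists>x\<in>S. norm x = 1 \<and> (\<exists>l. f x = l *\<^sub>R x)"
proof -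
  have K: "compact (S \<inter> sphere 0 1)" by (intro closed_Int_compact closed_subspace S) auto
  obtain z where z: "z \<in> S" "z \<noteq> 0" using S(3) subspace_0[OF S(1)] by blast
  have "(1 / norm z) *\<^sub>R z \<in> S \<inter> sphere 0 1" using z S(1) by (simp add: subspace_scale)
  then have ne: "S \<inter> sphere 0 1 \<noteq> {}" by blast
  have "continuous_on (S \<inter> sphere 0 1) (\<lambda>x. x \<bullet> f x)"
    by (intro continuous_intros linear_continuous_on linear_conv_bounded_linear[THEN iffD1] f)
  then obtain x where x: "x \<in> S" "norm x = 1" and max: "\<And>y. y \<in> S \<Longrightarrow> norm y = 1 \<Longrightarrow> y \<bullet> f y \<le> x \<bullet> f x"
    using continuous_attains_sup[OF K ne, of "\<lambda>x. x \<bullet> f x"] by force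
  define l where "l = x \<bullet> f x"
  have hom: "y \<bullet> f y \<le> l * (y \<bullet> y)" if y: "y \<in> S" for y
  proof (cases "y = 0")
    case False
    let ?u = "(1 / norm y) *\<^sub>R y"
    have "?u \<bullet> f ?u \<le> l" unfolding l_def using y False S(1) by (intro max) (auto simp: subspace_scale)
    moreover have "?u \<bullet> f ?u = (y \<bullet> f y) / (norm y)\<^sup>2"
      by (simp add: linear_scale[OF f(1)] power2_eq_square)
    ultimately have "(y \<bullet> f y) / (norm y)\<^sup>2 \<le> l" by (simp only:)
    then show ?thesis using False by (simp add: divide_le_eq flip: power2_norm_eq_inner)
  qed (simp add: linear_0[OF f(1)])
  define y where "y = f x - l *\<^sub>R x"
  have yS: "y \<in> S" unfolding y_def using x S by (intro subspace_diff subspace_scale) auto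
  define c where "c = l * (y \<bullet> y) - y \<bullet> f y"
  have c: "c \<ge> 0" using hom[OF yS] by (simp add: c_def)
  have xx: "x \<bullet> x = 1" using x(2) by (simp add: norm_eq_1)
  have "2 * t * (y \<bullet> y) \<le> t\<^sup>2 * c" for t
  proof -
    have "x + t *\<^sub>R y \<in> S" using x yS S(1) by (intro subspace_add subspace_scale) auto
    from hom[OF this] have
      "x \<bullet> f x + 2 * t * (y \<bullet> f x) + t\<^sup>2 * (y \<bullet> f y) \<le> l * (x \<bullet> x + 2 * t * (y \<bullet> x) + t\<^sup>2 * (y \<bullet> y))"
      using f(2)[of x y]
      by (simp add: linear_add[OF f(1)] linear_scale[OF f(1)] inner_add_left inner_add_right
        power2_eq_square inner_commute algebra_simps)
    moreover have "y \<bullet> f x - l * (y \<bullet> x) = y \<bullet> y" by (simp add: y_def inner_diff_right)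
    then have "y \<bullet> f x = y \<bullet> y + l * (y \<bullet> x)" by simp
    ultimately show ?thesis unfolding c_def xx l_def[symmetric] by (simp add: algebra_simps)
  qed
  have "y \<bullet> y \<le> 0"
  proof (rule ccontr)
    assume "\<not> y \<bullet> y \<le> 0"
    then have p: "y \<bullet> y > 0" by (simp only: not_le)
    define t where "t = (y \<bullet> y) / (c + 1)"
    have t: "t > 0" using p c by (simp add: t_def)
    have "2 * t * (y \<bullet> y) \<le> t\<^sup>2 * c" by fact
    then have "2 * (y \<bullet> y) \<le> t * c" using t by (simp add: power2_eq_square mult.assoc mult.left_commute)
    also have "\<dots> \<le> t * (c + 1)" using t by simp
    also have "\<dots> = y \<bullet> y" using c by (simp add: t_def)
    finally show False using p by simp
  qed
  then have "y = 0" by (metis inner_eq_zero_iff inner_ge_zero antisym)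
  then have "f x = l *\<^sub>R x" by (simp add: y_def)
  with x show ?thesis by blast
qed

lemma selfadjoint_eigenbasis:
  fixes f :: "'a::euclidean_space \<Rightarrow> 'a"
  assumes f: "linear f" "\<And>x y. x \<bullet> f y = f x \<bullet> y" and S: "subspace S" "f ` S \<subseteq> S"
  shows "\<exists>B. finite B \<and> B \<subseteq> S \<and> S \<subseteq> span B \<and> pairwise orthogonal B
    \<and> (\<forall>b\<in>B. norm b = 1 \<and> (\<exists>l. f b = l *\<^sub>R b))"
  using S
proof (induction "dim S" arbitrary: S rule: less_induct)
  case less
  show ?case
  proof (cases "S = {0}")
    case True then show ?thesis by (intro exI[of _ "{}"]) auto
  next
    case False
    then obtain x l where x: "x \<in> S" "norm x = 1" "f x = l *\<^sub>R x"
      using selfadjoint_eigenvector[OF f less.prems False] by blast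
    define S' where "S' = {y \<in> S. x \<bullet> y = 0}"
    have S': "subspace S'" using less.prems(1) unfolding S'_def subspace_def by (auto simp: inner_add_right)
    have "x \<notin> S'" using x(2) by (auto simp: S'_def norm_eq_1)
    moreover have "S' \<subseteq> S" by (auto simp: S'_def)
    ultimately have "S' \<subset> S" using x(1) by blast
    then have d: "dim S' < dim S"
      using S' less.prems(1) by (intro dim_psubset) (simp add: span_eq_iff[THEN iffD2])
    have "x \<bullet> f y = 0" if "x \<bullet> y = 0" for y using f(2)[of x y] x(3) that by simp
    then have inv: "f ` S' \<subseteq> S'" using less.prems(2) by (auto simp: S'_def)
    obtain B where B: "finite B" "B \<subseteq> S'" "S' \<subseteq> span B" "pairwise orthogonal B"
      "\<forall>b\<in>B. norm b = 1 \<and> (\<exists>l. f b = l *\<^sub>R b)"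
      using less.hyps[OF d S' inv] by blast
    have "S \<subseteq> span (insert x B)"
    proof
      fix y assume y: "y \<in> S"
      have xx: "x \<bullet> x = 1" using x(2) by (simp add: norm_eq_1)
      have "y - (x \<bullet> y) *\<^sub>R x \<in> S'"
        using y x(1) less.prems(1) xx by (auto simp: S'_def subspace_diff subspace_scale inner_diff_right)
      then have "y - (x \<bullet> y) *\<^sub>R x \<in> span (insert x B)" using B(3) span_mono[of B "insert x B"] by blast
      moreover have "(x \<bullet> y) *\<^sub>R x \<in> span (insert x B)" by (intro span_scale span_base) auto
      ultimately have "(y - (x \<bullet> y) *\<^sub>R x) + (x \<bullet> y) *\<^sub>R x \<in> span (insert x B)" by (rule span_add)
      then show "y \<in> span (insert x B)" by simp
    qed
    moreover have "pairwise orthogonal (insert x B)"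
      using B(2,4) by (auto simp: pairwise_insert S'_def orthogonal_def inner_commute)
    ultimately show ?thesis using B x
      by (intro exI[of _ "insert x B"]) (auto simp: S'_def)
  qed
qed

definition is_psd_root :: "real ^ 'n ^ 'n \<Rightarrow> real ^ 'n ^ 'n \<Rightarrow> bool"
  where "is_psd_root M S \<longleftrightarrow> transpose S = S \<and> (\<forall>\<xi>. 0 \<le> \<xi> \<bullet> (S *v \<xi>)) \<and> S ** S = M"

theorem psd_root_unique_existence:
  fixes M :: "real ^ 'n ^ 'n"
  assumes sym: "transpose M = M" and psd: "\<And>\<xi>. 0 \<le> \<xi> \<bullet> (M *v \<xi>)"
  shows "\<exists>!S. is_psd_root M S"
proof -
  have adj: "x \<bullet> (M *v y) = (M *v x) \<bullet> y" for x y using sym symmetric_matrix_inner by blast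
  obtain B where B: "finite B" "UNIV \<subseteq> span B" "pairwise orthogonal B"
    "\<forall>b\<in>B. norm b = 1 \<and> (\<exists>l. M *v b = l *\<^sub>R b)"
    using selfadjoint_eigenbasis[of "(*v) M" UNIV] adj by (auto simp: matrix_vector_mul_linear)
  define l where "l b = b \<bullet> (M *v b)" for b
  have l: "M *v b = l b *\<^sub>R b" "l b \<ge> 0" "b \<bullet> b = 1" if "b \<in> B" for b
  proof -
    show "b \<bullet> b = 1" using B(4) that by (simp add: norm_eq_1)
    then show "M *v b = l b *\<^sub>R b" using B(4) that by (force simp: l_def)
    show "l b \<ge> 0" using psd by (simp add: l_def)
  qed
  have eqI: "u = w" if "\<And>b. b \<in> B \<Longrightarrow> b \<bullet> u = b \<bullet> w" for u w :: "real ^ 'n"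
  proof -
    have "orthogonal (u - w) b" if "b \<in> B" for b
      using \<open>\<And>b. b \<in> B \<Longrightarrow> b \<bullet> u = b \<bullet> w\<close>[OF that] by (simp add: orthogonal_def inner_diff_right inner_commute[of "u - w"])
    moreover have "u - w \<in> span B" using B(2) by blast
    ultimately have "orthogonal (u - w) (u - w)" using orthogonal_to_span by blast
    then show ?thesis by (simp add: orthogonal_def)
  qed
  define R :: "real ^ 'n ^ 'n" where "R = matrix (\<lambda>x. \<Sum>b\<in>B. (sqrt (l b) * (b \<bullet> x)) *\<^sub>R b)"
  have lin: "linear (\<lambda>x. \<Sum>b\<in>B. (sqrt (l b) * (b \<bullet> x)) *\<^sub>R b)"
    by (intro linear_compose_sum ballI linearI) (auto simp: inner_add_right algebra_simps)
  have R: "R *v x = (\<Sum>b\<in>B. (sqrt (l b) * (b \<bullet> x)) *\<^sub>R b)" for x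
    unfolding R_def by (rule matrix_works) (simp add: linear_matrix_vector_mul_eq lin)
  have Rs: "x \<bullet> (R *v y) = (R *v x) \<bullet> y" for x y
    unfolding R inner_sum_left inner_sum_right by (intro sum.cong) (auto simp: inner_commute)
  have Rb: "R *v b = sqrt (l b) *\<^sub>R b" if b: "b \<in> B" for b
  proof -
    have "(\<Sum>c\<in>B. (sqrt (l c) * (c \<bullet> b)) *\<^sub>R c) = (\<Sum>c\<in>B. if c = b then sqrt (l b) *\<^sub>R b else 0)"
      using B(3) b l(3)[OF b] by (intro sum.cong) (auto simp: pairwise_def orthogonal_def)
    then show ?thesis using b B(1) by (simp add: R)
  qed
  have "is_psd_root M R"
    unfolding is_psd_root_def
  proof (intro conjI allI)
    show "transpose R = R" using Rs symmetric_matrix_inner by blast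
    show "0 \<le> \<xi> \<bullet> (R *v \<xi>)" for \<xi>
      unfolding R inner_sum_right using l(2)
      by (intro sum_nonneg) (simp add: inner_commute[of \<xi>] mult.assoc)
    show "R ** R = M"
      unfolding matrix_eq
    proof (intro allI eqI)
      fix x b assume b: "b \<in> B"
      have "b \<bullet> ((R ** R) *v x) = (R *v (R *v b)) \<bullet> x"
        by (simp add: matrix_vector_mul_assoc[symmetric] Rs)
      also have "\<dots> = l b * (b \<bullet> x)" using Rb[OF b] l(2)[OF b] by (simp add: matrix_vector_mult_scaleR)
      also have "\<dots> = b \<bullet> (M *v x)" using adj[of b x] l(1)[OF b] by simp
      finally show "b \<bullet> ((R ** R) *v x) = b \<bullet> (M *v x)" .
    qed
  qed
  moreover have "S = R" if S: "is_psd_root M S" for S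
  proof -
    have Ss: "x \<bullet> (S *v y) = (S *v x) \<bullet> y" for x y
      using S symmetric_matrix_inner unfolding is_psd_root_def by blast
    have Sp: "0 \<le> x \<bullet> (S *v x)" for x using S unfolding is_psd_root_def by blast
    have SS: "S *v (S *v x) = M *v x" for x
      using S unfolding is_psd_root_def by (metis matrix_vector_mul_assoc)
    have Sb: "S *v b = sqrt (l b) *\<^sub>R b" if b: "b \<in> B" for b
    proof (cases "l b = 0")
      case True
      have "(S *v b) \<bullet> (S *v b) = b \<bullet> (M *v b)" using Ss[of b "S *v b"] SS[of b] by simp
      then show ?thesis using l(1)[OF b] True by simp
    next
      case False
      define y where "y = S *v b - sqrt (l b) *\<^sub>R b"
      have "S *v y + sqrt (l b) *\<^sub>R y = 0"
        using l(1,2)[OF b] SS[of b]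
        by (simp add: y_def matrix_vector_mult_diff_distrib matrix_vector_mult_scaleR scaleR_diff_right)
      then have "y \<bullet> (S *v y) + sqrt (l b) * (y \<bullet> y) = 0" by (metis inner_add_right inner_scaleR_right inner_zero_right)
      moreover have "0 \<le> sqrt (l b) * (y \<bullet> y)" using l(2)[OF b] by simp
      ultimately have "sqrt (l b) * (y \<bullet> y) = 0" using Sp[of y] by linarith
      then have "y = 0" using False by simp
      then show ?thesis by (simp add: y_def)
    qed
    show "S = R" unfolding matrix_eq
    proof (intro allI eqI)
      fix x b assume b: "b \<in> B"
      show "b \<bullet> (S *v x) = b \<bullet> (R *v x)" unfolding Ss[of b x] Rs[of b x] Sb[OF b] Rb[OF b] ..
    qed
  qed
  ultimately show ?thesis by blast
qed

lemma msqrt_psd: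
  assumes "transpose M = M" and "\<And>\<xi>. 0 \<le> \<xi> \<bullet> (M *v \<xi>)"
  shows "transpose (msqrt M) = msqrt M" and "msqrt M ** msqrt M = M"
proof -
  have "is_psd_root M (msqrt M)"
    using theI'[OF psd_root_unique_existence[OF assms]] unfolding msqrt_def is_psd_root_def .
  then show "transpose (msqrt M) = msqrt M" and "msqrt M ** msqrt M = M" by (auto simp: is_psd_root_def)
qed

lemma norm_msqrt_inverse_le:
  fixes M :: "real ^ 'n ^ 'n"
  assumes sym: "transpose M = M" and c: "c > 0" and coer: "\<And>\<xi>. c * (\<xi> \<bullet> \<xi>) \<le> \<xi> \<bullet> (M *v \<xi>)"
  shows "(norm (msqrt (matrix_inv M) *v A))\<^sup>2 \<le> (norm A)\<^sup>2 / c"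
proof -
  have "x = 0" if "M *v x = 0" for x
  proof -
    have "c * (x \<bullet> x) \<le> 0" using coer[of x] that by simp
    then have "x \<bullet> x \<le> 0" using c inner_ge_zero[of x] by (simp only: mult_le_0_iff) linarith
    then show ?thesis by (metis inner_eq_zero_iff inner_ge_zero antisym)
  qed
  then have inv: "invertible M" using matrix_left_invertible_ker invertible_left_inverse by blast
  define N where "N = matrix_inv M"
  have MN: "M *v (N *v x) = x" for x
  proof -
    have "M ** N = mat 1"
      using someI_ex[OF inv[unfolded invertible_def]] unfolding N_def matrix_inv_def by blast
    then show ?thesis by (simp add: matrix_vector_mul_assoc)
  qed
  have adj: "x \<bullet> (M *v y) = (M *v x) \<bullet> y" for x y using sym symmetric_matrix_inner by blast
  have "x \<bullet> (N *v y) = (N *v x) \<bullet> y" for x y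
    using adj[of "N *v x" "N *v y"] by (simp add: MN)
  then have symN: "transpose N = N" using symmetric_matrix_inner by blast
  have NN: "c * ((N *v x) \<bullet> (N *v x)) \<le> x \<bullet> (N *v x)" for x
    using coer[of "N *v x"] by (simp add: MN inner_commute)
  have psdN: "0 \<le> x \<bullet> (N *v x)" for x
    using NN[of x] c by (meson inner_ge_zero mult_nonneg_nonneg less_imp_le order_trans)
  have S: "transpose (msqrt N) = msqrt N" "msqrt N ** msqrt N = N" using msqrt_psd[OF symN psdN] by auto
  have "(norm (msqrt N *v A))\<^sup>2 = A \<bullet> (N *v A)"
  proof -
    have "(msqrt N *v A) \<bullet> (msqrt N *v A) = A \<bullet> (msqrt N *v (msqrt N *v A))"
      using S(1) symmetric_matrix_inner by metis
    then show ?thesis by (simp add: power2_norm_eq_inner matrix_vector_mul_assoc S(2))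
  qed
  also have "\<dots> \<le> (norm A)\<^sup>2 / c"
  proof -
    define n where "n = norm (N *v A)"
    have "c * n\<^sup>2 \<le> A \<bullet> (N *v A)" using NN[of A] by (simp add: n_def power2_norm_eq_inner)
    moreover have le: "A \<bullet> (N *v A) \<le> norm A * n" unfolding n_def by (rule norm_cauchy_schwarz)
    ultimately have "c * n * n \<le> norm A * n" by (simp add: power2_eq_square mult.assoc)
    then have "c * n \<le> norm A" if "n > 0" using that by simp
    then have "n \<le> norm A / c" using c by (cases "n > 0") (auto simp: n_def field_simps)
    then have "norm A * n \<le> norm A * (norm A / c)" by (intro mult_left_mono) auto
    then show ?thesis using le by (simp add: power2_eq_square)
  qed
  finally show ?thesis unfolding N_def .
qed

section \<open>Calculus on the torus\<close>

definition partially_differentiable :: "(T3 \<Rightarrow> 'b::real_normed_vector) \<Rightarrow> bool"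
  where "partially_differentiable f \<longleftrightarrow>
    (\<forall>i x. (\<lambda>s. f (x + to_T3 (s *\<^sub>R axis i 1))) differentiable (at 0))"

abbreviation line :: "T3 \<Rightarrow> 3 \<Rightarrow> real \<Rightarrow> T3"
  where "line x i s \<equiv> x + to_T3 (s *\<^sub>R axis i 1)"

lemma to_T3_zero [simp]: "to_T3 0 = 0"
  by (simp add: to_T3_def vec_eq_iff zero_torus.abs_eq)

lemma line_add: "line x i (s + t) = line (line x i s) i t"
  by (simp add: scaleR_left_distrib to_T3_add add.assoc)

lemma continuous_on_line: "continuous_on UNIV (\<lambda>s. line x i s)"
proof -
  obtain y where y: "x = to_T3 y" using surj_to_T3 by (metis surjD)
  have "continuous_on UNIV (\<lambda>s::real. to_T3 (y + s *\<^sub>R axis i 1))"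
    by (intro continuous_on_compose2[OF cont_to_T3] continuous_intros) auto
  then show ?thesis by (simp add: y to_T3_add)
qed

lemma pd_has_derivative:
  "partially_differentiable f \<Longrightarrow> ((\<lambda>s. f (line x i s)) has_vector_derivative pd i f x) (at 0)"
  unfolding partially_differentiable_def pd_def vector_derivative_works[symmetric] by blast

lemma pdI: "((\<lambda>s. f (line x i s)) has_vector_derivative d) (at 0) \<Longrightarrow> pd i f x = d"
  unfolding pd_def by (rule vector_derivative_at)

lemma partially_differentiableI:
  "(\<And>x i. ((\<lambda>s. f (line x i s)) has_vector_derivative d i x) (at 0)) \<Longrightarrow> partially_differentiable f"
  unfolding partially_differentiable_def by (blast intro: differentiableI_vector)

lemma pd_along_line:
  assumes "partially_differentiable f"
  shows "((\<lambda>s. f (line x i s)) has_vector_derivative pd i f (line x i s0)) (at s0)"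
proof -
  have "((\<lambda>s. f (line (line x i s0) i s)) has_vector_derivative pd i f (line x i s0)) (at (s0 - s0))"
    using pd_has_derivative[OF assms] by simp
  moreover have "((\<lambda>s. s - s0) has_vector_derivative 1) (at s0)" by (auto intro!: derivative_eq_intros)
  ultimately have "((\<lambda>s. f (line (line x i s0) i s)) \<circ> (\<lambda>s. s - s0) has_vector_derivative
      1 *\<^sub>R pd i f (line x i s0)) (at s0)" by (intro vector_diff_chain_at)
  moreover have "line (line x i s0) i (s - s0) = line x i s" for s
    using line_add[of x s0 "s - s0" i] by simp
  ultimately show ?thesis by (simp add: o_def)
qed

lemma pd_bounded_linear:
  assumes L: "bounded_linear L" and f: "partially_differentiable f"
  shows "partially_differentiable (\<lambda>x. L (f x))" and "pd i (\<lambda>x. L (f x)) x = L (pd i f x)"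
proof -
  have *: "((\<lambda>s. L (f (line x i s))) has_vector_derivative L (pd i f x)) (at 0)" for x i
    by (rule bounded_linear.has_vector_derivative[OF L pd_has_derivative[OF f]])
  show "partially_differentiable (\<lambda>x. L (f x))" by (rule partially_differentiableI[OF *])
  show "pd i (\<lambda>x. L (f x)) x = L (pd i f x)" by (rule pdI[OF *])
qed

lemma pd_const: "partially_differentiable (\<lambda>x. c)" "pd i (\<lambda>x. c) x = 0"
proof -
  have *: "((\<lambda>s. c) has_vector_derivative 0) (at 0)" by simp
  show "partially_differentiable (\<lambda>x. c)" by (rule partially_differentiableI[OF *])
  show "pd i (\<lambda>x. c) x = 0" by (rule pdI[OF *])
qed

lemma pd_add:
  assumes "partially_differentiable f" "partially_differentiable g"
  shows "partially_differentiable (\<lambda>x. f x + g x)" and "pd i (\<lambda>x. f x + g x) x = pd i f x + pd i g x"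
proof -
  have *: "((\<lambda>s. f (line x i s) + g (line x i s)) has_vector_derivative pd i f x + pd i g x) (at 0)" for x i
    by (intro has_vector_derivative_add pd_has_derivative assms)
  show "partially_differentiable (\<lambda>x. f x + g x)" by (rule partially_differentiableI[OF *])
  show "pd i (\<lambda>x. f x + g x) x = pd i f x + pd i g x" by (rule pdI[OF *])
qed

lemma pd_diff:
  assumes "partially_differentiable f" "partially_differentiable g"
  shows "partially_differentiable (\<lambda>x. f x - g x)" and "pd i (\<lambda>x. f x - g x) x = pd i f x - pd i g x"
proof -
  have *: "((\<lambda>s. f (line x i s) - g (line x i s)) has_vector_derivative pd i f x - pd i g x) (at 0)" for x i
    by (intro has_vector_derivative_diff pd_has_derivative assms)
  show "partially_differentiable (\<lambda>x. f x - g x)" by (rule partially_differentiableI[OF *])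
  show "pd i (\<lambda>x. f x - g x) x = pd i f x - pd i g x" by (rule pdI[OF *])
qed

lemma pd_mult:
  fixes f g :: "T3 \<Rightarrow> real"
  assumes "partially_differentiable f" "partially_differentiable g"
  shows "partially_differentiable (\<lambda>x. f x * g x)" and "pd i (\<lambda>x. f x * g x) x = f x * pd i g x + pd i f x * g x"
proof -
  have *: "((\<lambda>s. f (line x i s) * g (line x i s)) has_vector_derivative f x * pd i g x + pd i f x * g x) (at 0)" for x i
    using has_vector_derivative_mult[OF pd_has_derivative[OF assms(1)] pd_has_derivative[OF assms(2)], of x i x i]
    by simp
  show "partially_differentiable (\<lambda>x. f x * g x)" by (rule partially_differentiableI[OF *])
  show "pd i (\<lambda>x. f x * g x) x = f x * pd i g x + pd i f x * g x" by (rule pdI[OF *])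
qed

lemma pd_inverse:
  fixes f :: "T3 \<Rightarrow> real"
  assumes f: "partially_differentiable f" and nz: "\<And>x. f x \<noteq> 0"
  shows "partially_differentiable (\<lambda>x. inverse (f x))"
    and "pd i (\<lambda>x. inverse (f x)) x = - (pd i f x * (inverse (f x) * inverse (f x)))"
proof -
  have *: "((\<lambda>s. inverse (f (line x i s))) has_vector_derivative - (pd i f x * (inverse (f x) * inverse (f x)))) (at 0)" for x i
  proof -
    have "((\<lambda>s. f (line x i s)) has_real_derivative pd i f x) (at 0)"
      using pd_has_derivative[OF f] by (simp add: has_real_derivative_iff_has_vector_derivative)
    from DERIV_inverse'[OF this] nz[of x] show ?thesis
      by (simp add: has_real_derivative_iff_has_vector_derivative mult.assoc mult.left_commute)
  qed
  show "partially_differentiable (\<lambda>x. inverse (f x))" by (rule partially_differentiableI[OF *])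
  show "pd i (\<lambda>x. inverse (f x)) x = - (pd i f x * (inverse (f x) * inverse (f x)))" by (rule pdI[OF *])
qed

lemma Ck_T3_Suc: "Ck_T3 (Suc k) f \<longleftrightarrow> continuous_on UNIV f \<and> partially_differentiable f \<and> (\<forall>i. Ck_T3 k (pd i f))"
  by (simp add: partially_differentiable_def)

declare Ck_T3.simps(2) [simp del]

lemma Ck_T3_continuous: "Ck_T3 k f \<Longrightarrow> continuous_on UNIV f"
  by (cases k) (auto simp: Ck_T3_Suc)

lemma Ck_T3_differentiable: "Ck_T3 (Suc k) f \<Longrightarrow> partially_differentiable f" by (simp add: Ck_T3_Suc)

lemma Ck_T3_pd: "Ck_T3 (Suc k) f \<Longrightarrow> Ck_T3 k (pd i f)" by (simp add: Ck_T3_Suc)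

lemma Ck_T3_SucD: "Ck_T3 (Suc k) f \<Longrightarrow> Ck_T3 k f"
proof (induction k arbitrary: f)
  case 0 then show ?case by (simp add: Ck_T3_Suc)
next
  case (Suc k)
  then show ?case by (subst Ck_T3_Suc) (auto simp: Ck_T3_Suc[of "Suc k"])
qed

lemma Ck_T3_const: "Ck_T3 k (\<lambda>x. c)"
proof (induction k arbitrary: c)
  case (Suc k)
  have "pd i (\<lambda>x. c) = (\<lambda>x. 0)" for i by (intro ext pd_const)
  then show ?case using Suc by (simp add: Ck_T3_Suc pd_const)
qed simp

lemma Ck_T3_bounded_linear:
  assumes L: "bounded_linear L" shows "Ck_T3 k f \<Longrightarrow> Ck_T3 k (\<lambda>x. L (f x))"
proof (induction k arbitrary: f)
  case 0 then show ?case using bounded_linear.continuous_on[OF L] by simp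
next
  case (Suc k)
  have d: "partially_differentiable f" by (rule Ck_T3_differentiable[OF Suc.prems])
  have "pd i (\<lambda>x. L (f x)) = (\<lambda>x. L (pd i f x))" for i by (intro ext pd_bounded_linear[OF L d])
  then show ?case using Suc pd_bounded_linear(1)[OF L d] bounded_linear.continuous_on[OF L Ck_T3_continuous[OF Suc.prems]]
    by (simp add: Ck_T3_Suc)
qed

lemma Ck_T3_add: "Ck_T3 k f \<Longrightarrow> Ck_T3 k g \<Longrightarrow> Ck_T3 k (\<lambda>x. f x + g x)"
proof (induction k arbitrary: f g)
  case (Suc k)
  have d: "partially_differentiable f" "partially_differentiable g" using Suc.prems by (auto dest: Ck_T3_differentiable)
  have "pd i (\<lambda>x. f x + g x) = (\<lambda>x. pd i f x + pd i g x)" for i by (intro ext pd_add d)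
  then show ?case using Suc pd_add(1)[OF d] by (auto simp: Ck_T3_Suc intro: continuous_on_add)
qed (simp add: continuous_on_add)

lemma Ck_T3_minus: "Ck_T3 k f \<Longrightarrow> Ck_T3 k (\<lambda>x. - f x)"
  by (rule Ck_T3_bounded_linear[OF bounded_linear_minus[OF bounded_linear_ident]])

lemma Ck_T3_diff: "Ck_T3 k f \<Longrightarrow> Ck_T3 k g \<Longrightarrow> Ck_T3 k (\<lambda>x. f x - g x)"
  using Ck_T3_add[OF _ Ck_T3_minus, of k f g] by simp

lemma Ck_T3_sum: "(\<And>j. j \<in> J \<Longrightarrow> Ck_T3 k (f j)) \<Longrightarrow> Ck_T3 k (\<lambda>x. \<Sum>j\<in>J. f j x)"
  by (induction J rule: infinite_finite_induct) (auto intro: Ck_T3_add Ck_T3_const)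

lemma Ck_T3_mult:
  fixes f g :: "T3 \<Rightarrow> real"
  shows "Ck_T3 k f \<Longrightarrow> Ck_T3 k g \<Longrightarrow> Ck_T3 k (\<lambda>x. f x * g x)"
proof (induction k arbitrary: f g)
  case (Suc k)
  have d: "partially_differentiable f" "partially_differentiable g" using Suc.prems by (auto dest: Ck_T3_differentiable)
  have e: "pd i (\<lambda>x. f x * g x) = (\<lambda>x. f x * pd i g x + pd i f x * g x)" for i by (intro ext pd_mult d)
  have "Ck_T3 k (pd i (\<lambda>x. f x * g x))" for i
    unfolding e by (intro Ck_T3_add Suc.IH Ck_T3_pd Suc.prems Ck_T3_SucD)
  then show ?case using Suc.prems pd_mult(1)[OF d] by (auto simp: Ck_T3_Suc intro: continuous_on_mult)
qed (simp add: continuous_on_mult)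

lemma Ck_T3_inverse:
  fixes f :: "T3 \<Rightarrow> real"
  assumes nz: "\<And>x. f x \<noteq> 0"
  shows "Ck_T3 k f \<Longrightarrow> Ck_T3 k (\<lambda>x. inverse (f x))"
proof (induction k)
  case 0 then show ?case using nz by (simp add: continuous_on_inverse)
next
  case (Suc k)
  have d: "partially_differentiable f" using Suc.prems by (rule Ck_T3_differentiable)
  have e: "pd i (\<lambda>x. inverse (f x)) = (\<lambda>x. - (pd i f x * (inverse (f x) * inverse (f x))))" for i
    by (intro ext pd_inverse d nz)
  have "Ck_T3 k (pd i (\<lambda>x. inverse (f x)))" for i
    unfolding e by (intro Ck_T3_minus Ck_T3_mult Suc.IH Ck_T3_pd Suc.prems Ck_T3_SucD)
  then show ?case using Suc.prems pd_inverse(1)[OF d nz] nz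
    by (auto simp: Ck_T3_Suc intro: continuous_on_inverse)
qed

lemma Ck_T3_nth:
  fixes v :: "T3 \<Rightarrow> real ^ 'n"
  shows "Ck_T3 k v \<Longrightarrow> Ck_T3 k (\<lambda>x. v x $ i)"
  by (rule Ck_T3_bounded_linear[OF bounded_linear_vec_nth])

lemma Ck_T3_vecI:
  fixes v :: "T3 \<Rightarrow> real ^ 'n"
  assumes "\<And>i. Ck_T3 k (\<lambda>x. v x $ i)" shows "Ck_T3 k v"
proof -
  have "Ck_T3 k (\<lambda>x. \<Sum>i\<in>UNIV. v x $ i *\<^sub>R axis i (1::real))"
    by (intro Ck_T3_sum Ck_T3_bounded_linear[OF bounded_linear_scaleR_left] assms)
  moreover have "(\<lambda>x. \<Sum>i\<in>UNIV. v x $ i *\<^sub>R axis i (1::real)) = v"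
    using basis_expansion[of "v _"] by (intro ext) (simp only: scalar_mult_eq_scaleR)
  ultimately show ?thesis by simp
qed

section \<open>Calculus on space-time\<close>

lemma Ck_ST_Suc:
  "Ck_ST T (Suc k) f \<longleftrightarrow> continuous_on ({0..T} \<times> UNIV) (case_prod f) \<and>
      (\<forall>t\<in>{0..T}. \<forall>x. (\<lambda>s. f s x) differentiable (at t within {0..T})) \<and>
      (\<forall>t\<in>{0..T}. partially_differentiable (f t)) \<and>
      Ck_ST T k (dt T f) \<and> (\<forall>i. Ck_ST T k (\<lambda>t. pd i (f t)))"
  by (auto simp: partially_differentiable_def)

declare Ck_ST.simps(2) [simp del]

lemma dt_has_derivative:
  "(\<lambda>s. f s x) differentiable (at t within {0..T}) \<Longrightarrow>
    ((\<lambda>s. f s x) has_vector_derivative dt T f t x) (at t within {0..T})"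
  unfolding dt_def vector_derivative_works[symmetric] .

lemma dtI:
  assumes "T > 0" "t \<in> {0..T}" "((\<lambda>s. f s x) has_vector_derivative d) (at t within {0..T})"
  shows "dt T f t x = d"
  unfolding dt_def using assms by (intro vector_derivative_within_cbox[of 0 T, unfolded cbox_interval]) auto

lemma Ck_ST_continuous: "Ck_ST T k f \<Longrightarrow> continuous_on ({0..T} \<times> UNIV) (case_prod f)"
  by (cases k) (auto simp: Ck_ST_Suc)

lemma Ck_ST_dt: "Ck_ST T (Suc k) f \<Longrightarrow> Ck_ST T k (dt T f)" by (simp add: Ck_ST_Suc)

lemma Ck_ST_pd: "Ck_ST T (Suc k) f \<Longrightarrow> Ck_ST T k (\<lambda>t. pd i (f t))" by (simp add: Ck_ST_Suc)

lemma Ck_ST_differentiable: "Ck_ST T (Suc k) f \<Longrightarrow> t \<in> {0..T} \<Longrightarrow> partially_differentiable (f t)"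
  by (simp add: Ck_ST_Suc)

lemma Ck_ST_has_dt:
  "Ck_ST T (Suc k) f \<Longrightarrow> t \<in> {0..T} \<Longrightarrow> ((\<lambda>s. f s x) has_vector_derivative dt T f t x) (at t within {0..T})"
  by (intro dt_has_derivative) (simp add: Ck_ST_Suc)

lemma Ck_ST_slice: "Ck_ST T k f \<Longrightarrow> t \<in> {0..T} \<Longrightarrow> Ck_T3 k (f t)"
proof (induction k arbitrary: f)
  case 0
  have "continuous_on UNIV (\<lambda>x. case_prod f (t, x))"
    by (rule continuous_on_compose2[OF Ck_ST_continuous[OF 0(1)]]) (use 0 in \<open>auto intro!: continuous_intros\<close>)
  then show ?case by simp
next
  case (Suc k)
  have "continuous_on UNIV (\<lambda>x. case_prod f (t, x))"
    by (rule continuous_on_compose2[OF Ck_ST_continuous[OF Suc(2)]]) (use Suc in \<open>auto intro!: continuous_intros\<close>)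
  then show ?case using Suc.IH[OF Ck_ST_pd[OF Suc.prems(1)] Suc.prems(2)] Ck_ST_differentiable[OF Suc.prems]
    by (simp add: Ck_T3_Suc)
qed

lemma dt_cong:
  assumes "\<And>t x. t \<in> {0..T} \<Longrightarrow> f t x = g t x" "t \<in> {0..T}" shows "dt T f t x = dt T g t x"
proof -
  have "((\<lambda>s. f s x) has_vector_derivative d) (at t within {0..T}) \<longleftrightarrow>
      ((\<lambda>s. g s x) has_vector_derivative d) (at t within {0..T})" for d
    using assms by (intro iffI) (auto elim!: has_vector_derivative_transform[rotated -1])
  then show ?thesis by (simp add: dt_def vector_derivative_def)
qed

lemma Ck_ST_cong:
  "(\<And>t x. t \<in> {0..T} \<Longrightarrow> f t x = g t x) \<Longrightarrow> Ck_ST T k f \<Longrightarrow> Ck_ST T k g"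
proof (induction k arbitrary: f g)
  case 0
  have "continuous_on ({0..T} \<times> UNIV) (case_prod g)"
    using Ck_ST_continuous[OF 0(2)] by (rule continuous_on_eq) (use 0(1) in auto)
  then show ?case by simp
next
  case (Suc k)
  have eq: "f t = g t" if "t \<in> {0..T}" for t using Suc.prems(1)[OF that] by (intro ext)
  have c: "continuous_on ({0..T} \<times> UNIV) (case_prod g)"
    using Ck_ST_continuous[OF Suc.prems(2)] by (rule continuous_on_eq) (use Suc.prems(1) in auto)
  have d: "(\<lambda>s. g s x) differentiable (at t within {0..T})" if "t \<in> {0..T}" for t x
  proof -
    have "((\<lambda>s. g s x) has_vector_derivative dt T f t x) (at t within {0..T})"
      by (rule has_vector_derivative_transform[OF that _ Ck_ST_has_dt[OF Suc.prems(2) that]]) (use Suc.prems(1) in auto)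
    then show ?thesis by (rule differentiableI_vector)
  qed
  have "Ck_ST T k (dt T g)"
    by (rule Suc.IH[OF _ Ck_ST_dt[OF Suc.prems(2)]]) (intro dt_cong Suc.prems(1))
  moreover have "Ck_ST T k (\<lambda>t. pd i (g t))" for i
    by (rule Suc.IH[OF _ Ck_ST_pd[OF Suc.prems(2)]]) (use eq in simp)
  moreover have "partially_differentiable (g t)" if "t \<in> {0..T}" for t
    using Ck_ST_differentiable[OF Suc.prems(2) that] eq[OF that] by simp
  ultimately show ?case using c d by (simp add: Ck_ST_Suc)
qed

lemma Ck_ST_bounded_linear:
  assumes L: "bounded_linear L" and T: "T > 0"
  shows "Ck_ST T k f \<Longrightarrow> Ck_ST T k (\<lambda>t x. L (f t x))"
    and "Ck_ST T (Suc k) f \<Longrightarrow> t \<in> {0..T} \<Longrightarrow> dt T (\<lambda>t x. L (f t x)) t x = L (dt T f t x)"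
proof -
  have hd: "((\<lambda>s. L (f s x)) has_vector_derivative L (dt T f t x)) (at t within {0..T})"
    if "Ck_ST T (Suc k) f" "t \<in> {0..T}" for k f t x
    by (rule bounded_linear.has_vector_derivative[OF L Ck_ST_has_dt[OF that]])
  have e: "dt T (\<lambda>t x. L (f t x)) t x = L (dt T f t x)" if "Ck_ST T (Suc k) f" "t \<in> {0..T}" for k f t x
    by (rule dtI[OF T that(2) hd[OF that]])
  then show "Ck_ST T (Suc k) f \<Longrightarrow> t \<in> {0..T} \<Longrightarrow> dt T (\<lambda>t x. L (f t x)) t x = L (dt T f t x)" .
  show "Ck_ST T k f \<Longrightarrow> Ck_ST T k (\<lambda>t x. L (f t x))"
  proof (induction k arbitrary: f)
    case 0
    then show ?case using bounded_linear.continuous_on[OF L, of _ "case_prod f"] by (simp add: split_beta)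
  next
    case (Suc k)
    have "continuous_on ({0..T} \<times> UNIV) (\<lambda>z. L (case_prod f z))"
      by (rule bounded_linear.continuous_on[OF L Ck_ST_continuous[OF Suc.prems]])
    moreover have "Ck_ST T k (dt T (\<lambda>t x. L (f t x)))"
      by (rule Ck_ST_cong[OF _ Suc.IH[OF Ck_ST_dt[OF Suc.prems]]]) (simp add: e[OF Suc.prems])
    moreover have "Ck_ST T k (\<lambda>t. pd i (\<lambda>x. L (f t x)))" for i
      by (rule Ck_ST_cong[OF _ Suc.IH[OF Ck_ST_pd[OF Suc.prems]]])
        (simp add: pd_bounded_linear(2)[OF L Ck_ST_differentiable[OF Suc.prems]])
    moreover have "(\<lambda>s. L (f s x)) differentiable (at t within {0..T})" if "t \<in> {0..T}" for t x
      using hd[OF Suc.prems that] by (rule differentiableI_vector)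
    moreover have "partially_differentiable (\<lambda>x. L (f t x))" if "t \<in> {0..T}" for t
      by (rule pd_bounded_linear(1)[OF L Ck_ST_differentiable[OF Suc.prems that]])
    ultimately show ?case by (simp add: Ck_ST_Suc split_beta)
  qed
qed

text \<open>Mixed partial derivatives commute, by differentiating \<open>f(t) = f(0) + \<integral>\<^sub>0\<^sup>t \<partial>\<^sub>t f\<close>
  under the integral sign.\<close>

lemma dt_pd_commute:
  fixes f :: "real \<Rightarrow> T3 \<Rightarrow> real"
  assumes f: "Ck_ST T (Suc (Suc k)) f" and T: "T > 0" and t: "t \<in> {0..T}"
  shows "dt T (\<lambda>t. pd i (f t)) t x = pd i (dt T f t) x"
proof -
  note df = Ck_ST_dt[OF f]
  define g where "g u = pd i (dt T f u) x" for u
  have ge: "g = (\<lambda>u. pd i (dt T f u) x)" by (intro ext) (simp add: g_def)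
  have cg: "continuous_on ({0..T} \<times> UNIV) (\<lambda>(u, y). pd i (dt T f u) y)"
    using Ck_ST_continuous[OF Ck_ST_pd[OF df]] by (simp add: split_beta)
  have cdf: "continuous_on ({0..T} \<times> UNIV) (case_prod (dt T f))" by (rule Ck_ST_continuous[OF df])
  note cl = continuous_on_line[of x i]
  have rep: "pd i (f t) x = pd i (f 0) x + integral {0..t} g" if t: "t \<in> {0..T}" for t
  proof -
    have ftc: "f t y = f 0 y + integral {0..t} (\<lambda>u. dt T f u y)" for y
    proof -
      have "((\<lambda>u. dt T f u y) has_integral (f t y - f 0 y)) {0..t}"
      proof (rule fundamental_theorem_of_calculus)
        show "((\<lambda>s. f s y) has_vector_derivative dt T f u y) (at u within {0..t})" if "u \<in> {0..t}" for u
          using Ck_ST_has_dt[OF f, of u y] that t by (auto intro: has_vector_derivative_within_subset)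
      qed (use t in auto)
      then show ?thesis by (simp add: integral_unique)
    qed
    have "((\<lambda>s. integral (cbox 0 t) (\<lambda>u. dt T f u (line x i s))) has_vector_derivative
        integral (cbox 0 t) (\<lambda>u. pd i (dt T f u) (line x i 0))) (at 0 within UNIV)"
    proof (rule leibniz_rule_vector_derivative)
      show "((\<lambda>s. dt T f u (line x i s)) has_vector_derivative pd i (dt T f u) (line x i s)) (at s within UNIV)"
        if "u \<in> cbox 0 t" for s u
        using pd_along_line[OF Ck_ST_differentiable[OF df]] that t by simp
      show "(\<lambda>u. dt T f u (line x i s)) integrable_on cbox 0 t" for s
      proof (rule integrable_continuous)
        have "continuous_on (cbox 0 t) (\<lambda>u. case_prod (dt T f) (u, line x i s))"
          by (rule continuous_on_compose2[OF cdf]) (use t in \<open>auto intro!: continuous_intros\<close>)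
        then show "continuous_on (cbox 0 t) (\<lambda>u. dt T f u (line x i s))" by simp
      qed
      have "continuous_on (UNIV \<times> cbox 0 t) (\<lambda>z. (\<lambda>(u, y). pd i (dt T f u) y) (snd z, line x i (fst z)))"
        by (rule continuous_on_compose2[OF cg])
          (use t in \<open>auto intro!: continuous_intros continuous_on_compose2[OF cl]\<close>)
      then show "continuous_on (UNIV \<times> cbox 0 t) (\<lambda>(s, u). pd i (dt T f u) (line x i s))"
        by (simp add: split_beta)
    qed auto
    then have "((\<lambda>s. integral {0..t} (\<lambda>u. dt T f u (line x i s))) has_vector_derivative integral {0..t} g) (at 0)"
      by (simp add: ge)
    with pd_has_derivative[OF Ck_ST_differentiable[OF f, of 0], of x i] T
    have "((\<lambda>s. f 0 (line x i s) + integral {0..t} (\<lambda>u. dt T f u (line x i s))) has_vector_derivative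
        pd i (f 0) x + integral {0..t} g) (at 0)" by (intro has_vector_derivative_add) auto
    then show ?thesis unfolding ftc[symmetric] by (rule pdI)
  qed
  have "continuous_on {0..T} (\<lambda>u. (\<lambda>(u, y). pd i (dt T f u) y) (u, x))"
    by (rule continuous_on_compose2[OF cg]) (auto intro!: continuous_intros)
  then have "continuous_on {0..T} g" by (simp add: g_def)
  from integral_has_vector_derivative[OF this t]
  have "((\<lambda>s. pd i (f 0) x + integral {0..s} g) has_vector_derivative 0 + g t) (at t within {0..T})"
    by (intro has_vector_derivative_add has_vector_derivative_const)
  then have hv: "((\<lambda>s. pd i (f 0) x + integral {0..s} g) has_vector_derivative g t) (at t within {0..T})" by simp
  have "((\<lambda>s. pd i (f s) x) has_vector_derivative g t) (at t within {0..T})"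
    by (rule has_vector_derivative_transform[OF t rep hv])
  then show ?thesis using dtI[OF T t, of "\<lambda>t. pd i (f t)"] by (simp add: g_def)
qed

text \<open>A criterion in terms of explicit derivatives, meant for fields \<open>a(x) + \<phi>(t) b(x)\<close> and their
  reciprocals, whose derivatives are known in closed form.\<close>

lemma Ck_ST_1I:
  assumes T: "T > 0" and c: "continuous_on ({0..T} \<times> UNIV) (\<lambda>(t, x). f t x)"
    and d: "\<And>t x. t \<in> {0..T} \<Longrightarrow> ((\<lambda>s. f s x) has_vector_derivative f' t x) (at t within {0..T})"
    and c': "continuous_on ({0..T} \<times> UNIV) (\<lambda>(t, x). f' t x)"
    and p: "\<And>t. t \<in> {0..T} \<Longrightarrow> partially_differentiable (f t)"
    and q: "\<And>t x i. t \<in> {0..T} \<Longrightarrow> pd i (f t) x = g i t x"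
    and cg: "\<And>i. continuous_on ({0..T} \<times> UNIV) (\<lambda>(t, x). g i t x)"
  shows "Ck_ST T 1 f"
proof -
  have "continuous_on ({0..T} \<times> UNIV) (case_prod (dt T f))"
    using c' by (rule continuous_on_eq) (auto simp: dtI[OF T _ d])
  moreover have "continuous_on ({0..T} \<times> UNIV) (\<lambda>(t, x). pd i (f t) x)" for i
    using cg[of i] by (rule continuous_on_eq) (auto simp: q)
  ultimately have "Ck_ST T (Suc 0) f"
    using c p differentiableI_vector[OF d] by (simp add: Ck_ST_Suc split_beta)
  then show ?thesis by simp
qed

section \<open>Short-time asymptotics\<close>

text \<open>Agreement to second order as \<open>t \<rightarrow> 0\<close>, uniformly in space. This is the accuracy needed for the time
  derivative of a field that is to be known up to \<open>O(t\<^sup>3)\<close>.\<close>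

definition close_T :: "real \<Rightarrow> (real \<Rightarrow> T3 \<Rightarrow> real) \<Rightarrow> (real \<Rightarrow> T3 \<Rightarrow> real) \<Rightarrow> bool"
  where "close_T T f g \<longleftrightarrow> (\<exists>C\<ge>0. \<forall>t\<in>{0..T}. \<forall>x. \<bar>f t x - g t x\<bar> \<le> C * t\<^sup>2)"

definition bdd_T :: "real \<Rightarrow> (real \<Rightarrow> T3 \<Rightarrow> real) \<Rightarrow> bool"
  where "bdd_T T f \<longleftrightarrow> (\<exists>C\<ge>0. \<forall>t\<in>{0..T}. \<forall>x. \<bar>f t x\<bar> \<le> C)"

lemma bdd_T_power:
  assumes "continuous_on UNIV g" "T \<ge> 0" shows "bdd_T T (\<lambda>t x. t ^ p * g x)"
proof -
  obtain K where K: "K > 0" "\<And>x. norm (g x) \<le> K" using continuous_T3_bounded[OF assms(1)] by blast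
  have "\<bar>t ^ p * g x\<bar> \<le> T ^ p * K" if "t \<in> {0..T}" for t x
    unfolding abs_mult using that K by (intro mult_mono) (auto simp: power_mono)
  then show ?thesis unfolding bdd_T_def using K(1) assms(2) by (intro exI[of _ "T ^ p * K"]) simp
qed

lemma bdd_T_close:
  assumes "close_T T f g" "bdd_T T g" shows "bdd_T T f"
proof -
  obtain C where C: "C \<ge> 0" "\<And>t x. t \<in> {0..T} \<Longrightarrow> \<bar>f t x - g t x\<bar> \<le> C * t\<^sup>2" using assms(1) unfolding close_T_def by blast
  obtain K where K: "K \<ge> 0" "\<And>t x. t \<in> {0..T} \<Longrightarrow> \<bar>g t x\<bar> \<le> K" using assms(2) unfolding bdd_T_def by blast
  have "\<bar>f t x\<bar> \<le> K + C * T\<^sup>2" if t: "t \<in> {0..T}" for t x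
  proof -
    have "C * t\<^sup>2 \<le> C * T\<^sup>2" using t C(1) by (intro mult_left_mono power_mono) auto
    then show ?thesis using C(2)[OF t, of x] K(2)[OF t, of x] by linarith
  qed
  then show ?thesis unfolding bdd_T_def using C(1) K(1) by (intro exI[of _ "K + C * T\<^sup>2"]) simp
qed

lemma bdd_T_mult:
  assumes "bdd_T T f" "bdd_T T g" shows "bdd_T T (\<lambda>t x. f t x * g t x)"
proof -
  obtain C where C: "C \<ge> 0" "\<And>t x. t \<in> {0..T} \<Longrightarrow> \<bar>f t x\<bar> \<le> C" using assms(1) unfolding bdd_T_def by blast
  obtain K where K: "K \<ge> 0" "\<And>t x. t \<in> {0..T} \<Longrightarrow> \<bar>g t x\<bar> \<le> K" using assms(2) unfolding bdd_T_def by blast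
  have "\<bar>f t x * g t x\<bar> \<le> C * K" if "t \<in> {0..T}" for t x
    unfolding abs_mult using C K that by (intro mult_mono) auto
  then show ?thesis unfolding bdd_T_def using C(1) K(1) by (intro exI[of _ "C * K"]) simp
qed

lemma close_T_add:
  assumes "close_T T f f'" "close_T T g g'" shows "close_T T (\<lambda>t x. f t x + g t x) (\<lambda>t x. f' t x + g' t x)"
proof -
  obtain C where C: "C \<ge> 0" "\<And>t x. t \<in> {0..T} \<Longrightarrow> \<bar>f t x - f' t x\<bar> \<le> C * t\<^sup>2" using assms(1) unfolding close_T_def by blast
  obtain K where K: "K \<ge> 0" "\<And>t x. t \<in> {0..T} \<Longrightarrow> \<bar>g t x - g' t x\<bar> \<le> K * t\<^sup>2" using assms(2) unfolding close_T_def by blast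
  have "\<bar>(f t x + g t x) - (f' t x + g' t x)\<bar> \<le> (C + K) * t\<^sup>2" if t: "t \<in> {0..T}" for t x
    using C(2)[OF t, of x] K(2)[OF t, of x] by (simp add: distrib_right)
  then show ?thesis unfolding close_T_def using C(1) K(1) by (intro exI[of _ "C + K"]) simp
qed

lemma close_T_minus:
  "close_T T f g \<Longrightarrow> close_T T (\<lambda>t x. - f t x) (\<lambda>t x. - g t x)"
  unfolding close_T_def by (simp add: abs_minus_commute)

lemma close_T_mult:
  assumes "close_T T f f'" "close_T T g g'" "bdd_T T f" "bdd_T T g'"
  shows "close_T T (\<lambda>t x. f t x * g t x) (\<lambda>t x. f' t x * g' t x)"
proof -
  obtain C where C: "C \<ge> 0" "\<And>t x. t \<in> {0..T} \<Longrightarrow> \<bar>f t x - f' t x\<bar> \<le> C * t\<^sup>2" using assms(1) unfolding close_T_def by blast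
  obtain K where K: "K \<ge> 0" "\<And>t x. t \<in> {0..T} \<Longrightarrow> \<bar>g t x - g' t x\<bar> \<le> K * t\<^sup>2" using assms(2) unfolding close_T_def by blast
  obtain a where a: "a \<ge> 0" "\<And>t x. t \<in> {0..T} \<Longrightarrow> \<bar>f t x\<bar> \<le> a" using assms(3) unfolding bdd_T_def by blast
  obtain b where b: "b \<ge> 0" "\<And>t x. t \<in> {0..T} \<Longrightarrow> \<bar>g' t x\<bar> \<le> b" using assms(4) unfolding bdd_T_def by blast
  have "\<bar>f t x * g t x - f' t x * g' t x\<bar> \<le> (a * K + C * b) * t\<^sup>2" if t: "t \<in> {0..T}" for t x
  proof -
    have "f t x * g t x - f' t x * g' t x = f t x * (g t x - g' t x) + (f t x - f' t x) * g' t x"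
      by (simp add: algebra_simps)
    then have "\<bar>f t x * g t x - f' t x * g' t x\<bar> \<le> \<bar>f t x\<bar> * \<bar>g t x - g' t x\<bar> + \<bar>f t x - f' t x\<bar> * \<bar>g' t x\<bar>"
      by (metis abs_mult abs_triangle_ineq)
    also have "\<dots> \<le> a * (K * t\<^sup>2) + (C * t\<^sup>2) * b"
      using C K a b t by (intro add_mono mult_mono) auto
    finally show ?thesis by (simp add: algebra_simps)
  qed
  then show ?thesis unfolding close_T_def using C(1) K(1) a(1) b(1) by (intro exI[of _ "a * K + C * b"]) simp
qed

lemma close_T_cong:
  "close_T T f g \<Longrightarrow> (\<And>t x. t \<in> {0..T} \<Longrightarrow> f' t x = f t x) \<Longrightarrow> (\<And>t x. t \<in> {0..T} \<Longrightarrow> g' t x = g t x) \<Longrightarrow> close_T T f' g'"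
  unfolding close_T_def by simp

lemma close_T_trans:
  assumes "close_T T f g" "close_T T g h" shows "close_T T f h"
  using close_T_add[OF assms] by (simp add: close_T_def algebra_simps)

text \<open>A one-term expansion \<open>f(t, x) = t\<^sup>p g(x) + O(t\<^sup>2)\<close> that may be differentiated in space, so that it can be
  inserted into first order differential operators. The exponents are \<open>0\<close> for \<open>h\<close> and \<open>B\<close>, which are
  even in time to this order, and \<open>1\<close> for \<open>D\<close> and \<open>P\<close>, which are odd.\<close>

definition expands :: "real \<Rightarrow> nat \<Rightarrow> (real \<Rightarrow> T3 \<Rightarrow> real) \<Rightarrow> (T3 \<Rightarrow> real) \<Rightarrow> bool"
  where "expands T p f g \<longleftrightarrow> (\<forall>t\<in>{0..T}. partially_differentiable (f t)) \<and> Ck_T3 1 g \<and>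
    close_T T f (\<lambda>t x. t ^ p * g x) \<and> (\<forall>i. close_T T (\<lambda>t. pd i (f t)) (\<lambda>t x. t ^ p * pd i g x))"

lemma expandsD:
  assumes "expands T p f g"
  shows "t \<in> {0..T} \<Longrightarrow> partially_differentiable (f t)" "Ck_T3 1 g" "partially_differentiable g"
    "continuous_on UNIV g" "continuous_on UNIV (pd i g)"
    "close_T T f (\<lambda>t x. t ^ p * g x)" "close_T T (\<lambda>t. pd i (f t)) (\<lambda>t x. t ^ p * pd i g x)"
  using assms Ck_T3_pd[of 0 g i] Ck_T3_differentiable[of 0 g] Ck_T3_continuous[of 1 g] by (auto simp: expands_def)

lemma expands_bdd:
  assumes "expands T p f g" "T \<ge> 0"
  shows "bdd_T T f" "bdd_T T (\<lambda>t. pd i (f t))" "bdd_T T (\<lambda>t x. t ^ p * g x)" "bdd_T T (\<lambda>t x. t ^ p * pd i g x)"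
proof -
  show 1: "bdd_T T (\<lambda>t x. t ^ p * g x)" "bdd_T T (\<lambda>t x. t ^ p * pd i g x)"
    using expandsD(4,5)[OF assms(1)] assms(2) by (auto intro: bdd_T_power)
  show "bdd_T T f" "bdd_T T (\<lambda>t. pd i (f t))"
    using bdd_T_close[OF expandsD(6)[OF assms(1)] 1(1)] bdd_T_close[OF expandsD(7)[OF assms(1)] 1(2)] by auto
qed

lemma expands_add:
  assumes f: "expands T p f f'" and g: "expands T p g g'"
  shows "expands T p (\<lambda>t x. f t x + g t x) (\<lambda>x. f' x + g' x)"
  unfolding expands_def
proof (intro conjI ballI allI)
  show "partially_differentiable (\<lambda>x. f t x + g t x)" if "t \<in> {0..T}" for t
    by (intro pd_add(1) expandsD(1)[OF f that] expandsD(1)[OF g that])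
  show "Ck_T3 1 (\<lambda>x. f' x + g' x)" by (intro Ck_T3_add expandsD(2)[OF f] expandsD(2)[OF g])
  show "close_T T (\<lambda>t x. f t x + g t x) (\<lambda>t x. t ^ p * (f' x + g' x))"
    using close_T_add[OF expandsD(6)[OF f] expandsD(6)[OF g]] by (simp add: distrib_left)
  show "close_T T (\<lambda>t. pd i (\<lambda>x. f t x + g t x)) (\<lambda>t x. t ^ p * pd i (\<lambda>x. f' x + g' x) x)" for i
    by (rule close_T_cong[OF close_T_add[OF expandsD(7)[OF f] expandsD(7)[OF g]]])
      (simp_all add: pd_add(2) expandsD(1)[OF f] expandsD(1)[OF g] expandsD(3)[OF f] expandsD(3)[OF g] distrib_left)
qed

lemma pd_minus:
  assumes "partially_differentiable f"
  shows "partially_differentiable (\<lambda>x. - f x)" and "pd i (\<lambda>x. - f x) x = - pd i f x"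
  using pd_bounded_linear[OF bounded_linear_minus[OF bounded_linear_ident] assms] by auto

lemma expands_minus:
  assumes f: "expands T p f f'" shows "expands T p (\<lambda>t x. - f t x) (\<lambda>x. - f' x)"
proof -
  show ?thesis unfolding expands_def
  proof (intro conjI ballI allI)
    show "partially_differentiable (\<lambda>x. - f t x)" if "t \<in> {0..T}" for t
      by (rule pd_minus(1)[OF expandsD(1)[OF f that]])
    show "Ck_T3 1 (\<lambda>x. - f' x)" by (intro Ck_T3_minus expandsD(2)[OF f])
    show "close_T T (\<lambda>t x. - f t x) (\<lambda>t x. t ^ p * - f' x)"
      using close_T_minus[OF expandsD(6)[OF f]] by simp
    show "close_T T (\<lambda>t. pd i (\<lambda>x. - f t x)) (\<lambda>t x. t ^ p * pd i (\<lambda>x. - f' x) x)" for i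
    proof (rule close_T_cong[OF close_T_minus[OF expandsD(7)[OF f, of i]]])
      show "pd i (\<lambda>x. - f t x) x = - pd i (f t) x" if "t \<in> {0..T}" for t x
        by (rule pd_minus(2)[OF expandsD(1)[OF f that]])
      show "t ^ p * pd i (\<lambda>x. - f' x) x = - (t ^ p * pd i f' x)" for t x
        using pd_minus(2)[OF expandsD(3)[OF f], of i x] by simp
    qed
  qed
qed

lemma expands_diff:
  "expands T p f f' \<Longrightarrow> expands T p g g' \<Longrightarrow> expands T p (\<lambda>t x. f t x - g t x) (\<lambda>x. f' x - g' x)"
  using expands_add[OF _ expands_minus, of T p f f' g g'] by simp

lemma expands_const: "expands T 0 (\<lambda>t x. c) (\<lambda>x. c)"
  using Ck_T3_const by (auto simp: expands_def pd_const close_T_def)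

lemma expands_mult:
  assumes f: "expands T p f f'" and g: "expands T q g g'" and T: "T \<ge> 0"
  shows "expands T (p + q) (\<lambda>t x. f t x * g t x) (\<lambda>x. f' x * g' x)"
  unfolding expands_def
proof (intro conjI ballI allI)
  note b = expands_bdd[OF f T] expands_bdd[OF g T]
  show "partially_differentiable (\<lambda>x. f t x * g t x)" if "t \<in> {0..T}" for t
    by (intro pd_mult(1) expandsD(1)[OF f that] expandsD(1)[OF g that])
  show "Ck_T3 1 (\<lambda>x. f' x * g' x)" by (intro Ck_T3_mult expandsD(2)[OF f] expandsD(2)[OF g])
  show "close_T T (\<lambda>t x. f t x * g t x) (\<lambda>t x. t ^ (p + q) * (f' x * g' x))"
    using close_T_mult[OF expandsD(6)[OF f] expandsD(6)[OF g]] b by (simp add: power_add mult_ac)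
  show "close_T T (\<lambda>t. pd i (\<lambda>x. f t x * g t x)) (\<lambda>t x. t ^ (p + q) * pd i (\<lambda>x. f' x * g' x) x)" for i
  proof (rule close_T_cong[OF close_T_add[OF close_T_mult[OF expandsD(6)[OF f] expandsD(7)[OF g, of i]]
        close_T_mult[OF expandsD(7)[OF f, of i] expandsD(6)[OF g]]]])
    show "pd i (\<lambda>x. f t x * g t x) x = f t x * pd i (g t) x + pd i (f t) x * g t x" if "t \<in> {0..T}" for t x
      by (rule pd_mult(2)[OF expandsD(1)[OF f that] expandsD(1)[OF g that]])
    show "t ^ (p + q) * pd i (\<lambda>x. f' x * g' x) x
        = t ^ p * f' x * (t ^ q * pd i g' x) + t ^ p * pd i f' x * (t ^ q * g' x)" for t x
      by (simp add: pd_mult(2)[OF expandsD(3)[OF f] expandsD(3)[OF g]] power_add algebra_simps)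
  qed (use b in auto)
qed

text \<open>The product of two odd fields is of the size of the error term.\<close>

lemma expands_2_0:
  assumes f: "expands T 2 f g" and T: "T \<ge> 0" shows "expands T 0 f (\<lambda>x. 0)"
proof -
  have z: "close_T T (\<lambda>t x. t ^ 2 * k x) (\<lambda>t x. 0)" if "continuous_on UNIV k" for k
  proof -
    obtain K where "K > 0" "\<And>x. norm (k x) \<le> K" using continuous_T3_bounded[OF \<open>continuous_on UNIV k\<close>] by blast
    then show ?thesis unfolding close_T_def
      by (intro exI[of _ K]) (auto simp: abs_mult mult.commute intro!: mult_mono)
  qed
  show ?thesis unfolding expands_def
    using expandsD(1)[OF f] close_T_trans[OF expandsD(6)[OF f] z[OF expandsD(4)[OF f]]]
      close_T_trans[OF expandsD(7)[OF f] z[OF expandsD(5)[OF f]]]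
    by (auto simp: pd_const Ck_T3_const)
qed

lemma expands_inverse:
  assumes f: "expands T 0 f g" and T: "T \<ge> 0" and m: "m > 0"
    and lf: "\<And>t x. t \<in> {0..T} \<Longrightarrow> m \<le> f t x" and lg: "\<And>x. m \<le> g x"
  shows "expands T 0 (\<lambda>t x. inverse (f t x)) (\<lambda>x. inverse (g x))"
proof -
  have nzf: "f t x \<noteq> 0" if "t \<in> {0..T}" for t x using lf[OF that, of x] m by linarith
  have nzg: "g x \<noteq> 0" for x using lg[of x] m by linarith
  obtain C where C: "C \<ge> 0" "\<And>t x. t \<in> {0..T} \<Longrightarrow> \<bar>f t x - g x\<bar> \<le> C * t\<^sup>2"
    using expandsD(6)[OF f] unfolding close_T_def by auto
  have cl: "close_T T (\<lambda>t x. inverse (f t x)) (\<lambda>t x. inverse (g x))"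
  proof -
    have "\<bar>inverse (f t x) - inverse (g x)\<bar> \<le> (inverse m * C * inverse m) * t\<^sup>2" if t: "t \<in> {0..T}" for t x
    proof -
      have "inverse (f t x) - inverse (g x) = - (inverse (f t x) * (f t x - g x) * inverse (g x))"
        by (rule inverse_diff_inverse[OF nzf[OF t] nzg])
      then have "\<bar>inverse (f t x) - inverse (g x)\<bar> = inverse (f t x) * \<bar>f t x - g x\<bar> * inverse (g x)"
        using lf[OF t, of x] lg[of x] m by (simp add: abs_mult)
      also have "\<dots> \<le> inverse m * (C * t\<^sup>2) * inverse m"
        using lf[OF t, of x] lg[of x] m C(1) C(2)[OF t, of x] by (intro mult_mono) (auto intro: le_imp_inverse_le)
      finally show ?thesis by (simp add: algebra_simps)
    qed
    then show ?thesis unfolding close_T_def using C(1) m by (intro exI[of _ "inverse m * C * inverse m"]) simp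
  qed
  have bi: "bdd_T T (\<lambda>t x. inverse (f t x))" "bdd_T T (\<lambda>t x. inverse (g x))"
    unfolding bdd_T_def using lf lg m
    by (auto intro!: exI[of _ "inverse m"] le_imp_inverse_le less_imp_le[OF m] simp: abs_of_pos order.strict_trans2[OF m])
  show ?thesis unfolding expands_def
  proof (intro conjI ballI allI)
    show "partially_differentiable (\<lambda>x. inverse (f t x))" if "t \<in> {0..T}" for t
      by (rule pd_inverse(1)[OF expandsD(1)[OF f that] nzf[OF that]])
    show "Ck_T3 1 (\<lambda>x. inverse (g x))" by (rule Ck_T3_inverse[OF nzg expandsD(2)[OF f]])
    show "close_T T (\<lambda>t x. inverse (f t x)) (\<lambda>t x. t ^ 0 * inverse (g x))" using cl by simp
    fix i
    have "close_T T (\<lambda>t x. - (pd i (f t) x * (inverse (f t x) * inverse (f t x))))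
      (\<lambda>t x. - (t ^ 0 * pd i g x * (inverse (g x) * inverse (g x))))"
      by (intro close_T_minus close_T_mult expandsD(7)[OF f] cl bi bdd_T_mult expands_bdd(2)[OF f T])
    then show "close_T T (\<lambda>t. pd i (\<lambda>x. inverse (f t x))) (\<lambda>t x. t ^ 0 * pd i (\<lambda>x. inverse (g x)) x)"
      by (rule close_T_cong)
        (simp_all add: pd_inverse(2)[OF expandsD(1)[OF f] nzf] pd_inverse(2)[OF expandsD(3)[OF f] nzg])
  qed
qed

lemma growth_bound:
  fixes u :: "real \<Rightarrow> real"
  assumes d: "\<And>t. t \<in> {0..T} \<Longrightarrow> (u has_vector_derivative u' t) (at t within {0..T})"
    and u0: "u 0 = 0" and b: "\<And>t. t \<in> {0..T} \<Longrightarrow> \<bar>u' t\<bar> \<le> C * t ^ k" and C: "C \<ge> 0" and t: "t \<in> {0..T}"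
  shows "\<bar>u t\<bar> \<le> C * t ^ Suc k"
proof (cases "t = 0")
  case False
  then have tp: "0 < t" using t by simp
  have "\<exists>x\<in>{0<..<t}. u t - u 0 = (\<lambda>h. h *\<^sub>R u' x) (t - 0)"
  proof (rule mvt_simple[OF tp])
    show "(u has_derivative (\<lambda>h. h *\<^sub>R u' x)) (at x within {0..t})" if "0 \<le> x" "x \<le> t" for x
    proof -
      have "(u has_vector_derivative u' x) (at x within {0..t})"
        using d[of x] that t by (auto intro: has_vector_derivative_within_subset)
      then show ?thesis by (simp add: has_vector_derivative_def)
    qed
  qed
  then obtain x where x: "0 < x" "x < t" "u t = t * u' x" using u0 by auto
  have "\<bar>u' x\<bar> \<le> C * t ^ k"
  proof -
    have "C * x ^ k \<le> C * t ^ k" using x C by (intro mult_left_mono power_mono) auto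
    moreover have "\<bar>u' x\<bar> \<le> C * x ^ k" using x t by (intro b) auto
    ultimately show ?thesis by linarith
  qed
  then have "t * \<bar>u' x\<bar> \<le> t * (C * t ^ k)" using tp by (intro mult_left_mono) auto
  then show ?thesis using tp by (simp add: x(3) abs_mult mult.left_commute)
qed (simp add: u0)

lemma Ck_ST_bdd:
  fixes f :: "real \<Rightarrow> T3 \<Rightarrow> real"
  assumes "Ck_ST T k f" obtains C where "C \<ge> 0" "\<And>t x. t \<in> {0..T} \<Longrightarrow> \<bar>f t x\<bar> \<le> C"
proof -
  obtain K where "K > 0" "\<And>s x. s \<in> {0..T} \<Longrightarrow> norm (case_prod f (s, x)) \<le> K"
    using continuous_slab_bounded[OF Ck_ST_continuous[OF assms]] by blast
  then show ?thesis by (intro that[of K]) auto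
qed

lemma taylor1:
  assumes f: "Ck_ST T (Suc (Suc k)) f" and T: "T > 0" and z: "\<And>x. dt T f 0 x = (0::real)"
  shows "close_T T f (\<lambda>t. f 0)"
proof -
  obtain C where C: "C \<ge> 0" "\<And>t x. t \<in> {0..T} \<Longrightarrow> \<bar>dt T (dt T f) t x\<bar> \<le> C"
    using Ck_ST_bdd[OF Ck_ST_dt[OF Ck_ST_dt[OF f]]] by blast
  have le: "\<bar>dt T f t x\<bar> \<le> C * t ^ Suc 0" if t: "t \<in> {0..T}" for t x
    by (rule growth_bound[where u' = "\<lambda>t. dt T (dt T f) t x" and T = T])
      (use Ck_ST_has_dt[OF Ck_ST_dt[OF f]] z C t in auto)
  have "\<bar>f t x - f 0 x\<bar> \<le> C * t ^ Suc (Suc 0)" if t: "t \<in> {0..T}" for t x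
    by (rule growth_bound[where u = "\<lambda>t. f t x - f 0 x" and u' = "\<lambda>t. dt T f t x" and T = T])
      (use C t le in \<open>auto simp: has_vector_derivative_diff_const intro: Ck_ST_has_dt[OF f]\<close>)
  then show ?thesis unfolding close_T_def using C(1) by (intro exI[of _ C]) (auto simp: numeral_2_eq_2)
qed

lemma taylor2:
  assumes f: "Ck_ST T (Suc (Suc k)) f" and T: "T > 0" and z: "\<And>x. f 0 x = (0::real)"
  shows "close_T T f (\<lambda>t x. t * dt T f 0 x)"
proof -
  obtain C where C: "C \<ge> 0" "\<And>t x. t \<in> {0..T} \<Longrightarrow> \<bar>dt T (dt T f) t x\<bar> \<le> C"
    using Ck_ST_bdd[OF Ck_ST_dt[OF Ck_ST_dt[OF f]]] by blast
  have le: "\<bar>dt T f t x - dt T f 0 x\<bar> \<le> C * t ^ Suc 0" if t: "t \<in> {0..T}" for t x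
    by (rule growth_bound[where u = "\<lambda>t. dt T f t x - dt T f 0 x" and u' = "\<lambda>t. dt T (dt T f) t x" and T = T])
      (use C t in \<open>auto simp: has_vector_derivative_diff_const intro: Ck_ST_has_dt[OF Ck_ST_dt[OF f]]\<close>)
  have hv: "((\<lambda>t. f t x - t * dt T f 0 x) has_vector_derivative (dt T f t x - dt T f 0 x)) (at t within {0..T})"
    if "t \<in> {0..T}" for t x
    using has_vector_derivative_diff[OF Ck_ST_has_dt[OF f that]
        has_vector_derivative_mult_left[OF has_vector_derivative_id[of "at t within {0..T}"]], of x "dt T f 0 x"] by simp
  have "\<bar>f t x - t * dt T f 0 x\<bar> \<le> C * t ^ Suc (Suc 0)" if t: "t \<in> {0..T}" for t x
    by (rule growth_bound[where u = "\<lambda>t. f t x - t * dt T f 0 x" and u' = "\<lambda>t. dt T f t x - dt T f 0 x" and T = T])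
      (use C t z le hv in auto)
  then show ?thesis unfolding close_T_def using C(1) by (intro exI[of _ C]) (auto simp: numeral_2_eq_2)
qed

text \<open>The absence of a linear term is inherited by the space derivatives, because mixed derivatives
  commute.\<close>

lemma expands_even:
  assumes f: "Ck_ST T 3 f" and T: "T > 0" and z: "\<And>x. dt T f 0 x = 0"
  shows "expands T 0 f (f 0)"
  unfolding expands_def
proof (intro conjI ballI allI)
  have f3: "Ck_ST T (Suc (Suc (Suc 0))) f" using f by (simp add: numeral_3_eq_3)
  show "partially_differentiable (f t)" if "t \<in> {0..T}" for t by (rule Ck_ST_differentiable[OF f3 that])
  show "Ck_T3 1 (f 0)" using Ck_ST_slice[OF f3, of 0] T by (auto dest!: Ck_T3_SucD)
  show "close_T T f (\<lambda>t x. t ^ 0 * f 0 x)" using taylor1[OF f3 T z] by simp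
  have "dt T (\<lambda>t. pd i (f t)) 0 x = 0" for i x
    using dt_pd_commute[OF f3 T, of 0 i x] T z pd_const(2)[of i 0 x] by (simp add: z[abs_def])
  from taylor1[OF Ck_ST_pd[OF f3] T this]
  show "close_T T (\<lambda>t. pd i (f t)) (\<lambda>t x. t ^ 0 * pd i (f 0) x)" for i by simp
qed

lemma expands_odd:
  assumes f: "Ck_ST T 3 f" and T: "T > 0" and z: "\<And>x. f 0 x = 0"
  shows "expands T 1 f (dt T f 0)"
  unfolding expands_def
proof (intro conjI ballI allI)
  have f3: "Ck_ST T (Suc (Suc (Suc 0))) f" using f by (simp add: numeral_3_eq_3)
  show "partially_differentiable (f t)" if "t \<in> {0..T}" for t by (rule Ck_ST_differentiable[OF f3 that])
  show "Ck_T3 1 (dt T f 0)" using Ck_ST_slice[OF Ck_ST_dt[OF f3], of 0] T by (auto dest!: Ck_T3_SucD)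
  show "close_T T f (\<lambda>t x. t ^ 1 * dt T f 0 x)" using taylor2[OF f3 T z] by simp
  fix i
  have f0: "f 0 = (\<lambda>x. 0)" using z by (intro ext)
  have "pd i (f 0) x = 0" for x unfolding f0 by (rule pd_const)
  from taylor2[OF Ck_ST_pd[OF f3] T this]
  show "close_T T (\<lambda>t. pd i (f t)) (\<lambda>t x. t ^ 1 * pd i (dt T f 0) x)"
    using dt_pd_commute[OF f3 T, of 0 i] T by simp
qed

section \<open>Smooth fields on the torus\<close>

lemma smooth_T3_Ck: "smooth_T3 f \<Longrightarrow> Ck_T3 k f" by (simp add: smooth_T3_def)

lemma smooth_T3_differentiable: "smooth_T3 f \<Longrightarrow> partially_differentiable f"
  using smooth_T3_Ck[of f "Suc 0"] by (rule Ck_T3_differentiable)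

lemma smooth_T3_continuous: "smooth_T3 f \<Longrightarrow> continuous_on UNIV f"
  using smooth_T3_Ck[of f 0] by simp

lemma smooth_T3_pd: "smooth_T3 f \<Longrightarrow> smooth_T3 (pd i f)"
  using Ck_T3_pd unfolding smooth_T3_def by blast

lemma smooth_T3_pd': "smooth_T3 f \<Longrightarrow> smooth_T3 (\<lambda>x. pd i f x)"
  using smooth_T3_pd[of f i] by simp

lemma smooth_T3_const: "smooth_T3 (\<lambda>x. c)" by (simp add: smooth_T3_def Ck_T3_const)

lemma smooth_T3_add: "smooth_T3 f \<Longrightarrow> smooth_T3 g \<Longrightarrow> smooth_T3 (\<lambda>x. f x + g x)"
  by (simp add: smooth_T3_def Ck_T3_add)

lemma smooth_T3_diff: "smooth_T3 f \<Longrightarrow> smooth_T3 g \<Longrightarrow> smooth_T3 (\<lambda>x. f x - g x)"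
  by (simp add: smooth_T3_def Ck_T3_diff)

lemma smooth_T3_minus: "smooth_T3 f \<Longrightarrow> smooth_T3 (\<lambda>x. - f x)"
  by (simp add: smooth_T3_def Ck_T3_minus)

lemma smooth_T3_mult: "smooth_T3 f \<Longrightarrow> smooth_T3 g \<Longrightarrow> smooth_T3 (\<lambda>x. f x * g x :: real)"
  by (simp add: smooth_T3_def Ck_T3_mult)

lemma smooth_T3_inverse: "(\<And>x. f x \<noteq> (0::real)) \<Longrightarrow> smooth_T3 f \<Longrightarrow> smooth_T3 (\<lambda>x. inverse (f x))"
  by (simp add: smooth_T3_def Ck_T3_inverse)

lemma smooth_T3_sum: "(\<And>j. j \<in> J \<Longrightarrow> smooth_T3 (f j)) \<Longrightarrow> smooth_T3 (\<lambda>x. \<Sum>j\<in>J. f j x)"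
  by (simp add: smooth_T3_def Ck_T3_sum)

lemma smooth_T3_nth: "smooth_T3 v \<Longrightarrow> smooth_T3 (\<lambda>x. v x $ i :: real)"
  by (simp add: smooth_T3_def Ck_T3_nth)

lemma smooth_T3_vecI: "(\<And>i. smooth_T3 (\<lambda>x. v x $ i :: real)) \<Longrightarrow> smooth_T3 v"
  by (simp add: smooth_T3_def Ck_T3_vecI)

lemmas smooth_T3_intros = smooth_T3_const smooth_T3_add smooth_T3_diff smooth_T3_minus smooth_T3_mult
  smooth_T3_sum smooth_T3_nth smooth_T3_pd smooth_T3_pd'

lemma curl_nth:
  "curl v x $ 1 = pd 2 (\<lambda>y. v y $ 3) x - pd 3 (\<lambda>y. v y $ 2) x"
  "curl v x $ 2 = pd 3 (\<lambda>y. v y $ 1) x - pd 1 (\<lambda>y. v y $ 3) x"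
  "curl v x $ 3 = pd 1 (\<lambda>y. v y $ 2) x - pd 2 (\<lambda>y. v y $ 1) x"
  by (simp_all add: curl_def)

lemma grad_nth: "grad u x $ i = pd i u x" by (simp add: grad_def)

lemma jac_nth: "jac v x $ i $ j = pd j (\<lambda>y. v y $ i) x" by (simp add: jac_def)

lemma matrix_vector_nth: "(A *v (u :: real ^ 3)) $ i = A $ i $ 1 * u $ 1 + A $ i $ 2 * u $ 2 + A $ i $ 3 * u $ 3"
  by (simp add: matrix_vector_mult_def sum_3)

lemma diverg_3: "diverg v x = pd 1 (\<lambda>y. v y $ 1) x + pd 2 (\<lambda>y. v y $ 2) x + pd 3 (\<lambda>y. v y $ 3) x"
  by (simp add: diverg_def sum_3)

lemma inner_3: "(u :: real ^ 3) \<bullet> w = u $ 1 * w $ 1 + u $ 2 * w $ 2 + u $ 3 * w $ 3"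
  by (simp add: inner_vec_def sum_3)

lemma cross3_nth:
  "cross3 u w $ 1 = u $ 2 * w $ 3 - u $ 3 * w $ 2"
  "cross3 u w $ 2 = u $ 3 * w $ 1 - u $ 1 * w $ 3"
  "cross3 u w $ 3 = u $ 1 * w $ 2 - u $ 2 * w $ 1"
  by (simp_all add: cross3_def)

lemma mdiverg_nth:
  "mdiverg M x $ i = pd 1 (\<lambda>y. M y $ i $ 1) x + pd 2 (\<lambda>y. M y $ i $ 2) x + pd 3 (\<lambda>y. M y $ i $ 3) x"
  by (simp add: mdiverg_def sum_3)

lemma smooth_curl: "smooth_T3 v \<Longrightarrow> smooth_T3 (curl v)"
  by (rule smooth_T3_vecI, rule forall_3[THEN iffD2, rule_format])
    (simp add: curl_nth, intro conjI smooth_T3_intros; assumption)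

lemma smooth_grad: "smooth_T3 u \<Longrightarrow> smooth_T3 (grad u)"
  by (rule smooth_T3_vecI) (simp add: grad_nth, intro smooth_T3_intros)

lemma smooth_diverg: "smooth_T3 v \<Longrightarrow> smooth_T3 (diverg v)"
  unfolding diverg_def[abs_def] by (intro smooth_T3_intros)

lemma smooth_jac_mult: "smooth_T3 v \<Longrightarrow> smooth_T3 u \<Longrightarrow> smooth_T3 (\<lambda>x. jac v x *v (u x :: real ^ 3))"
  for v u :: "T3 \<Rightarrow> real ^ 3"
  by (rule smooth_T3_vecI) (simp add: matrix_vector_nth jac_nth, intro smooth_T3_intros)

lemma smooth_scaleR: "smooth_T3 f \<Longrightarrow> smooth_T3 v \<Longrightarrow> smooth_T3 (\<lambda>x. f x *\<^sub>R v x)"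
  for v :: "T3 \<Rightarrow> real ^ 3"
  by (rule smooth_T3_vecI) (simp, intro smooth_T3_intros)

lemma smooth_inner: "smooth_T3 u \<Longrightarrow> smooth_T3 v \<Longrightarrow> smooth_T3 (\<lambda>x. u x \<bullet> v x)"
  for u v :: "T3 \<Rightarrow> real ^ 3"
  by (simp add: inner_3) (intro smooth_T3_intros)

section \<open>Coefficients determined by the initial data\<close>

locale initial_data =
  fixes h0 :: "T3 \<Rightarrow> real" and B0 :: "T3 \<Rightarrow> real ^ 3"
  assumes sh0: "smooth_T3 h0" and h0_pos: "\<And>x. h0 x > 0"
    and sB0: "smooth_T3 B0" and div_B0: "\<And>x. diverg B0 x = 0"
begin

text \<open>The coefficients of the formal expansion of a solution of the Darcy system in terms of its own time
  \<open>\<theta>\<close>: \<open>1/h = \<tau>\<^sub>0 + \<theta> \<tau>\<^sub>1 + \<dots>\<close> and \<open>B/h = b\<^sub>0 + \<theta> b\<^sub>1 + \<dots>\<close>, while \<open>D/h\<close> and \<open>P/h\<close> start with \<open>d\<^sub>1\<close> and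
  \<open>v\<^sub>1\<close>. They are the values for which the field \<open>L\<close> of the relative entropy inequality vanishes at
  time zero. The index \<open>1\<close> of \<open>d\<^sub>1\<close> and \<open>v\<^sub>1\<close> refers to the Born-Infeld solution, in which \<open>D\<close> and \<open>P\<close>
  start with \<open>t h\<^sub>0 d\<^sub>1\<close> and \<open>t h\<^sub>0 v\<^sub>1\<close>.\<close>

definition tau0 :: "T3 \<Rightarrow> real" where "tau0 x = inverse (h0 x)"
definition b0 :: "T3 \<Rightarrow> real ^ 3" where "b0 x = tau0 x *\<^sub>R B0 x"
definition d1 :: "T3 \<Rightarrow> real ^ 3" where "d1 x = tau0 x *\<^sub>R curl b0 x"
definition v1 :: "T3 \<Rightarrow> real ^ 3" where "v1 x = jac b0 x *v b0 x + tau0 x *\<^sub>R grad tau0 x"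
definition tau1 :: "T3 \<Rightarrow> real" where "tau1 x = tau0 x * diverg v1 x - v1 x \<bullet> grad tau0 x"
definition b1 :: "T3 \<Rightarrow> real ^ 3"
  where "b1 x = jac v1 x *v b0 x - jac b0 x *v v1 x - tau0 x *\<^sub>R curl d1 x"

lemma h0_nz: "h0 x \<noteq> 0" using h0_pos[of x] by simp

lemma smooth_tau0: "smooth_T3 tau0"
  unfolding tau0_def[abs_def] by (rule smooth_T3_inverse[OF h0_nz sh0])

lemma smooth_b0: "smooth_T3 b0" unfolding b0_def[abs_def] by (intro smooth_scaleR smooth_tau0 sB0)

lemma smooth_d1: "smooth_T3 d1"
  unfolding d1_def[abs_def] by (intro smooth_scaleR smooth_tau0 smooth_curl smooth_b0)

lemma smooth_v1: "smooth_T3 v1"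
  unfolding v1_def[abs_def]
  by (intro smooth_T3_add smooth_scaleR smooth_tau0 smooth_jac_mult smooth_grad smooth_b0)

lemma smooth_tau1: "smooth_T3 tau1"
  unfolding tau1_def[abs_def]
  by (intro smooth_T3_diff smooth_T3_mult smooth_inner smooth_diverg smooth_grad smooth_tau0 smooth_v1)

lemma smooth_b1: "smooth_T3 b1"
  unfolding b1_def[abs_def]
  by (intro smooth_T3_diff smooth_scaleR smooth_curl smooth_jac_mult smooth_tau0 smooth_v1 smooth_b0 smooth_d1)

lemma tau0_h0: "h0 x * tau0 x = 1" using h0_nz by (simp add: tau0_def)

lemma B0_eq: "B0 x = h0 x *\<^sub>R b0 x" using tau0_h0[of x] by (simp add: b0_def)

lemmas diff_nth = smooth_T3_differentiable[OF smooth_T3_nth]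
lemmas dh0 = smooth_T3_differentiable[OF sh0]
lemmas dtau0 = smooth_T3_differentiable[OF smooth_tau0]
lemmas dB0 = diff_nth[OF sB0] and db0 = diff_nth[OF smooth_b0] and dv1 = diff_nth[OF smooth_v1]
  and dd1 = diff_nth[OF smooth_d1]

lemma pd_h0: "pd j h0 x = - (h0 x * h0 x * pd j tau0 x)"
proof -
  have "pd j tau0 x = - (pd j h0 x * (tau0 x * tau0 x))"
    unfolding tau0_def[abs_def] by (rule pd_inverse(2)[OF dh0 h0_nz])
  then show ?thesis using tau0_h0[of x] by algebra
qed

lemma pd_B0: "pd j (\<lambda>y. B0 y $ i) x = h0 x * pd j (\<lambda>y. b0 y $ i) x - h0 x * h0 x * pd j tau0 x * b0 x $ i"
proof -
  have "(\<lambda>y. B0 y $ i) = (\<lambda>y. h0 y * b0 y $ i)" by (intro ext) (simp add: B0_eq)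
  then show ?thesis using pd_mult(2)[OF dh0 db0, of j i x] by (simp add: pd_h0)
qed

text \<open>The initial accelerations of the augmented system: with \<open>D\<^sub>0 = P\<^sub>0 = 0\<close> the right-hand sides
  of the equations for \<open>D\<close> and \<open>P\<close> at time zero are \<open>h\<^sub>0 d\<^sub>1\<close> and \<open>h\<^sub>0 v\<^sub>1\<close>.\<close>

lemma initial_D: "- curl (\<lambda>y. (0 - B0 y) /\<^sub>R h0 y) x = h0 x *\<^sub>R d1 x"
proof -
  have e: "(\<lambda>y. ((0 - B0 y) /\<^sub>R h0 y) $ i) = (\<lambda>y. - (b0 y $ i))" for i
    by (intro ext) (simp add: b0_def tau0_def)
  have "\<forall>i. (- curl (\<lambda>y. (0 - B0 y) /\<^sub>R h0 y) x) $ i = (h0 x *\<^sub>R d1 x) $ i"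
    unfolding forall_3 vector_uminus_component curl_nth e using tau0_h0[of x]
    by (simp add: curl_nth pd_minus(2)[OF db0] d1_def mult.assoc[symmetric])
  then show ?thesis by (simp add: vec_eq_iff)
qed

lemma initial_P:
  "- mdiverg (\<lambda>y. (- outer (B0 y) (B0 y) - mat 1) /\<^sub>R h0 y) x = h0 x *\<^sub>R v1 x"
proof -
  define del :: "3 \<Rightarrow> 3 \<Rightarrow> real" where "del i j = (if i = j then 1 else 0)" for i j
  have e: "(\<lambda>y. ((- outer (B0 y) (B0 y) - mat 1) /\<^sub>R h0 y) $ i $ j)
      = (\<lambda>y. - (B0 y $ j * b0 y $ i) - del i j * tau0 y)" for i j
    by (intro ext) (simp add: outer_def mat_def b0_def tau0_def del_def algebra_simps)
  have p: "pd j (\<lambda>y. - (B0 y $ j * b0 y $ i) - del i j * tau0 y) x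
      = - (B0 x $ j * pd j (\<lambda>y. b0 y $ i) x + pd j (\<lambda>y. B0 y $ j) x * b0 x $ i) - del i j * pd j tau0 x" for i j
    by (subst pd_diff(2) pd_minus(2) pd_mult(2) pd_const,
        (intro pd_minus(1) pd_mult(1) pd_const(1) dB0 db0 dtau0)+)+ (simp add: pd_const(2))
  have "\<forall>i. (- mdiverg (\<lambda>y. (- outer (B0 y) (B0 y) - mat 1) /\<^sub>R h0 y) x) $ i = (h0 x *\<^sub>R v1 x) $ i"
  proof
    fix i
    have B: "B0 x $ k = h0 x * b0 x $ k" for k by (simp add: B0_eq)
    have "(- mdiverg (\<lambda>y. (- outer (B0 y) (B0 y) - mat 1) /\<^sub>R h0 y) x) $ i
      = B0 x $ 1 * pd 1 (\<lambda>y. b0 y $ i) x + B0 x $ 2 * pd 2 (\<lambda>y. b0 y $ i) x + B0 x $ 3 * pd 3 (\<lambda>y. b0 y $ i) x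
        + diverg B0 x * b0 x $ i + (del i 1 * pd 1 tau0 x + del i 2 * pd 2 tau0 x + del i 3 * pd 3 tau0 x)"
      unfolding vector_uminus_component mdiverg_nth e p diverg_3 by (simp add: algebra_simps)
    also have "del i 1 * pd 1 tau0 x + del i 2 * pd 2 tau0 x + del i 3 * pd 3 tau0 x = pd i tau0 x"
      using exhaust_3[of i] by (auto simp: del_def)
    finally show "(- mdiverg (\<lambda>y. (- outer (B0 y) (B0 y) - mat 1) /\<^sub>R h0 y) x) $ i = (h0 x *\<^sub>R v1 x) $ i"
      unfolding div_B0 v1_def matrix_vector_nth jac_nth grad_nth vector_scaleR_component vector_add_component
        real_scaleR_def B
      using tau0_h0[of x] by algebra
  qed
  then show ?thesis by (simp add: vec_eq_iff)
qed

text \<open>Once \<open>D\<close> and \<open>P\<close> are known to grow like \<open>t h\<^sub>0 d\<^sub>1\<close> and \<open>t h\<^sub>0 v\<^sub>1\<close>, the equations for \<open>h\<close> and \<open>B\<close> have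
  right-hand sides linear in \<open>t\<close>. Their coefficients are the \<open>\<theta>\<close>-derivatives of \<open>1/(\<tau>\<^sub>0 + \<theta> \<tau>\<^sub>1)\<close> and
  \<open>(b\<^sub>0 + \<theta> b\<^sub>1)/(\<tau>\<^sub>0 + \<theta> \<tau>\<^sub>1)\<close> at \<open>\<theta> = 0\<close>, which is why \<open>\<theta> = t\<^sup>2/2\<close> matches the two systems.\<close>

lemma initial_h: "diverg (\<lambda>y. h0 y *\<^sub>R v1 y) x = h0 x * h0 x * tau1 x"
proof -
  have p: "pd i (\<lambda>y. (h0 y *\<^sub>R v1 y) $ i) x = h0 x * pd i (\<lambda>y. v1 y $ i) x + pd i h0 x * v1 x $ i" for i
    using pd_mult(2)[OF dh0 dv1, of i i x] by simp
  show ?thesis unfolding diverg_3 p tau1_def inner_3 grad_nth pd_h0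
    using tau0_h0[of x] by algebra
qed

lemma initial_B:
  "- curl (\<lambda>y. cross3 (B0 y) (v1 y) + d1 y) x = h0 x *\<^sub>R b1 x - (h0 x * h0 x * tau1 x) *\<^sub>R b0 x"
proof -
  have pc: "pd j (\<lambda>y. B0 y $ k * v1 y $ l - B0 y $ m * v1 y $ n + d1 y $ i) x
      = B0 x $ k * pd j (\<lambda>y. v1 y $ l) x + pd j (\<lambda>y. B0 y $ k) x * v1 x $ l
        - (B0 x $ m * pd j (\<lambda>y. v1 y $ n) x + pd j (\<lambda>y. B0 y $ m) x * v1 x $ n) + pd j (\<lambda>y. d1 y $ i) x"
    for i j k l m n
    by (simp add: pd_add(2) pd_diff(2) pd_mult(2) pd_diff(1) pd_mult(1) dB0 dv1 dd1)
  have dv: "h0 x * pd 1 (\<lambda>y. b0 y $ 1) x - h0 x * h0 x * pd 1 tau0 x * b0 x $ 1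
     + (h0 x * pd 2 (\<lambda>y. b0 y $ 2) x - h0 x * h0 x * pd 2 tau0 x * b0 x $ 2)
     + (h0 x * pd 3 (\<lambda>y. b0 y $ 3) x - h0 x * h0 x * pd 3 tau0 x * b0 x $ 3) = 0"
    using div_B0[of x] unfolding diverg_3 pd_B0 .
  have B: "B0 x $ i = h0 x * b0 x $ i" for i by (simp add: B0_eq)
  have "\<forall>i. (- curl (\<lambda>y. cross3 (B0 y) (v1 y) + d1 y) x) $ i
      = (h0 x *\<^sub>R b1 x - (h0 x * h0 x * tau1 x) *\<^sub>R b0 x) $ i"
    unfolding forall_3
    unfolding curl_nth vector_uminus_component vector_minus_component vector_add_component cross3_nth pc
      pd_B0 B vector_scaleR_component b1_def tau1_def matrix_vector_nth jac_nth inner_3 grad_nth diverg_3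
      real_scaleR_def
    using tau0_h0[of x] dv by (intro conjI; algebra)
  then show ?thesis by (simp add: vec_eq_iff)
qed

end

section \<open>Taylor expansion of the Born-Infeld solution\<close>

definition cubic_T :: "real \<Rightarrow> (real \<Rightarrow> T3 \<Rightarrow> real) \<Rightarrow> (real \<Rightarrow> T3 \<Rightarrow> real) \<Rightarrow> bool"
  where "cubic_T T f g \<longleftrightarrow> (\<exists>C\<ge>0. \<forall>t\<in>{0..T}. \<forall>x. \<bar>f t x - g t x\<bar> \<le> C * t ^ 3)"

lemma taylor_cubic:
  assumes f: "Ck_ST T (Suc k) f" and cl: "close_T T (dt T f) (\<lambda>t x. t ^ p * X x)"
  shows "cubic_T T f (\<lambda>t x. f 0 x + t ^ Suc p / Suc p * X x)"
proof -
  obtain C where C: "C \<ge> 0" "\<And>t x. t \<in> {0..T} \<Longrightarrow> \<bar>dt T f t x - t ^ p * X x\<bar> \<le> C * t\<^sup>2"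
    using cl unfolding close_T_def by blast
  have hv: "((\<lambda>t. f t x - (f 0 x + t ^ Suc p / Suc p * X x)) has_vector_derivative (dt T f t x - t ^ p * X x)) (at t within {0..T})"
    if "t \<in> {0..T}" for t x
  proof (intro has_vector_derivative_diff Ck_ST_has_dt[OF f that])
    have "((\<lambda>t. f 0 x + t ^ Suc p / Suc p * X x) has_real_derivative t ^ p * X x) (at t within {0..T})"
      by (auto intro!: derivative_eq_intros simp del: power_Suc)
    then show "((\<lambda>t. f 0 x + t ^ Suc p / Suc p * X x) has_vector_derivative t ^ p * X x) (at t within {0..T})"
      by (simp add: has_real_derivative_iff_has_vector_derivative)
  qed
  have "\<bar>f t x - (f 0 x + t ^ Suc p / Suc p * X x)\<bar> \<le> C * t ^ Suc 2" if t: "t \<in> {0..T}" for t x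
    by (rule growth_bound[OF hv _ C(2) C(1) t]) auto
  then show ?thesis unfolding cubic_T_def using C(1) by (intro exI[of _ C]) (auto simp: numeral_3_eq_3 numeral_2_eq_2)
qed

lemma expands_eq:
  assumes "expands T p f g" "\<And>t x. f' t x = f t x" "\<And>x. g' x = g x" shows "expands T p f' g'"
proof -
  have "f' = f" "g' = g" using assms(2,3) by (auto intro!: ext)
  then show ?thesis using assms(1) by simp
qed

lemma close_T_diff:
  "close_T T f f' \<Longrightarrow> close_T T g g' \<Longrightarrow> close_T T (\<lambda>t x. f t x - g t x) (\<lambda>t x. f' t x - g' t x)"
  using close_T_add[OF _ close_T_minus, of T f f' g g'] by simp

lemma expands_curl:
  fixes F :: "real \<Rightarrow> T3 \<Rightarrow> real ^ 3"
  assumes "\<And>k. expands T p (\<lambda>t y. F t y $ k) (\<lambda>y. G y $ k)"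
  shows "close_T T (\<lambda>t x. curl (F t) x $ i) (\<lambda>t x. t ^ p * curl G x $ i)"
proof -
  have c: "close_T T (\<lambda>t x. pd a (\<lambda>y. F t y $ k) x - pd b (\<lambda>y. F t y $ l) x)
      (\<lambda>t x. t ^ p * pd a (\<lambda>y. G y $ k) x - t ^ p * pd b (\<lambda>y. G y $ l) x)" for a b k l
    by (intro close_T_diff expandsD(7) assms)
  have "\<forall>i. close_T T (\<lambda>t x. curl (F t) x $ i) (\<lambda>t x. t ^ p * curl G x $ i)"
    unfolding forall_3 curl_nth right_diff_distrib by (intro conjI c)
  then show ?thesis by blast
qed

lemma expands_diverg:
  fixes F :: "real \<Rightarrow> T3 \<Rightarrow> real ^ 3"
  assumes "\<And>k. expands T p (\<lambda>t y. F t y $ k) (\<lambda>y. G y $ k)"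
  shows "close_T T (\<lambda>t x. diverg (F t) x) (\<lambda>t x. t ^ p * diverg G x)"
  unfolding diverg_3 distrib_left by (intro close_T_add expandsD(7) assms)

lemma expands_mdiverg:
  fixes F :: "real \<Rightarrow> T3 \<Rightarrow> real ^ 3 ^ 3"
  assumes "\<And>k l. expands T p (\<lambda>t y. F t y $ k $ l) (\<lambda>y. G y $ k $ l)"
  shows "close_T T (\<lambda>t x. mdiverg (F t) x $ i) (\<lambda>t x. t ^ p * mdiverg G x $ i)"
  unfolding mdiverg_nth distrib_left by (intro close_T_add expandsD(7) assms)

lemma curl_zero [simp]: "curl (\<lambda>y. 0) x = 0"
proof -
  have "\<forall>i. curl (\<lambda>y. 0) x $ i = 0" unfolding forall_3 curl_nth by (simp add: pd_const)
  then show ?thesis by (simp add: vec_eq_iff)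
qed

lemma outer_zero [simp]: "outer 0 0 = 0" by (simp add: outer_def vec_eq_iff)

context initial_data
begin

text \<open>The data make \<open>h\<close>, \<open>B\<close> even and \<open>D\<close>, \<open>P\<close> odd to second order. Hence each flux has a one-term expansion:
  the terms quadratic in \<open>D\<close>, \<open>P\<close> are \<open>O(t\<^sup>2)\<close> and disappear, and integrating the equations in time gains
  one order.\<close>

theorem ABI_expansion:
  fixes T :: real
  assumes T: "T > 0" and sh: "smooth_ST T h" and sB: "smooth_ST T B" and sD: "smooth_ST T D" and sP: "smooth_ST T P"
    and pos: "\<And>t x. t \<in> {0..T} \<Longrightarrow> h t x > 0" and ABI: "ABI_solution T h B D P"
    and init: "\<And>x. h 0 x = h0 x" "\<And>x. B 0 x = B0 x" "\<And>x. D 0 x = 0" "\<And>x. P 0 x = 0"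
  shows "cubic_T T h (\<lambda>t x. h0 x - t\<^sup>2 / 2 * (h0 x * h0 x * tau1 x))"
    and "cubic_T T (\<lambda>t x. B t x $ i) (\<lambda>t x. B0 x $ i + t\<^sup>2 / 2 * (h0 x * b1 x $ i - h0 x * h0 x * tau1 x * b0 x $ i))"
    and "cubic_T T (\<lambda>t x. D t x $ i) (\<lambda>t x. t * (h0 x * d1 x $ i))"
    and "cubic_T T (\<lambda>t x. P t x $ i) (\<lambda>t x. t * (h0 x * v1 x $ i))"
proof -
  have z: "0 \<in> {0..T}" and T0: "T \<ge> 0" using T by auto
  note L = bounded_linear_vec_nth
  have ck: "Ck_ST T k h" "Ck_ST T k B" "Ck_ST T k D" "Ck_ST T k P" for k
    using sh sB sD sP by (auto simp: smooth_ST_def)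
  have ckn: "Ck_ST T k (\<lambda>t x. B t x $ j)" "Ck_ST T k (\<lambda>t x. D t x $ j)" "Ck_ST T k (\<lambda>t x. P t x $ j)" for k j
    by (intro Ck_ST_bounded_linear(1)[OF L T] ck)+
  have dtn: "dt T (\<lambda>t x. B t x $ j) t x = dt T B t x $ j" "dt T (\<lambda>t x. D t x $ j) t x = dt T D t x $ j"
    "dt T (\<lambda>t x. P t x $ j) t x = dt T P t x $ j" if "t \<in> {0..T}" for t x j
    by (intro Ck_ST_bounded_linear(2)[OF L T ck(2) that] Ck_ST_bounded_linear(2)[OF L T ck(3) that]
        Ck_ST_bounded_linear(2)[OF L T ck(4) that])+
  have i0: "h 0 = h0" "B 0 = B0" "D 0 = (\<lambda>x. 0)" "P 0 = (\<lambda>x. 0)" using init by auto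
  have eqs: "dt T h t x = - diverg (P t) x"
    "dt T B t x = - curl (\<lambda>y. (cross3 (B t y) (P t y) + D t y) /\<^sub>R h t y) x"
    "dt T D t x = - curl (\<lambda>y. (cross3 (D t y) (P t y) - B t y) /\<^sub>R h t y) x"
    "dt T P t x = - mdiverg (\<lambda>y. (outer (P t y) (P t y) - outer (B t y) (B t y) - outer (D t y) (D t y) - mat 1) /\<^sub>R h t y) x"
    if "t \<in> {0..T}" for t x
    using ABI[unfolded ABI_solution_def, rule_format, OF that, of x] by (auto simp: eq_neg_iff_add_eq_0)
  have dh0: "dt T h 0 x = 0" for x using eqs(1)[OF z, of x] by (simp add: i0 diverg_3 pd_const)
  have dB0: "dt T B 0 x = 0" for x using eqs(2)[OF z, of x] by (simp add: i0)
  have dD0: "dt T D 0 x = h0 x *\<^sub>R d1 x" for x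
    using eqs(3)[OF z, of x] initial_D[of x] by (simp only: i0 cross_zero_left cross_zero_right cross_refl)
  have dP0: "dt T P 0 x = h0 x *\<^sub>R v1 x" for x
    using eqs(4)[OF z, of x] initial_P[of x] by (simp add: i0)
  have Eh: "expands T 0 h h0" using expands_even[OF ck(1) T dh0] by (simp add: i0)
  have EB: "expands T 0 (\<lambda>t x. B t x $ j) (\<lambda>x. B0 x $ j)" for j
    using expands_even[OF ckn(1) T, of j] dtn(1)[OF z, of j] dB0 by (simp add: i0)
  have ED: "expands T 1 (\<lambda>t x. D t x $ j) (\<lambda>x. h0 x * d1 x $ j)" for j
  proof -
    have "dt T (\<lambda>t x. D t x $ j) 0 = (\<lambda>x. h0 x * d1 x $ j)" using dtn(2)[OF z, of j] dD0 by (intro ext) simp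
    then show ?thesis using expands_odd[OF ckn(2) T, of j] by (simp add: i0)
  qed
  have EP: "expands T 1 (\<lambda>t x. P t x $ j) (\<lambda>x. h0 x * v1 x $ j)" for j
  proof -
    have "dt T (\<lambda>t x. P t x $ j) 0 = (\<lambda>x. h0 x * v1 x $ j)" using dtn(3)[OF z, of j] dP0 by (intro ext) simp
    then show ?thesis using expands_odd[OF ckn(3) T, of j] by (simp add: i0)
  qed
  have EI: "expands T 0 (\<lambda>t x. inverse (h t x)) tau0"
  proof -
    have ne: "{0..T} \<times> (UNIV :: T3 set) \<noteq> {}" using T by auto
    obtain z0 where z0: "z0 \<in> {0..T} \<times> (UNIV :: T3 set)"
      "\<forall>y\<in>{0..T} \<times> (UNIV :: T3 set). case_prod h z0 \<le> case_prod h y"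
      using continuous_attains_inf[OF compact_slab ne Ck_ST_continuous[OF ck(1)]] by blast
    define m where "m = case_prod h z0"
    have m: "m > 0" using z0(1) pos by (auto simp: m_def split_beta)
    have le: "m \<le> h t x" if "t \<in> {0..T}" for t x using z0(2) that unfolding m_def by force
    have "m \<le> h0 x" for x using le[OF z, of x] i0 by simp
    from expands_inverse[OF Eh T0 m le this] show ?thesis by (rule expands_eq) (simp_all add: tau0_def)
  qed
  have q2: "expands T 0 (\<lambda>t x. f t x * g t x) (\<lambda>x. 0)" if "expands T 1 f f'" "expands T 1 g g'" for f f' g g'
    using expands_2_0[OF _ T0] expands_mult[OF that T0] by (simp add: numeral_2_eq_2)
  have m01: "expands T 1 (\<lambda>t x. f t x * g t x) (\<lambda>x. f' x * g' x)" if "expands T 0 f f'" "expands T 1 g g'" for f f' g g'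
    using expands_mult[OF that T0] by simp
  have m00: "expands T 0 (\<lambda>t x. f t x * g t x) (\<lambda>x. f' x * g' x)" if "expands T 0 f f'" "expands T 0 g g'" for f f' g g'
    using expands_mult[OF that T0] by simp
  have cancel: "tau0 x * (p * (h0 x * q) - r * (h0 x * s) + h0 x * e) = p * q - r * s + e" for x p q r s e
    using tau0_h0[of x] by algebra
  have E1: "expands T 1 (\<lambda>t y. ((cross3 (B t y) (P t y) + D t y) /\<^sub>R h t y) $ k) (\<lambda>y. (cross3 (B0 y) (v1 y) + d1 y) $ k)" for k
  proof -
    have c: "expands T 1 (\<lambda>t y. inverse (h t y) * (B t y $ a * P t y $ b - B t y $ c * P t y $ d + D t y $ e))
      (\<lambda>y. tau0 y * (B0 y $ a * (h0 y * v1 y $ b) - B0 y $ c * (h0 y * v1 y $ d) + h0 y * d1 y $ e))" for a b c d e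
      by (intro m01 EI expands_add expands_diff EB EP ED)
    have "\<forall>k. expands T 1 (\<lambda>t y. ((cross3 (B t y) (P t y) + D t y) /\<^sub>R h t y) $ k) (\<lambda>y. (cross3 (B0 y) (v1 y) + d1 y) $ k)"
      unfolding forall_3
    proof (intro conjI)
      show "expands T 1 (\<lambda>t y. ((cross3 (B t y) (P t y) + D t y) /\<^sub>R h t y) $ 1) (\<lambda>y. (cross3 (B0 y) (v1 y) + d1 y) $ 1)"
        by (rule expands_eq[OF c[of 2 3 3 2 1]]) (simp_all add: cross3_nth cancel)
      show "expands T 1 (\<lambda>t y. ((cross3 (B t y) (P t y) + D t y) /\<^sub>R h t y) $ 2) (\<lambda>y. (cross3 (B0 y) (v1 y) + d1 y) $ 2)"
        by (rule expands_eq[OF c[of 3 1 1 3 2]]) (simp_all add: cross3_nth cancel)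
      show "expands T 1 (\<lambda>t y. ((cross3 (B t y) (P t y) + D t y) /\<^sub>R h t y) $ 3) (\<lambda>y. (cross3 (B0 y) (v1 y) + d1 y) $ 3)"
        by (rule expands_eq[OF c[of 1 2 2 1 3]]) (simp_all add: cross3_nth cancel)
    qed
    then show ?thesis by blast
  qed
  have E2: "expands T 0 (\<lambda>t y. ((cross3 (D t y) (P t y) - B t y) /\<^sub>R h t y) $ k) (\<lambda>y. ((0 - B0 y) /\<^sub>R h0 y) $ k)" for k
  proof -
    have c: "expands T 0 (\<lambda>t y. inverse (h t y) * (D t y $ a * P t y $ b - D t y $ c * P t y $ d - B t y $ e))
      (\<lambda>y. tau0 y * (0 - 0 - B0 y $ e))" for a b c d e
      by (intro m00 EI expands_diff EB) (rule q2[OF ED EP])+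
    have "\<forall>k. expands T 0 (\<lambda>t y. ((cross3 (D t y) (P t y) - B t y) /\<^sub>R h t y) $ k) (\<lambda>y. ((0 - B0 y) /\<^sub>R h0 y) $ k)"
      unfolding forall_3
    proof (intro conjI)
      show "expands T 0 (\<lambda>t y. ((cross3 (D t y) (P t y) - B t y) /\<^sub>R h t y) $ 1) (\<lambda>y. ((0 - B0 y) /\<^sub>R h0 y) $ 1)"
        by (rule expands_eq[OF c[of 2 3 3 2 1]]) (simp_all add: cross3_nth tau0_def)
      show "expands T 0 (\<lambda>t y. ((cross3 (D t y) (P t y) - B t y) /\<^sub>R h t y) $ 2) (\<lambda>y. ((0 - B0 y) /\<^sub>R h0 y) $ 2)"
        by (rule expands_eq[OF c[of 3 1 1 3 2]]) (simp_all add: cross3_nth tau0_def)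
      show "expands T 0 (\<lambda>t y. ((cross3 (D t y) (P t y) - B t y) /\<^sub>R h t y) $ 3) (\<lambda>y. ((0 - B0 y) /\<^sub>R h0 y) $ 3)"
        by (rule expands_eq[OF c[of 1 2 2 1 3]]) (simp_all add: cross3_nth tau0_def)
    qed
    then show ?thesis by blast
  qed
  have E3: "expands T 0 (\<lambda>t y. ((outer (P t y) (P t y) - outer (B t y) (B t y) - outer (D t y) (D t y) - mat 1) /\<^sub>R h t y) $ k $ l)
      (\<lambda>y. ((- outer (B0 y) (B0 y) - mat 1) /\<^sub>R h0 y) $ k $ l)" for k l
  proof -
    have "expands T 0 (\<lambda>t y. inverse (h t y) * (P t y $ k * P t y $ l - B t y $ k * B t y $ l - D t y $ k * D t y $ l
        - (if k = l then 1 else 0))) (\<lambda>y. tau0 y * (0 - B0 y $ k * B0 y $ l - 0 - (if k = l then 1 else 0)))"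
      by (intro m00 EI expands_diff EB expands_const) (rule q2[OF EP EP] q2[OF ED ED])+
    then show ?thesis by (rule expands_eq) (simp_all add: outer_def mat_def tau0_def)
  qed
  have c2: "t ^ Suc 1 / real (Suc 1) = t\<^sup>2 / 2" for t :: real by (simp add: power2_eq_square)
  have "close_T T (dt T h) (\<lambda>t x. t ^ 1 * - (h0 x * h0 x * tau1 x))"
  proof (rule close_T_cong[OF close_T_minus[OF expands_diverg[where F = P and p = 1 and G = "\<lambda>y. h0 y *\<^sub>R v1 y"]]])
    show "expands T 1 (\<lambda>t y. P t y $ k) (\<lambda>y. (h0 y *\<^sub>R v1 y) $ k)" for k using EP by simp
  qed (simp_all add: eqs(1) initial_h)
  from taylor_cubic[OF ck(1) this] show "cubic_T T h (\<lambda>t x. h0 x - t\<^sup>2 / 2 * (h0 x * h0 x * tau1 x))"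
    unfolding c2 by (simp add: i0)
  have "close_T T (dt T (\<lambda>t x. B t x $ i)) (\<lambda>t x. t ^ 1 * (h0 x * b1 x $ i - h0 x * h0 x * tau1 x * b0 x $ i))"
  proof (rule close_T_cong[OF close_T_minus[OF expands_curl[OF E1, of i]]])
    show "t ^ 1 * (h0 x * b1 x $ i - h0 x * h0 x * tau1 x * b0 x $ i)
        = - (t ^ 1 * curl (\<lambda>y. cross3 (B0 y) (v1 y) + d1 y) x $ i)" for t x
    proof -
      have e: "h0 x * b1 x $ i - h0 x * h0 x * tau1 x * b0 x $ i = - (curl (\<lambda>y. cross3 (B0 y) (v1 y) + d1 y) x $ i)"
        using arg_cong[OF initial_B[of x], of "\<lambda>v. v $ i"] by simp
      show ?thesis unfolding e by simp
    qed
  qed (simp add: dtn eqs(2))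
  from taylor_cubic[OF ckn(1) this]
  show "cubic_T T (\<lambda>t x. B t x $ i) (\<lambda>t x. B0 x $ i + t\<^sup>2 / 2 * (h0 x * b1 x $ i - h0 x * h0 x * tau1 x * b0 x $ i))"
    unfolding c2 by (simp add: i0)
  have "close_T T (dt T (\<lambda>t x. D t x $ i)) (\<lambda>t x. t ^ 0 * (h0 x * d1 x $ i))"
  proof (rule close_T_cong[OF close_T_minus[OF expands_curl[OF E2, of i]]])
    show "t ^ 0 * (h0 x * d1 x $ i) = - (t ^ 0 * curl (\<lambda>y. (0 - B0 y) /\<^sub>R h0 y) x $ i)" for t x
      using arg_cong[OF initial_D[of x], of "\<lambda>v. v $ i"] by simp
  qed (simp add: dtn eqs(3))
  from taylor_cubic[OF ckn(2) this] show "cubic_T T (\<lambda>t x. D t x $ i) (\<lambda>t x. t * (h0 x * d1 x $ i))"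
    by (simp add: i0)
  have "close_T T (dt T (\<lambda>t x. P t x $ i)) (\<lambda>t x. t ^ 0 * (h0 x * v1 x $ i))"
  proof (rule close_T_cong[OF close_T_minus[OF expands_mdiverg[OF E3, of i]]])
    show "t ^ 0 * (h0 x * v1 x $ i) = - (t ^ 0 * mdiverg (\<lambda>y. (- outer (B0 y) (B0 y) - mat 1) /\<^sub>R h0 y) x $ i)" for t x
      using arg_cong[OF initial_P[of x], of "\<lambda>v. v $ i"] by simp
  qed (simp add: dtn eqs(4))
  from taylor_cubic[OF ckn(3) this] show "cubic_T T (\<lambda>t x. P t x $ i) (\<lambda>t x. t * (h0 x * v1 x $ i))"
    by (simp add: i0)
qed

end

section \<open>Coercivity of the matrices Q\<close>

definition first_block :: "i10 \<Rightarrow> bool"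
  where "first_block i = (case i of Inl _ \<Rightarrow> True | Inr (Inl _) \<Rightarrow> True | Inr (Inr _) \<Rightarrow> False)"

lemma i10_cases:
  fixes i :: i10
  obtains "i = Inl 1" | k where "i = Inr (Inl k)" | k where "i = Inr (Inr (Inl k))" | k where "i = Inr (Inr (Inr k))"
  using UNIV_i10 by blast

lemma Qmat_transpose: "transpose (Qmat b d v x) = Qmat b d v x"
proof -
  have "Qmat b d v x $ j $ i = Qmat b d v x $ i $ j" for i j
    by (cases i rule: i10_cases; cases j rule: i10_cases)
      (auto simp: Qmat_def transpose_def mat_def)
  then show ?thesis by (simp add: transpose_def vec_eq_iff)
qed

lemma Qr_transpose: "transpose (Qr r b d v x) = Qr r b d v x"
proof -
  have "Qr r b d v x $ j $ i = Qr r b d v x $ i $ j" for i j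
    using arg_cong[OF Qmat_transpose[of b d v x], of "\<lambda>M. M $ i $ j"] by (auto simp: Qr_def transpose_def)
  then show ?thesis by (simp add: transpose_def vec_eq_iff)
qed

lemma abs_curl_le:
  assumes "\<And>i j. \<bar>pd j (\<lambda>y. v y $ i) x\<bar> \<le> K" shows "\<bar>curl v x $ i\<bar> \<le> 2 * K"
proof -
  have *: "\<bar>pd j (\<lambda>y. v y $ i) x - pd l (\<lambda>y. v y $ k) x\<bar> \<le> 2 * K" for i j k l
    using assms[of j i] assms[of l k] by linarith
  have "\<forall>i. \<bar>curl v x $ i\<bar> \<le> 2 * K" unfolding forall_3 curl_nth by (intro conjI *)
  then show ?thesis by blast
qed

lemma Qmat_entry_le:
  assumes b: "\<And>i j. \<bar>pd j (\<lambda>y. b y $ i) x\<bar> \<le> K" and d: "\<And>i j. \<bar>pd j (\<lambda>y. d y $ i) x\<bar> \<le> K"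
    and v: "\<And>i j. \<bar>pd j (\<lambda>y. v y $ i) x\<bar> \<le> K"
  shows "\<bar>Qmat b d v x $ i $ j\<bar> \<le> 6 * K + 2"
proof -
  have K: "K \<ge> 0" using b[of 1 1] by linarith
  have dv: "\<bar>- 2 * diverg v x\<bar> \<le> 6 * K + 2"
  proof -
    have "\<bar>diverg v x\<bar> \<le> 3 * K" using v[of 1 1] v[of 2 2] v[of 3 3] unfolding diverg_3 by linarith
    then show ?thesis by (simp add: abs_mult)
  qed
  have c: "\<bar>curl d x $ l\<bar> \<le> 6 * K + 2" "\<bar>- (curl b x $ l)\<bar> \<le> 6 * K + 2" for l
    using abs_curl_le[of d x K l] abs_curl_le[of b x K l] d b K by auto
  have j1: "\<bar>- jac v x $ k $ l - jac v x $ l $ k\<bar> \<le> 6 * K + 2" for k l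
    using v[of l k] v[of k l] K unfolding jac_nth by linarith
  have j2: "\<bar>jac b x $ k $ l - jac b x $ l $ k\<bar> \<le> 6 * K + 2" for k l
    using b[of l k] b[of k l] K unfolding jac_nth by linarith
  show ?thesis using K dv c j1 j2
    by (cases i rule: i10_cases; cases j rule: i10_cases)
      (auto simp: Qmat_def transpose_def mat_def)
qed

text \<open>The last two diagonal blocks equal \<open>2 I\<close>; every other entry meets one of the first four
  coordinates, so it is absorbed by half of these blocks and by a large multiple of the first four squares.\<close>

lemma Qr_coercive:
  assumes M: "\<And>i j. \<bar>Qmat b d v x $ i $ j\<bar> \<le> M" and r: "r \<ge> 1 + 10 * M + 100 * M\<^sup>2"
  shows "\<xi> \<bullet> \<xi> \<le> \<xi> \<bullet> (Qr r b d v x *v \<xi>)"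
proof -
  define p where "p i = (if first_block i then \<bar>\<xi> $ i\<bar> else 0)" for i
  define q where "q i = (if first_block i then 0 else \<bar>\<xi> $ i\<bar>)" for i
  have M0: "M \<ge> 0" using M[of "Inl 1" "Inl 1"] by linarith
  have diag: "blk10 (blk4 1 1) 0 0 $ i = (if first_block i then 1 else 0)" for i
    by (cases i rule: i10_cases) (auto simp: first_block_def)
  have last: "Qmat b d v x $ i $ j = (if i = j then 2 else 0)" if "\<not> first_block i" "\<not> first_block j" for i j
    using that by (cases i rule: i10_cases; cases j rule: i10_cases) (auto simp: Qmat_def mat_def first_block_def)
  have tm: "\<xi> $ i * (Qmat b d v x $ i $ j * \<xi> $ j)
      \<ge> - M * (p i * p j + p i * q j + q i * p j) + (if i = j then 2 * (q i)\<^sup>2 else 0)" for i j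
  proof (cases "first_block i \<or> first_block j")
    case True
    have "\<bar>\<xi> $ i * (Qmat b d v x $ i $ j * \<xi> $ j)\<bar> \<le> \<bar>\<xi> $ i\<bar> * (M * \<bar>\<xi> $ j\<bar>)"
      unfolding abs_mult using M by (intro mult_left_mono mult_right_mono) auto
    then have "\<xi> $ i * (Qmat b d v x $ i $ j * \<xi> $ j) \<ge> - (M * (\<bar>\<xi> $ i\<bar> * \<bar>\<xi> $ j\<bar>))"
      by (simp add: mult.left_commute abs_le_iff)
    moreover have "\<bar>\<xi> $ i\<bar> * \<bar>\<xi> $ j\<bar> = p i * p j + p i * q j + q i * p j" using True by (auto simp: p_def q_def)
    moreover have "(if i = j then 2 * (q i)\<^sup>2 else 0) = 0" using True by (auto simp: q_def)
    ultimately show ?thesis by simp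
  next
    case False
    then show ?thesis by (auto simp: last p_def q_def power2_eq_square)
  qed
  define P S where "P = (\<Sum>i\<in>UNIV. p i)" and "S = (\<Sum>i\<in>UNIV. q i)"
  define PP QQ where "PP = (\<Sum>i\<in>UNIV. (p i)\<^sup>2)" and "QQ = (\<Sum>i\<in>UNIV. (q i)\<^sup>2)"
  have card: "card (UNIV :: i10 set) = 10" by simp
  have P2: "P\<^sup>2 \<le> 10 * PP" using sum_squared_le_sum_of_squares[of p UNIV] unfolding card by (simp add: P_def PP_def mult.commute)
  have S2: "S\<^sup>2 \<le> 10 * QQ" using sum_squared_le_sum_of_squares[of q UNIV] unfolding card by (simp add: S_def QQ_def mult.commute)
  have n: "\<xi> \<bullet> \<xi> = PP + QQ"
    unfolding inner_vec_def PP_def QQ_def sum.distrib[symmetric]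
    by (intro sum.cong) (auto simp: p_def q_def power2_eq_square)
  have "\<xi> \<bullet> (Qmat b d v x *v \<xi>) = (\<Sum>i\<in>UNIV. \<Sum>j\<in>UNIV. \<xi> $ i * (Qmat b d v x $ i $ j * \<xi> $ j))"
    by (simp add: inner_vec_def matrix_vector_mult_def sum_distrib_left)
  also have "\<dots> \<ge> (\<Sum>i\<in>UNIV. \<Sum>j\<in>UNIV. - M * (p i * p j + p i * q j + q i * p j) + (if i = j then 2 * (q i)\<^sup>2 else 0))"
    by (intro sum_mono tm)
  also have "(\<Sum>i\<in>UNIV. \<Sum>j\<in>UNIV. - M * (p i * p j + p i * q j + q i * p j) + (if i = j then 2 * (q i)\<^sup>2 else 0))
      = - M * (P * P + P * S + S * P) + 2 * QQ"
    unfolding P_def S_def QQ_def sum_product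
    by (simp add: sum.distrib sum_distrib_left[symmetric] distrib_left sum_negf sum_subtractf)
  finally have Q: "\<xi> \<bullet> (Qmat b d v x *v \<xi>) \<ge> - M * (P * P + P * S + S * P) + 2 * QQ" .
  have "0 \<le> (10 * M * P - S)\<^sup>2" by simp
  then have "2 * M * P * S \<le> 10 * M\<^sup>2 * P\<^sup>2 + S\<^sup>2 / 10" by (simp add: power2_eq_square algebra_simps)
  moreover have "10 * M\<^sup>2 * P\<^sup>2 \<le> 10 * M\<^sup>2 * (10 * PP)" using P2 by (intro mult_left_mono) auto
  moreover have "M * P\<^sup>2 \<le> M * (10 * PP)" using P2 M0 by (rule mult_left_mono)
  ultimately have "M * (P * P + P * S + S * P) \<le> (10 * M + 100 * M\<^sup>2) * PP + QQ"
    using S2 by (simp add: power2_eq_square algebra_simps)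
  with Q have Q': "\<xi> \<bullet> (Qmat b d v x *v \<xi>) \<ge> QQ - (10 * M + 100 * M\<^sup>2) * PP" by simp
  have "(\<chi> i j. if i = j then blk10 (blk4 1 1) 0 0 $ i else (0::real)) *v \<xi> = (\<chi> i. (if first_block i then 1 else 0) * \<xi> $ i)"
    by (simp add: matrix_vector_mult_def vec_eq_iff diag if_distrib[of "\<lambda>a. a * _"] cong: if_cong)
  then have "\<xi> \<bullet> (Qr r b d v x *v \<xi>) = \<xi> \<bullet> (Qmat b d v x *v \<xi>)
      + r * (\<xi> \<bullet> (\<chi> i. (if first_block i then 1 else 0) * \<xi> $ i))"
    by (simp add: Qr_def matrix_vector_mult_add_rdistrib scaleR_matrix_vector_assoc[symmetric] inner_add_right
      del: mult_if_delta)
  also have "\<xi> \<bullet> (\<chi> i. (if first_block i then 1 else 0) * \<xi> $ i) = PP"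
    unfolding inner_vec_def PP_def by (intro sum.cong) (auto simp: p_def power2_eq_square)
  finally have "\<xi> \<bullet> (Qr r b d v x *v \<xi>) = \<xi> \<bullet> (Qmat b d v x *v \<xi>) + r * PP" .
  moreover have "PP \<ge> 0" unfolding PP_def by (intro sum_nonneg) simp
  with r have "(1 + 10 * M + 100 * M\<^sup>2) * PP \<le> r * PP" by (rule mult_right_mono)
  ultimately show ?thesis unfolding n using Q' by (simp add: algebra_simps)
qed

section \<open>The test fields\<close>

lemma continuous_on_snd_T3 [continuous_intros]:
  assumes "continuous_on UNIV g" shows "continuous_on S (\<lambda>z :: real \<times> T3. g (snd z))"
  by (rule continuous_on_compose2[OF assms]) (auto intro!: continuous_intros)

context initial_data
begin

lemma ex_rate: "\<exists>M>0. \<forall>x. \<bar>tau1 x\<bar> \<le> M * (tau0 x / 2)"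
proof -
  obtain z where z: "\<And>y. tau0 z \<le> tau0 y"
    using continuous_attains_inf[OF compact_T3 _ smooth_T3_continuous[OF smooth_tau0]] by blast
  have tz: "tau0 z > 0" using h0_pos by (simp add: tau0_def)
  obtain K where K: "K > 0" "\<And>x. norm (tau1 x) \<le> K"
    using continuous_T3_bounded[OF smooth_T3_continuous[OF smooth_tau1]] by blast
  have "\<bar>tau1 x\<bar> \<le> 2 * K / tau0 z * (tau0 x / 2)" for x
  proof -
    have "\<bar>tau1 x\<bar> \<le> K" using K(2)[of x] by simp
    also have "K = K / tau0 z * tau0 z" using tz by simp
    also have "\<dots> \<le> K / tau0 z * tau0 x" using z[of x] K(1) tz by (intro mult_left_mono) auto
    finally show ?thesis by simp
  qed
  then show ?thesis using K(1) tz by (intro exI[of _ "2 * K / tau0 z"]) simp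
qed

definition mu :: real where "mu = (SOME M. M > 0 \<and> (\<forall>x. \<bar>tau1 x\<bar> \<le> M * (tau0 x / 2)))"

lemma mu: "mu > 0" "\<bar>tau1 x\<bar> \<le> mu * (tau0 x / 2)"
  using someI_ex[OF ex_rate] unfolding mu_def by auto

text \<open>A bounded substitute for the time \<open>s\<close>, equal to it to first order at zero. Since \<open>\<mu> \<phi> \<le> 1\<close>, the field
  \<open>\<tau>\<^sub>0 + \<phi> \<tau>\<^sub>1\<close> stays above \<open>\<tau>\<^sub>0/2\<close> at all times. The test fields are thus admissible on every interval
  \<open>[0, T]\<close>, with bounds that do not depend on \<open>T\<close>.\<close>

definition phi :: "real \<Rightarrow> real" where "phi s = s / (1 + mu * s)"
definition phi' :: "real \<Rightarrow> real" where "phi' s = 1 / (1 + mu * s)\<^sup>2"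

lemma phi_denom: "s \<ge> 0 \<Longrightarrow> 1 + mu * s \<ge> 1" using mu(1) by simp

lemma phi_bounds:
  assumes s: "s \<ge> 0"
  shows "0 \<le> phi s" "phi s \<le> s" "mu * phi s \<le> 1" "\<bar>phi' s - 1\<bar> \<le> 2 * mu * s" "\<bar>phi s - s\<bar> \<le> mu * s\<^sup>2"
proof -
  note d = phi_denom[OF s]
  show "0 \<le> phi s" using s d by (simp add: phi_def)
  show "phi s \<le> s" unfolding phi_def using s d mult_left_mono[of 1 "1 + mu * s" s] by (simp add: divide_le_eq)
  show "mu * phi s \<le> 1" unfolding phi_def using d by (simp add: divide_le_eq)
  show "\<bar>phi' s - 1\<bar> \<le> 2 * mu * s"
  proof -
    have e: "1 - phi' s = (2 * (mu * s) + (mu * s)\<^sup>2) / (1 + mu * s)\<^sup>2"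
    proof -
      have "(1 + mu * s)\<^sup>2 \<noteq> 0" using d by simp
      then have "1 - phi' s = ((1 + mu * s)\<^sup>2 - 1) / (1 + mu * s)\<^sup>2" unfolding phi'_def by (simp add: diff_divide_distrib)
      then show ?thesis by (simp add: power2_sum)
    qed
    define u where "u = mu * s"
    have u: "u \<ge> 0" using s mu(1) by (simp add: u_def)
    have "2 * u + u\<^sup>2 \<le> 2 * u * (1 + u)\<^sup>2" using u by (simp add: power2_eq_square algebra_simps)
    then have "(2 * u + u\<^sup>2) / (1 + u)\<^sup>2 \<le> 2 * u" using u by (simp add: divide_le_eq)
    moreover have "0 \<le> (2 * u + u\<^sup>2) / (1 + u)\<^sup>2" using u by simp
    ultimately show ?thesis using e unfolding u_def[symmetric] by (simp add: abs_if u_def)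
  qed
  show "\<bar>phi s - s\<bar> \<le> mu * s\<^sup>2"
  proof -
    have "s - phi s = mu * s\<^sup>2 / (1 + mu * s)"
      unfolding phi_def using d by (simp add: field_simps power2_eq_square)
    moreover have "mu * s\<^sup>2 / (1 + mu * s) \<le> mu * s\<^sup>2 / 1" using d mu(1) by (intro divide_left_mono) auto
    moreover have "0 \<le> mu * s\<^sup>2 / (1 + mu * s)" using d mu(1) by simp
    ultimately show ?thesis by simp
  qed
qed

lemma phi_deriv: "s \<ge> 0 \<Longrightarrow> (phi has_vector_derivative phi' s) (at s within S)"
proof -
  assume s: "s \<ge> 0"
  have "(phi has_real_derivative phi' s) (at s within S)"
    unfolding phi_def[abs_def] phi'_def using phi_denom[OF s]
    by (auto intro!: derivative_eq_intros simp: field_simps power2_eq_square)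
  then show ?thesis by (simp add: has_real_derivative_iff_has_vector_derivative)
qed

lemma phi_cont: "continuous_on {0..T} phi" "continuous_on {0..T} phi'"
proof -
  have "1 + mu * s \<noteq> 0" if "s \<in> {0..T}" for s using phi_denom[of s] that by auto
  then show "continuous_on {0..T} phi" "continuous_on {0..T} phi'"
    unfolding phi_def[abs_def] phi'_def[abs_def] by (auto intro!: continuous_intros)
qed

lemma phi_cont_slab [continuous_intros]:
  "continuous_on ({0..T} \<times> (UNIV :: T3 set)) (\<lambda>z. phi (fst z))"
  "continuous_on ({0..T} \<times> (UNIV :: T3 set)) (\<lambda>z. phi' (fst z))"
  by (rule continuous_on_compose2[OF phi_cont(1)] continuous_on_compose2[OF phi_cont(2)];
      auto intro!: continuous_intros)+

definition ttau :: "real \<Rightarrow> T3 \<Rightarrow> real" where "ttau s x = tau0 x + phi s * tau1 x"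
definition ths :: "real \<Rightarrow> T3 \<Rightarrow> real" where "ths s x = inverse (ttau s x)"
definition tbs :: "real \<Rightarrow> T3 \<Rightarrow> real ^ 3" where "tbs s x = b0 x + phi s *\<^sub>R b1 x"

lemma tau0_pos: "tau0 x > 0" using h0_pos by (simp add: tau0_def)

lemma ttau_ge: assumes "s \<ge> 0" shows "ttau s x \<ge> tau0 x / 2"
proof -
  have "\<bar>phi s * tau1 x\<bar> \<le> phi s * (mu * (tau0 x / 2))"
    unfolding abs_mult using mult_left_mono[OF mu(2)[of x] phi_bounds(1)[OF assms]] phi_bounds(1)[OF assms] by simp
  also have "\<dots> = (mu * phi s) * (tau0 x / 2)" by simp
  also have "\<dots> \<le> 1 * (tau0 x / 2)" using phi_bounds(3)[OF assms] tau0_pos[of x] by (intro mult_right_mono) auto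
  finally show ?thesis by (simp add: ttau_def abs_le_iff)
qed

lemma ttau_pos: "s \<ge> 0 \<Longrightarrow> ttau s x > 0" using ttau_ge[of s x] tau0_pos[of x] by linarith

lemma ths_pos: "s \<ge> 0 \<Longrightarrow> ths s x > 0" using ttau_pos by (simp add: ths_def)

lemma affine_field:
  fixes a b :: "T3 \<Rightarrow> 'b::real_normed_vector"
  assumes a: "smooth_T3 a" and b: "smooth_T3 b" and T: "T > 0"
  shows "Ck_ST T 1 (\<lambda>s x. a x + phi s *\<^sub>R b x)"
    and "s \<in> {0..T} \<Longrightarrow> dt T (\<lambda>s x. a x + phi s *\<^sub>R b x) s x = phi' s *\<^sub>R b x"
    and "pd i (\<lambda>x. a x + phi s *\<^sub>R b x) x = pd i a x + phi s *\<^sub>R pd i b x"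
    and "partially_differentiable (\<lambda>x. a x + phi s *\<^sub>R b x)"
    and "continuous_on ({0..T} \<times> UNIV) (\<lambda>z. a (snd z) + phi (fst z) *\<^sub>R b (snd z))"
    and "s \<in> {0..T} \<Longrightarrow> ((\<lambda>s. a x + phi s *\<^sub>R b x) has_vector_derivative phi' s *\<^sub>R b x) (at s within {0..T})"
proof -
  note L = bounded_linear_scaleR_right
  note da = smooth_T3_differentiable[OF a] and db = smooth_T3_differentiable[OF b]
  show dv: "((\<lambda>s. a x + phi s *\<^sub>R b x) has_vector_derivative phi' s *\<^sub>R b x) (at s within {0..T})" if "s \<in> {0..T}" for s x
    using has_vector_derivative_add[OF has_vector_derivative_const[of "a x"]
        bounded_linear.has_vector_derivative[OF bounded_linear_scaleR_left phi_deriv[of s "{0..T}"]], of "b x"] that by simp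
  then show "s \<in> {0..T} \<Longrightarrow> dt T (\<lambda>s x. a x + phi s *\<^sub>R b x) s x = phi' s *\<^sub>R b x" by (intro dtI[OF T]) auto
  show p: "partially_differentiable (\<lambda>x. a x + phi s *\<^sub>R b x)" for s
    by (rule pd_add(1)[OF da pd_bounded_linear(1)[OF L db]])
  show q: "pd i (\<lambda>x. a x + phi s *\<^sub>R b x) x = pd i a x + phi s *\<^sub>R pd i b x" for i s x
    using pd_add(2)[OF da pd_bounded_linear(1)[OF L db], of i "phi s" x] pd_bounded_linear(2)[OF L db, of i "phi s" x] by simp
  note ca = smooth_T3_continuous[OF a] and cb = smooth_T3_continuous[OF b]
  show c: "continuous_on ({0..T} \<times> UNIV) (\<lambda>z. a (snd z) + phi (fst z) *\<^sub>R b (snd z))"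
    by (intro continuous_intros ca cb)
  show "Ck_ST T 1 (\<lambda>s x. a x + phi s *\<^sub>R b x)"
  proof (rule Ck_ST_1I[OF T _ dv _ p q])
    show "continuous_on ({0..T} \<times> UNIV) (\<lambda>(t, x). a x + phi t *\<^sub>R b x)" using c by (simp add: split_beta)
    show "continuous_on ({0..T} \<times> UNIV) (\<lambda>(t, x). phi' t *\<^sub>R b x)"
      unfolding split_beta by (intro continuous_intros cb)
    show "continuous_on ({0..T} \<times> UNIV) (\<lambda>(t, x). pd i a x + phi t *\<^sub>R pd i b x)" for i
      unfolding split_beta
      by (intro continuous_intros smooth_T3_continuous[OF smooth_T3_pd[OF a]] smooth_T3_continuous[OF smooth_T3_pd[OF b]])
  qed
qed

lemma Ck_ST_static: "smooth_T3 a \<Longrightarrow> T > 0 \<Longrightarrow> Ck_ST T 1 (\<lambda>s. a)" for a :: "T3 \<Rightarrow> 'b::real_normed_vector"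
  using affine_field(1)[OF _ smooth_T3_const[of 0], of a T] by simp

lemma Ck_ST_tbs: "T > 0 \<Longrightarrow> Ck_ST T 1 tbs"
  unfolding tbs_def[abs_def] by (rule affine_field(1)[OF smooth_b0 smooth_b1])

lemma Ck_ST_ths: assumes T: "T > 0" shows "Ck_ST T 1 ths"
proof -
  have nz: "ttau s x \<noteq> 0" if "s \<in> {0..T}" for s x using ttau_pos[of s x] that by auto
  note A = affine_field[OF smooth_tau0 smooth_tau1 T]
  have te: "ttau = (\<lambda>s x. tau0 x + phi s *\<^sub>R tau1 x)" by (intro ext) (simp add: ttau_def)
  have c: "continuous_on ({0..T} \<times> UNIV) (\<lambda>z. ttau (fst z) (snd z))" using A(5) by (simp add: te)
  then have ci: "continuous_on ({0..T} \<times> UNIV) (\<lambda>z. inverse (ttau (fst z) (snd z)))"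
    by (intro continuous_on_inverse) (use nz in auto)
  show ?thesis
  proof (rule Ck_ST_1I[OF T, where f' = "\<lambda>s x. - (phi' s * tau1 x * (inverse (ttau s x) * inverse (ttau s x)))"
        and g = "\<lambda>i s x. - ((pd i tau0 x + phi s * pd i tau1 x) * (inverse (ttau s x) * inverse (ttau s x)))"])
    show "continuous_on ({0..T} \<times> UNIV) (\<lambda>(t, x). ths t x)" using ci by (simp add: split_beta ths_def)
    show "((\<lambda>s. ths s x) has_vector_derivative - (phi' s * tau1 x * (inverse (ttau s x) * inverse (ttau s x)))) (at s within {0..T})"
      if s: "s \<in> {0..T}" for s x
    proof -
      have "((\<lambda>s. ttau s x) has_real_derivative phi' s * tau1 x) (at s within {0..T})"
        using A(6)[OF s, of x] by (simp add: te has_real_derivative_iff_has_vector_derivative)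
      from DERIV_inverse'[OF this nz[OF s]] show ?thesis
        by (simp add: ths_def has_real_derivative_iff_has_vector_derivative mult.assoc mult.left_commute)
    qed
    have pt: "partially_differentiable (ttau s)" "pd i (ttau s) x = pd i tau0 x + phi s * pd i tau1 x" for s i x
      using A(4)[of s] A(3)[of i s x] by (auto simp: te)
    show "partially_differentiable (ths s)" if "s \<in> {0..T}" for s
      unfolding ths_def[abs_def] by (rule pd_inverse(1)[OF pt(1) nz[OF that]])
    show "pd i (ths s) x = - ((pd i tau0 x + phi s * pd i tau1 x) * (inverse (ttau s x) * inverse (ttau s x)))"
      if "s \<in> {0..T}" for s x i
      unfolding ths_def[abs_def] pd_inverse(2)[OF pt(1) nz[OF that]] pt(2) ..
    show "continuous_on ({0..T} \<times> UNIV) (\<lambda>(s, x). - (phi' s * tau1 x * (inverse (ttau s x) * inverse (ttau s x))))"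
      unfolding split_beta by (intro continuous_intros ci smooth_T3_continuous[OF smooth_tau1])
    show "continuous_on ({0..T} \<times> UNIV) (\<lambda>(s, x). - ((pd i tau0 x + phi s * pd i tau1 x) * (inverse (ttau s x) * inverse (ttau s x))))" for i
      unfolding split_beta
      by (intro continuous_intros ci smooth_T3_continuous[OF smooth_T3_pd[OF smooth_tau1]]
        smooth_T3_continuous[OF smooth_T3_pd[OF smooth_tau0]])
  qed
qed

lemma smooth_pd_bounded:
  fixes f :: "T3 \<Rightarrow> real ^ 3"
  assumes "smooth_T3 f" shows "\<exists>K. \<forall>i j x. \<bar>pd j (\<lambda>y. f y $ i) x\<bar> \<le> K"
proof -
  have "\<exists>K. \<forall>x. \<bar>pd j (\<lambda>y. f y $ i) x\<bar> \<le> K" for i j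
  proof -
    obtain K where "\<And>x. norm (pd j (\<lambda>y. f y $ i) x) \<le> K"
      using continuous_T3_bounded[OF smooth_T3_continuous[OF smooth_T3_pd[OF smooth_T3_nth[OF assms]]]] by blast
    then show ?thesis by auto
  qed
  then have "\<forall>i j. \<exists>K. \<forall>x. \<bar>pd j (\<lambda>y. f y $ i) x\<bar> \<le> K" by blast
  then obtain K where K: "\<And>i j x. \<bar>pd j (\<lambda>y. f y $ i) x\<bar> \<le> K i j" by metis
  have "\<bar>pd j (\<lambda>y. f y $ i) x\<bar> \<le> (\<Sum>i\<in>UNIV. \<Sum>j\<in>UNIV. \<bar>K i j\<bar>)" for i j x
  proof -
    have "\<bar>pd j (\<lambda>y. f y $ i) x\<bar> \<le> \<bar>K i j\<bar>" using K[of j i x] by force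
    also have "\<dots> \<le> (\<Sum>j\<in>UNIV. \<bar>K i j\<bar>)" by (intro member_le_sum) auto
    also have "\<dots> \<le> (\<Sum>i\<in>UNIV. \<Sum>j\<in>UNIV. \<bar>K i j\<bar>)"
      by (rule member_le_sum[of i UNIV "\<lambda>i. \<Sum>j\<in>UNIV. \<bar>K i j\<bar>"]) (auto intro: sum_nonneg)
    finally show ?thesis .
  qed
  then show ?thesis by blast
qed

lemma pd_tbs: "pd j (\<lambda>y. tbs s y $ i) x = pd j (\<lambda>y. b0 y $ i) x + phi s * pd j (\<lambda>y. b1 y $ i) x"
proof -
  note L = bounded_linear_mult_right
  have "pd j (\<lambda>y. b0 y $ i + phi s * b1 y $ i) x = pd j (\<lambda>y. b0 y $ i) x + pd j (\<lambda>y. phi s * b1 y $ i) x"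
    by (rule pd_add(2)[OF db0 pd_bounded_linear(1)[OF L diff_nth[OF smooth_b1]]])
  then show ?thesis using pd_bounded_linear(2)[OF L diff_nth[OF smooth_b1], of j "phi s" i x] by (simp add: tbs_def)
qed

text \<open>As \<open>\<phi>\<close> is bounded, so are the entries of \<open>Q\<close>, uniformly in time.\<close>

lemma ex_coercive: "\<exists>r\<ge>0. \<forall>s\<ge>0. \<forall>x \<xi>. \<xi> \<bullet> \<xi> \<le> \<xi> \<bullet> (Qr r (tbs s) d1 v1 x *v \<xi>)"
proof -
  obtain K0 K1 K2 K3 where K: "\<And>i j x. \<bar>pd j (\<lambda>y. b0 y $ i) x\<bar> \<le> K0" "\<And>i j x. \<bar>pd j (\<lambda>y. b1 y $ i) x\<bar> \<le> K1"
    "\<And>i j x. \<bar>pd j (\<lambda>y. d1 y $ i) x\<bar> \<le> K2" "\<And>i j x. \<bar>pd j (\<lambda>y. v1 y $ i) x\<bar> \<le> K3"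
    using smooth_pd_bounded[OF smooth_b0] smooth_pd_bounded[OF smooth_b1] smooth_pd_bounded[OF smooth_d1]
      smooth_pd_bounded[OF smooth_v1] by metis
  have nn: "K0 \<ge> 0" "K1 \<ge> 0" "K2 \<ge> 0" "K3 \<ge> 0" using K[of 1 1 0] by linarith+
  define K where "K = K0 + K1 / mu + K2 + K3"
  have K1m: "K1 / mu \<ge> 0" using nn mu(1) by simp
  have tb: "\<bar>pd j (\<lambda>y. tbs s y $ i) x\<bar> \<le> K" if s: "s \<ge> 0" for i j s x
  proof -
    have "\<bar>phi s * pd j (\<lambda>y. b1 y $ i) x\<bar> \<le> 1 / mu * K1"
      unfolding abs_mult using phi_bounds(1,3)[OF s] K(2)[of j i x] mu(1)
      by (intro mult_mono) (auto simp: field_simps)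
    then have "\<bar>phi s * pd j (\<lambda>y. b1 y $ i) x\<bar> \<le> K1 / mu" by simp
    then show ?thesis using K(1)[of j i x] nn unfolding pd_tbs K_def by linarith
  qed
  have dv: "\<bar>pd j (\<lambda>y. d1 y $ i) x\<bar> \<le> K" "\<bar>pd j (\<lambda>y. v1 y $ i) x\<bar> \<le> K" for i j x
    using K(3)[of j i x] K(4)[of j i x] nn K1m unfolding K_def by linarith+
  define M where "M = 6 * K + 2"
  have "\<xi> \<bullet> \<xi> \<le> \<xi> \<bullet> (Qr (1 + 10 * M + 100 * M\<^sup>2) (tbs s) d1 v1 x *v \<xi>)" if s: "s \<ge> 0" for s x \<xi>
    by (rule Qr_coercive[OF Qmat_entry_le[OF tb[OF s] dv, folded M_def] order_refl])
  moreover have "M \<ge> 0" using nn K1m unfolding M_def K_def by simp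
  ultimately show ?thesis by (intro exI[of _ "1 + 10 * M + 100 * M\<^sup>2"]) simp
qed

text \<open>The residual is a polynomial in \<open>\<phi>\<close> and \<open>\<phi>'\<close> with these static coefficients.\<close>

definition Y1 :: "T3 \<Rightarrow> real ^ i10" where "Y1 x = blk10 (blk4 (tau1 x) (b1 x)) 0 0"
definition Y2 :: "T3 \<Rightarrow> real ^ i10"
  where "Y2 x = blk10
    (blk4 (v1 x \<bullet> grad tau1 x - tau1 x * diverg v1 x) (jac b1 x *v v1 x - jac v1 x *v b1 x + tau1 x *\<^sub>R curl d1 x))
    (- (tau1 x *\<^sub>R curl b0 x + tau0 x *\<^sub>R curl b1 x))
    (- (jac b0 x *v b1 x + jac b1 x *v b0 x + tau0 x *\<^sub>R grad tau1 x + tau1 x *\<^sub>R grad tau0 x))"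
definition Y3 :: "T3 \<Rightarrow> real ^ i10"
  where "Y3 x = blk10 0 (- (tau1 x *\<^sub>R curl b1 x)) (- (jac b1 x *v b1 x + tau1 x *\<^sub>R grad tau1 x))"

lemma continuous_Y: "continuous_on UNIV Y1" "continuous_on UNIV Y2" "continuous_on UNIV Y3"
proof -
  note c = smooth_T3_continuous[OF smooth_tau0] smooth_T3_continuous[OF smooth_tau1] smooth_T3_continuous[OF smooth_b1]
    smooth_T3_continuous[OF smooth_v1] smooth_T3_continuous[OF smooth_grad[OF smooth_tau0]]
    smooth_T3_continuous[OF smooth_grad[OF smooth_tau1]] smooth_T3_continuous[OF smooth_diverg[OF smooth_v1]]
    smooth_T3_continuous[OF smooth_curl[OF smooth_d1]] smooth_T3_continuous[OF smooth_curl[OF smooth_b0]]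
    smooth_T3_continuous[OF smooth_curl[OF smooth_b1]]
    smooth_T3_continuous[OF smooth_jac_mult[OF smooth_b1 smooth_v1]] smooth_T3_continuous[OF smooth_jac_mult[OF smooth_v1 smooth_b1]]
    smooth_T3_continuous[OF smooth_jac_mult[OF smooth_b0 smooth_b1]] smooth_T3_continuous[OF smooth_jac_mult[OF smooth_b1 smooth_b0]]
    smooth_T3_continuous[OF smooth_jac_mult[OF smooth_b1 smooth_b1]]
  show "continuous_on UNIV Y1" "continuous_on UNIV Y2" "continuous_on UNIV Y3"
    unfolding Y1_def[abs_def] Y2_def[abs_def] Y3_def[abs_def] by (intro continuous_intros c)+
qed

lemma blk10_eqI:
  assumes "w $ Inl 1 = a" "\<And>k. w $ Inr (Inl k) = u $ k" "\<And>k. w $ Inr (Inr (Inl k)) = d $ k"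
    "\<And>k. w $ Inr (Inr (Inr k)) = v $ k"
  shows "blk10 (blk4 a u) d v = w"
  unfolding vec_eq_iff
proof
  fix i :: i10 show "blk10 (blk4 a u) d v $ i = w $ i"
    by (cases i rule: i10_cases) (auto simp: assms)
qed

text \<open>The coefficients of the zeroth order in \<open>\<phi>\<close> vanish by the choice of \<open>d\<^sub>1\<close>, \<open>v\<^sub>1\<close>, \<open>\<tau>\<^sub>1\<close>, \<open>b\<^sub>1\<close>.\<close>

lemma Lfield_eq:
  assumes T: "T > 0" and s: "s \<in> {0..T}"
  shows "Lfield T ths tbs (\<lambda>s. d1) (\<lambda>s. v1) s x = (phi' s - 1) *\<^sub>R Y1 x + phi s *\<^sub>R Y2 x + (phi s)\<^sup>2 *\<^sub>R Y3 x"
proof -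
  have te: "(\<lambda>t x. inverse (ths t x)) = (\<lambda>s x. tau0 x + phi s *\<^sub>R tau1 x)"
    by (intro ext) (simp add: ths_def ttau_def)
  have be: "tbs = (\<lambda>s x. b0 x + phi s *\<^sub>R b1 x)" by (intro ext) (simp add: tbs_def)
  have d1: "dt T (\<lambda>s x. tau0 x + phi s *\<^sub>R tau1 x) s x = phi' s * tau1 x"
    using affine_field(2)[OF smooth_tau0 smooth_tau1 T s, of x] by simp
  have d2: "dt T tbs s x = phi' s *\<^sub>R b1 x" unfolding be by (rule affine_field(2)[OF smooth_b0 smooth_b1 T s])
  have g: "grad (\<lambda>x. tau0 x + phi s *\<^sub>R tau1 x) x $ k = pd k tau0 x + phi s * pd k tau1 x" for k
    using affine_field(3)[OF smooth_tau0 smooth_tau1 T, of k s x] by (simp add: grad_nth)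
  have c: "\<forall>k. curl (tbs s) x $ k = curl b0 x $ k + phi s * curl b1 x $ k"
    unfolding forall_3 curl_nth pd_tbs by (simp add: algebra_simps)
  show ?thesis
    unfolding Lfield_def Let_def te
  proof (rule blk10_eqI)
    let ?w = "(phi' s - 1) *\<^sub>R Y1 x + phi s *\<^sub>R Y2 x + (phi s)\<^sup>2 *\<^sub>R Y3 x"
    have b1e: "b1 x $ k = (jac v1 x *v b0 x) $ k - (jac b0 x *v v1 x) $ k - tau0 x * curl d1 x $ k" for k
      by (simp add: b1_def)
    have tau1_eq: "tau1 x = tau0 x * diverg v1 x - (v1 x $ 1 * pd 1 tau0 x + v1 x $ 2 * pd 2 tau0 x + v1 x $ 3 * pd 3 tau0 x)"
      by (simp add: tau1_def inner_3 grad_nth)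
    have t1: "phi' s * t - (a + phi s * t) * D + (V1 * (p1 + phi s * q1) + V2 * (p2 + phi s * q2) + V3 * (p3 + phi s * q3))
      = (phi' s - 1) * t + phi s * (V1 * q1 + V2 * q2 + V3 * q3 - t * D)"
      if "t = a * D - (V1 * p1 + V2 * p2 + V3 * p3)" for t a D V1 V2 V3 p1 p2 p3 q1 q2 q3 :: real
      using that by algebra
    show "?w $ Inl 1 = dt T (\<lambda>s x. tau0 x + phi s *\<^sub>R tau1 x) s x - (tau0 x + phi s *\<^sub>R tau1 x) * diverg v1 x
        + v1 x \<bullet> grad (\<lambda>x. tau0 x + phi s *\<^sub>R tau1 x) x"
      unfolding d1 inner_3 g unfolding real_scaleR_def t1[OF tau1_eq]
      by (simp add: Y1_def Y2_def Y3_def inner_3 grad_nth)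
    show "?w $ Inr (Inl k) = (dt T tbs s x + jac (tbs s) x *v v1 x - jac v1 x *v tbs s x
        + (tau0 x + phi s *\<^sub>R tau1 x) *\<^sub>R curl d1 x) $ k" for k
      unfolding d2 vector_minus_component vector_add_component vector_scaleR_component matrix_vector_nth jac_nth pd_tbs
      by (simp add: Y1_def Y2_def Y3_def matrix_vector_nth jac_nth tbs_def b1e[of k] algebra_simps)
    show "?w $ Inr (Inr (Inl k)) = (d1 x - (tau0 x + phi s *\<^sub>R tau1 x) *\<^sub>R curl (tbs s) x) $ k" for k
      by (simp add: Y1_def Y2_def Y3_def c[rule_format] d1_def[of x] power2_eq_square algebra_simps)
    show "?w $ Inr (Inr (Inr k)) = (v1 x - jac (tbs s) x *v tbs s x
        - (tau0 x + phi s *\<^sub>R tau1 x) *\<^sub>R grad (\<lambda>x. tau0 x + phi s *\<^sub>R tau1 x) x) $ k" for k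
      unfolding vector_minus_component vector_scaleR_component g matrix_vector_nth jac_nth pd_tbs
      by (simp add: Y1_def Y2_def Y3_def v1_def[of x] matrix_vector_nth jac_nth tbs_def grad_nth power2_eq_square algebra_simps)
  qed
qed

text \<open>Each of \<open>\<phi>' - 1\<close>, \<open>\<phi>\<close> and \<open>\<phi>\<^sup>2 \<le> \<phi>/\<mu>\<close> is at most linear in \<open>s\<close>.\<close>

lemma ex_Lfield_bound:
  "\<exists>c\<ge>0. \<forall>T>0. \<forall>s\<in>{0..T}. \<forall>x. norm (Lfield T ths tbs (\<lambda>s. d1) (\<lambda>s. v1) s x) \<le> c * s"
proof -
  obtain K1 K2 K3 where K: "K1 > 0" "\<And>x. norm (Y1 x) \<le> K1" "K2 > 0" "\<And>x. norm (Y2 x) \<le> K2" "K3 > 0" "\<And>x. norm (Y3 x) \<le> K3"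
    using continuous_T3_bounded[OF continuous_Y(1)] continuous_T3_bounded[OF continuous_Y(2)]
      continuous_T3_bounded[OF continuous_Y(3)] by metis
  have "norm (Lfield T ths tbs (\<lambda>s. d1) (\<lambda>s. v1) s x) \<le> (2 * mu * K1 + K2 + K3 / mu) * s"
    if T: "T > 0" and s: "s \<in> {0..T}" for T s x
  proof -
    have s0: "s \<ge> 0" using s by simp
    note p = phi_bounds[OF s0]
    have "norm ((phi' s - 1) *\<^sub>R Y1 x) \<le> 2 * mu * s * K1" unfolding norm_scaleR using p(4) K(2)[of x] s0 mu(1) by (intro mult_mono) auto
    moreover have "norm (phi s *\<^sub>R Y2 x) \<le> s * K2" unfolding norm_scaleR using p(1,2) K(4)[of x] s0 by (intro mult_mono) auto
    moreover have "norm ((phi s)\<^sup>2 *\<^sub>R Y3 x) \<le> (s / mu) * K3"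
    proof -
      have "phi s \<le> 1 / mu" using p(3) mu(1) by (simp add: field_simps)
      then have "phi s * phi s \<le> s * (1 / mu)" using p(1,2) s0 by (intro mult_mono) auto
      then show ?thesis unfolding norm_scaleR using K(6)[of x] s0 mu(1) by (intro mult_mono) (auto simp: power2_eq_square)
    qed
    ultimately show ?thesis
      unfolding Lfield_eq[OF T s]
      using norm_triangle_ineq[of "(phi' s - 1) *\<^sub>R Y1 x + phi s *\<^sub>R Y2 x" "(phi s)\<^sup>2 *\<^sub>R Y3 x"]
        norm_triangle_ineq[of "(phi' s - 1) *\<^sub>R Y1 x" "phi s *\<^sub>R Y2 x"]
      by (simp add: algebra_simps)
  qed
  moreover have "2 * mu * K1 + K2 + K3 / mu \<ge> 0" using K mu(1) by simp
  ultimately show ?thesis by blast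
qed

lemma continuous_Lfield:
  assumes T: "T > 0" and \<theta>: "\<theta> \<le> T"
  shows "continuous_on ({0..\<theta>} \<times> UNIV) (\<lambda>(s, x). Lfield T ths tbs (\<lambda>s. d1) (\<lambda>s. v1) s x)"
proof -
  have "continuous_on ({0..\<theta>} \<times> UNIV) (\<lambda>z. (phi' (fst z) - 1) *\<^sub>R Y1 (snd z) + phi (fst z) *\<^sub>R Y2 (snd z)
      + (phi (fst z))\<^sup>2 *\<^sub>R Y3 (snd z))"
    by (intro continuous_intros continuous_Y)
  then show ?thesis
    by (rule continuous_on_eq) (use \<theta> in \<open>auto simp: Lfield_eq[OF T]\<close>)
qed

end

section \<open>Consequences of the relative entropy inequality\<close>

lemma sintegral_vanishing: "(\<And>z. z \<in> E \<Longrightarrow> f z = 0) \<Longrightarrow> sintegral E \<nu> f = 0"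
proof -
  assume z: "\<And>z. z \<in> E \<Longrightarrow> f z = 0"
  have "integral\<^sup>L (pos_part E \<mu>) f = integral\<^sup>L (pos_part E \<mu>) (\<lambda>x. 0)" for \<mu>
    by (intro Bochner_Integration.integral_cong refl) (simp add: z)
  then show ?thesis by (simp add: sintegral_def)
qed

lemma vintegral_vanishing: "(\<And>z. z \<in> E \<Longrightarrow> F z = 0) \<Longrightarrow> vintegral E \<nu> F = 0"
  unfolding vintegral_def by (intro sum.neutral ballI sintegral_vanishing) simp

lemma sintegral_zero_measure:
  assumes "\<And>A. A \<in> bsets E \<Longrightarrow> \<nu> A = 0" "bounded_measurable E f" shows "sintegral E \<nu> f = 0"
proof -
  have "bounded_integral E (\<lambda>f. 0)" by (rule bounded_integralI) auto
  from sintegral_eqI(2)[OF this] assms show ?thesis by simp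
qed

lemma sintegral_const:
  assumes "vector_measure_on E \<nu>" "E \<in> bsets E" shows "sintegral E \<nu> (\<lambda>x. c) = c * \<nu> E"
proof -
  note BI = bounded_integral_sintegral[OF assms(1)]
  have "sintegral E \<nu> (\<lambda>x. 1) = sintegral E \<nu> (indicator E)" by (rule bounded_integral_cong[OF BI]) auto
  then show ?thesis using bounded_integral_const[OF BI, of c] sintegral_indicator[OF assms] by simp
qed

lemma bounded_measurable_T3: "continuous_on UNIV f \<Longrightarrow> bounded_measurable (UNIV :: T3 set) f"
  by (rule bounded_measurable_continuous[OF compact_T3])

lemma bounded_measurable_slab:
  "continuous_on ({0..\<theta>::real} \<times> UNIV) f \<Longrightarrow> bounded_measurable ({0..\<theta>} \<times> (UNIV :: T3 set)) f"
  by (rule bounded_measurable_continuous[OF compact_slab])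

lemma slab_bsets: "\<theta> \<le> T \<Longrightarrow> {0..\<theta>} \<times> UNIV \<in> bsets ({0..T::real} \<times> (UNIV :: T3 set))"
  unfolding bsets_iff by (intro bexI[of _ "{0..\<theta>} \<times> UNIV"]) (auto intro!: borel_closed closed_Times)

lemma slab_borel: "{0..\<theta>::real} \<times> (UNIV :: T3 set) \<in> sets borel"
  by (auto intro!: borel_closed closed_Times)

lemma spacetime_nth:
  fixes \<mu> :: "real \<Rightarrow> T3 set \<Rightarrow> real ^ 'n"
  assumes k: "\<And>i. \<exists>L. measure_kernel T L (\<lambda>s A. \<mu> s A $ i)" and A: "A \<in> sets borel"
  shows "spacetime T \<mu> A $ i = spacetime T (\<lambda>s A. \<mu> s A $ i) A"
proof -
  have int: "integrable lborel (\<lambda>s. indicator {0..T} s *\<^sub>R \<mu> s {x. (s, x) \<in> A} $ i)" for i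
  proof -
    obtain L where k: "measure_kernel T L (\<lambda>s A. \<mu> s A $ i)" using k by blast
    have "bounded_measurable {0..T} (\<lambda>s. \<mu> s {x. (s, x) \<in> A} $ i)"
      by (rule bounded_measurableI[OF kernel_slice_measurable[OF k A]]) (use kernelD(2)[OF k _ slice_sets[OF A]] in auto)
    then have "integrable (time_measure T) (\<lambda>s. \<mu> s {x. (s, x) \<in> A} $ i)"
      by (rule bounded_measurable_integrable[OF finite_time_measure sets_time_measure])
    then show ?thesis by (subst (asm) integrable_restrict_space) auto
  qed
  have "integrable lborel (\<lambda>s. \<Sum>i\<in>UNIV. (indicator {0..T} s *\<^sub>R \<mu> s {x. (s, x) \<in> A} $ i) *\<^sub>R axis i (1::real))"
    by (intro Bochner_Integration.integrable_sum integrable_scaleR_left int)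
  moreover have "(\<Sum>i\<in>UNIV. (indicator {0..T} s *\<^sub>R \<mu> s {x. (s, x) \<in> A} $ i) *\<^sub>R axis i (1::real))
      = indicator {0..T} s *\<^sub>R \<mu> s {x. (s, x) \<in> A}" for s
  proof -
    have "(\<Sum>i\<in>UNIV. \<mu> s {x. (s, x) \<in> A} $ i *\<^sub>R axis i (1::real)) = \<mu> s {x. (s, x) \<in> A}"
      using basis_expansion[of "\<mu> s {x. (s, x) \<in> A}"] by (simp only: scalar_mult_eq_scaleR)
    then show ?thesis by (cases "s \<in> {0..T}") auto
  qed
  ultimately have "integrable lborel (\<lambda>s. indicator {0..T} s *\<^sub>R \<mu> s {x. (s, x) \<in> A})" by (simp only:)
  from integral_bounded_linear[OF bounded_linear_vec_nth[of i] this] show ?thesis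
    by (simp add: spacetime_def set_lebesgue_integral_def)
qed

text \<open>What the inequality yields for one choice of competitors in the two suprema.\<close>

lemma relative_entropy_apply:
  assumes DS: "dissipative_solution T K h0 B0 h B D P" and t: "t \<in> {0..T}"
    and hs: "Ck_ST T 1 hs" "\<And>s x. s \<in> {0..T} \<Longrightarrow> 0 < hs s x" and bs: "Ck_ST T 1 bs" and ds: "Ck_ST T 1 ds" and vs: "Ck_ST T 1 vs"
    and Q: "\<And>s x \<xi>. s \<in> {0..T} \<Longrightarrow> \<xi> \<bullet> \<xi> \<le> \<xi> \<bullet> (Qr r (bs s) (ds s) (vs s) x *v \<xi>)"
    and C0: "\<Lambda> (h 0) (Utilde h B hs bs 0) \<le> ereal C0"
    and A: "continuous_on UNIV a" "continuous_on UNIV A" "\<And>x. a x + 1/2 * (norm (A x))\<^sup>2 \<le> 0"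
    and A': "continuous_on ({0..t} \<times> UNIV) a'" "continuous_on ({0..t} \<times> UNIV) A'"
      "\<And>s x. s \<in> {0..t} \<Longrightarrow> a' (s, x) + 1/2 * (norm (msqrt (matrix_inv (exp (- r * s) *\<^sub>R Qr r (bs s) (ds s) (vs s) x)) *v A' (s, x)))\<^sup>2 \<le> 0"
  shows "exp (- r * t) * (sintegral UNIV (h t) a + vintegral UNIV (Utilde h B hs bs t) A)
    + (sintegral ({0..t} \<times> UNIV) (spacetime T h) a' + vintegral ({0..t} \<times> UNIV) (Wtilde T h B D P hs bs ds vs) A')
    + vintegral ({0..t} \<times> UNIV) (Wtilde T h B D P hs bs ds vs) (\<lambda>(s, x). exp (- r * s) *\<^sub>R Lfield T hs bs ds vs s x) \<le> C0"
proof -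
  let ?W = "Wtilde T h B D P hs bs ds vs" and ?E = "{0..t} \<times> (UNIV :: T3 set)"
  let ?Q = "\<lambda>(s, x). exp (- r * s) *\<^sub>R Qr r (bs s) (ds s) (vs s) x"
  have RE: "ereal (exp (- r * t)) * \<Lambda> (h t) (Utilde h B hs bs t) + \<Lambda>t (spacetime T h) ?W ?Q 0 t
      + ereal (vintegral ?E ?W (\<lambda>(s, x). exp (- r * s) *\<^sub>R Lfield T hs bs ds vs s x)) \<le> \<Lambda> (h 0) (Utilde h B hs bs 0)"
  proof -
    note R = DS[unfolded dissipative_solution_def, THEN conjunct2, THEN conjunct2, THEN conjunct2, THEN conjunct2,
        THEN conjunct2, THEN conjunct2, THEN conjunct2, THEN bspec, OF t, THEN spec[of _ hs], THEN spec[of _ bs],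
        THEN spec[of _ ds], THEN spec[of _ vs], THEN spec[of _ r], THEN mp]
    show ?thesis by (rule R) (use hs bs ds vs Q in blast)
  qed
  have "ereal (sintegral UNIV (h t) a + vintegral UNIV (Utilde h B hs bs t) A) \<le> \<Lambda> (h t) (Utilde h B hs bs t)"
    unfolding \<Lambda>_def by (rule SUP_upper2[of "(a, A)"]) (use A in auto)
  then have 1: "ereal (exp (- r * t) * (sintegral UNIV (h t) a + vintegral UNIV (Utilde h B hs bs t) A))
      \<le> ereal (exp (- r * t)) * \<Lambda> (h t) (Utilde h B hs bs t)"
    unfolding times_ereal.simps(1)[symmetric] by (intro ereal_mult_left_mono) auto
  have 2: "ereal (sintegral ?E (spacetime T h) a' + vintegral ?E ?W A') \<le> \<Lambda>t (spacetime T h) ?W ?Q 0 t"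
    unfolding \<Lambda>t_def by (rule SUP_upper2[of "(a', A')"]) (use A' in auto)
  have "ereal (exp (- r * t) * (sintegral UNIV (h t) a + vintegral UNIV (Utilde h B hs bs t) A))
    + ereal (sintegral ?E (spacetime T h) a' + vintegral ?E ?W A')
    + ereal (vintegral ?E ?W (\<lambda>(s, x). exp (- r * s) *\<^sub>R Lfield T hs bs ds vs s x))
    \<le> ereal (exp (- r * t)) * \<Lambda> (h t) (Utilde h B hs bs t) + \<Lambda>t (spacetime T h) ?W ?Q 0 t
      + ereal (vintegral ?E ?W (\<lambda>(s, x). exp (- r * s) *\<^sub>R Lfield T hs bs ds vs s x))"
    by (intro add_mono 1 2 order_refl)
  also note RE
  also note C0
  finally show ?thesis by simp
qed

lemma vector_measure_Utilde:
  assumes "vector_measure_on UNIV (h t)" "vector_measure_on UNIV (B t)"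
    and "bounded_measurable UNIV (\<lambda>x. inverse (hs t x))" "vbounded_measurable UNIV (bs t)"
  shows "vector_measure_on UNIV (Utilde h B hs bs t)"
proof (rule vector_measure_onI_nth)
  fix i :: i4
  show "vector_measure_on UNIV (\<lambda>A. Utilde h B hs bs t A $ i)"
  proof (cases i)
    case (Inl k)
    then show ?thesis using sintegral_diff_measure(1)[OF sintegral_Leb(1) sintegral_smult(1)[OF assms(1,3)]]
      by (simp add: Utilde_def smult_def)
  next
    case (Inr k)
    then show ?thesis
      using sintegral_diff_measure(1)[OF vm_nth[OF assms(2)] sintegral_smult(1)[OF assms(1) vbounded_measurableD[OF assms(4), of k]], of k]
      by (simp add: Utilde_def)
  qed
qed

lemma vintegral_Utilde:
  assumes "vector_measure_on UNIV (h t)" "vector_measure_on UNIV (B t)"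
    and "bounded_measurable UNIV (\<lambda>x. inverse (hs t x))" "vbounded_measurable UNIV (bs t)"
    and f: "bounded_measurable UNIV f" and F: "vbounded_measurable UNIV F"
  shows "vintegral UNIV (Utilde h B hs bs t) (\<lambda>x. blk4 (f x) (F x))
    = integral\<^sup>L Leb f - sintegral UNIV (h t) (\<lambda>x. inverse (hs t x) * f x)
      + (vintegral UNIV (B t) F - sintegral UNIV (h t) (\<lambda>x. bs t x \<bullet> F x))"
proof -
  have 0: "sintegral UNIV (\<lambda>A. Utilde h B hs bs t A $ Inl 1) f
      = integral\<^sup>L Leb f - sintegral UNIV (h t) (\<lambda>x. inverse (hs t x) * f x)"
    using sintegral_diff_measure(2)[OF sintegral_Leb(1) sintegral_smult(1)[OF assms(1,3)] f]
    by (simp add: Utilde_def smult_def sintegral_Leb(2)[OF f] sintegral_smult(2)[OF assms(1,3) f])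
  have 1: "sintegral UNIV (\<lambda>A. Utilde h B hs bs t A $ Inr k) (\<lambda>x. F x $ k)
      = sintegral UNIV (\<lambda>A. B t A $ k) (\<lambda>x. F x $ k) - sintegral UNIV (h t) (\<lambda>x. bs t x $ k * F x $ k)" for k
    using sintegral_diff_measure(2)[OF vm_nth[OF assms(2)] sintegral_smult(1)[OF assms(1) vbounded_measurableD[OF assms(4), of k]]
        vbounded_measurableD[OF F, of k], of k]
    by (simp add: Utilde_def sintegral_smult(2)[OF assms(1) vbounded_measurableD[OF assms(4)] vbounded_measurableD[OF F]])
  have "(\<Sum>k\<in>UNIV. sintegral UNIV (h t) (\<lambda>x. bs t x $ k * F x $ k)) = sintegral UNIV (h t) (\<lambda>x. bs t x \<bullet> F x)"
    unfolding inner_vec_def inner_real_def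
    by (rule bounded_integral_sum[OF bounded_integral_sintegral[OF assms(1)], symmetric])
      (intro bounded_measurable_mult vbounded_measurableD[OF assms(4)] vbounded_measurableD[OF F])
  then show ?thesis
    unfolding vintegral_def[of _ "Utilde h B hs bs t"] sum_i4 blk4_nth 0 1 by (simp add: vintegral_def sum_subtractf)
qed

context initial_data
begin

definition mass :: real where "mass = integral\<^sup>L Leb h0"

lemma mass_nonneg: "mass \<ge> 0"
  unfolding mass_def using h0_pos by (intro Bochner_Integration.integral_nonneg) (auto intro: less_imp_le)

end

locale dissipative = initial_data +
  fixes T K :: real and h :: "real \<Rightarrow> T3 set \<Rightarrow> real" and B :: "real \<Rightarrow> T3 set \<Rightarrow> real ^ 3"
    and D P :: "(real \<times> T3) set \<Rightarrow> real ^ 3"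
  assumes T: "T > 0" and DS: "dissipative_solution T K (dens h0) (dens B0) h B D P"
begin

lemma vm_h: "t \<in> {0..T} \<Longrightarrow> vector_measure_on UNIV (h t)"
  using DS unfolding dissipative_solution_def wstar_continuous_scalar_def by blast

lemma vm_B: "t \<in> {0..T} \<Longrightarrow> vector_measure_on UNIV (B t)"
  using DS unfolding dissipative_solution_def wstar_continuous_def by blast

lemma vm_D: "vector_measure_on ({0..T} \<times> UNIV) D" and vm_P: "vector_measure_on ({0..T} \<times> UNIV) P"
  using DS unfolding dissipative_solution_def by blast+

lemma h_0: "A \<in> sets borel \<Longrightarrow> h 0 A = dens h0 A" and B_0: "A \<in> sets borel \<Longrightarrow> B 0 A = dens B0 A"
  using DS unfolding dissipative_solution_def by blast+

lemma bm_h0: "bounded_measurable UNIV h0" by (rule bounded_measurable_T3[OF smooth_T3_continuous[OF sh0]])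

lemma bm_B0: "bounded_measurable UNIV (\<lambda>x. B0 x $ k)"
  by (rule bounded_measurable_T3[OF smooth_T3_continuous[OF smooth_T3_nth[OF sB0]]])

lemma sintegral_h_0: "bounded_measurable UNIV f \<Longrightarrow> sintegral UNIV (h 0) f = integral\<^sup>L Leb (\<lambda>x. h0 x * f x)"
  using sintegral_cong_measure[OF sintegral_dens(1)[OF bm_h0], of "h 0" f] sintegral_dens(2)[OF bm_h0] h_0 by simp

lemma sintegral_B_0:
  "bounded_measurable UNIV f \<Longrightarrow> sintegral UNIV (\<lambda>A. B 0 A $ k) f = integral\<^sup>L Leb (\<lambda>x. B0 x $ k * f x)"
  using sintegral_cong_measure[OF sintegral_dens(1)[OF bm_B0], of "\<lambda>A. B 0 A $ k" k f] sintegral_dens(2)[OF bm_B0, of f k]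
    B_0 dens_nth[OF bm_B0] by simp

text \<open>Conservation of mass: the continuity equation tested with \<open>u = 1\<close>.\<close>

lemma sintegral_h_const:
  assumes t: "t \<in> {0..T}" shows "sintegral UNIV (h t) (\<lambda>x. c) = c * mass"
proof -
  have u: "Ck_ST T 1 (\<lambda>t (x::T3). 1 :: real)" by (rule Ck_ST_static[OF smooth_T3_const T])
  have g: "grad (\<lambda>x. 1) x = 0" for x by (simp add: grad_def pd_const vec_eq_iff)
  have d: "dt T (\<lambda>t (x::T3). 1 :: real) s x = 0" if "s \<in> {0..T}" for s x by (rule dtI[OF T that]) simp
  have "sintegral ({0..t} \<times> UNIV) (spacetime T h) (case_prod (dt T (\<lambda>t x. 1)))
      + vintegral ({0..t} \<times> UNIV) P (\<lambda>(s, x). grad ((\<lambda>t x. 1) s) x)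
      = sintegral UNIV (h t) ((\<lambda>t x. 1) t) - sintegral UNIV (h 0) ((\<lambda>t x. 1) 0)"
    using DS u t unfolding dissipative_solution_def by blast
  moreover have "sintegral ({0..t} \<times> UNIV) (spacetime T h) (case_prod (dt T (\<lambda>t x. 1))) = 0"
    using d t by (intro sintegral_vanishing) auto
  moreover have "vintegral ({0..t} \<times> UNIV) P (\<lambda>(s, x). grad ((\<lambda>t x. 1) s) x) = 0"
    by (intro vintegral_vanishing) (auto simp: g)
  moreover have "sintegral UNIV (h 0) (\<lambda>x. 1) = mass" using sintegral_h_0[of "\<lambda>x. 1"] by (simp add: mass_def)
  ultimately have "sintegral UNIV (h t) (\<lambda>x. 1) = mass" by simp
  then show ?thesis using bounded_integral_const[OF bounded_integral_sintegral[OF vm_h[OF t]], of c] by simp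
qed

text \<open>By Young's inequality \<open>h\<^sub>0 a + u \<bullet> A \<le> u \<bullet> A - h\<^sub>0 |A|\<^sup>2/2 \<le> |u|\<^sup>2/(2 h\<^sub>0)\<close> for the density
  \<open>u = (1 - h\<^sub>0, B\<^sub>0)\<close> of the relative measure.\<close>

lemma initial_entropy_bound:
  "\<exists>C. \<Lambda> (h 0) (Utilde h B (\<lambda>s x. 1) (\<lambda>s x. 0) 0) \<le> ereal C"
proof -
  define u where "u x = blk4 (1 - h0 x) (B0 x)" for x
  have cu: "continuous_on UNIV (\<lambda>x. (norm (u x))\<^sup>2 / (2 * h0 x))"
    unfolding u_def using h0_nz
    by (intro continuous_intros smooth_T3_continuous[OF sh0] smooth_T3_continuous[OF sB0]) auto
  have z: "0 \<in> {0..T}" using T by simp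
  have "sintegral UNIV (h 0) a + vintegral UNIV (Utilde h B (\<lambda>s x. 1) (\<lambda>s x. 0) 0) A
      \<le> integral\<^sup>L Leb (\<lambda>x. (norm (u x))\<^sup>2 / (2 * h0 x))"
    if aA: "continuous_on UNIV a" "continuous_on UNIV A" "\<And>x. a x + 1/2 * (norm (A x))\<^sup>2 \<le> 0" for a and A :: "T3 \<Rightarrow> real ^ i4"
  proof -
    define f F where "f x = A x $ Inl 1" and "F x = (\<chi> k. A x $ Inr k)" for x
    have Ae: "A x = blk4 (f x) (F x)" for x
    proof -
      have "A x $ i = blk4 (f x) (F x) $ i" for i
        using UNIV_i4 by (cases "i = Inl 1") (auto simp: f_def F_def)
      then show ?thesis by (simp add: vec_eq_iff)
    qed
    have Aeq: "A = (\<lambda>x. blk4 (f x) (F x))" using Ae by (intro ext)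
    have bf: "bounded_measurable UNIV f" unfolding f_def by (intro bounded_measurable_T3 continuous_intros aA)
    have bF: "bounded_measurable UNIV (\<lambda>x. F x $ k)" for k
      unfolding F_def by (simp, intro bounded_measurable_T3 continuous_intros aA)
    have ba: "bounded_measurable UNIV a" by (rule bounded_measurable_T3[OF aA(1)])
    have "vintegral UNIV (Utilde h B (\<lambda>s x. 1) (\<lambda>s x. 0) 0) A
        = integral\<^sup>L Leb f - sintegral UNIV (h 0) f + (vintegral UNIV (B 0) F - sintegral UNIV (h 0) (\<lambda>x. 0))"
      using vintegral_Utilde[of h 0 B "\<lambda>s x. 1" "\<lambda>s x. 0", OF vm_h[OF z] vm_B[OF z] _ _ bf, of F] bF
      unfolding Aeq by (simp add: vbounded_measurable_def)
    also have "\<dots> = integral\<^sup>L Leb f - integral\<^sup>L Leb (\<lambda>x. h0 x * f x) + (\<Sum>k\<in>UNIV. integral\<^sup>L Leb (\<lambda>x. B0 x $ k * F x $ k))"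
      using sintegral_h_0[OF bf] sintegral_B_0[OF bF] sintegral_vanishing[of UNIV "\<lambda>x. 0"] by (simp add: vintegral_def)
    also have "\<dots> = integral\<^sup>L Leb (\<lambda>x. f x - h0 x * f x + (\<Sum>k\<in>UNIV. B0 x $ k * F x $ k))"
      using integrable_Leb[OF bf] integrable_Leb[OF bounded_measurable_mult[OF bm_h0 bf]]
        integrable_Leb[OF bounded_measurable_mult[OF bm_B0 bF]] by simp
    also have "(\<lambda>x. f x - h0 x * f x + (\<Sum>k\<in>UNIV. B0 x $ k * F x $ k)) = (\<lambda>x. u x \<bullet> A x)"
      by (intro ext) (simp add: u_def Ae inner_vec_def sum_i4 algebra_simps)
    finally have V: "vintegral UNIV (Utilde h B (\<lambda>s x. 1) (\<lambda>s x. 0) 0) A = integral\<^sup>L Leb (\<lambda>x. u x \<bullet> A x)" .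
    have cA: "continuous_on UNIV (\<lambda>x. u x \<bullet> A x)"
      unfolding u_def by (intro continuous_intros smooth_T3_continuous[OF sh0] smooth_T3_continuous[OF sB0] aA(2))
    have i1: "integrable Leb (\<lambda>x. h0 x * a x)" "integrable Leb (\<lambda>x. u x \<bullet> A x)"
      "integrable Leb (\<lambda>x. (norm (u x))\<^sup>2 / (2 * h0 x))"
      by (rule integrable_Leb[OF bounded_measurable_mult[OF bm_h0 ba]] integrable_Leb[OF bounded_measurable_T3[OF cA]]
          integrable_Leb[OF bounded_measurable_T3[OF cu]])+
    have "sintegral UNIV (h 0) a + vintegral UNIV (Utilde h B (\<lambda>s x. 1) (\<lambda>s x. 0) 0) A
        = integral\<^sup>L Leb (\<lambda>x. h0 x * a x + u x \<bullet> A x)"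
      using i1 by (simp add: V sintegral_h_0[OF ba])
    also have "\<dots> \<le> integral\<^sup>L Leb (\<lambda>x. (norm (u x))\<^sup>2 / (2 * h0 x))"
    proof (intro integral_mono)
      fix x
      define n where "n = norm (A x)"
      have h: "h0 x > 0" by (rule h0_pos)
      have "h0 x * a x \<le> h0 x * (- (n\<^sup>2 / 2))" using aA(3)[of x] h by (intro mult_left_mono) (auto simp: n_def)
      moreover have "u x \<bullet> A x \<le> norm (u x) * n" unfolding n_def by (rule norm_cauchy_schwarz)
      moreover have "norm (u x) * n - h0 x * (n\<^sup>2 / 2) \<le> (norm (u x))\<^sup>2 / (2 * h0 x)"
      proof -
        have "0 \<le> (norm (u x) - h0 x * n)\<^sup>2 / (2 * h0 x)" using h by simp
        also have "\<dots> = (norm (u x))\<^sup>2 / (2 * h0 x) - (norm (u x) * n - h0 x * (n\<^sup>2 / 2))"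
          using h by (simp add: field_simps power2_eq_square)
        finally show ?thesis by simp
      qed
      ultimately show "h0 x * a x + u x \<bullet> A x \<le> (norm (u x))\<^sup>2 / (2 * h0 x)" by linarith
    qed (use i1 in auto)
    finally show ?thesis .
  qed
  then show ?thesis unfolding \<Lambda>_def
    by (intro exI[of _ "integral\<^sup>L Leb (\<lambda>x. (norm (u x))\<^sup>2 / (2 * h0 x))"] SUP_least) auto
qed

text \<open>The competitor \<open>(- l\<^sup>2/2, l F)\<close>. Its cost is a multiple of the conserved mass, so a bound on \<open>\<Lambda>\<close>
  becomes a bound on linear pairings, with \<open>l\<close> left to be optimised.\<close>

lemma pairing_bound:
  assumes t: "t \<in> {0..T}" and U: "vector_measure_on UNIV U"
    and X: "\<And>a A. continuous_on UNIV a \<Longrightarrow> continuous_on UNIV A \<Longrightarrow> (\<And>x. a x + 1/2 * (norm (A x))\<^sup>2 \<le> 0) \<Longrightarrow>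
      sintegral UNIV (h t) a + vintegral UNIV U A \<le> X"
    and F: "continuous_on UNIV F" "\<And>x. norm (F x) \<le> 1" and l: "l \<ge> 0"
  shows "l * vintegral UNIV U F \<le> X + l\<^sup>2 / 2 * mass"
proof -
  have "sintegral UNIV (h t) (\<lambda>x. - (l\<^sup>2 / 2)) + vintegral UNIV U (\<lambda>x. l *\<^sub>R F x) \<le> X"
  proof (rule X)
    show "- (l\<^sup>2 / 2) + 1/2 * (norm (l *\<^sub>R F x))\<^sup>2 \<le> 0" for x
    proof -
      have "(norm (F x))\<^sup>2 \<le> 1" using F(2)[of x] by (simp add: power_le_one)
      then have "l\<^sup>2 * (norm (F x))\<^sup>2 \<le> l\<^sup>2 * 1" by (intro mult_left_mono) auto
      then show ?thesis by (simp add: power_mult_distrib)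
    qed
  qed (intro continuous_intros F)+
  then show ?thesis
    unfolding sintegral_h_const[OF t] vintegral_scale[OF U vbounded_measurable_continuous[OF compact_T3 F(1)]] by simp
qed

text \<open>Competing with \<open>h\<^sup>* = 1\<close> and vanishing \<open>b\<^sup>*\<close>, \<open>d\<^sup>*\<close>, \<open>v\<^sup>*\<close>, for which \<open>L = 0\<close>, bounds the total
  variation of \<open>h(t)\<close> and \<open>B(t)\<close> uniformly in time, so that they can be integrated in time.\<close>

lemma ex_uniform_bound:
  "\<exists>L\<ge>0. \<forall>t\<in>{0..T}. \<forall>A\<in>sets borel. \<bar>h t A\<bar> \<le> L \<and> (\<forall>k. \<bar>B t A $ k\<bar> \<le> L)"
proof -
  obtain C where C: "\<Lambda> (h 0) (Utilde h B (\<lambda>s x. 1) (\<lambda>s x. 0) 0) \<le> ereal C" using initial_entropy_bound by blast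
  \<comment> \<open>The coercivity threshold \<open>1 + 10 M + 100 M\<^sup>2\<close> for entries bounded by \<open>M = 2\<close>.\<close>
  define r :: real where "r = 421"
  define X where "X = exp (r * T) * \<bar>C\<bar>"
  have X0: "X \<ge> 0" by (simp add: X_def)
  have Q: "\<xi> \<bullet> \<xi> \<le> \<xi> \<bullet> (Qr r (\<lambda>x. 0) (\<lambda>x. 0) (\<lambda>x. 0) x *v \<xi>)" for x \<xi>
    by (rule Qr_coercive[OF Qmat_entry_le[where K = 0]]) (simp_all add: pd_const r_def)
  have c1: "Ck_ST T 1 (\<lambda>s (x::T3). 1 :: real)" "Ck_ST T 1 (\<lambda>s (x::T3). 0 :: real ^ 3)"
    by (rule Ck_ST_static[OF smooth_T3_const T])+
  have L: "Lfield T (\<lambda>s x. 1) (\<lambda>s x. 0) (\<lambda>s x. 0) (\<lambda>s x. 0) s x = 0" if s: "s \<in> {0..T}" for s x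
  proof -
    have d: "dt T (\<lambda>t (x::T3). 1 :: real) s x = 0" "dt T (\<lambda>t (x::T3). 0 :: real ^ 3) s x = 0"
      by (rule dtI[OF T s]; simp)+
    have g: "diverg (\<lambda>x. 0) x = 0" "grad (\<lambda>x. 1) x = 0"
      by (simp_all add: diverg_3 pd_const vec_eq_iff grad_nth)
    show ?thesis unfolding Lfield_def Let_def
      by (rule blk10_eqI) (simp_all add: d g)
  qed
  have bound: "norm (Utilde h B (\<lambda>s x. 1) (\<lambda>s x. 0) t A) \<le> X + mass / 2" if t: "t \<in> {0..T}" and A: "A \<in> sets borel" for t A
  proof -
    let ?U = "Utilde h B (\<lambda>s x. 1) (\<lambda>s x. 0) t"
    have U: "vector_measure_on UNIV ?U"
      by (rule vector_measure_Utilde[of h t B, OF vm_h[OF t] vm_B[OF t]]) (auto simp: vbounded_measurable_def)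
    have val: "sintegral UNIV (h t) a + vintegral UNIV ?U A \<le> X"
      if aA: "continuous_on UNIV a" "continuous_on UNIV A" "\<And>x. a x + 1/2 * (norm (A x))\<^sup>2 \<le> 0" for a A
    proof -
      let ?v = "sintegral UNIV (h t) a + vintegral UNIV ?U A"
      have "exp (- r * t) * ?v
        + (sintegral ({0..t} \<times> UNIV) (spacetime T h) (\<lambda>z. 0)
          + vintegral ({0..t} \<times> UNIV) (Wtilde T h B D P (\<lambda>s x. 1) (\<lambda>s x. 0) (\<lambda>s x. 0) (\<lambda>s x. 0)) (\<lambda>z. 0))
        + vintegral ({0..t} \<times> UNIV) (Wtilde T h B D P (\<lambda>s x. 1) (\<lambda>s x. 0) (\<lambda>s x. 0) (\<lambda>s x. 0))
          (\<lambda>(s, x). exp (- r * s) *\<^sub>R Lfield T (\<lambda>s x. 1) (\<lambda>s x. 0) (\<lambda>s x. 0) (\<lambda>s x. 0) s x) \<le> C"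
        by (rule relative_entropy_apply[OF DS t c1(1) _ c1(2) c1(2) c1(2) Q C aA]) auto
      moreover have "vintegral ({0..t} \<times> UNIV) (Wtilde T h B D P (\<lambda>s x. 1) (\<lambda>s x. 0) (\<lambda>s x. 0) (\<lambda>s x. 0))
          (\<lambda>(s, x). exp (- r * s) *\<^sub>R Lfield T (\<lambda>s x. 1) (\<lambda>s x. 0) (\<lambda>s x. 0) (\<lambda>s x. 0) s x) = 0"
        using L t by (intro vintegral_vanishing) auto
      ultimately have "exp (- r * t) * ?v \<le> C" by (simp add: sintegral_vanishing)
      then have "exp (r * t) * (exp (- r * t) * ?v) \<le> exp (r * t) * \<bar>C\<bar>" by (intro mult_left_mono) auto
      moreover have "exp (r * t) * (exp (- r * t) * ?v) = ?v" by (simp add: mult.assoc[symmetric] exp_minus)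
      moreover have "exp (r * t) * \<bar>C\<bar> \<le> X" unfolding X_def using t by (intro mult_right_mono) (auto simp: r_def)
      ultimately show ?thesis by linarith
    qed
    have "(\<Sum>B\<in>{A}. norm (?U B)) \<le> X + mass / 2"
    proof (rule variation_sum_le[OF U])
      fix F :: "T3 \<Rightarrow> real ^ i4" assume "continuous_on UNIV F" "\<And>x. norm (F x) \<le> 1"
      from pairing_bound[OF t U val this, of 1] show "vintegral UNIV ?U F \<le> X + mass / 2" by simp
    qed (use A in auto)
    then show ?thesis by simp
  qed
  have "\<bar>h t A\<bar> \<le> 1 + (X + mass / 2) \<and> (\<forall>k. \<bar>B t A $ k\<bar> \<le> 1 + (X + mass / 2))" if t: "t \<in> {0..T}" and A: "A \<in> sets borel" for t A
  proof -
    have s1: "sintegral A (h t) (\<lambda>x. 1) = h t A"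
      using sintegral_const[OF vm_subset[OF vm_h[OF t], of A], of 1] A by (simp add: bsets_Int)
    have "Utilde h B (\<lambda>s x. 1) (\<lambda>s x. 0) t A $ Inl 1 = measure Leb A - h t A" by (simp add: Utilde_def smult_def s1)
    then have 1: "\<bar>measure Leb A - h t A\<bar> \<le> X + mass / 2"
      using component_le_norm_cart[of "Utilde h B (\<lambda>s x. 1) (\<lambda>s x. 0) t A" "Inl 1"] bound[OF t A] by simp
    have "measure Leb A \<le> 1"
      using finite_measure.bounded_measure[OF finite_measure_Leb, of A] by simp
    then have "\<bar>h t A\<bar> \<le> 1 + (X + mass / 2)" using 1 measure_nonneg[of Leb A] by linarith
    moreover have "\<bar>B t A $ k\<bar> \<le> 1 + (X + mass / 2)" for k
    proof -
      have "Utilde h B (\<lambda>s x. 1) (\<lambda>s x. 0) t A $ Inr k = B t A $ k" by (simp add: Utilde_def sintegral_vanishing)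
      then show ?thesis
        using component_le_norm_cart[of "Utilde h B (\<lambda>s x. 1) (\<lambda>s x. 0) t A" "Inr k"] bound[OF t A] by simp
    qed
    ultimately show ?thesis by blast
  qed
  then show ?thesis using X0 mass_nonneg by (intro exI[of _ "1 + (X + mass / 2)"]) auto
qed

lemma kernel_h: "\<exists>L. measure_kernel T L h" and kernel_B: "\<exists>L. measure_kernel T L (\<lambda>t A. B t A $ k)"
proof -
  obtain L where L: "\<And>t A. t \<in> {0..T} \<Longrightarrow> A \<in> sets borel \<Longrightarrow> \<bar>h t A\<bar> \<le> L"
    "\<And>t A k. t \<in> {0..T} \<Longrightarrow> A \<in> sets borel \<Longrightarrow> \<bar>B t A $ k\<bar> \<le> L" using ex_uniform_bound by blast
  have "measure_kernel T L h"
  proof (rule kernel_weak_star[OF vm_h _ L(1)])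
    show "continuous_on {0..T} (\<lambda>s. sintegral UNIV (h s) \<phi>)" if "continuous_on UNIV \<phi>" for \<phi>
      using DS that unfolding dissipative_solution_def wstar_continuous_scalar_def by blast
  qed
  then show "\<exists>L. measure_kernel T L h" by blast
  have "measure_kernel T L (\<lambda>t A. B t A $ k)"
  proof (rule kernel_weak_star[OF vm_nth[OF vm_B] _ L(2)])
    fix \<phi> :: "T3 \<Rightarrow> real" assume \<phi>: "continuous_on UNIV \<phi>"
    have "continuous_on UNIV (\<lambda>x. axis k (\<phi> x) :: real ^ 3)"
    proof (rule continuous_on_vecI)
      show "continuous_on UNIV (\<lambda>x. (axis k (\<phi> x) :: real ^ 3) $ i)" for i
        using \<phi> by (cases "i = k") (simp_all add: axis_def)
    qed
    then have "continuous_on {0..T} (\<lambda>t. vintegral UNIV (B t) (\<lambda>x. axis k (\<phi> x)))"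
      using DS unfolding dissipative_solution_def wstar_continuous_def by blast
    moreover have "vintegral UNIV (B t) (\<lambda>x. axis k (\<phi> x)) = sintegral UNIV (\<lambda>A. B t A $ k) \<phi>" for t
    proof -
      have "vintegral UNIV (B t) (\<lambda>x. axis k (\<phi> x)) = (\<Sum>i\<in>UNIV. if i = k then sintegral UNIV (\<lambda>A. B t A $ k) \<phi> else 0)"
        unfolding vintegral_def by (intro sum.cong) (auto simp: axis_def sintegral_vanishing)
      then show ?thesis by simp
    qed
    ultimately show "continuous_on {0..T} (\<lambda>t. sintegral UNIV (\<lambda>A. B t A $ k) \<phi>)" by simp
  qed
  then show "\<exists>L. measure_kernel T L (\<lambda>t A. B t A $ k)" by blast
qed

lemma vm_H: "\<theta> \<le> T \<Longrightarrow> vector_measure_on ({0..\<theta>} \<times> UNIV) (spacetime T h)"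
  using kernel_h sintegral_spacetime(1) by blast

lemma sintegral_H_const:
  assumes \<theta>: "0 \<le> \<theta>" "\<theta> \<le> T"
  shows "sintegral ({0..\<theta>} \<times> UNIV) (spacetime T h) (\<lambda>z. c) = c * (\<theta> * mass)"
proof -
  obtain L where k: "measure_kernel T L h" using kernel_h by blast
  have "sintegral ({0..\<theta>} \<times> UNIV) (spacetime T h) (\<lambda>z. c)
      = integral\<^sup>L (time_measure \<theta>) (\<lambda>s. sintegral UNIV (h s) (\<lambda>x. c))"
    by (rule sintegral_spacetime(2)[OF k \<theta>(2)]) simp
  also have "\<dots> = integral\<^sup>L (time_measure \<theta>) (\<lambda>s. c * mass)"
    using \<theta> by (intro Bochner_Integration.integral_cong refl sintegral_h_const) (simp add: space_time_measure)
  also have "\<dots> = c * (\<theta> * mass)" using measure_time_measure[OF \<theta>(1)] by (simp add: space_time_measure)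
  finally show ?thesis .
qed

lemma kernel_Utilde:
  assumes hs: "continuous_on ({0..T} \<times> UNIV) (\<lambda>(s, x). inverse (hs s x))" and bs: "continuous_on ({0..T} \<times> UNIV) (\<lambda>(s, x). bs s x)"
  shows "\<exists>L. measure_kernel T L (\<lambda>s A. Utilde h B hs bs s A $ i)"
proof -
  obtain L where k: "measure_kernel T L h" using kernel_h by blast
  show ?thesis
  proof (cases i)
    case (Inl j)
    obtain L1 where k1: "measure_kernel T L1 (\<lambda>s A. sintegral A (h s) (\<lambda>x. inverse (hs s x)))"
      using kernel_smult[OF k bounded_measurable_slab[OF hs]] by blast
    show ?thesis using kernel_diff[OF kernel_Leb k1] Inl by (auto simp: Utilde_def smult_def)
  next
    case (Inr j)
    have "continuous_on ({0..T} \<times> UNIV) (\<lambda>(s, x). bs s x $ j)"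
      using continuous_on_component[OF bs, of j] by (simp add: split_beta)
    then obtain L1 where k1: "measure_kernel T L1 (\<lambda>s A. sintegral A (h s) (\<lambda>x. bs s x $ j))"
      using kernel_smult[OF k bounded_measurable_slab] by blast
    obtain L2 where k2: "measure_kernel T L2 (\<lambda>t A. B t A $ j)" using kernel_B by blast
    show ?thesis using kernel_diff[OF k2 k1] Inr by (auto simp: Utilde_def)
  qed
qed

end

section \<open>Stability estimate\<close>

context initial_data
begin

definition coercivity_rate :: real
  where "coercivity_rate = (SOME r. r \<ge> 0 \<and> (\<forall>s\<ge>0. \<forall>x \<xi>. \<xi> \<bullet> \<xi> \<le> \<xi> \<bullet> (Qr r (tbs s) d1 v1 x *v \<xi>)))"

lemma coercivity_rate: "coercivity_rate \<ge> 0"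
  "s \<ge> 0 \<Longrightarrow> \<xi> \<bullet> \<xi> \<le> \<xi> \<bullet> (Qr coercivity_rate (tbs s) d1 v1 x *v \<xi>)"
proof -
  have "\<exists>r. r \<ge> 0 \<and> (\<forall>s\<ge>0. \<forall>x \<xi>. \<xi> \<bullet> \<xi> \<le> \<xi> \<bullet> (Qr r (tbs s) d1 v1 x *v \<xi>))" using ex_coercive by blast
  from someI_ex[OF this] show "coercivity_rate \<ge> 0"
    "s \<ge> 0 \<Longrightarrow> \<xi> \<bullet> \<xi> \<le> \<xi> \<bullet> (Qr coercivity_rate (tbs s) d1 v1 x *v \<xi>)"
    unfolding coercivity_rate_def by blast+
qed

definition residual_rate :: real
  where "residual_rate = (SOME c. c \<ge> 0 \<and>
    (\<forall>T>0. \<forall>s\<in>{0..T}. \<forall>x. norm (Lfield T ths tbs (\<lambda>s. d1) (\<lambda>s. v1) s x) \<le> c * s))"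

lemma residual_rate: "residual_rate \<ge> 0"
  "T > 0 \<Longrightarrow> s \<in> {0..T} \<Longrightarrow> norm (Lfield T ths tbs (\<lambda>s. d1) (\<lambda>s. v1) s x) \<le> residual_rate * s"
proof -
  have "\<exists>c. c \<ge> 0 \<and> (\<forall>T>0. \<forall>s\<in>{0..T}. \<forall>x. norm (Lfield T ths tbs (\<lambda>s. d1) (\<lambda>s. v1) s x) \<le> c * s)"
    using ex_Lfield_bound by blast
  from someI_ex[OF this] show "residual_rate \<ge> 0"
    "T > 0 \<Longrightarrow> s \<in> {0..T} \<Longrightarrow> norm (Lfield T ths tbs (\<lambda>s. d1) (\<lambda>s. v1) s x) \<le> residual_rate * s"
    unfolding residual_rate_def by blast+
qed

abbreviation density_constant :: "real \<Rightarrow> real"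
  where "density_constant \<Theta> \<equiv> (exp (coercivity_rate * \<Theta>))\<^sup>2 * residual_rate\<^sup>2 * mass / 16 + mass / 2"

abbreviation flux_constant :: "real \<Rightarrow> real"
  where "flux_constant \<Theta> \<equiv> exp (coercivity_rate * \<Theta>) / 2 * (1 + residual_rate)\<^sup>2 * mass"

lemma continuous_fields:
  "continuous_on ({0..\<theta>} \<times> UNIV) (\<lambda>(s, x). inverse (ths s x))"
  "continuous_on ({0..\<theta>} \<times> UNIV) (\<lambda>(s, x). ths s x)"
  "continuous_on ({0..\<theta>} \<times> UNIV) (\<lambda>(s, x). tbs s x)"
  "s \<ge> 0 \<Longrightarrow> continuous_on UNIV (\<lambda>x. inverse (ths s x))"
  "s \<ge> 0 \<Longrightarrow> continuous_on UNIV (ths s)" "continuous_on UNIV (tbs s)"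
proof -
  note c = smooth_T3_continuous[OF smooth_tau0] smooth_T3_continuous[OF smooth_tau1]
    smooth_T3_continuous[OF smooth_b0] smooth_T3_continuous[OF smooth_b1]
  have t: "continuous_on ({0..\<theta>} \<times> UNIV) (\<lambda>(s, x). ttau s x)"
    unfolding ttau_def split_beta by (intro continuous_intros c)
  have nz: "ttau s x \<noteq> 0" if "s \<ge> 0" for s x using ttau_pos[OF that, of x] by simp
  show "continuous_on ({0..\<theta>} \<times> UNIV) (\<lambda>(s, x). inverse (ths s x))" using t by (simp add: ths_def)
  show "continuous_on ({0..\<theta>} \<times> UNIV) (\<lambda>(s, x). ths s x)"
    using continuous_on_inverse[OF t] nz by (auto simp: ths_def split_beta)
  show "continuous_on ({0..\<theta>} \<times> UNIV) (\<lambda>(s, x). tbs s x)"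
    unfolding tbs_def split_beta by (intro continuous_intros c)
  show "continuous_on UNIV (\<lambda>x. inverse (ths s x))"
    unfolding ths_def ttau_def by (simp, intro continuous_intros c)
  have "continuous_on UNIV (ttau s)" unfolding ttau_def[abs_def] by (intro continuous_intros c)
  then show "continuous_on UNIV (ths s)" if "s \<ge> 0"
    unfolding ths_def[abs_def] using nz[OF that] by (intro continuous_on_inverse) auto
  show "continuous_on UNIV (tbs s)" unfolding tbs_def[abs_def] by (intro continuous_intros c)
qed

end

context dissipative
begin

abbreviation U where "U \<equiv> Utilde h B ths tbs"
abbreviation W where "W \<equiv> Wtilde T h B D P ths tbs (\<lambda>s. d1) (\<lambda>s. v1)"

lemma kernel_U: "\<exists>L. measure_kernel T L (\<lambda>s A. U s A $ i)"
  by (rule kernel_Utilde[OF continuous_fields(1,3)])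

lemma vm_U: "t \<in> {0..T} \<Longrightarrow> vector_measure_on UNIV (U t)"
  using kernelD(1) kernel_U by (intro vector_measure_onI_nth) blast

lemma bm_static:
  "bounded_measurable ({0..\<theta>::real} \<times> UNIV) (\<lambda>z. case_prod (\<lambda>s. d1) z $ k)"
  "bounded_measurable ({0..\<theta>::real} \<times> UNIV) (\<lambda>z. case_prod (\<lambda>s. v1) z $ k)"
  unfolding split_beta
  by (intro bounded_measurable_slab continuous_intros smooth_T3_continuous[OF smooth_d1]
      smooth_T3_continuous[OF smooth_v1])+

lemma W_components:
  assumes \<theta>: "\<theta> \<le> T" and A: "A \<in> bsets ({0..\<theta>} \<times> UNIV)"
  shows "W A $ Inl 1 = spacetime T (\<lambda>s A. U s A $ Inl 1) A"
    and "W A $ Inr (Inl k) = spacetime T (\<lambda>s A. U s A $ Inr k) A"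
    and "W A $ Inr (Inr (Inl k)) = D A $ k - sintegral A (spacetime T h) (\<lambda>z. case_prod (\<lambda>s. d1) z $ k)"
    and "W A $ Inr (Inr (Inr k)) = P A $ k - sintegral A (spacetime T h) (\<lambda>z. case_prod (\<lambda>s. v1) z $ k)"
proof -
  have "A \<in> sets borel" using A by (simp add: bsets_Int[OF slab_borel])
  from spacetime_nth[OF kernel_U this]
  show "W A $ Inl 1 = spacetime T (\<lambda>s A. U s A $ Inl 1) A" "W A $ Inr (Inl k) = spacetime T (\<lambda>s A. U s A $ Inr k) A"
    by (simp_all add: Wtilde_def)
qed (simp_all add: Wtilde_def)

lemma vm_W:
  assumes \<theta>: "\<theta> \<le> T" shows "vector_measure_on ({0..\<theta>} \<times> UNIV) W"
proof (rule vector_measure_onI_nth)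
  fix i :: i10
  note DP = vm_nth[OF vm_subset[OF vm_D slab_bsets[OF \<theta>]]] vm_nth[OF vm_subset[OF vm_P slab_bsets[OF \<theta>]]]
  have k: "vector_measure_on ({0..\<theta>} \<times> UNIV) (spacetime T (\<lambda>s A. U s A $ j))" for j
    using kernel_U sintegral_spacetime(1)[OF _ \<theta>] by blast
  show "vector_measure_on ({0..\<theta>} \<times> UNIV) (\<lambda>A. W A $ i)"
  proof (cases i rule: i10_cases)
    case 1
    show ?thesis unfolding 1 by (rule vm_cong[OF W_components(1)[OF \<theta>] k])
  next
    case (2 k')
    show ?thesis unfolding 2 by (rule vm_cong[OF W_components(2)[OF \<theta>] k])
  next
    case (3 k)
    show ?thesis unfolding 3
      by (rule vm_cong[OF W_components(3)[OF \<theta>] sintegral_diff_measure(1)[OF DP(1) sintegral_smult(1)[OF vm_H[OF \<theta>] bm_static(1)]]])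
  next
    case (4 k)
    show ?thesis unfolding 4
      by (rule vm_cong[OF W_components(4)[OF \<theta>] sintegral_diff_measure(1)[OF DP(2) sintegral_smult(1)[OF vm_H[OF \<theta>] bm_static(2)]]])
  qed
qed

lemma vintegral_W:
  assumes \<theta>: "0 \<le> \<theta>" "\<theta> \<le> T" and f: "continuous_on ({0..\<theta>} \<times> UNIV) f"
    and F: "continuous_on ({0..\<theta>} \<times> UNIV) F" and G: "continuous_on ({0..\<theta>} \<times> UNIV) G"
  shows "vintegral ({0..\<theta>} \<times> UNIV) W (\<lambda>z. blk10 (blk4 (f z) 0) (F z) (G z))
    = integral\<^sup>L (time_measure \<theta>) (\<lambda>s. integral\<^sup>L Leb (\<lambda>x. f (s, x)))
      - sintegral ({0..\<theta>} \<times> UNIV) (spacetime T h) (\<lambda>(s, x). inverse (ths s x) * f (s, x))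
      + (vintegral ({0..\<theta>} \<times> UNIV) D F - sintegral ({0..\<theta>} \<times> UNIV) (spacetime T h) (\<lambda>z. d1 (snd z) \<bullet> F z))
      + (vintegral ({0..\<theta>} \<times> UNIV) P G - sintegral ({0..\<theta>} \<times> UNIV) (spacetime T h) (\<lambda>z. v1 (snd z) \<bullet> G z))"
proof -
  let ?E = "{0..\<theta>} \<times> (UNIV :: T3 set)" and ?H = "spacetime T h"
  note DP = vm_nth[OF vm_subset[OF vm_D slab_bsets[OF \<theta>(2)]]] vm_nth[OF vm_subset[OF vm_P slab_bsets[OF \<theta>(2)]]]
  note bf = bounded_measurable_slab[OF f]
  have bF: "bounded_measurable ?E (\<lambda>z. F z $ k)" "bounded_measurable ?E (\<lambda>z. G z $ k)" for k
    by (intro bounded_measurable_slab continuous_intros F G)+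
  obtain L where kh: "measure_kernel T L h" using kernel_h by blast
  obtain L0 where k0: "measure_kernel T L0 (\<lambda>s A. U s A $ Inl 1)" using kernel_U by blast
  have bt: "bounded_measurable ?E (\<lambda>(s, x). inverse (ths s x) * f (s, x))"
  proof -
    have "bounded_measurable ?E (\<lambda>z. (\<lambda>(s, x). inverse (ths s x)) z * f z)"
      by (intro bounded_measurable_mult bounded_measurable_slab[OF continuous_fields(1)] bf)
    then show ?thesis by (simp add: case_prod_unfold)
  qed
  have c1: "sintegral ?E (\<lambda>A. W A $ Inl 1) f
      = integral\<^sup>L (time_measure \<theta>) (\<lambda>s. integral\<^sup>L Leb (\<lambda>x. f (s, x)))
        - sintegral ?E ?H (\<lambda>(s, x). inverse (ths s x) * f (s, x))"
  proof -
    have "sintegral ?E (\<lambda>A. W A $ Inl 1) f = sintegral ?E (spacetime T (\<lambda>s A. U s A $ Inl 1)) f"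
      by (rule sintegral_cong_measure[OF sintegral_spacetime(1)[OF k0 \<theta>(2)] W_components(1)[OF \<theta>(2)] bf])
    also have "\<dots> = integral\<^sup>L (time_measure \<theta>) (\<lambda>s. sintegral UNIV (\<lambda>A. U s A $ Inl 1) (\<lambda>x. f (s, x)))"
      by (rule sintegral_spacetime(2)[OF k0 \<theta>(2) bf])
    also have "\<dots> = integral\<^sup>L (time_measure \<theta>) (\<lambda>s. sintegral UNIV (measure Leb) (\<lambda>x. f (s, x))
        - sintegral UNIV (h s) (\<lambda>x. inverse (ths s x) * f (s, x)))"
    proof (intro Bochner_Integration.integral_cong refl)
      fix s assume "s \<in> space (time_measure \<theta>)"
      then have s: "s \<in> {0..\<theta>}" by (simp add: space_time_measure)
      then have sT: "s \<in> {0..T}" using \<theta> by simp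
      have fs: "bounded_measurable UNIV (\<lambda>x. f (s, x))" by (rule bounded_measurable_slice[OF bf s])
      have ts: "bounded_measurable UNIV (\<lambda>x. inverse (ths s x))"
        using s by (intro bounded_measurable_T3 continuous_fields(4)) simp
      show "sintegral UNIV (\<lambda>A. U s A $ Inl 1) (\<lambda>x. f (s, x)) = sintegral UNIV (measure Leb) (\<lambda>x. f (s, x))
        - sintegral UNIV (h s) (\<lambda>x. inverse (ths s x) * f (s, x))"
        using sintegral_diff_measure(2)[OF sintegral_Leb(1) sintegral_smult(1)[OF vm_h[OF sT] ts] fs]
        by (simp add: Utilde_def smult_def sintegral_smult(2)[OF vm_h[OF sT] ts fs])
    qed
    also have "\<dots> = integral\<^sup>L (time_measure \<theta>) (\<lambda>s. sintegral UNIV (measure Leb) (\<lambda>x. f (s, x)))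
        - integral\<^sup>L (time_measure \<theta>) (\<lambda>s. sintegral UNIV (h s) (\<lambda>x. (\<lambda>(s, x). inverse (ths s x) * f (s, x)) (s, x)))"
      using bounded_integral_diff[OF bounded_integral_time kernel_integral_bounded[OF kernel_Leb bf]
          kernel_integral_bounded[OF kernel_mono[OF kh \<theta>(2)] bt]] by simp
    also have "integral\<^sup>L (time_measure \<theta>) (\<lambda>s. sintegral UNIV (h s) (\<lambda>x. (\<lambda>(s, x). inverse (ths s x) * f (s, x)) (s, x)))
        = sintegral ?E ?H (\<lambda>(s, x). inverse (ths s x) * f (s, x))"
      by (rule sintegral_spacetime(2)[OF kh \<theta>(2) bt, symmetric])
    also have "integral\<^sup>L (time_measure \<theta>) (\<lambda>s. sintegral UNIV (measure Leb) (\<lambda>x. f (s, x)))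
        = integral\<^sup>L (time_measure \<theta>) (\<lambda>s. integral\<^sup>L Leb (\<lambda>x. f (s, x)))"
      by (intro Bochner_Integration.integral_cong refl sintegral_Leb(2) bounded_measurable_slice[OF bf])
        (simp add: space_time_measure)
    finally show ?thesis .
  qed
  have c2: "sintegral ?E (\<lambda>A. W A $ Inr (Inl k)) (\<lambda>z. 0) = 0" for k by (rule sintegral_vanishing) simp
  have inner: "(\<Sum>k\<in>UNIV. sintegral ?E ?H (\<lambda>z. g z $ k * F' z $ k)) = sintegral ?E ?H (\<lambda>z. g z \<bullet> F' z)"
    if "\<And>k. bounded_measurable ?E (\<lambda>z. g z $ k)" "\<And>k. bounded_measurable ?E (\<lambda>z. F' z $ k)" for g F' :: "real \<times> T3 \<Rightarrow> real ^ 3"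
    unfolding inner_vec_def inner_real_def
    by (rule bounded_integral_sum[OF bounded_integral_sintegral[OF vm_H[OF \<theta>(2)]], symmetric]) (intro bounded_measurable_mult that)
  have c3: "sintegral ?E (\<lambda>A. W A $ Inr (Inr (Inl k))) (\<lambda>z. F z $ k)
      = sintegral ?E (\<lambda>A. D A $ k) (\<lambda>z. F z $ k) - sintegral ?E ?H (\<lambda>z. case_prod (\<lambda>s. d1) z $ k * F z $ k)" for k
  proof -
    note d = sintegral_diff_measure[OF DP(1)[where i = k] sintegral_smult(1)[OF vm_H[OF \<theta>(2)] bm_static(1)[where k = k]]]
    show ?thesis
      using sintegral_cong_measure[OF d(1) W_components(3)[OF \<theta>(2)] bF(1)] d(2)[OF bF(1)]
        sintegral_smult(2)[OF vm_H[OF \<theta>(2)] bm_static(1) bF(1)] by simp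
  qed
  have c4: "sintegral ?E (\<lambda>A. W A $ Inr (Inr (Inr k))) (\<lambda>z. G z $ k)
      = sintegral ?E (\<lambda>A. P A $ k) (\<lambda>z. G z $ k) - sintegral ?E ?H (\<lambda>z. case_prod (\<lambda>s. v1) z $ k * G z $ k)" for k
  proof -
    note d = sintegral_diff_measure[OF DP(2)[where i = k] sintegral_smult(1)[OF vm_H[OF \<theta>(2)] bm_static(2)[where k = k]]]
    show ?thesis
      using sintegral_cong_measure[OF d(1) W_components(4)[OF \<theta>(2)] bF(2)] d(2)[OF bF(2)]
        sintegral_smult(2)[OF vm_H[OF \<theta>(2)] bm_static(2) bF(2)] by simp
  qed
  show ?thesis
    unfolding vintegral_def[of _ W] sum_i10 blk10_nth blk4_nth zero_index c1 c2 c3 c4 sum_subtractf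
      inner[OF bm_static(1) bF(1)] inner[OF bm_static(2) bF(2)]
    by (simp add: vintegral_def split_beta)
qed

text \<open>At time zero the test fields are the initial data, so the relative measure vanishes.\<close>

lemma initial_U_zero: "\<Lambda> (h 0) (U 0) \<le> ereal 0"
proof -
  have z: "0 \<in> {0..T}" using T by simp
  have t0: "inverse (ths 0 x) = tau0 x" "tbs 0 x = b0 x" for x by (simp_all add: ths_def ttau_def tbs_def phi_def)
  have bt: "bounded_measurable UNIV tau0" "bounded_measurable UNIV (\<lambda>x. b0 x $ k)" for k
    by (rule bounded_measurable_T3[OF smooth_T3_continuous[OF smooth_tau0]]
        bounded_measurable_T3[OF smooth_T3_continuous[OF smooth_T3_nth[OF smooth_b0]]])+
  have sub: "sintegral A (h 0) g = integral\<^sup>L Leb (\<lambda>x. h0 x * (indicator A x * g x))"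
    if A: "A \<in> sets borel" and g: "bounded_measurable UNIV g" for A g
    using sintegral_subset[OF vm_h[OF z], of A g] bounded_measurable_subset[OF g, of A]
      sintegral_h_0[OF bounded_measurable_extend[of A UNIV g]] A by simp
  have "U 0 A $ i = 0" if A: "A \<in> sets borel" for A i
  proof (cases "i = Inl 1")
    case True
    have "sintegral A (h 0) (\<lambda>x. inverse (ths 0 x)) = integral\<^sup>L Leb (\<lambda>x. h0 x * (indicator A x * tau0 x))"
      unfolding t0 by (rule sub[OF A bt(1)])
    also have "(\<lambda>x. h0 x * (indicator A x * tau0 x)) = indicator A"
      using tau0_h0 by (intro ext) (simp add: mult.left_commute)
    finally show ?thesis using True A by (simp add: Utilde_def smult_def)
  next
    case False
    then obtain k where k: "i = Inr k" using UNIV_i4 by blast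
    have "sintegral A (h 0) (\<lambda>x. tbs 0 x $ k) = integral\<^sup>L Leb (\<lambda>x. h0 x * (indicator A x * b0 x $ k))"
      unfolding t0 by (rule sub[OF A bt(2)])
    also have "(\<lambda>x. h0 x * (indicator A x * b0 x $ k)) = (\<lambda>x. indicator A x *\<^sub>R B0 x $ k)"
      by (intro ext) (simp add: B0_eq)
    also have "integral\<^sup>L Leb \<dots> = B 0 A $ k"
      using B_0[OF A] dens_nth[OF bm_B0 A, of k] by (simp add: dens_def set_lebesgue_integral_def)
    finally show ?thesis using k by (simp add: Utilde_def)
  qed
  then have Uz: "vintegral UNIV (U 0) F = 0" if "continuous_on UNIV F" for F
    unfolding vintegral_def using that
    by (intro sum.neutral ballI sintegral_zero_measure bounded_measurable_T3 continuous_intros) auto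
  have nonpos: "sintegral UNIV (h 0) a \<le> 0" if a: "continuous_on UNIV a" "\<And>x. a x \<le> 0" for a
  proof -
    have "h0 x * a x \<le> 0" for x using h0_pos[of x] a(2)[of x] by (simp add: mult_nonneg_nonpos)
    then have "0 \<le> integral\<^sup>L Leb (\<lambda>x. - (h0 x * a x))" by (intro Bochner_Integration.integral_nonneg) simp
    then have "integral\<^sup>L Leb (\<lambda>x. h0 x * a x) \<le> 0" by simp
    then show ?thesis using sintegral_h_0[OF bounded_measurable_T3[OF a(1)]] by simp
  qed
  have "sintegral UNIV (h 0) a + vintegral UNIV (U 0) A \<le> 0"
    if aA: "continuous_on UNIV a" "continuous_on UNIV A" "\<forall>x. a x + 1/2 * (norm (A x))\<^sup>2 \<le> 0" for a A
  proof -
    have "a x \<le> 0" for x using aA(3)[rule_format, of x] zero_le_power2[of "norm (A x)"] by linarith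
    from nonpos[OF aA(1) this] show ?thesis by (simp add: Uz[OF aA(2)])
  qed
  then show ?thesis unfolding \<Lambda>_def by (intro SUP_least) auto
qed

text \<open>The residual is absorbed by the competitor \<open>A = \<lambda> F - e\<^sup>-\<^sup>r\<^sup>s L\<close> in the dissipation; the remaining cost is
  that of the constant \<open>a\<close> dominating \<open>A\<close>.\<close>

lemma stability:
  assumes \<theta>: "0 \<le> \<theta>" "\<theta> \<le> T" "\<theta> \<le> \<Theta>" and l: "l \<ge> 0"
    and F: "continuous_on ({0..\<theta>} \<times> UNIV) F" "\<And>z. norm (F z) \<le> 1"
    and A: "continuous_on UNIV a" "continuous_on UNIV A" "\<And>x. a x + 1/2 * (norm (A x))\<^sup>2 \<le> 0"
  shows "exp (- coercivity_rate * \<theta>) * (sintegral UNIV (h \<theta>) a + vintegral UNIV (U \<theta>) A)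
      + l * vintegral ({0..\<theta>} \<times> UNIV) W F
    \<le> exp (coercivity_rate * \<Theta>) / 2 * (l + residual_rate * \<theta>)\<^sup>2 * (\<theta> * mass)"
proof -
  let ?r = coercivity_rate and ?E = "{0..\<theta>} \<times> (UNIV :: T3 set)"
  let ?L = "\<lambda>z. exp (- ?r * fst z) *\<^sub>R Lfield T ths tbs (\<lambda>s. d1) (\<lambda>s. v1) (fst z) (snd z)"
  define A' where "A' z = l *\<^sub>R F z - ?L z" for z
  define c where "c = - (exp (?r * \<Theta>) / 2 * (l + residual_rate * \<theta>)\<^sup>2)"
  note r = coercivity_rate(1)
  have cL: "continuous_on ?E ?L"
    using continuous_Lfield[OF T \<theta>(2)] by (intro continuous_intros) (simp add: split_beta)
  have cA': "continuous_on ?E A'" unfolding A'_def by (intro continuous_intros F cL)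
  have t: "\<theta> \<in> {0..T}" using \<theta> by simp
  have "exp (- ?r * \<theta>) * (sintegral UNIV (h \<theta>) a + vintegral UNIV (U \<theta>) A)
    + (sintegral ?E (spacetime T h) (\<lambda>z. c) + vintegral ?E W A')
    + vintegral ?E W (\<lambda>(s, x). exp (- ?r * s) *\<^sub>R Lfield T ths tbs (\<lambda>s. d1) (\<lambda>s. v1) s x) \<le> 0"
  proof (rule relative_entropy_apply[OF DS t Ck_ST_ths[OF T] _ Ck_ST_tbs[OF T] Ck_ST_static[OF smooth_d1 T]
        Ck_ST_static[OF smooth_v1 T] _ initial_U_zero A _ cA'])
    show "0 < ths s x" if "s \<in> {0..T}" for s x using that by (intro ths_pos) simp
    show "\<xi> \<bullet> \<xi> \<le> \<xi> \<bullet> (Qr ?r (tbs s) d1 v1 x *v \<xi>)" if "s \<in> {0..T}" for s x \<xi>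
      using that by (intro coercivity_rate(2)) simp
    fix s x assume s: "s \<in> {0..\<theta>}"
    let ?Q = "exp (- ?r * s) *\<^sub>R Qr ?r (tbs s) d1 v1 x"
    have "(norm (msqrt (matrix_inv ?Q) *v A' (s, x)))\<^sup>2 \<le> (norm (A' (s, x)))\<^sup>2 / exp (- ?r * s)"
    proof (rule norm_msqrt_inverse_le)
      show "transpose ?Q = ?Q"
        using Qr_transpose[of ?r "tbs s" d1 v1 x] by (simp add: transpose_def vec_eq_iff)
      show "exp (- ?r * s) * (\<xi> \<bullet> \<xi>) \<le> \<xi> \<bullet> (?Q *v \<xi>)" for \<xi>
        using coercivity_rate(2)[of s \<xi> x] s by (simp add: scaleR_matrix_vector_assoc[symmetric])
    qed simp
    also have "\<dots> = exp (?r * s) * (norm (A' (s, x)))\<^sup>2" by (simp add: exp_minus field_simps)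
    also have "\<dots> \<le> exp (?r * \<Theta>) * (l + residual_rate * \<theta>)\<^sup>2"
    proof (intro mult_mono power_mono)
      have "norm (A' (s, x)) \<le> norm (l *\<^sub>R F (s, x)) + norm (?L (s, x))" unfolding A'_def by (rule norm_triangle_ineq4)
      moreover have "norm (l *\<^sub>R F (s, x)) \<le> l * 1" using F(2)[of "(s, x)"] l by (simp add: mult_left_le)
      moreover have "norm (?L (s, x)) \<le> 1 * (residual_rate * \<theta>)"
        unfolding norm_scaleR
      proof (intro mult_mono)
        show "\<bar>exp (- ?r * fst (s, x))\<bar> \<le> 1" using r s by simp
        have "norm (Lfield T ths tbs (\<lambda>s. d1) (\<lambda>s. v1) s x) \<le> residual_rate * s"
          using s \<theta> by (intro residual_rate(2) T) auto
        also have "\<dots> \<le> residual_rate * \<theta>" using s residual_rate(1) by (intro mult_left_mono) auto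
        finally show "norm (Lfield T ths tbs (\<lambda>s. d1) (\<lambda>s. v1) (fst (s, x)) (snd (s, x))) \<le> residual_rate * \<theta>" by simp
      qed auto
      ultimately show "norm (A' (s, x)) \<le> l + residual_rate * \<theta>" by simp
      show "exp (?r * s) \<le> exp (?r * \<Theta>)" using r s \<theta> by (simp add: mult_left_mono)
    qed auto
    finally show "c + 1/2 * (norm (msqrt (matrix_inv ?Q) *v A' (s, x)))\<^sup>2 \<le> 0" unfolding c_def by simp
  qed (intro continuous_intros)
  moreover have "vintegral ?E W A' + vintegral ?E W (\<lambda>(s, x). exp (- ?r * s) *\<^sub>R Lfield T ths tbs (\<lambda>s. d1) (\<lambda>s. v1) s x)
      = l * vintegral ?E W F"
  proof -
    have "vintegral ?E W A' + vintegral ?E W ?L = vintegral ?E W (\<lambda>z. A' z + ?L z)"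
      by (rule vintegral_add[OF vm_W[OF \<theta>(2)] vbounded_measurable_continuous[OF compact_slab cA']
          vbounded_measurable_continuous[OF compact_slab cL], symmetric])
    also have "\<dots> = l * vintegral ?E W F"
      unfolding A'_def diff_add_cancel
      by (rule vintegral_scale[OF vm_W[OF \<theta>(2)] vbounded_measurable_continuous[OF compact_slab F(1)]])
    finally show ?thesis by (simp add: case_prod_unfold)
  qed
  moreover have "sintegral ?E (spacetime T h) (\<lambda>z. c) = c * (\<theta> * mass)" by (rule sintegral_H_const[OF \<theta>(1,2)])
  ultimately have "exp (- ?r * \<theta>) * (sintegral UNIV (h \<theta>) a + vintegral UNIV (U \<theta>) A) + l * vintegral ?E W F
      \<le> - (c * (\<theta> * mass))" by linarith
  then show ?thesis by (simp add: c_def)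
qed

text \<open>With \<open>l = \<theta>\<close> the right-hand side of the stability estimate is of order \<open>\<theta>\<^sup>3\<close>.\<close>

lemma W_estimate:
  assumes \<theta>: "0 \<le> \<theta>" "\<theta> \<le> T" "\<theta> \<le> \<Theta>" and F: "continuous_on ({0..\<theta>} \<times> UNIV) F" "\<And>z. norm (F z) \<le> 1"
  shows "vintegral ({0..\<theta>} \<times> UNIV) W F \<le> flux_constant \<Theta> * \<theta>\<^sup>2"
proof -
  have st: "l * vintegral ({0..\<theta>} \<times> UNIV) W F \<le> exp (coercivity_rate * \<Theta>) / 2 * (l + residual_rate * \<theta>)\<^sup>2 * (\<theta> * mass)"
    if "l \<ge> 0" for l
    using stability[OF \<theta> that F, of "\<lambda>x. 0" "\<lambda>x. 0"] by (simp add: sintegral_vanishing)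
  show ?thesis
  proof (cases "\<theta> = 0")
    case True
    then show ?thesis using st[of 1] by simp
  next
    case False
    then have p: "\<theta> > 0" using \<theta> by simp
    have "\<theta> * vintegral ({0..\<theta>} \<times> UNIV) W F \<le> \<theta> * (flux_constant \<Theta> * \<theta>\<^sup>2)"
      using st[of \<theta>] \<theta>(1) by (simp add: power2_eq_square algebra_simps)
    then show ?thesis using p by simp
  qed
qed

text \<open>The stability estimate with \<open>l = 0\<close> bounds \<open>\<Lambda>\<close> at time \<open>\<theta> = t\<^sup>2/2\<close> by a multiple of \<open>\<theta>\<^sup>3\<close>, hence of \<open>t\<^sup>6\<close>. The
  pairing bound loses a square root; its two terms balance for \<open>l = t\<^sup>3\<close>.\<close>

lemma U_estimate:
  assumes t: "0 \<le> t" "t\<^sup>2 / 2 \<le> T" "t\<^sup>2 / 2 \<le> \<Theta>" and F: "continuous_on UNIV F" "\<And>x. norm (F x) \<le> 1"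
  shows "vintegral UNIV (U (t\<^sup>2 / 2)) F \<le> density_constant \<Theta> * t ^ 3"
proof -
  define \<theta> where "\<theta> = t\<^sup>2 / 2"
  define E where "E = exp (coercivity_rate * \<Theta>)"
  have \<theta>: "0 \<le> \<theta>" "\<theta> \<le> T" "\<theta> \<le> \<Theta>" using t by (auto simp: \<theta>_def)
  have E0: "E > 0" by (simp add: E_def)
  have val: "sintegral UNIV (h \<theta>) a + vintegral UNIV (U \<theta>) A \<le> E\<^sup>2 * residual_rate\<^sup>2 * mass / 2 * \<theta> ^ 3"
    if aA: "continuous_on UNIV a" "continuous_on UNIV A" "\<And>x. a x + 1/2 * (norm (A x))\<^sup>2 \<le> 0" for a A
  proof -
    let ?v = "sintegral UNIV (h \<theta>) a + vintegral UNIV (U \<theta>) A"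
    have "exp (- coercivity_rate * \<theta>) * ?v \<le> E / 2 * (residual_rate * \<theta>)\<^sup>2 * (\<theta> * mass)"
      using stability[OF \<theta> order_refl _ _ aA, of "\<lambda>z. 0"] by (simp add: E_def)
    then have "exp (coercivity_rate * \<theta>) * (exp (- coercivity_rate * \<theta>) * ?v)
        \<le> exp (coercivity_rate * \<theta>) * (E / 2 * (residual_rate * \<theta>)\<^sup>2 * (\<theta> * mass))" by (intro mult_left_mono) auto
    moreover have "exp (coercivity_rate * \<theta>) * (exp (- coercivity_rate * \<theta>) * ?v) = ?v"
      by (simp add: mult.assoc[symmetric] exp_minus)
    moreover have "exp (coercivity_rate * \<theta>) * (E / 2 * (residual_rate * \<theta>)\<^sup>2 * (\<theta> * mass))
        \<le> E * (E / 2 * (residual_rate * \<theta>)\<^sup>2 * (\<theta> * mass))"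
      using \<theta> coercivity_rate(1) mass_nonneg E0 unfolding E_def by (intro mult_right_mono) (auto simp: mult_left_mono)
    ultimately show ?thesis by (simp add: power2_eq_square power3_eq_cube algebra_simps)
  qed
  have tT: "\<theta> \<in> {0..T}" using \<theta> by simp
  note pb = pairing_bound[OF tT vm_U[OF tT] val F]
  have "vintegral UNIV (U \<theta>) F \<le> (E\<^sup>2 * residual_rate\<^sup>2 * mass / 16 + mass / 2) * t ^ 3"
  proof (cases "t = 0")
    case True
    \<comment> \<open>At \<open>t = 0\<close> the balance degenerates, and \<open>l\<close> tends to zero instead.\<close>
    have "vintegral UNIV (U \<theta>) F \<le> 0 + e" if "e > 0" for e
    proof -
      define l where "l = e / (mass + 1)"
      have l: "l > 0" using that mass_nonneg by (simp add: l_def)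
      have "l * vintegral UNIV (U \<theta>) F \<le> l\<^sup>2 / 2 * mass" using pb[of l] l True by (simp add: \<theta>_def)
      then have "l * vintegral UNIV (U \<theta>) F \<le> l * (l / 2 * mass)" by (simp add: power2_eq_square)
      then have "vintegral UNIV (U \<theta>) F \<le> l / 2 * mass" using l by simp
      also have "\<dots> \<le> l * (mass + 1)" using l mass_nonneg by (simp add: algebra_simps)
      also have "\<dots> = e" using mass_nonneg by (simp add: l_def)
      finally show ?thesis by simp
    qed
    then have "vintegral UNIV (U \<theta>) F \<le> 0" by (rule field_le_epsilon)
    then show ?thesis using True by simp
  next
    case False
    then have p: "t ^ 3 > 0" using t by simp
    have "t ^ 3 * vintegral UNIV (U \<theta>) F \<le> E\<^sup>2 * residual_rate\<^sup>2 * mass / 2 * \<theta> ^ 3 + (t ^ 3)\<^sup>2 / 2 * mass"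
      using pb[of "t ^ 3"] p by simp
    also have "\<theta> ^ 3 = (t ^ 3)\<^sup>2 / 8" by (simp add: \<theta>_def power_divide power_mult[symmetric])
    finally have "t ^ 3 * vintegral UNIV (U \<theta>) F \<le> t ^ 3 * ((E\<^sup>2 * residual_rate\<^sup>2 * mass / 16 + mass / 2) * t ^ 3)"
      by (simp add: power2_eq_square algebra_simps)
    then show ?thesis using p by simp
  qed
  then show ?thesis by (simp add: \<theta>_def E_def)
qed

end

section \<open>Comparison with the Born-Infeld solution\<close>

lemma Leb_integral_le:
  fixes g :: "T3 \<Rightarrow> real"
  assumes "continuous_on UNIV g" "\<And>x. g x \<le> c" shows "integral\<^sup>L Leb g \<le> c"
proof -
  have "integral\<^sup>L Leb g \<le> integral\<^sup>L Leb (\<lambda>x. c)"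
  proof (rule Bochner_Integration.integral_mono)
    show "integrable Leb g" by (rule integrable_Leb[OF bounded_measurable_T3[OF assms(1)]])
    show "integrable Leb (\<lambda>x. c)" by (rule finite_measure.integrable_const[OF finite_measure_Leb])
  qed (rule assms(2))
  then show ?thesis by simp
qed

lemma vbounded_measurable_T3: "continuous_on UNIV F \<Longrightarrow> vbounded_measurable (UNIV :: T3 set) F"
  by (rule vbounded_measurable_continuous[OF compact_T3])

lemma vintegral_dens:
  fixes G :: "T3 \<Rightarrow> real ^ 'n"
  assumes G: "continuous_on UNIV G"
  shows "vector_measure_on UNIV (dens G)"
    and "continuous_on UNIV F \<Longrightarrow> vintegral UNIV (dens G) F = integral\<^sup>L Leb (\<lambda>x. G x \<bullet> F x)"
proof -
  note bG = vbounded_measurableD[OF vbounded_measurable_T3[OF G]]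
  show vm: "vector_measure_on UNIV (dens G)"
    by (rule vector_measure_onI_nth, rule vm_cong[OF _ sintegral_dens(1)[OF bG]]) (simp add: dens_nth[OF bG])
  assume F: "continuous_on UNIV F"
  note bF = vbounded_measurableD[OF vbounded_measurable_T3[OF F]]
  have "sintegral UNIV (\<lambda>A. dens G A $ i) (\<lambda>x. F x $ i) = integral\<^sup>L Leb (\<lambda>x. G x $ i * F x $ i)" for i
    using sintegral_cong_measure[OF sintegral_dens(1)[OF bG] _ bF, of "\<lambda>A. dens G A $ i" i i]
      sintegral_dens(2)[OF bG bF] dens_nth[OF bG] by simp
  then have "vintegral UNIV (dens G) F = (\<Sum>i\<in>UNIV. integral\<^sup>L Leb (\<lambda>x. G x $ i * F x $ i))" by (simp add: vintegral_def)
  also have "\<dots> = integral\<^sup>L Leb (\<lambda>x. G x \<bullet> F x)"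
    unfolding inner_vec_def inner_real_def
    by (rule Bochner_Integration.integral_sum[symmetric]) (intro integrable_Leb bounded_measurable_mult bG bF)
  finally show "vintegral UNIV (dens G) F = integral\<^sup>L Leb (\<lambda>x. G x \<bullet> F x)" .
qed

lemma kernel_cong:
  assumes k: "measure_kernel T K \<mu>" and eq: "\<And>s A. s \<in> {0..T} \<Longrightarrow> A \<in> sets borel \<Longrightarrow> \<nu> s A = \<mu> s A"
  shows "measure_kernel T K \<nu>"
proof (rule kernelI)
  show "vector_measure_on UNIV (\<nu> s)" if "s \<in> {0..T}" for s
    by (rule vm_cong[OF _ kernelD(1)[OF k that]]) (simp add: eq[OF that])
  show "\<bar>\<nu> s A\<bar> \<le> K" if "s \<in> {0..T}" "A \<in> sets borel" for s A using kernelD(2)[OF k that] eq[OF that] by simp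
  show "(\<lambda>s. \<nu> s A) \<in> borel_measurable (restrict_space borel {0..T})" if "A \<in> sets borel" for A
    using kernelD(3)[OF k that] eq[OF _ that] by (subst measurable_cong) (auto simp: space_restrict_space)
qed

lemma continuous_slice:
  "continuous_on ({0..T} \<times> UNIV) f \<Longrightarrow> s \<in> {0..T::real} \<Longrightarrow> continuous_on UNIV (\<lambda>x. f (s, x))"
  by (rule continuous_on_compose2) (auto intro!: continuous_intros)

lemma bounded_measurable_fibre_integral:
  fixes T :: real
  assumes "continuous_on ({0..T} \<times> UNIV) f"
  shows "bounded_measurable {0..T} (\<lambda>s. integral\<^sup>L Leb (\<lambda>x. f (s, x)))"
proof -
  note bf = bounded_measurable_slab[OF assms]
  have e: "sintegral UNIV (measure Leb) (\<lambda>x. f (s, x)) = integral\<^sup>L Leb (\<lambda>x. f (s, x))" if "s \<in> {0..T}" for s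
    by (rule sintegral_Leb(2)[OF bounded_measurable_slice[OF bf that]])
  have b: "bounded_measurable {0..T} (\<lambda>s. sintegral UNIV (measure Leb) (\<lambda>x. f (s, x)))"
    by (rule kernel_integral_bounded[OF kernel_Leb bf])
  obtain K where K: "\<forall>s\<in>{0..T}. \<bar>sintegral UNIV (measure Leb) (\<lambda>x. f (s, x))\<bar> \<le> K" using bounded_measurableD[OF b] by blast
  show ?thesis
  proof (rule bounded_measurableI[where K = K])
    show "(\<lambda>s. integral\<^sup>L Leb (\<lambda>x. f (s, x))) \<in> borel_measurable (restrict_space borel {0..T})"
      using bounded_measurable_measurable[OF b] e
      by (subst measurable_cong[where g = "\<lambda>s. sintegral UNIV (measure Leb) (\<lambda>x. f (s, x))"]) (auto simp: space_restrict_space)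
  qed (use K e in auto)
qed

lemma vintegral_spacetime_dens:
  fixes G :: "real \<Rightarrow> T3 \<Rightarrow> real ^ 'n"
  assumes G: "continuous_on ({0..T} \<times> UNIV) (case_prod G)" and t: "t \<le> T"
  shows "vector_measure_on ({0..t} \<times> UNIV) (spacetime T (\<lambda>s. dens (G s)))"
    and "continuous_on ({0..t} \<times> UNIV) F \<Longrightarrow> vintegral ({0..t} \<times> UNIV) (spacetime T (\<lambda>s. dens (G s))) F
      = integral\<^sup>L (time_measure t) (\<lambda>s. integral\<^sup>L Leb (\<lambda>x. G s x \<bullet> F (s, x)))"
proof -
  let ?E = "{0..t} \<times> (UNIV :: T3 set)"
  have cG: "continuous_on UNIV (G s)" if "s \<in> {0..T}" for s using continuous_slice[OF G that] by simp
  note bG = vbounded_measurableD[OF vbounded_measurable_T3[OF cG]]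
  have k: "\<exists>L. measure_kernel T L (\<lambda>s A. dens (G s) A $ i)" for i
  proof -
    have "continuous_on ({0..T} \<times> UNIV) (\<lambda>(s, x). G s x $ i)"
      using continuous_on_component[OF G, of i] by (simp add: split_beta)
    from kernel_smult[OF kernel_Leb bounded_measurable_slab[OF this]]
    obtain L where "measure_kernel T L (\<lambda>s A. sintegral A (measure Leb) (\<lambda>x. G s x $ i))" by blast
    then have "measure_kernel T L (\<lambda>s A. dens (G s) A $ i)"
      by (rule kernel_cong) (simp add: dens_nth[OF bG] dens_eq_smult[OF bG])
    then show ?thesis by blast
  qed
  have c: "vector_measure_on ?E (spacetime T (\<lambda>s A. dens (G s) A $ i))" for i
    using k sintegral_spacetime(1)[OF _ t] by blast
  have e: "spacetime T (\<lambda>s. dens (G s)) A $ i = spacetime T (\<lambda>s A. dens (G s) A $ i) A" if "A \<in> bsets ?E" for A i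
    using that by (intro spacetime_nth k) (simp add: bsets_Int[OF slab_borel])
  show "vector_measure_on ?E (spacetime T (\<lambda>s. dens (G s)))"
    by (rule vector_measure_onI_nth, rule vm_cong[OF e c])
  assume F: "continuous_on ?E F"
  have bF: "bounded_measurable ?E (\<lambda>z. F z $ i)" for i by (intro bounded_measurable_slab continuous_intros F)
  have fib: "bounded_measurable {0..t} (\<lambda>s. integral\<^sup>L Leb (\<lambda>x. G s x $ i * F (s, x) $ i))" for i
  proof -
    have "continuous_on ?E (\<lambda>z. case_prod G z $ i * F z $ i)"
      by (intro continuous_intros F continuous_on_subset[OF G]) (use t in auto)
    from bounded_measurable_fibre_integral[OF this] show ?thesis by simp
  qed
  have "sintegral ?E (\<lambda>A. spacetime T (\<lambda>s. dens (G s)) A $ i) (\<lambda>z. F z $ i)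
      = integral\<^sup>L (time_measure t) (\<lambda>s. integral\<^sup>L Leb (\<lambda>x. G s x $ i * F (s, x) $ i))" for i
  proof -
    obtain L where k: "measure_kernel T L (\<lambda>s A. dens (G s) A $ i)" using k by blast
    have "sintegral ?E (\<lambda>A. spacetime T (\<lambda>s. dens (G s)) A $ i) (\<lambda>z. F z $ i)
        = integral\<^sup>L (time_measure t) (\<lambda>s. sintegral UNIV (\<lambda>A. dens (G s) A $ i) (\<lambda>x. F (s, x) $ i))"
      using sintegral_cong_measure[OF c e bF] sintegral_spacetime(2)[OF k t bF] by simp
    also have "\<dots> = integral\<^sup>L (time_measure t) (\<lambda>s. integral\<^sup>L Leb (\<lambda>x. G s x $ i * F (s, x) $ i))"
    proof (intro Bochner_Integration.integral_cong refl)
      fix s assume "s \<in> space (time_measure t)"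
      then have s: "s \<in> {0..t}" by (simp add: space_time_measure)
      then have sT: "s \<in> {0..T}" using t by simp
      note bFs = bounded_measurable_slice[OF bF s]
      show "sintegral UNIV (\<lambda>A. dens (G s) A $ i) (\<lambda>x. F (s, x) $ i) = integral\<^sup>L Leb (\<lambda>x. G s x $ i * F (s, x) $ i)"
        using sintegral_cong_measure[OF sintegral_dens(1)[OF bG[OF sT]] _ bFs, of "\<lambda>A. dens (G s) A $ i" i i]
          sintegral_dens(2)[OF bG[OF sT] bFs] dens_nth[OF bG[OF sT]] by simp
    qed
    finally show ?thesis .
  qed
  then have "vintegral ?E (spacetime T (\<lambda>s. dens (G s))) F
      = (\<Sum>i\<in>UNIV. integral\<^sup>L (time_measure t) (\<lambda>s. integral\<^sup>L Leb (\<lambda>x. G s x $ i * F (s, x) $ i)))"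
    by (simp add: vintegral_def)
  also have "\<dots> = integral\<^sup>L (time_measure t) (\<lambda>s. \<Sum>i\<in>UNIV. integral\<^sup>L Leb (\<lambda>x. G s x $ i * F (s, x) $ i))"
    by (rule Bochner_Integration.integral_sum[symmetric])
      (rule bounded_measurable_integrable[OF finite_time_measure sets_time_measure fib])
  also have "\<dots> = integral\<^sup>L (time_measure t) (\<lambda>s. integral\<^sup>L Leb (\<lambda>x. G s x \<bullet> F (s, x)))"
  proof (intro Bochner_Integration.integral_cong refl)
    fix s assume "s \<in> space (time_measure t)"
    then have s: "s \<in> {0..t}" by (simp add: space_time_measure)
    then have sT: "s \<in> {0..T}" using t by simp
    show "(\<Sum>i\<in>UNIV. integral\<^sup>L Leb (\<lambda>x. G s x $ i * F (s, x) $ i)) = integral\<^sup>L Leb (\<lambda>x. G s x \<bullet> F (s, x))"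
      unfolding inner_vec_def inner_real_def
      by (rule Bochner_Integration.integral_sum[symmetric])
        (intro integrable_Leb bounded_measurable_mult bG[OF sT] bounded_measurable_slice[OF bF s])
  qed
  finally show "vintegral ?E (spacetime T (\<lambda>s. dens (G s))) F
      = integral\<^sup>L (time_measure t) (\<lambda>s. integral\<^sup>L Leb (\<lambda>x. G s x \<bullet> F (s, x)))" .
qed

lemma quadratic_time_substitution:
  assumes J: "bounded_measurable {0..t\<^sup>2 / 2} J" and t: "t \<ge> 0"
  shows "integral\<^sup>L (time_measure (t\<^sup>2 / 2)) J = integral\<^sup>L (time_measure t) (\<lambda>s. s * J (s\<^sup>2 / 2))"
proof -
  have "integrable (time_measure (t\<^sup>2 / 2)) J"
    by (rule bounded_measurable_integrable[OF finite_time_measure sets_time_measure J])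
  then have i: "set_integrable lborel {0\<^sup>2 / 2..t\<^sup>2 / 2} J"
    by (subst (asm) integrable_restrict_space) (auto simp: set_integrable_def)
  have d: "((\<lambda>s. s\<^sup>2 / 2) has_real_derivative x) (at x)" for x :: real
    by (auto intro!: derivative_eq_intros)
  have "(LBINT x. J x * indicator {0\<^sup>2 / 2..t\<^sup>2 / 2} x) = (LBINT x. J (x\<^sup>2 / 2) * x * indicator {0..t} x)"
    by (rule integral_substitution(2)[where g = "\<lambda>s. s\<^sup>2 / 2" and g' = "\<lambda>s. s", OF i d continuous_on_id _ t]) simp
  then show ?thesis
    by (subst (1 2) integral_restrict_space) (auto simp: mult_ac)
qed

text \<open>A rescaled measure is compared with a density through the measure before rescaling, on which
  the substitution \<open>\<sigma> = s\<^sup>2 / 2\<close> acts.\<close>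

lemma rescaled_variation:
  fixes G w :: "real \<Rightarrow> T3 \<Rightarrow> real ^ 3"
  assumes t0: "t0 > 0" and M: "vector_measure_on ({0..t0\<^sup>2 / 2} \<times> UNIV) M" and N: "is_rescaled t0 M N"
    and G: "continuous_on ({0..t0} \<times> UNIV) (case_prod G)"
    and w: "continuous_on ({0..t0\<^sup>2 / 2} \<times> UNIV) (case_prod w)"
    and pair: "\<And>\<theta> F. 0 \<le> \<theta> \<Longrightarrow> \<theta> \<le> t0\<^sup>2 / 2 \<Longrightarrow> continuous_on ({0..\<theta>} \<times> UNIV) F \<Longrightarrow> (\<And>z. norm (F z) \<le> 1) \<Longrightarrow>
      integral\<^sup>L (time_measure \<theta>) (\<lambda>s. integral\<^sup>L Leb (\<lambda>x. w s x \<bullet> F (s, x))) - vintegral ({0..\<theta>} \<times> UNIV) M F \<le> a * \<theta>\<^sup>2"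
    and cmp: "\<And>s x. s \<in> {0..t0} \<Longrightarrow> norm (G s x - s *\<^sub>R w (s\<^sup>2 / 2) x) \<le> c * s ^ 3"
    and a: "a \<ge> 0" and c: "c \<ge> 0" and t: "t \<in> {0..t0}"
  shows "variation (\<lambda>A. spacetime t0 (\<lambda>s. dens (G s)) A - N A) ({0..t} \<times> UNIV) \<le> ereal ((c + a) * t ^ 4)"
proof (rule variation_le_dual[OF slab_borel])
  let ?E = "{0..t} \<times> (UNIV :: T3 set)" and ?\<theta> = "t\<^sup>2 / 2" and ?F = "{0..t\<^sup>2 / 2} \<times> (UNIV :: T3 set)"
  have tt: "0 \<le> t" "t \<le> t0" using t by auto
  have \<theta>: "?\<theta> \<le> t0\<^sup>2 / 2" using tt by (simp add: power_mono)
  define R where "R A = M ((\<lambda>(s, x). (sqrt (2 * s), x)) -` A \<inter> ?F)" for A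
  have R: "is_rescaled t M R"
    unfolding R_def by (rule is_rescaled_image[OF tt(1) vm_subset[OF M slab_bsets[OF \<theta>]]])
  have NR: "N A = R A" if A: "A \<in> bsets ?E" for A
  proof -
    have AE: "A \<subseteq> ?E" using A by (rule sets_restrict_borel_sub)
    have "A \<in> bsets ({0..t0} \<times> UNIV)" by (rule bsets_mono[OF slab_bsets[OF tt(2)] A])
    from rescaled_unique[OF less_imp_le[OF t0] M N this]
    have "N A = M ((\<lambda>(s, x). (sqrt (2 * s), x)) -` A \<inter> {0..t0\<^sup>2 / 2} \<times> UNIV)" .
    moreover have "(\<lambda>(s, x). (sqrt (2 * s), x)) -` A \<inter> {0..t0\<^sup>2 / 2} \<times> UNIV = (\<lambda>(s, x). (sqrt (2 * s), x)) -` A \<inter> ?F"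
    proof -
      have "s \<le> ?\<theta>" if "(sqrt (2 * s), x) \<in> A" "0 \<le> s" for s x
      proof -
        have "sqrt (2 * s) \<le> t" using that(1) AE by auto
        then have "(sqrt (2 * s))\<^sup>2 \<le> t\<^sup>2" using that(2) by (intro power_mono) auto
        then show ?thesis using that(2) by simp
      qed
      then show ?thesis using \<theta> by auto
    qed
    ultimately show ?thesis by (simp add: R_def)
  qed
  have vR: "vector_measure_on ?E R" using R by (simp add: is_rescaled_def)
  have vN: "vector_measure_on ?E N" by (rule vm_cong[OF NR vR])
  note vS = vintegral_spacetime_dens(1)[OF G tt(2)]
  show "vector_measure_on ?E (\<lambda>A. spacetime t0 (\<lambda>s. dens (G s)) A - N A)"
    by (rule vintegral_diff_measure(1)[OF vS vN])
  fix F :: "real \<times> T3 \<Rightarrow> real ^ 3" assume F: "continuous_on ?E F" "\<And>z. norm (F z) \<le> 1"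
  note bF = vbounded_measurable_continuous[OF compact_slab F(1)]
  define \<psi> where "\<psi> = (\<lambda>(s, x). F (sqrt (2 * s), x))"
  have c\<psi>: "continuous_on ?F \<psi>"
    unfolding \<psi>_def case_prod_unfold
  proof (rule continuous_on_compose2[OF F(1)])
    show "continuous_on ?F (\<lambda>z. (sqrt (2 * fst z), snd z))" by (intro continuous_intros)
    have "sqrt (2 * s) \<le> t" if "s \<le> ?\<theta>" for s
      using real_sqrt_le_mono[of "2 * s" "t\<^sup>2"] that tt by simp
    then show "(\<lambda>z. (sqrt (2 * fst z), snd z)) ` ?F \<subseteq> ?E" by auto
  qed
  have n\<psi>: "norm (\<psi> z) \<le> 1" for z using F(2) by (simp add: \<psi>_def split_beta)
  have "vintegral ?E N F = vintegral ?E R F"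
    unfolding vintegral_def
    by (intro sum.cong refl sintegral_cong_measure[OF vm_nth[OF vR] _ vbounded_measurableD[OF bF]]) (simp add: NR)
  also have "\<dots> = vintegral ?F M \<psi>" using R F(1) by (simp add: is_rescaled_def \<psi>_def)
  finally have VN: "vintegral ?E N F = vintegral ?F M \<psi>" .
  define J where "J \<sigma> = integral\<^sup>L Leb (\<lambda>x. w \<sigma> x \<bullet> \<psi> (\<sigma>, x))" for \<sigma>
  have cw: "continuous_on ?F (case_prod w)" by (rule continuous_on_subset[OF w]) (use \<theta> in auto)
  have bJ: "bounded_measurable {0..?\<theta>} J"
  proof -
    have "continuous_on ?F (\<lambda>z. case_prod w z \<bullet> \<psi> z)" by (intro continuous_intros cw c\<psi>)
    from bounded_measurable_fibre_integral[OF this] show ?thesis by (simp add: J_def[abs_def])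
  qed
  have sub: "integral\<^sup>L (time_measure ?\<theta>) J = integral\<^sup>L (time_measure t) (\<lambda>s. s * J (s\<^sup>2 / 2))"
    by (rule quadratic_time_substitution[OF bJ tt(1)])
  have kw: "continuous_on ?E (\<lambda>z. w ((fst z)\<^sup>2 / 2) (snd z))"
  proof -
    have "continuous_on ?E (\<lambda>z. case_prod w ((fst z)\<^sup>2 / 2, snd z))"
    proof (rule continuous_on_compose2[OF cw])
      show "(\<lambda>z. ((fst z)\<^sup>2 / 2, snd z)) ` ?E \<subseteq> ?F" by (auto simp: power_mono)
    qed (intro continuous_intros, simp)
    then show ?thesis by simp
  qed
  have cG: "continuous_on ?E (\<lambda>z. case_prod G z)" by (rule continuous_on_subset[OF G]) (use tt in auto)
  have sJ: "s * J (s\<^sup>2 / 2) = integral\<^sup>L Leb (\<lambda>x. (s *\<^sub>R w (s\<^sup>2 / 2) x) \<bullet> F (s, x))" if "s \<in> {0..t}" for s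
    using that by (simp add: J_def \<psi>_def)
  have b1: "bounded_measurable {0..t} (\<lambda>s. integral\<^sup>L Leb (\<lambda>x. G s x \<bullet> F (s, x)))"
    "bounded_measurable {0..t} (\<lambda>s. integral\<^sup>L Leb (\<lambda>x. (s *\<^sub>R w (s\<^sup>2 / 2) x) \<bullet> F (s, x)))"
  proof -
    have "continuous_on ?E (\<lambda>z. case_prod G z \<bullet> F z)" by (intro continuous_intros cG F)
    from bounded_measurable_fibre_integral[OF this]
    show "bounded_measurable {0..t} (\<lambda>s. integral\<^sup>L Leb (\<lambda>x. G s x \<bullet> F (s, x)))" by simp
    have "continuous_on ?E (\<lambda>z. (fst z *\<^sub>R w ((fst z)\<^sup>2 / 2) (snd z)) \<bullet> F z)" by (intro continuous_intros kw F)
    from bounded_measurable_fibre_integral[OF this]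
    show "bounded_measurable {0..t} (\<lambda>s. integral\<^sup>L Leb (\<lambda>x. (s *\<^sub>R w (s\<^sup>2 / 2) x) \<bullet> F (s, x)))" by simp
  qed
  have subJ: "integral\<^sup>L (time_measure ?\<theta>) J = integral\<^sup>L (time_measure t) (\<lambda>s. integral\<^sup>L Leb (\<lambda>x. (s *\<^sub>R w (s\<^sup>2 / 2) x) \<bullet> F (s, x)))"
    unfolding sub by (intro Bochner_Integration.integral_cong refl sJ) (simp add: space_time_measure)
  have "integral\<^sup>L (time_measure t) (\<lambda>s. integral\<^sup>L Leb (\<lambda>x. G s x \<bullet> F (s, x))) - integral\<^sup>L (time_measure ?\<theta>) J
      = integral\<^sup>L (time_measure t) (\<lambda>s. integral\<^sup>L Leb (\<lambda>x. G s x \<bullet> F (s, x)) - integral\<^sup>L Leb (\<lambda>x. (s *\<^sub>R w (s\<^sup>2 / 2) x) \<bullet> F (s, x)))"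
    unfolding subJ by (rule bounded_integral_diff[OF bounded_integral_time b1, symmetric])
  also have "\<dots> \<le> integral\<^sup>L (time_measure t) (\<lambda>s. c * t ^ 3)"
  proof (rule integral_mono)
    show "integrable (time_measure t) (\<lambda>s. integral\<^sup>L Leb (\<lambda>x. G s x \<bullet> F (s, x)) - integral\<^sup>L Leb (\<lambda>x. (s *\<^sub>R w (s\<^sup>2 / 2) x) \<bullet> F (s, x)))"
      by (intro bounded_measurable_integrable[OF finite_time_measure sets_time_measure] bounded_measurable_diff b1)
    show "integrable (time_measure t) (\<lambda>s. c * t ^ 3)" by (rule finite_measure.integrable_const[OF finite_time_measure])
    fix s assume "s \<in> space (time_measure t)"
    then have s: "s \<in> {0..t}" by (simp add: space_time_measure)
    have cs: "continuous_on UNIV (\<lambda>x. G s x)" "continuous_on UNIV (\<lambda>x. w (s\<^sup>2 / 2) x)" "continuous_on UNIV (\<lambda>x. F (s, x))"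
      using continuous_slice[OF cG s] continuous_slice[OF kw s] continuous_slice[OF F(1) s] by simp_all
    have "integral\<^sup>L Leb (\<lambda>x. G s x \<bullet> F (s, x)) - integral\<^sup>L Leb (\<lambda>x. (s *\<^sub>R w (s\<^sup>2 / 2) x) \<bullet> F (s, x))
        = integral\<^sup>L Leb (\<lambda>x. G s x \<bullet> F (s, x) - (s *\<^sub>R w (s\<^sup>2 / 2) x) \<bullet> F (s, x))"
      by (rule Bochner_Integration.integral_diff[symmetric]) (intro integrable_Leb bounded_measurable_T3 continuous_intros cs)+
    also have "\<dots> \<le> c * t ^ 3"
    proof (rule Leb_integral_le)
      show "continuous_on UNIV (\<lambda>x. G s x \<bullet> F (s, x) - (s *\<^sub>R w (s\<^sup>2 / 2) x) \<bullet> F (s, x))" by (intro continuous_intros cs)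
      fix x
      have "G s x \<bullet> F (s, x) - (s *\<^sub>R w (s\<^sup>2 / 2) x) \<bullet> F (s, x) = (G s x - s *\<^sub>R w (s\<^sup>2 / 2) x) \<bullet> F (s, x)"
        by (simp add: inner_diff_left)
      also have "\<dots> \<le> norm (G s x - s *\<^sub>R w (s\<^sup>2 / 2) x) * norm (F (s, x))" by (rule norm_cauchy_schwarz)
      also have "\<dots> \<le> norm (G s x - s *\<^sub>R w (s\<^sup>2 / 2) x)" using F(2) by (simp add: mult_left_le)
      also have "\<dots> \<le> c * s ^ 3" using s tt by (intro cmp) simp
      also have "\<dots> \<le> c * t ^ 3" using s c by (intro mult_left_mono power_mono) auto
      finally show "G s x \<bullet> F (s, x) - (s *\<^sub>R w (s\<^sup>2 / 2) x) \<bullet> F (s, x) \<le> c * t ^ 3" .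
    qed
    finally show "integral\<^sup>L Leb (\<lambda>x. G s x \<bullet> F (s, x)) - integral\<^sup>L Leb (\<lambda>x. (s *\<^sub>R w (s\<^sup>2 / 2) x) \<bullet> F (s, x)) \<le> c * t ^ 3" .
  qed
  also have "\<dots> = c * t ^ 4" using measure_time_measure[OF tt(1)] by (simp add: space_time_measure power4_eq_xxxx power3_eq_cube)
  finally have 1: "integral\<^sup>L (time_measure t) (\<lambda>s. integral\<^sup>L Leb (\<lambda>x. G s x \<bullet> F (s, x))) - integral\<^sup>L (time_measure ?\<theta>) J \<le> c * t ^ 4" .
  have "integral\<^sup>L (time_measure ?\<theta>) J - vintegral ?F M \<psi> \<le> a * ?\<theta>\<^sup>2"
    unfolding J_def by (rule pair[OF _ \<theta> c\<psi> n\<psi>]) simp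
  also have "\<dots> \<le> a * t ^ 4" using a by (intro mult_left_mono) (simp_all add: power_divide power_mult[symmetric])
  finally have 2: "integral\<^sup>L (time_measure ?\<theta>) J - vintegral ?F M \<psi> \<le> a * t ^ 4" .
  have "vintegral ?E (\<lambda>A. spacetime t0 (\<lambda>s. dens (G s)) A - N A) F
      = integral\<^sup>L (time_measure t) (\<lambda>s. integral\<^sup>L Leb (\<lambda>x. G s x \<bullet> F (s, x))) - vintegral ?F M \<psi>"
    using vintegral_diff_measure(2)[OF vS vN bF] vintegral_spacetime_dens(2)[OF G tt(2) F(1)] VN by simp
  also have "\<dots> \<le> (c + a) * t ^ 4" using 1 2 by (simp add: distrib_right)
  finally show "vintegral ?E (\<lambda>A. spacetime t0 (\<lambda>s. dens (G s)) A - N A) F \<le> (c + a) * t ^ 4" .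
qed

lemma cubic_T_trans:
  assumes "cubic_T T f g" "cubic_T T g k" shows "cubic_T T f k"
proof -
  obtain C where C: "C \<ge> 0" "\<And>t x. t \<in> {0..T} \<Longrightarrow> \<bar>f t x - g t x\<bar> \<le> C * t ^ 3" using assms(1) unfolding cubic_T_def by blast
  obtain L where L: "L \<ge> 0" "\<And>t x. t \<in> {0..T} \<Longrightarrow> \<bar>g t x - k t x\<bar> \<le> L * t ^ 3" using assms(2) unfolding cubic_T_def by blast
  have "\<bar>f t x - k t x\<bar> \<le> (C + L) * t ^ 3" if t: "t \<in> {0..T}" for t x
    using C(2)[OF t, of x] L(2)[OF t, of x] by (simp add: distrib_right)
  then show ?thesis unfolding cubic_T_def using C(1) L(1) by (intro exI[of _ "C + L"]) simp
qed

text \<open>An error \<open>O(s\<^sup>2)\<close> becomes \<open>O(t\<^sup>4)\<close> under \<open>s = t\<^sup>2/2\<close>, more than enough.\<close>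

lemma cubic_T_quadratic_time:
  assumes K: "K \<ge> 0" "\<And>s x. s \<ge> 0 \<Longrightarrow> \<bar>f s x - g s x\<bar> \<le> K * s\<^sup>2" and T: "T \<ge> 0"
  shows "cubic_T T (\<lambda>t. f (t\<^sup>2 / 2)) (\<lambda>t. g (t\<^sup>2 / 2))"
proof -
  have "\<bar>f (t\<^sup>2 / 2) x - g (t\<^sup>2 / 2) x\<bar> \<le> (K * T) * t ^ 3" if t: "t \<in> {0..T}" for t x
  proof -
    have "\<bar>f (t\<^sup>2 / 2) x - g (t\<^sup>2 / 2) x\<bar> \<le> K * (t\<^sup>2 / 2)\<^sup>2" by (rule K(2)) simp
    also have "(t\<^sup>2 / 2)\<^sup>2 \<le> T * t ^ 3"
    proof -
      have "(t\<^sup>2 / 2)\<^sup>2 = t / 4 * t ^ 3" by (simp add: power_divide power2_eq_square power3_eq_cube)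
      also have "\<dots> \<le> T * t ^ 3" using t by (intro mult_right_mono) auto
      finally show ?thesis .
    qed
    finally show ?thesis using K(1) by (simp add: mult_left_mono mult.assoc)
  qed
  then show ?thesis unfolding cubic_T_def using K(1) T by (intro exI[of _ "K * T"]) simp
qed

lemma cubic_T_norm:
  fixes f g :: "real \<Rightarrow> T3 \<Rightarrow> real ^ 'n"
  assumes "\<And>i. cubic_T T (\<lambda>t x. f t x $ i) (\<lambda>t x. g t x $ i)"
  shows "\<exists>C\<ge>0. \<forall>t\<in>{0..T}. \<forall>x. norm (f t x - g t x) \<le> C * t ^ 3"
proof -
  have "\<forall>i. \<exists>C. C \<ge> 0 \<and> (\<forall>t\<in>{0..T}. \<forall>x. \<bar>f t x $ i - g t x $ i\<bar> \<le> C * t ^ 3)"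
    using assms unfolding cubic_T_def by blast
  then obtain C where C: "\<And>i. C i \<ge> 0" "\<And>i t x. t \<in> {0..T} \<Longrightarrow> \<bar>f t x $ i - g t x $ i\<bar> \<le> C i * t ^ 3" by metis
  have "norm (f t x - g t x) \<le> (\<Sum>i\<in>UNIV. C i) * t ^ 3" if t: "t \<in> {0..T}" for t x
  proof -
    have "norm (f t x - g t x) \<le> (\<Sum>i\<in>UNIV. \<bar>(f t x - g t x) $ i\<bar>)" by (rule norm_le_l1_cart)
    also have "\<dots> \<le> (\<Sum>i\<in>UNIV. C i * t ^ 3)" using C(2)[OF t] by (intro sum_mono) simp
    finally show ?thesis by (simp add: sum_distrib_right)
  qed
  then show ?thesis using C(1) by (intro exI[of _ "\<Sum>i\<in>UNIV. C i"]) (simp add: sum_nonneg)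
qed

context initial_data
begin

lemma ths_le: "s \<ge> 0 \<Longrightarrow> ths s x \<le> 2 * h0 x"
proof -
  assume s: "s \<ge> 0"
  have "ths s x \<le> inverse (tau0 x / 2)"
    unfolding ths_def using ttau_ge[OF s, of x] tau0_pos[of x] by (intro le_imp_inverse_le) auto
  then show ?thesis by (simp add: tau0_def inverse_eq_divide)
qed

text \<open>All three follow from the identity \<open>h\<^sup>* (\<tau>\<^sub>0 + \<phi> \<tau>\<^sub>1) = h\<^sub>0 \<tau>\<^sub>0 = 1\<close>, since \<open>\<phi> = s + O(s\<^sup>2)\<close>.\<close>

lemma ths_expansions:
  "\<exists>K\<ge>0. \<forall>s\<ge>0. \<forall>x. \<bar>ths s x - h0 x\<bar> \<le> K * s \<and> \<bar>ths s x - (h0 x - s * (h0 x * h0 x * tau1 x))\<bar> \<le> K * s\<^sup>2 \<and>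
    (\<forall>i. \<bar>ths s x * tbs s x $ i - (B0 x $ i + s * (h0 x * b1 x $ i - h0 x * h0 x * tau1 x * b0 x $ i))\<bar> \<le> K * s\<^sup>2)"
proof -
  obtain H where H: "H > 0" "\<And>x. norm (h0 x) \<le> H" using continuous_T3_bounded[OF smooth_T3_continuous[OF sh0]] by blast
  obtain m where m: "m > 0" "\<And>x. norm (tau1 x) \<le> m" using continuous_T3_bounded[OF smooth_T3_continuous[OF smooth_tau1]] by blast
  obtain p where p: "p > 0" "\<And>x. norm (b0 x) \<le> p" using continuous_T3_bounded[OF smooth_T3_continuous[OF smooth_b0]] by blast
  obtain q where q: "q > 0" "\<And>x. norm (b1 x) \<le> q" using continuous_T3_bounded[OF smooth_T3_continuous[OF smooth_b1]] by blast
  define K0 where "K0 = H * m * (2 * H)"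
  define K1 where "K1 = H\<^sup>2 * m\<^sup>2 * (2 * H) + H\<^sup>2 * m * mu"
  define K2 where "K2 = K1 * p + K0 * q + H * mu * q"
  have nn: "K0 \<ge> 0" "K1 \<ge> 0" "K2 \<ge> 0" using H(1) m(1) p(1) q(1) mu(1) by (auto simp: K0_def K1_def K2_def)
  have *: "\<bar>ths s x - h0 x\<bar> \<le> K0 * s" "\<bar>ths s x - (h0 x - s * (h0 x * h0 x * tau1 x))\<bar> \<le> K1 * s\<^sup>2"
    "\<bar>ths s x * tbs s x $ i - (B0 x $ i + s * (h0 x * b1 x $ i - h0 x * h0 x * tau1 x * b0 x $ i))\<bar> \<le> K2 * s\<^sup>2"
    if s: "s \<ge> 0" for s x i
  proof -
    note f = phi_bounds[OF s]
    have t: "ths s x * (tau0 x + phi s * tau1 x) = 1"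
      using ttau_pos[OF s, of x] by (simp add: ths_def ttau_def)
    have h: "0 \<le> h0 x" "h0 x \<le> H" "\<bar>h0 x\<bar> \<le> H" "\<bar>tau1 x\<bar> \<le> m" "0 \<le> ths s x" "\<bar>ths s x\<bar> \<le> 2 * H"
      using h0_pos[of x] H(2)[of x] m(2)[of x] ths_pos[OF s, of x] ths_le[OF s, of x] by auto
    have fs: "\<bar>phi s\<bar> \<le> s" using f(1,2) by simp
    have e0: "ths s x - h0 x = - (h0 x * (phi s * tau1 x) * ths s x)" using t tau0_h0[of x] by algebra
    show c0: "\<bar>ths s x - h0 x\<bar> \<le> K0 * s"
    proof -
      have "\<bar>ths s x - h0 x\<bar> = \<bar>h0 x\<bar> * (\<bar>phi s\<bar> * \<bar>tau1 x\<bar>) * \<bar>ths s x\<bar>" unfolding e0 by (simp add: abs_mult)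
      also have "\<dots> \<le> H * (s * m) * (2 * H)" using h fs s H(1) m(1) by (intro mult_mono) auto
      finally show ?thesis by (simp add: K0_def mult_ac)
    qed
    have e1: "ths s x - (h0 x - s * (h0 x * h0 x * tau1 x))
        = (h0 x)\<^sup>2 * ((phi s)\<^sup>2 * (tau1 x)\<^sup>2) * ths s x - (h0 x)\<^sup>2 * tau1 x * (phi s - s)" using t tau0_h0[of x] by algebra
    show c1: "\<bar>ths s x - (h0 x - s * (h0 x * h0 x * tau1 x))\<bar> \<le> K1 * s\<^sup>2"
    proof -
      have "\<bar>(h0 x)\<^sup>2 * ((phi s)\<^sup>2 * (tau1 x)\<^sup>2) * ths s x\<bar> = \<bar>h0 x\<bar>\<^sup>2 * (\<bar>phi s\<bar>\<^sup>2 * \<bar>tau1 x\<bar>\<^sup>2) * \<bar>ths s x\<bar>"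
        by (simp add: abs_mult)
      also have "\<dots> \<le> H\<^sup>2 * (s\<^sup>2 * m\<^sup>2) * (2 * H)" using h fs s H(1) m(1) by (intro mult_mono power_mono) auto
      finally have a: "\<bar>(h0 x)\<^sup>2 * ((phi s)\<^sup>2 * (tau1 x)\<^sup>2) * ths s x\<bar> \<le> H\<^sup>2 * (s\<^sup>2 * m\<^sup>2) * (2 * H)" .
      have "\<bar>(h0 x)\<^sup>2 * tau1 x * (phi s - s)\<bar> = \<bar>h0 x\<bar>\<^sup>2 * \<bar>tau1 x\<bar> * \<bar>phi s - s\<bar>" by (simp add: abs_mult)
      also have "\<dots> \<le> H\<^sup>2 * m * (mu * s\<^sup>2)" using h f(5) H(1) m(1) by (intro mult_mono power_mono) auto
      finally have "\<bar>ths s x - (h0 x - s * (h0 x * h0 x * tau1 x))\<bar> \<le> H\<^sup>2 * (s\<^sup>2 * m\<^sup>2) * (2 * H) + H\<^sup>2 * m * (mu * s\<^sup>2)"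
        unfolding e1 using a by linarith
      then show ?thesis by (simp add: K1_def algebra_simps)
    qed
    have b: "\<bar>b0 x $ i\<bar> \<le> p" "\<bar>b1 x $ i\<bar> \<le> q"
      using component_le_norm_cart[of "b0 x" i] component_le_norm_cart[of "b1 x" i] p(2)[of x] q(2)[of x] by auto
    have e2: "ths s x * tbs s x $ i - (B0 x $ i + s * (h0 x * b1 x $ i - h0 x * h0 x * tau1 x * b0 x $ i))
        = (ths s x - (h0 x - s * (h0 x * h0 x * tau1 x))) * b0 x $ i + (ths s x - h0 x) * (phi s * b1 x $ i)
          + h0 x * ((phi s - s) * b1 x $ i)"
      by (simp add: tbs_def B0_eq algebra_simps)
    show "\<bar>ths s x * tbs s x $ i - (B0 x $ i + s * (h0 x * b1 x $ i - h0 x * h0 x * tau1 x * b0 x $ i))\<bar> \<le> K2 * s\<^sup>2"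
    proof -
      have "\<bar>(ths s x - (h0 x - s * (h0 x * h0 x * tau1 x))) * b0 x $ i\<bar> \<le> K1 * s\<^sup>2 * p"
        unfolding abs_mult using c1 b nn by (intro mult_mono) auto
      moreover have "\<bar>(ths s x - h0 x) * (phi s * b1 x $ i)\<bar> \<le> K0 * s * (s * q)"
        unfolding abs_mult using c0 b nn fs s by (intro mult_mono) auto
      moreover have "\<bar>h0 x * ((phi s - s) * b1 x $ i)\<bar> \<le> H * (mu * s\<^sup>2 * q)"
        unfolding abs_mult using h b f(5) H(1) mu(1) by (intro mult_mono) auto
      ultimately have "\<bar>ths s x * tbs s x $ i - (B0 x $ i + s * (h0 x * b1 x $ i - h0 x * h0 x * tau1 x * b0 x $ i))\<bar>
          \<le> K1 * s\<^sup>2 * p + K0 * s * (s * q) + H * (mu * s\<^sup>2 * q)" unfolding e2 by linarith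
      then show ?thesis by (simp add: K2_def power2_eq_square algebra_simps)
    qed
  qed
  define K where "K = K0 + K1 + K2"
  have le: "K0 \<le> K" "K1 \<le> K" "K2 \<le> K" using nn by (auto simp: K_def)
  show ?thesis
  proof (intro exI[of _ K] conjI allI impI)
    fix s :: real and x i assume s: "s \<ge> 0"
    show "\<bar>ths s x - h0 x\<bar> \<le> K * s" using *(1)[OF s, of x] mult_right_mono[OF le(1) s] by linarith
    have s2: "s\<^sup>2 \<ge> 0" by simp
    show "\<bar>ths s x - (h0 x - s * (h0 x * h0 x * tau1 x))\<bar> \<le> K * s\<^sup>2"
      using *(2)[OF s, of x] mult_right_mono[OF le(2) s2] by linarith
    show "\<bar>ths s x * tbs s x $ i - (B0 x $ i + s * (h0 x * b1 x $ i - h0 x * h0 x * tau1 x * b0 x $ i))\<bar> \<le> K * s\<^sup>2"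
      using *(3)[OF s, of x i] mult_right_mono[OF le(3) s2] by linarith
  qed (use nn in \<open>simp add: K_def\<close>)
qed

lemma Born_Infeld_vs_test_fields:
  fixes t0 :: real
  assumes t0: "t0 > 0" and sm: "smooth_ST t0 h'" "smooth_ST t0 B'" "smooth_ST t0 D'" "smooth_ST t0 P'"
    and pos: "\<And>t x. t \<in> {0..t0} \<Longrightarrow> h' t x > 0" and ABI: "ABI_solution t0 h' B' D' P'"
    and init: "\<And>x. h' 0 x = h0 x" "\<And>x. B' 0 x = B0 x" "\<And>x. D' 0 x = 0" "\<And>x. P' 0 x = 0"
  shows "\<exists>C\<ge>0. \<forall>t\<in>{0..t0}. \<forall>x. \<bar>h' t x - ths (t\<^sup>2 / 2) x\<bar> \<le> C * t ^ 3 \<and>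
    norm (B' t x - ths (t\<^sup>2 / 2) x *\<^sub>R tbs (t\<^sup>2 / 2) x) \<le> C * t ^ 3 \<and>
    norm (D' t x - t *\<^sub>R (ths (t\<^sup>2 / 2) x *\<^sub>R d1 x)) \<le> C * t ^ 3 \<and>
    norm (P' t x - t *\<^sub>R (ths (t\<^sup>2 / 2) x *\<^sub>R v1 x)) \<le> C * t ^ 3"
proof -
  note E = ABI_expansion[OF t0 sm pos ABI init]
  have T: "t0 \<ge> 0" using t0 by simp
  obtain K where K: "K \<ge> 0" "\<And>s x. s \<ge> 0 \<Longrightarrow> \<bar>ths s x - h0 x\<bar> \<le> K * s"
    "\<And>s x. s \<ge> 0 \<Longrightarrow> \<bar>ths s x - (h0 x - s * (h0 x * h0 x * tau1 x))\<bar> \<le> K * s\<^sup>2"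
    "\<And>s x i. s \<ge> 0 \<Longrightarrow> \<bar>ths s x * tbs s x $ i - (B0 x $ i + s * (h0 x * b1 x $ i - h0 x * h0 x * tau1 x * b0 x $ i))\<bar> \<le> K * s\<^sup>2"
    using ths_expansions by blast
  have ch: "cubic_T t0 h' (\<lambda>t. ths (t\<^sup>2 / 2))"
  proof (rule cubic_T_trans[OF E(1)])
    show "cubic_T t0 (\<lambda>t x. h0 x - t\<^sup>2 / 2 * (h0 x * h0 x * tau1 x)) (\<lambda>t. ths (t\<^sup>2 / 2))"
      using cubic_T_quadratic_time[of K "\<lambda>s x. h0 x - s * (h0 x * h0 x * tau1 x)" ths, OF K(1) _ T] K(3)
      by (simp add: abs_minus_commute)
  qed
  have cB: "cubic_T t0 (\<lambda>t x. B' t x $ i) (\<lambda>t x. (ths (t\<^sup>2 / 2) x *\<^sub>R tbs (t\<^sup>2 / 2) x) $ i)" for i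
  proof (rule cubic_T_trans[OF E(2)])
    show "cubic_T t0 (\<lambda>t x. B0 x $ i + t\<^sup>2 / 2 * (h0 x * b1 x $ i - h0 x * h0 x * tau1 x * b0 x $ i))
        (\<lambda>t x. (ths (t\<^sup>2 / 2) x *\<^sub>R tbs (t\<^sup>2 / 2) x) $ i)"
      using cubic_T_quadratic_time[of K "\<lambda>s x. B0 x $ i + s * (h0 x * b1 x $ i - h0 x * h0 x * tau1 x * b0 x $ i)"
          "\<lambda>s x. ths s x * tbs s x $ i", OF K(1) _ T] K(4)
      by (simp add: abs_minus_commute)
  qed
  have lin: "cubic_T t0 (\<lambda>t x. t * (h0 x * w x $ i)) (\<lambda>t x. (t *\<^sub>R (ths (t\<^sup>2 / 2) x *\<^sub>R w x)) $ i)"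
    if w: "continuous_on UNIV w" for w :: "T3 \<Rightarrow> real ^ 3" and i
  proof -
    obtain L where L: "L > 0" "\<And>x. norm (w x) \<le> L" using continuous_T3_bounded[OF w] by blast
    have "\<bar>t * (h0 x * w x $ i) - (t *\<^sub>R (ths (t\<^sup>2 / 2) x *\<^sub>R w x)) $ i\<bar> \<le> (K * L) * t ^ 3" if t: "t \<in> {0..t0}" for t x
    proof -
      have "\<bar>t * (h0 x * w x $ i) - (t *\<^sub>R (ths (t\<^sup>2 / 2) x *\<^sub>R w x)) $ i\<bar> = t * (\<bar>ths (t\<^sup>2 / 2) x - h0 x\<bar> * \<bar>w x $ i\<bar>)"
      proof -
        have "t * (h0 x * w x $ i) - (t *\<^sub>R (ths (t\<^sup>2 / 2) x *\<^sub>R w x)) $ i = - (t * ((ths (t\<^sup>2 / 2) x - h0 x) * w x $ i))"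
          by (simp add: algebra_simps)
        then show ?thesis using t by (simp add: abs_mult)
      qed
      also have "\<dots> \<le> t * ((K * (t\<^sup>2 / 2)) * L)"
        using K(2)[of "t\<^sup>2 / 2" x] component_le_norm_cart[of "w x" i] L(2)[of x] t K(1)
        by (intro mult_left_mono mult_mono) auto
      also have "\<dots> \<le> (K * L) * t ^ 3" using t K(1) L(1) by (simp add: power2_eq_square power3_eq_cube)
      finally show ?thesis .
    qed
    then show ?thesis unfolding cubic_T_def using K(1) L(1) by (intro exI[of _ "K * L"]) simp
  qed
  obtain C1 where C1: "C1 \<ge> 0" "\<And>t x. t \<in> {0..t0} \<Longrightarrow> \<bar>h' t x - ths (t\<^sup>2 / 2) x\<bar> \<le> C1 * t ^ 3"
    using ch unfolding cubic_T_def by blast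
  obtain C2 where C2: "C2 \<ge> 0" "\<And>t x. t \<in> {0..t0} \<Longrightarrow> norm (B' t x - ths (t\<^sup>2 / 2) x *\<^sub>R tbs (t\<^sup>2 / 2) x) \<le> C2 * t ^ 3"
    using cubic_T_norm[OF cB] by blast
  obtain C3 where C3: "C3 \<ge> 0" "\<And>t x. t \<in> {0..t0} \<Longrightarrow> norm (D' t x - t *\<^sub>R (ths (t\<^sup>2 / 2) x *\<^sub>R d1 x)) \<le> C3 * t ^ 3"
    using cubic_T_norm[OF cubic_T_trans[OF E(3) lin[OF smooth_T3_continuous[OF smooth_d1]]]] by blast
  obtain C4 where C4: "C4 \<ge> 0" "\<And>t x. t \<in> {0..t0} \<Longrightarrow> norm (P' t x - t *\<^sub>R (ths (t\<^sup>2 / 2) x *\<^sub>R v1 x)) \<le> C4 * t ^ 3"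
    using cubic_T_norm[OF cubic_T_trans[OF E(4) lin[OF smooth_T3_continuous[OF smooth_v1]]]] by blast
  define C where "C = C1 + C2 + C3 + C4"
  have up: "a * t ^ 3 \<le> C * t ^ 3" if "a \<in> {C1, C2, C3, C4}" "t \<in> {0..t0}" for a t
    using that C1(1) C2(1) C3(1) C4(1) by (intro mult_right_mono) (auto simp: C_def)
  show ?thesis
  proof (intro exI[of _ C] conjI ballI allI)
    fix t x assume t: "t \<in> {0..t0}"
    show "\<bar>h' t x - ths (t\<^sup>2 / 2) x\<bar> \<le> C * t ^ 3" using C1(2)[OF t, of x] up[of C1, OF _ t] by simp
    show "norm (B' t x - ths (t\<^sup>2 / 2) x *\<^sub>R tbs (t\<^sup>2 / 2) x) \<le> C * t ^ 3" using C2(2)[OF t, of x] up[of C2, OF _ t] by simp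
    show "norm (D' t x - t *\<^sub>R (ths (t\<^sup>2 / 2) x *\<^sub>R d1 x)) \<le> C * t ^ 3" using C3(2)[OF t, of x] up[of C3, OF _ t] by simp
    show "norm (P' t x - t *\<^sub>R (ths (t\<^sup>2 / 2) x *\<^sub>R v1 x)) \<le> C * t ^ 3" using C4(2)[OF t, of x] up[of C4, OF _ t] by simp
  qed (use C1 C2 C3 C4 in \<open>simp add: C_def\<close>)
qed

lemma ex_test_field_bound:
  "\<exists>R>0. \<forall>s\<ge>0. \<forall>x. ths s x \<le> R \<and> ths s x * norm (tbs s x) + 1 \<le> R \<and> ths s x * norm (d1 x) + 1 \<le> R \<and> ths s x * norm (v1 x) + 1 \<le> R"
proof -
  obtain H where H: "H > 0" "\<And>x. norm (h0 x) \<le> H" using continuous_T3_bounded[OF smooth_T3_continuous[OF sh0]] by blast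
  obtain p where p: "p > 0" "\<And>x. norm (b0 x) \<le> p" using continuous_T3_bounded[OF smooth_T3_continuous[OF smooth_b0]] by blast
  obtain q where q: "q > 0" "\<And>x. norm (b1 x) \<le> q" using continuous_T3_bounded[OF smooth_T3_continuous[OF smooth_b1]] by blast
  obtain d where d: "d > 0" "\<And>x. norm (d1 x) \<le> d" using continuous_T3_bounded[OF smooth_T3_continuous[OF smooth_d1]] by blast
  obtain v where v: "v > 0" "\<And>x. norm (v1 x) \<le> v" using continuous_T3_bounded[OF smooth_T3_continuous[OF smooth_v1]] by blast
  define N where "N = 1 + p + 1 / mu * q + d + v"
  have N: "N \<ge> 1" "d \<le> N" "v \<le> N" using p(1) q(1) d(1) v(1) mu(1) by (auto simp: N_def)
  have t: "ths s x * n + 1 \<le> 2 * H * N + 1" if s: "s \<ge> 0" and n: "0 \<le> n" "n \<le> N" for s x n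
  proof -
    have "ths s x * n \<le> 2 * H * N"
      using ths_le[OF s, of x] H(2)[of x] H(1) n N ths_pos[OF s, of x] by (intro mult_mono) auto
    then show ?thesis by simp
  qed
  have "norm (tbs s x) \<le> N" if s: "s \<ge> 0" for s x
  proof -
    have "norm (phi s *\<^sub>R b1 x) \<le> 1 / mu * q"
      unfolding norm_scaleR using phi_bounds(1,3)[OF s] q(2)[of x] mu(1) by (intro mult_mono) (auto simp: field_simps)
    then show ?thesis
      unfolding tbs_def N_def using norm_triangle_ineq[of "b0 x" "phi s *\<^sub>R b1 x"] p(2)[of x] d(1) v(1) by linarith
  qed
  moreover have "norm (d1 x) \<le> N" "norm (v1 x) \<le> N" for x using d(2)[of x] v(2)[of x] N by auto
  moreover have "ths s x \<le> 2 * H * N + 1" if "s \<ge> 0" for s x using t[OF that, of 1 x] N by simp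
  ultimately show ?thesis using t H(1) N by (intro exI[of _ "2 * H * N + 1"]) (auto simp: add_pos_pos)
qed

end

context dissipative
begin

lemma U_estimate_scaled:
  assumes t: "0 \<le> t" "t\<^sup>2 / 2 \<le> T" "t\<^sup>2 / 2 \<le> \<Theta>" and F: "continuous_on UNIV F" "\<And>x. norm (F x) \<le> R" and R: "R > 0"
  shows "vintegral UNIV (U (t\<^sup>2 / 2)) F
    \<le> R * density_constant \<Theta> * t ^ 3"
proof -
  have vm: "vector_measure_on UNIV (U (t\<^sup>2 / 2))" using t by (intro vm_U) simp
  have c: "continuous_on UNIV (\<lambda>x. (1 / R) *\<^sub>R F x)" by (intro continuous_intros F)
  have "vintegral UNIV (U (t\<^sup>2 / 2)) (\<lambda>x. (1 / R) *\<^sub>R F x)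
      \<le> density_constant \<Theta> * t ^ 3"
    by (rule U_estimate[OF t c]) (use F(2) R in \<open>simp add: divide_le_eq\<close>)
  then have "R * vintegral UNIV (U (t\<^sup>2 / 2)) (\<lambda>x. (1 / R) *\<^sub>R F x)
      \<le> R * (density_constant \<Theta> * t ^ 3)"
    using R by (intro mult_left_mono) auto
  then show ?thesis
    using R unfolding vintegral_scale[OF vm vbounded_measurable_T3[OF F(1)]] by (simp add: mult.assoc)
qed

lemma W_estimate_scaled:
  assumes \<theta>: "0 \<le> \<theta>" "\<theta> \<le> T" "\<theta> \<le> \<Theta>" and F: "continuous_on ({0..\<theta>} \<times> UNIV) F"
    "\<And>s x. s \<in> {0..\<theta>} \<Longrightarrow> norm (F (s, x)) \<le> R" and R: "R > 0"
  shows "vintegral ({0..\<theta>} \<times> UNIV) W F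
    \<le> R * flux_constant \<Theta> * \<theta>\<^sup>2"
proof -
  let ?E = "{0..\<theta>} \<times> (UNIV :: T3 set)"
  \<comment> \<open>Cut off to zero outside the slab, as the unscaled estimate asks for a bound everywhere.\<close>
  define G where "G = (\<lambda>(s, x). (1 / R) *\<^sub>R (if s \<in> {0..\<theta>} then F (s, x) else 0))"
  have c: "continuous_on ?E G"
    by (rule continuous_on_eq[of _ "\<lambda>z. (1 / R) *\<^sub>R F z"]) (auto simp: G_def intro!: continuous_intros F)
  have n: "norm (G z) \<le> 1" for z
    using F(2)[of "fst z" "snd z"] R by (auto simp: G_def split_beta divide_le_eq)
  have "vintegral ?E W F = R * vintegral ?E W G"
  proof -
    have "vintegral ?E W F = vintegral ?E W (\<lambda>z. R *\<^sub>R G z)"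
      unfolding vintegral_def
    proof (intro sum.cong refl bounded_integral_cong[OF bounded_integral_sintegral[OF vm_nth[OF vm_W[OF \<theta>(2)]]]])
      show "bounded_measurable ?E (\<lambda>z. F z $ i)" for i by (intro bounded_measurable_slab continuous_intros F)
    qed (use R in \<open>auto simp: G_def\<close>)
    then show ?thesis using vintegral_scale[OF vm_W[OF \<theta>(2)] vbounded_measurable_continuous[OF compact_slab c]] by simp
  qed
  also have "\<dots> \<le> R * (flux_constant \<Theta> * \<theta>\<^sup>2)"
    using R W_estimate[OF \<theta> c n] by (intro mult_left_mono) auto
  finally show ?thesis by (simp add: mult.assoc)
qed

text \<open>\<open>W\<close> is tested with \<open>(h\<^sup>* d\<^sub>1 \<bullet> F, 0, - F, 0)\<close>. The first entry is chosen so that the two terms with \<open>h\<close>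
  cancel, which leaves the difference between \<open>h\<^sup>* d\<^sub>1\<close> and \<open>D\<close>; likewise for \<open>P\<close>.\<close>

lemma flux_pairing:
  assumes \<theta>: "0 \<le> \<theta>" "\<theta> \<le> T" "\<theta> \<le> \<Theta>" and F: "continuous_on ({0..\<theta>} \<times> UNIV) F" "\<And>z. norm (F z) \<le> 1"
    and R: "R > 0" "\<And>s x. s \<ge> 0 \<Longrightarrow> ths s x * norm (d1 x) + 1 \<le> R" "\<And>s x. s \<ge> 0 \<Longrightarrow> ths s x * norm (v1 x) + 1 \<le> R"
  shows "integral\<^sup>L (time_measure \<theta>) (\<lambda>s. integral\<^sup>L Leb (\<lambda>x. (ths s x *\<^sub>R d1 x) \<bullet> F (s, x))) - vintegral ({0..\<theta>} \<times> UNIV) D F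
      \<le> R * flux_constant \<Theta> * \<theta>\<^sup>2"
    and "integral\<^sup>L (time_measure \<theta>) (\<lambda>s. integral\<^sup>L Leb (\<lambda>x. (ths s x *\<^sub>R v1 x) \<bullet> F (s, x))) - vintegral ({0..\<theta>} \<times> UNIV) P F
      \<le> R * flux_constant \<Theta> * \<theta>\<^sup>2"
proof -
  let ?E = "{0..\<theta>} \<times> (UNIV :: T3 set)"
  have ch: "continuous_on ?E (\<lambda>z. ths (fst z) (snd z))" using continuous_fields(2)[of \<theta>] by (simp add: case_prod_unfold)
  have gen: "continuous_on ?E (\<lambda>z. (ths (fst z) (snd z) *\<^sub>R w (snd z)) \<bullet> F z)"
    and size: "s \<in> {0..\<theta>} \<Longrightarrow> \<bar>(ths s x *\<^sub>R w x) \<bullet> F (s, x)\<bar> \<le> ths s x * norm (w x)"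
    and minus: "sintegral ?E (spacetime T h) (\<lambda>(s, x). inverse (ths s x) * ((ths s x *\<^sub>R w x) \<bullet> F (s, x)))
      = sintegral ?E (spacetime T h) (\<lambda>z. w (snd z) \<bullet> F z)"
    if w: "continuous_on UNIV w" for w :: "T3 \<Rightarrow> real ^ 3" and s x
  proof -
    show "continuous_on ?E (\<lambda>z. (ths (fst z) (snd z) *\<^sub>R w (snd z)) \<bullet> F z)" by (intro continuous_intros ch w F)
    show "\<bar>(ths s x *\<^sub>R w x) \<bullet> F (s, x)\<bar> \<le> ths s x * norm (w x)" if "s \<in> {0..\<theta>}"
    proof -
      have "\<bar>(ths s x *\<^sub>R w x) \<bullet> F (s, x)\<bar> \<le> norm (ths s x *\<^sub>R w x) * norm (F (s, x))" by (rule Cauchy_Schwarz_ineq2)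
      also have "\<dots> \<le> norm (ths s x *\<^sub>R w x) * 1" using F(2) by (intro mult_left_mono) auto
      finally show ?thesis using ths_pos[of s x] that by simp
    qed
    have "sintegral ?E (spacetime T h) (\<lambda>z. w (snd z) \<bullet> F z)
        = sintegral ?E (spacetime T h) (\<lambda>(s, x). inverse (ths s x) * ((ths s x *\<^sub>R w x) \<bullet> F (s, x)))"
    proof (rule bounded_integral_cong[OF bounded_integral_sintegral[OF vm_H[OF \<theta>(2)]]])
      show "bounded_measurable ?E (\<lambda>z. w (snd z) \<bullet> F z)" by (intro bounded_measurable_slab continuous_intros w F)
      fix z assume z: "z \<in> ?E"
      then have "ths (fst z) (snd z) \<noteq> 0" using ths_pos[of "fst z" "snd z"] by force
      then show "w (snd z) \<bullet> F z = (\<lambda>(s, x). inverse (ths s x) * ((ths s x *\<^sub>R w x) \<bullet> F (s, x))) z" by (simp add: split_beta)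
    qed
    then show "sintegral ?E (spacetime T h) (\<lambda>(s, x). inverse (ths s x) * ((ths s x *\<^sub>R w x) \<bullet> F (s, x)))
      = sintegral ?E (spacetime T h) (\<lambda>z. w (snd z) \<bullet> F z)" by simp
  qed
  have z0: "continuous_on ?E (\<lambda>z. 0 :: real ^ 3)" by simp
  have cF: "continuous_on ?E (\<lambda>z. - F z)" by (intro continuous_intros F)
  note cd = smooth_T3_continuous[OF smooth_d1] and cv = smooth_T3_continuous[OF smooth_v1]
  have neg: "sintegral ?E (spacetime T h) (\<lambda>z. w (snd z) \<bullet> - F z) = - sintegral ?E (spacetime T h) (\<lambda>z. w (snd z) \<bullet> F z)"
    "vintegral ?E M (\<lambda>z. - F z) = - vintegral ?E M F"
    if w: "continuous_on UNIV w" and M: "vector_measure_on ?E M" for w :: "T3 \<Rightarrow> real ^ 3" and M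
  proof -
    have "bounded_measurable ?E (\<lambda>z. w (snd z) \<bullet> F z)" by (intro bounded_measurable_slab continuous_intros w F)
    from bounded_integral_scale[OF bounded_integral_sintegral[OF vm_H[OF \<theta>(2)]] this, of "-1"]
    show "sintegral ?E (spacetime T h) (\<lambda>z. w (snd z) \<bullet> - F z) = - sintegral ?E (spacetime T h) (\<lambda>z. w (snd z) \<bullet> F z)" by simp
    show "vintegral ?E M (\<lambda>z. - F z) = - vintegral ?E M F"
      using vintegral_scale[OF M vbounded_measurable_continuous[OF compact_slab F(1)], of "-1"] by simp
  qed
  have bound: "norm (blk10 (blk4 ((ths s x *\<^sub>R d1 x) \<bullet> F (s, x)) 0) (- F (s, x)) 0) \<le> R"
    "norm (blk10 (blk4 ((ths s x *\<^sub>R v1 x) \<bullet> F (s, x)) 0) 0 (- F (s, x))) \<le> R" if s: "s \<in> {0..\<theta>}" for s x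
  proof -
    have r: "ths s x * norm (d1 x) + 1 \<le> R" "ths s x * norm (v1 x) + 1 \<le> R" using s R(2,3) by auto
    show "norm (blk10 (blk4 ((ths s x *\<^sub>R d1 x) \<bullet> F (s, x)) 0) (- F (s, x)) 0) \<le> R"
      using norm_blk10_le[of "blk4 ((ths s x *\<^sub>R d1 x) \<bullet> F (s, x)) 0" "- F (s, x)" 0]
        norm_blk4_le[of "(ths s x *\<^sub>R d1 x) \<bullet> F (s, x)" 0] size[OF cd s, of x] F(2)[of "(s, x)"] r by simp
    show "norm (blk10 (blk4 ((ths s x *\<^sub>R v1 x) \<bullet> F (s, x)) 0) 0 (- F (s, x))) \<le> R"
      using norm_blk10_le[of "blk4 ((ths s x *\<^sub>R v1 x) \<bullet> F (s, x)) 0" 0 "- F (s, x)"]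
        norm_blk4_le[of "(ths s x *\<^sub>R v1 x) \<bullet> F (s, x)" 0] size[OF cv s, of x] F(2)[of "(s, x)"] r by simp
  qed
  have vmDP: "vector_measure_on ?E D" "vector_measure_on ?E P"
    using vm_subset[OF vm_D slab_bsets[OF \<theta>(2)]] vm_subset[OF vm_P slab_bsets[OF \<theta>(2)]] by auto
  let ?d = "\<lambda>z. (ths (fst z) (snd z) *\<^sub>R d1 (snd z)) \<bullet> F z" and ?v = "\<lambda>z. (ths (fst z) (snd z) *\<^sub>R v1 (snd z)) \<bullet> F z"
  have "vintegral ?E W (\<lambda>z. blk10 (blk4 (?d z) 0) (- F z) 0)
      \<le> R * flux_constant \<Theta> * \<theta>\<^sup>2"
    by (rule W_estimate_scaled[OF \<theta> _ _ R(1)]) (intro continuous_intros gen[OF cd] cF, use bound(1) in simp)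
  then show "integral\<^sup>L (time_measure \<theta>) (\<lambda>s. integral\<^sup>L Leb (\<lambda>x. (ths s x *\<^sub>R d1 x) \<bullet> F (s, x))) - vintegral ?E D F
      \<le> R * flux_constant \<Theta> * \<theta>\<^sup>2"
    unfolding vintegral_W[OF \<theta>(1,2) gen[OF cd] cF z0] neg[OF cd vmDP(1)] fst_conv snd_conv minus[OF cd]
    by (simp add: sintegral_vanishing)
  have "vintegral ?E W (\<lambda>z. blk10 (blk4 (?v z) 0) 0 (- F z))
      \<le> R * flux_constant \<Theta> * \<theta>\<^sup>2"
    by (rule W_estimate_scaled[OF \<theta> _ _ R(1)]) (intro continuous_intros gen[OF cv] cF, use bound(2) in simp)
  then show "integral\<^sup>L (time_measure \<theta>) (\<lambda>s. integral\<^sup>L Leb (\<lambda>x. (ths s x *\<^sub>R v1 x) \<bullet> F (s, x))) - vintegral ?E P F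
      \<le> R * flux_constant \<Theta> * \<theta>\<^sup>2"
    unfolding vintegral_W[OF \<theta>(1,2) gen[OF cv] z0 cF] neg[OF cv vmDP(2)] fst_conv snd_conv minus[OF cv]
    by (simp add: sintegral_vanishing)
qed

text \<open>The relative measure is tested with \<open>(k h\<^sup>*, 0)\<close> and with \<open>(h\<^sup>* b\<^sup>* \<bullet> F, - F)\<close>: the former turns \<open>\<L> - h/h\<^sup>*\<close> into
  \<open>h\<^sup>* - h\<close>, the latter eliminates \<open>h\<close> from \<open>B - h b\<^sup>*\<close>.\<close>

lemma density_variation:
  assumes t: "0 \<le> t" "t\<^sup>2 / 2 \<le> T" "t\<^sup>2 / 2 \<le> \<Theta>" and R: "R > 0" "\<And>s x. s \<ge> 0 \<Longrightarrow> ths s x \<le> R"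
    "\<And>s x. s \<ge> 0 \<Longrightarrow> ths s x * norm (tbs s x) + 1 \<le> R"
    and f: "continuous_on UNIV f" "\<And>x. \<bar>f x - ths (t\<^sup>2 / 2) x\<bar> \<le> c" and c: "c \<ge> 0"
    and G: "continuous_on UNIV G" "\<And>x. norm (G x - ths (t\<^sup>2 / 2) x *\<^sub>R tbs (t\<^sup>2 / 2) x) \<le> c"
  shows "variation (\<lambda>A. dens f A - h (t\<^sup>2 / 2) A) UNIV
      \<le> ereal (c + R * density_constant \<Theta> * t ^ 3)"
    and "variation (\<lambda>A. dens G A - B (t\<^sup>2 / 2) A) UNIV
      \<le> ereal (c + R * density_constant \<Theta> * t ^ 3)"
proof -
  define \<theta> where "\<theta> = t\<^sup>2 / 2"
  have \<theta>0: "\<theta> \<ge> 0" and tT: "\<theta> \<in> {0..T}" using t by (auto simp: \<theta>_def)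
  note est = U_estimate_scaled[OF t _ _ R(1), folded \<theta>_def]
  note bf = bounded_measurable_T3[OF f(1)]
  have ct: "continuous_on UNIV (ths \<theta>)" "continuous_on UNIV (tbs \<theta>)" "continuous_on UNIV (\<lambda>x. inverse (ths \<theta> x))"
    using continuous_fields(4,5,6) \<theta>0 by auto
  note bt = bounded_measurable_T3[OF ct(3)] vbounded_measurable_T3[OF ct(2)]
  have nz: "ths \<theta> x \<noteq> 0" for x using ths_pos[OF \<theta>0, of x] by simp
  have tp: "0 \<le> ths \<theta> x" for x using ths_pos[OF \<theta>0, of x] by simp
  show "variation (\<lambda>A. dens f A - h (t\<^sup>2 / 2) A) UNIV
      \<le> ereal (c + R * density_constant \<Theta> * t ^ 3)"
    unfolding \<theta>_def[symmetric]
  proof (rule variation_le_dual_scalar)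
    show "vector_measure_on UNIV (\<lambda>A. dens f A - h \<theta> A)"
      by (rule sintegral_diff_measure(1)[OF sintegral_dens(1)[OF bf] vm_h[OF tT]])
    fix k :: "T3 \<Rightarrow> real" assume k: "continuous_on UNIV k" "\<And>x. \<bar>k x\<bar> \<le> 1"
    note bk = bounded_measurable_T3[OF k(1)]
    have ck: "continuous_on UNIV (\<lambda>x. k x * ths \<theta> x)" by (intro continuous_intros k ct)
    have kt: "inverse (ths \<theta> x) * (k x * ths \<theta> x) = k x" for x using nz[of x] by simp
    have "vintegral UNIV (U \<theta>) (\<lambda>x. blk4 (k x * ths \<theta> x) 0) = integral\<^sup>L Leb (\<lambda>x. k x * ths \<theta> x) - sintegral UNIV (h \<theta>) k"
      using vintegral_Utilde[of h \<theta> B ths tbs, OF vm_h[OF tT] vm_B[OF tT] bt bounded_measurable_T3[OF ck] vbounded_measurable_T3[of "\<lambda>x. 0"]]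
      unfolding kt by (simp add: sintegral_vanishing)
    moreover have "vintegral UNIV (U \<theta>) (\<lambda>x. blk4 (k x * ths \<theta> x) 0)
        \<le> R * density_constant \<Theta> * t ^ 3"
    proof (rule est)
      show "continuous_on UNIV (\<lambda>x. blk4 (k x * ths \<theta> x) 0)" by (intro continuous_intros ck)
      fix x
      have "\<bar>k x * ths \<theta> x\<bar> \<le> 1 * R" unfolding abs_mult using k(2)[of x] R(2)[OF \<theta>0, of x] tp[of x] by (intro mult_mono) auto
      then show "norm (blk4 (k x * ths \<theta> x) 0) \<le> R" using norm_blk4_le[of "k x * ths \<theta> x" 0] by simp
    qed
    moreover have "integral\<^sup>L Leb (\<lambda>x. f x * k x) - integral\<^sup>L Leb (\<lambda>x. k x * ths \<theta> x) \<le> c"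
    proof -
      have "integral\<^sup>L Leb (\<lambda>x. f x * k x) - integral\<^sup>L Leb (\<lambda>x. k x * ths \<theta> x) = integral\<^sup>L Leb (\<lambda>x. f x * k x - k x * ths \<theta> x)"
        by (rule Bochner_Integration.integral_diff[symmetric]) (intro integrable_Leb bounded_measurable_T3 continuous_intros f k ct)+
      also have "\<dots> \<le> c"
      proof (rule Leb_integral_le)
        show "continuous_on UNIV (\<lambda>x. f x * k x - k x * ths \<theta> x)" by (intro continuous_intros f k ct)
        fix x
        have "f x * k x - k x * ths \<theta> x = (f x - ths \<theta> x) * k x" by (simp add: algebra_simps)
        also have "\<dots> \<le> \<bar>f x - ths \<theta> x\<bar> * \<bar>k x\<bar>" using abs_ge_self[of "(f x - ths \<theta> x) * k x"] by (simp add: abs_mult)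
        also have "\<dots> \<le> c * 1" using f(2)[of x] k(2)[of x] c unfolding \<theta>_def by (intro mult_mono) auto
        finally show "f x * k x - k x * ths \<theta> x \<le> c" by simp
      qed
      finally show ?thesis .
    qed
    ultimately show "sintegral UNIV (\<lambda>A. dens f A - h \<theta> A) k
        \<le> c + R * density_constant \<Theta> * t ^ 3"
      using sintegral_diff_measure(2)[OF sintegral_dens(1)[OF bf] vm_h[OF tT] bk] sintegral_dens(2)[OF bf bk] by simp
  qed simp
  show "variation (\<lambda>A. dens G A - B (t\<^sup>2 / 2) A) UNIV
      \<le> ereal (c + R * density_constant \<Theta> * t ^ 3)"
    unfolding \<theta>_def[symmetric]
  proof (rule variation_le_dual)
    show "vector_measure_on UNIV (\<lambda>A. dens G A - B \<theta> A)"
      by (rule vintegral_diff_measure(1)[OF vintegral_dens(1)[OF G(1)] vm_B[OF tT]])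
    fix F :: "T3 \<Rightarrow> real ^ 3" assume F: "continuous_on UNIV F" "\<And>x. norm (F x) \<le> 1"
    note bF = vbounded_measurable_T3[OF F(1)]
    have cw: "continuous_on UNIV (\<lambda>x. (ths \<theta> x *\<^sub>R tbs \<theta> x) \<bullet> F x)" by (intro continuous_intros F ct)
    have cF: "continuous_on UNIV (\<lambda>x. - F x)" by (intro continuous_intros F)
    have bi: "bounded_measurable UNIV (\<lambda>x. tbs \<theta> x \<bullet> F x)" by (intro bounded_measurable_T3 continuous_intros F ct)
    have "vintegral UNIV (U \<theta>) (\<lambda>x. blk4 ((ths \<theta> x *\<^sub>R tbs \<theta> x) \<bullet> F x) (- F x))
        = integral\<^sup>L Leb (\<lambda>x. (ths \<theta> x *\<^sub>R tbs \<theta> x) \<bullet> F x) - vintegral UNIV (B \<theta>) F"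
    proof -
      have "sintegral UNIV (h \<theta>) (\<lambda>x. tbs \<theta> x \<bullet> - F x) = - sintegral UNIV (h \<theta>) (\<lambda>x. tbs \<theta> x \<bullet> F x)"
        using bounded_integral_scale[OF bounded_integral_sintegral[OF vm_h[OF tT]] bi, of "-1"] by simp
      moreover have "vintegral UNIV (B \<theta>) (\<lambda>x. - F x) = - vintegral UNIV (B \<theta>) F"
        using vintegral_scale[OF vm_B[OF tT] bF, of "-1"] by simp
      moreover have "inverse (ths \<theta> x) * ((ths \<theta> x *\<^sub>R tbs \<theta> x) \<bullet> F x) = tbs \<theta> x \<bullet> F x" for x using nz[of x] by simp
      ultimately show ?thesis
        using vintegral_Utilde[of h \<theta> B ths tbs, OF vm_h[OF tT] vm_B[OF tT] bt bounded_measurable_T3[OF cw] vbounded_measurable_T3[OF cF]]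
        by (simp only:)
    qed
    moreover have "vintegral UNIV (U \<theta>) (\<lambda>x. blk4 ((ths \<theta> x *\<^sub>R tbs \<theta> x) \<bullet> F x) (- F x))
        \<le> R * density_constant \<Theta> * t ^ 3"
    proof (rule est)
      show "continuous_on UNIV (\<lambda>x. blk4 ((ths \<theta> x *\<^sub>R tbs \<theta> x) \<bullet> F x) (- F x))" by (intro continuous_intros cw cF)
      fix x
      have "\<bar>(ths \<theta> x *\<^sub>R tbs \<theta> x) \<bullet> F x\<bar> \<le> norm (ths \<theta> x *\<^sub>R tbs \<theta> x) * norm (F x)" by (rule Cauchy_Schwarz_ineq2)
      also have "\<dots> \<le> norm (ths \<theta> x *\<^sub>R tbs \<theta> x) * 1" using F(2)[of x] by (intro mult_left_mono) auto
      finally have "\<bar>(ths \<theta> x *\<^sub>R tbs \<theta> x) \<bullet> F x\<bar> \<le> ths \<theta> x * norm (tbs \<theta> x)" using tp[of x] by simp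
      then show "norm (blk4 ((ths \<theta> x *\<^sub>R tbs \<theta> x) \<bullet> F x) (- F x)) \<le> R"
        using norm_blk4_le[of "(ths \<theta> x *\<^sub>R tbs \<theta> x) \<bullet> F x" "- F x"] R(3)[OF \<theta>0, of x] F(2)[of x] by simp
    qed
    moreover have "integral\<^sup>L Leb (\<lambda>x. G x \<bullet> F x) - integral\<^sup>L Leb (\<lambda>x. (ths \<theta> x *\<^sub>R tbs \<theta> x) \<bullet> F x) \<le> c"
    proof -
      have "integral\<^sup>L Leb (\<lambda>x. G x \<bullet> F x) - integral\<^sup>L Leb (\<lambda>x. (ths \<theta> x *\<^sub>R tbs \<theta> x) \<bullet> F x)
          = integral\<^sup>L Leb (\<lambda>x. G x \<bullet> F x - (ths \<theta> x *\<^sub>R tbs \<theta> x) \<bullet> F x)"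
        by (rule Bochner_Integration.integral_diff[symmetric]) (intro integrable_Leb bounded_measurable_T3 continuous_intros G F ct)+
      also have "\<dots> \<le> c"
      proof (rule Leb_integral_le)
        show "continuous_on UNIV (\<lambda>x. G x \<bullet> F x - (ths \<theta> x *\<^sub>R tbs \<theta> x) \<bullet> F x)" by (intro continuous_intros G F ct)
        fix x
        have "G x \<bullet> F x - (ths \<theta> x *\<^sub>R tbs \<theta> x) \<bullet> F x = (G x - ths \<theta> x *\<^sub>R tbs \<theta> x) \<bullet> F x" by (simp add: inner_diff_left)
        also have "\<dots> \<le> norm (G x - ths \<theta> x *\<^sub>R tbs \<theta> x) * norm (F x)" by (rule norm_cauchy_schwarz)
        also have "\<dots> \<le> c * 1" using G(2)[of x] F(2)[of x] c unfolding \<theta>_def by (intro mult_mono) auto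
        finally show "G x \<bullet> F x - (ths \<theta> x *\<^sub>R tbs \<theta> x) \<bullet> F x \<le> c" by simp
      qed
      finally show ?thesis .
    qed
    ultimately show "vintegral UNIV (\<lambda>A. dens G A - B \<theta> A) F
        \<le> c + R * density_constant \<Theta> * t ^ 3"
      using vintegral_diff_measure(2)[OF vintegral_dens(1)[OF G(1)] vm_B[OF tT] bF] vintegral_dens(2)[OF G(1) F(1)] by simp
  qed simp
qed

end

theorem proposition5p1:
  fixes t0 :: real
    and h0 :: "T3 \<Rightarrow> real" and B0 :: "T3 \<Rightarrow> real ^ 3"
    and h' :: "real \<Rightarrow> T3 \<Rightarrow> real" and B' D' P' :: "real \<Rightarrow> T3 \<Rightarrow> real ^ 3"
  assumes "t0 > 0"
    and "smooth_T3 h0" and "\<And>x. h0 x > 0"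
    and "smooth_T3 B0" and "\<And>x. diverg B0 x = 0"
    and "smooth_ST t0 h'" and "smooth_ST t0 B'" and "smooth_ST t0 D'" and "smooth_ST t0 P'"
    and "\<And>t x. t \<in> {0..t0} \<Longrightarrow> h' t x > 0"
    and "ABI_solution t0 h' B' D' P'"
    and "\<And>x. h' 0 x = h0 x" and "\<And>x. B' 0 x = B0 x" and "\<And>x. D' 0 x = 0" and "\<And>x. P' 0 x = 0"
  shows "\<exists>C::real. \<forall>T K h B D P sD sP.
    t0\<^sup>2 / 2 \<le> T \<and> 0 < K \<and> dissipative_solution T K (dens h0) (dens B0) h B D P \<and>
    is_rescaled t0 D sD \<and> is_rescaled t0 P sP \<longrightarrow>
    (\<forall>t\<in>{0..t0}.
      variation (\<lambda>A. dens (h' t) A - h (t\<^sup>2 / 2) A) UNIV \<le> ereal (C * t ^ 3) \<and>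
      variation (\<lambda>A. dens (B' t) A - B (t\<^sup>2 / 2) A) UNIV \<le> ereal (C * t ^ 3) \<and>
      variation (\<lambda>A. spacetime t0 (\<lambda>s. dens (D' s)) A - sD A) ({0..t} \<times> UNIV) \<le> ereal (C * t ^ 4) \<and>
      variation (\<lambda>A. spacetime t0 (\<lambda>s. dens (P' s)) A - sP A) ({0..t} \<times> UNIV) \<le> ereal (C * t ^ 4))"
proof -
  interpret initial_data h0 B0 by standard (fact assms)+
  define \<Theta> where "\<Theta> = t0\<^sup>2 / 2"
  have \<Theta>: "\<Theta> > 0" using assms(1) by (simp add: \<Theta>_def)
  obtain c where c: "c \<ge> 0" "\<And>t x. t \<in> {0..t0} \<Longrightarrow> \<bar>h' t x - ths (t\<^sup>2 / 2) x\<bar> \<le> c * t ^ 3"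
    "\<And>t x. t \<in> {0..t0} \<Longrightarrow> norm (B' t x - ths (t\<^sup>2 / 2) x *\<^sub>R tbs (t\<^sup>2 / 2) x) \<le> c * t ^ 3"
    "\<And>t x. t \<in> {0..t0} \<Longrightarrow> norm (D' t x - t *\<^sub>R (ths (t\<^sup>2 / 2) x *\<^sub>R d1 x)) \<le> c * t ^ 3"
    "\<And>t x. t \<in> {0..t0} \<Longrightarrow> norm (P' t x - t *\<^sub>R (ths (t\<^sup>2 / 2) x *\<^sub>R v1 x)) \<le> c * t ^ 3"
    using Born_Infeld_vs_test_fields[of t0 h' B' D' P'] assms by blast
  obtain R where R: "R > 0" "\<And>s x. s \<ge> 0 \<Longrightarrow> ths s x \<le> R" "\<And>s x. s \<ge> 0 \<Longrightarrow> ths s x * norm (tbs s x) + 1 \<le> R"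
    "\<And>s x. s \<ge> 0 \<Longrightarrow> ths s x * norm (d1 x) + 1 \<le> R" "\<And>s x. s \<ge> 0 \<Longrightarrow> ths s x * norm (v1 x) + 1 \<le> R"
    using ex_test_field_bound by blast
  define kU where "kU = R * density_constant \<Theta>"
  define kW where "kW = R * flux_constant \<Theta>"
  have kn: "kU \<ge> 0" "kW \<ge> 0" unfolding kU_def kW_def using R(1) mass_nonneg by auto
  define C where "C = c + kU + kW"
  have cont: "continuous_on ({0..t0} \<times> UNIV) (case_prod D')" "continuous_on ({0..t0} \<times> UNIV) (case_prod P')"
    using assms(8,9) Ck_ST_continuous unfolding smooth_ST_def by blast+
  have conth: "continuous_on UNIV (h' t)" "continuous_on UNIV (B' t)" if "t \<in> {0..t0}" for t
    using assms(6,7) that Ck_ST_slice Ck_T3_continuous unfolding smooth_ST_def by blast+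
  have cw: "continuous_on ({0..t0\<^sup>2 / 2} \<times> UNIV) (\<lambda>(s, x). ths s x *\<^sub>R w x)" if "continuous_on UNIV w" for w :: "T3 \<Rightarrow> real ^ 3"
    using continuous_fields(2)[of "t0\<^sup>2 / 2"] unfolding case_prod_unfold by (intro continuous_intros that)
  show ?thesis
  proof (intro exI[of _ C] allI impI ballI, elim conjE)
    fix T K h B D P sD sP t
    assume Tge: "t0\<^sup>2 / 2 \<le> T" and DS: "dissipative_solution T K (dens h0) (dens B0) h B D P"
      and sD: "is_rescaled t0 D sD" and sP: "is_rescaled t0 P sP" and t: "t \<in> {0..t0}"
    interpret dissipative h0 B0 T K h B D P by standard (use Tge \<Theta>[unfolded \<Theta>_def] DS in \<open>linarith | assumption\<close>)+
    have tt: "0 \<le> t" "t \<le> t0" using t by auto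
    have t2: "t\<^sup>2 / 2 \<le> \<Theta>" using tt by (simp add: \<Theta>_def power_mono)
    then have tT: "t\<^sup>2 / 2 \<le> T" using Tge unfolding \<Theta>_def by linarith
    have c3: "c * t ^ 3 \<ge> 0" using c(1) tt by simp
    have up3: "c * t ^ 3 + kU * t ^ 3 \<le> C * t ^ 3"
      using kn tt by (simp add: C_def distrib_right)
    have up4: "(c + kW) * t ^ 4 \<le> C * t ^ 4"
      using kn by (intro mult_right_mono) (auto simp: C_def)
    note dv = density_variation[OF tt(1) tT t2 R(1,2,3) conth(1)[OF t] c(2)[OF t] c3 conth(2)[OF t] c(3)[OF t], folded kU_def]
    have vh: "variation (\<lambda>A. dens (h' t) A - h (t\<^sup>2 / 2) A) UNIV \<le> ereal (C * t ^ 3)"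
      using order_trans[OF dv(1)] up3 by simp
    have vB: "variation (\<lambda>A. dens (B' t) A - B (t\<^sup>2 / 2) A) UNIV \<le> ereal (C * t ^ 3)"
      using order_trans[OF dv(2)] up3 by simp
    have vD: "variation (\<lambda>A. spacetime t0 (\<lambda>s. dens (D' s)) A - sD A) ({0..t} \<times> UNIV) \<le> ereal ((c + kW) * t ^ 4)"
    proof (rule rescaled_variation[OF assms(1) vm_subset[OF vm_D slab_bsets[OF Tge]] sD cont(1)
          cw[OF smooth_T3_continuous[OF smooth_d1]] _ _ kn(2) c(1) t])
      show "integral\<^sup>L (time_measure \<theta>) (\<lambda>s. integral\<^sup>L Leb (\<lambda>x. (ths s x *\<^sub>R d1 x) \<bullet> F (s, x))) - vintegral ({0..\<theta>} \<times> UNIV) D F \<le> kW * \<theta>\<^sup>2"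
        if "0 \<le> \<theta>" "\<theta> \<le> t0\<^sup>2 / 2" "continuous_on ({0..\<theta>} \<times> UNIV) F" "\<And>z. norm (F z) \<le> 1" for \<theta> F
        unfolding kW_def using that Tge by (intro flux_pairing(1) R) (auto simp: \<Theta>_def)
    qed (rule c(4))
    have vP: "variation (\<lambda>A. spacetime t0 (\<lambda>s. dens (P' s)) A - sP A) ({0..t} \<times> UNIV) \<le> ereal ((c + kW) * t ^ 4)"
    proof (rule rescaled_variation[OF assms(1) vm_subset[OF vm_P slab_bsets[OF Tge]] sP cont(2)
          cw[OF smooth_T3_continuous[OF smooth_v1]] _ _ kn(2) c(1) t])
      show "integral\<^sup>L (time_measure \<theta>) (\<lambda>s. integral\<^sup>L Leb (\<lambda>x. (ths s x *\<^sub>R v1 x) \<bullet> F (s, x))) - vintegral ({0..\<theta>} \<times> UNIV) P F \<le> kW * \<theta>\<^sup>2"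
        if "0 \<le> \<theta>" "\<theta> \<le> t0\<^sup>2 / 2" "continuous_on ({0..\<theta>} \<times> UNIV) F" "\<And>z. norm (F z) \<le> 1" for \<theta> F
        unfolding kW_def using that Tge by (intro flux_pairing(2) R) (auto simp: \<Theta>_def)
    qed (rule c(5))
    from vD vP up4 have "variation (\<lambda>A. spacetime t0 (\<lambda>s. dens (D' s)) A - sD A) ({0..t} \<times> UNIV) \<le> ereal (C * t ^ 4)"
      "variation (\<lambda>A. spacetime t0 (\<lambda>s. dens (P' s)) A - sP A) ({0..t} \<times> UNIV) \<le> ereal (C * t ^ 4)"
      by (auto elim!: order_trans)
    with vh vB show "variation (\<lambda>A. dens (h' t) A - h (t\<^sup>2 / 2) A) UNIV \<le> ereal (C * t ^ 3) \<and>
      variation (\<lambda>A. dens (B' t) A - B (t\<^sup>2 / 2) A) UNIV \<le> ereal (C * t ^ 3) \<and>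
      variation (\<lambda>A. spacetime t0 (\<lambda>s. dens (D' s)) A - sD A) ({0..t} \<times> UNIV) \<le> ereal (C * t ^ 4) \<and>
      variation (\<lambda>A. spacetime t0 (\<lambda>s. dens (P' s)) A - sP A) ({0..t} \<times> UNIV) \<le> ereal (C * t ^ 4)" by blast
  qed
qed

end
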